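(* Let $k$ be a commutative ring, $\mathbf{a}$ an essentially small $k$-linear category, and $\mathcal{S}$ a $k$-linear Grothendieck pretopology on $\mathbf{a}$. Then $\mathsf{Sh}_{\mathcal{S}}\mathbf{a}=\mathsf{Sh}(\mathbf{a},\mathrm{top}(\mathcal{S}))$ as full subcategories of $\mathsf{PSh}\,\mathbf{a}$. So in particular, $\mathsf{Sh}_{\mathcal{S}}\mathbf{a}$ is a Grothendieck category.
   Context: $\mathsf{PSh}\,\mathbf{a}$ is the category of $k$-linear functors $\mathbf{a}^{op}\to\mathsf{Mod}_k$, with Yoneda embedding $\mathtt{Y}$. A sieve on $A$ is a $k$-linear subfunctor $R\subset\mathbf{a}(-,A)$. For a $k$-linear Grothendieck topology $\mathcal{T}$ (an assignment of a set $\mathcal{T}(A)$ of sieves to each $A$, containing the maximal sieves, stable under pullback, and satisfying the usual local character axiom), $\mathsf{Sh}(\mathbf{a},\mathcal{T})\subset\mathsf{PSh}\,\mathbf{a}$ is the full subcategory of $F$ for which $F(A)\simeq\mathrm{Nat}(\mathbf{a}(-,A),F)\to\mathrm{Nat}(R,F)$ is an isomorphism for all $A\in\mathbf{a}$ and $R\in\mathcal{T}(A)$. Formal morphisms: for set-indexed families of objects of $\mathbf{a}$, a formal morphism $f:\amalg_\alpha A_\alpha\to\amalg_\beta B_\beta$ is an element of $\prod_\alpha\bigoplus_\beta\mathbf{a}(A_\alpha,B_\beta)$ (equivalently a morphism $\bigoplus_\alpha\mathtt{Y}(A_\alpha)\to\bigoplus_\beta\mathtt{Y}(B_\beta)$ in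 $\mathsf{PSh}\,\mathbf{a}$), composed accordingly. For $v=(v_\alpha):\amalg_\alpha V_\alpha\to A$, $R_v$ is the sieve on $A$ generated by all $v_\alpha$. A (formal) sequence is a pair of formal morphisms $\amalg_\gamma Z_\gamma\xrightarrow{p}\amalg_\beta Y_\beta\xrightarrow{q}X$ with $X\in\mathbf{a}$, $q\circ p=0$. For a class $\mathcal{S}$ of sequences, $\mathcal{C}o(\mathcal{S})=\mathcal{C}o^1(\mathcal{S})$ is the class of right-hand morphisms $q$; $\mathcal{C}o^0(\mathcal{S})$ is the class of identity morphisms in $\mathbf{a}$; for $i>1$, $\mathcal{C}o^i(\mathcal{S})$ consists of all $(v_\alpha\circ w(\alpha)_\delta):\amalg_\alpha\amalg_{\delta\in D(\alpha)}W_\delta(\alpha)\to X$ with $v:\amalg_\alpha V_\alpha\to X$ in $\mathcal{C}o^{i-1}(\mathcal{S})$ and, for each $\alpha$, $w(\alpha):\amalg_{\delta\in D(\alpha)}W_\delta(\alpha)\to V_\alpha$ in $\mathcal{C}o(\mathcal{S})$. Set $\widetilde{\mathcal{C}o}(\mathcal{S})=\bigcup_{i\in\mathbb{N}}\mathcal{C}o^i(\mathcal{S})$; a subscript $X$ means target $X$. A ($k$-linear Grothendieck) pretopology is a class $\mathcal{S}$ of sequences such that: (PTa) for each $q:\amalg_\beta Y_\beta\to X$ in $\mathcal{C}o(\mathcal{S})$ and $f:A\to X$ in $\mathbf{a}$ there exist $q':\amalg_\delta C_\delta\to A$ in $\widetilde{\mathcal{C}o}_A(\mathcal{S})$ and a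 formal morphism $f':\amalg_\delta C_\delta\to\amalg_\beta Y_\beta$ with $q\circ f'=f\circ q'$; (PTb) for each sequence $(p,q)$ in $\mathcal{S}$ and $f:A\to\amalg_\beta Y_\beta$ with $A\in\mathbf{a}$, $q\circ f=0$, there exist $q':\amalg_\alpha B_\alpha\to A$ in $\widetilde{\mathcal{C}o}_A(\mathcal{S})$ and $f':\amalg_\alpha B_\alpha\to\amalg_\gamma Z_\gamma$ with $p\circ f'=f\circ q'$. For a pretopology $\mathcal{S}$, $\mathrm{top}(\mathcal{S})$ is the Grothendieck topology of all sieves $R\subset\mathbf{a}(-,X)$ containing $R_r$ for some $r\in\widetilde{\mathcal{C}o}_X(\mathcal{S})$. $\mathsf{Sh}_{\mathcal{S}}\mathbf{a}$ is the full subcategory of $\mathsf{PSh}\,\mathbf{a}$ of all $F$ for which $0\to F(X)\to\prod_\beta F(Y_\beta)\to\prod_\gamma F(Z_\gamma)$ is exact in $\mathsf{Mod}_k$ for every $\amalg_\gamma Z_\gamma\to\amalg_\beta Y_\beta\to X$ in $\mathcal{S}$. *)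

theory Defs
  imports "HOL-Algebra.Module" "HOL-Algebra.AbelCoset" "HOL-Library.FuncSet"
begin

unbundle cardinal_syntax

section \<open>Size\<close>

text \<open>
  HOL has no type of all sets, so size is measured against a type \<open>'u\<close> that plays the role of a
  Grothendieck universe: a set (of any type) is small if it has fewer elements than \<open>'u\<close>, and the
  cardinality of \<open>'u\<close> is required to be a regular strong limit (which forces \<open>'u\<close> to be infinite).
  An inaccessible cardinality gives the usual notion of a universe. The countable case is
  not excluded: there "small" means "finite".
\<close>

definition small :: "'u itself \<Rightarrow> 'x set \<Rightarrow> bool" where
  "small (_ :: 'u itself) A \<longleftrightarrow> |A| <o |UNIV :: 'u set|"

definition universe :: "'u itself \<Rightarrow> bool" where
  "universe (U :: 'u itself) \<longleftrightarrow>
     regularCard |UNIV :: 'u set| \<and> (\<forall>A :: 'u set. small U A \<longrightarrow> small U (Pow A))"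


section \<open>Categories, functors, colimits\<close>

text \<open>
  Hom-sets need not be disjoint; composition and identities are therefore indexed by objects:
  \<open>Comp C X Y Z g f\<close> is the composite of \<open>f : X \<rightarrow> Y\<close> and \<open>g : Y \<rightarrow> Z\<close>.
\<close>

record ('o, 'm) cat =
  Obj :: "'o set"
  Arr :: "'o \<Rightarrow> 'o \<Rightarrow> 'm set"
  Comp :: "'o \<Rightarrow> 'o \<Rightarrow> 'o \<Rightarrow> 'm \<Rightarrow> 'm \<Rightarrow> 'm"
  Ident :: "'o \<Rightarrow> 'm"

record ('k, 'o, 'm) lincat = "('o, 'm) cat" +
  HomM :: "'o \<Rightarrow> 'o \<Rightarrow> ('k, 'm) module"

record ('o, 'm, 'p, 'n) func =
  fobj :: "'o \<Rightarrow> 'p"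
  fmap :: "'o \<Rightarrow> 'o \<Rightarrow> 'm \<Rightarrow> 'n"

definition category :: "('o, 'm, 'z) cat_scheme \<Rightarrow> bool" where
  "category C \<longleftrightarrow>
     (\<forall>X\<in>Obj C. Ident C X \<in> Arr C X X) \<and>
     (\<forall>X\<in>Obj C. \<forall>Y\<in>Obj C. \<forall>Z\<in>Obj C. \<forall>f\<in>Arr C X Y. \<forall>g\<in>Arr C Y Z. Comp C X Y Z g f \<in> Arr C X Z) \<and>
     (\<forall>X\<in>Obj C. \<forall>Y\<in>Obj C. \<forall>f\<in>Arr C X Y.
        Comp C X X Y f (Ident C X) = f \<and> Comp C X Y Y (Ident C Y) f = f) \<and>
     (\<forall>W\<in>Obj C. \<forall>X\<in>Obj C. \<forall>Y\<in>Obj C. \<forall>Z\<in>Obj C. \<forall>f\<in>Arr C W X. \<forall>g\<in>Arr C X Y. \<forall>h\<in>Arr C Y Z.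
        Comp C W Y Z h (Comp C W X Y g f) = Comp C W X Z (Comp C X Y Z h g) f)"

definition is_iso :: "('o, 'm, 'z) cat_scheme \<Rightarrow> 'o \<Rightarrow> 'o \<Rightarrow> 'm \<Rightarrow> bool" where
  "is_iso C X Y f \<longleftrightarrow> f \<in> Arr C X Y \<and>
     (\<exists>g\<in>Arr C Y X. Comp C X Y X g f = Ident C X \<and> Comp C Y X Y f g = Ident C Y)"

definition is_mono :: "('o, 'm, 'z) cat_scheme \<Rightarrow> 'o \<Rightarrow> 'o \<Rightarrow> 'm \<Rightarrow> bool" where
  "is_mono C X Y f \<longleftrightarrow> f \<in> Arr C X Y \<and>
     (\<forall>T\<in>Obj C. \<forall>g\<in>Arr C T X. \<forall>h\<in>Arr C T X. Comp C T X Y f g = Comp C T X Y f h \<longrightarrow> g = h)"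

definition is_functor ::
  "('o, 'm, 'y) cat_scheme \<Rightarrow> ('p, 'n, 'z) cat_scheme \<Rightarrow> ('o, 'm, 'p, 'n) func \<Rightarrow> bool" where
  "is_functor C D F \<longleftrightarrow>
     (\<forall>X\<in>Obj C. fobj F X \<in> Obj D \<and> fmap F X X (Ident C X) = Ident D (fobj F X)) \<and>
     (\<forall>X\<in>Obj C. \<forall>Y\<in>Obj C. \<forall>f\<in>Arr C X Y. fmap F X Y f \<in> Arr D (fobj F X) (fobj F Y)) \<and>
     (\<forall>X\<in>Obj C. \<forall>Y\<in>Obj C. \<forall>Z\<in>Obj C. \<forall>f\<in>Arr C X Y. \<forall>g\<in>Arr C Y Z.
        fmap F X Z (Comp C X Y Z g f) =
        Comp D (fobj F X) (fobj F Y) (fobj F Z) (fmap F Y Z g) (fmap F X Y f))"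

definition nat_trans ::
  "('o, 'm, 'y) cat_scheme \<Rightarrow> ('p, 'n, 'z) cat_scheme \<Rightarrow>
   ('o, 'm, 'p, 'n) func \<Rightarrow> ('o, 'm, 'p, 'n) func \<Rightarrow> ('o \<Rightarrow> 'n) set" where
  "nat_trans C D F G =
     {\<eta> \<in> (\<Pi>\<^sub>E X\<in>Obj C. Arr D (fobj F X) (fobj G X)).
        \<forall>X\<in>Obj C. \<forall>Y\<in>Obj C. \<forall>f\<in>Arr C X Y.
          Comp D (fobj F X) (fobj F Y) (fobj G Y) (\<eta> Y) (fmap F X Y f) =
          Comp D (fobj F X) (fobj G X) (fobj G Y) (fmap G X Y f) (\<eta> X)}"

definition is_cocone ::
  "('j, 'a, 'y) cat_scheme \<Rightarrow> ('o, 'm, 'z) cat_scheme \<Rightarrow> ('j, 'a, 'o, 'm) func \<Rightarrow>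
   'o \<Rightarrow> ('j \<Rightarrow> 'm) \<Rightarrow> bool" where
  "is_cocone J C F L l \<longleftrightarrow> L \<in> Obj C \<and>
     (\<forall>i\<in>Obj J. l i \<in> Arr C (fobj F i) L) \<and>
     (\<forall>i\<in>Obj J. \<forall>j\<in>Obj J. \<forall>u\<in>Arr J i j.
        Comp C (fobj F i) (fobj F j) L (l j) (fmap F i j u) = l i)"

definition is_colimit ::
  "('j, 'a, 'y) cat_scheme \<Rightarrow> ('o, 'm, 'z) cat_scheme \<Rightarrow> ('j, 'a, 'o, 'm) func \<Rightarrow>
   'o \<Rightarrow> ('j \<Rightarrow> 'm) \<Rightarrow> bool" where
  "is_colimit J C F L l \<longleftrightarrow> is_cocone J C F L l \<and>
     (\<forall>T t. is_cocone J C F T t \<longrightarrow>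
        (\<exists>!h. h \<in> Arr C L T \<and> (\<forall>i\<in>Obj J. Comp C (fobj F i) L T h (l i) = t i)))"

definition small_category :: "'u itself \<Rightarrow> ('j, 'a, 'z) cat_scheme \<Rightarrow> bool" where
  "small_category U J \<longleftrightarrow> category J \<and> small U (Obj J) \<and>
     (\<forall>i\<in>Obj J. \<forall>j\<in>Obj J. small U (Arr J i j))"

definition filtered :: "('j, 'a, 'z) cat_scheme \<Rightarrow> bool" where
  "filtered J \<longleftrightarrow> Obj J \<noteq> {} \<and>
     (\<forall>i\<in>Obj J. \<forall>j\<in>Obj J. \<exists>l\<in>Obj J. Arr J i l \<noteq> {} \<and> Arr J j l \<noteq> {}) \<and>
     (\<forall>i\<in>Obj J. \<forall>j\<in>Obj J. \<forall>u\<in>Arr J i j. \<forall>v\<in>Arr J i j.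
        \<exists>l\<in>Obj J. \<exists>w\<in>Arr J j l. Comp J i j l w u = Comp J i j l w v)"

definition full_subcat :: "('k, 'o, 'm) lincat \<Rightarrow> ('o \<Rightarrow> bool) \<Rightarrow> ('k, 'o, 'm) lincat" where
  "full_subcat C P = C\<lparr>Obj := {X \<in> Obj C. P X}\<rparr>"


section \<open>Modules\<close>

definition linear_map :: "('k, 'c) ring_scheme \<Rightarrow> ('k, 'm) module \<Rightarrow> ('k, 'n) module \<Rightarrow> ('m \<Rightarrow> 'n) \<Rightarrow> bool"
  where
  "linear_map k M N f \<longleftrightarrow> f \<in> carrier M \<rightarrow> carrier N \<and>
     (\<forall>x\<in>carrier M. \<forall>y\<in>carrier M. f (x \<oplus>\<^bsub>M\<^esub> y) = f x \<oplus>\<^bsub>N\<^esub> f y) \<and>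
     (\<forall>c\<in>carrier k. \<forall>x\<in>carrier M. f (c \<odot>\<^bsub>M\<^esub> x) = c \<odot>\<^bsub>N\<^esub> f x)"

text \<open>The \<^const>\<open>mult\<close> and \<^const>\<open>one\<close> fields of a module record have no meaning for a module.\<close>

definition prod_module :: "'i set \<Rightarrow> ('i \<Rightarrow> ('k, 'm) module) \<Rightarrow> ('k, 'i \<Rightarrow> 'm) module" where
  "prod_module I M =
     \<lparr>carrier = (\<Pi>\<^sub>E i\<in>I. carrier (M i)), mult = undefined, one = undefined,
      zero = (\<lambda>i\<in>I. \<zero>\<^bsub>M i\<^esub>),
      add = (\<lambda>x y. \<lambda>i\<in>I. x i \<oplus>\<^bsub>M i\<^esub> y i),
      smult = (\<lambda>c x. \<lambda>i\<in>I. c \<odot>\<^bsub>M i\<^esub> x i)\<rparr>"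


section \<open>Linear categories\<close>

definition lin_category :: "('k, 'c) ring_scheme \<Rightarrow> ('k, 'o, 'm) lincat \<Rightarrow> bool" where
  "lin_category k C \<longleftrightarrow> category C \<and>
     (\<forall>X\<in>Obj C. \<forall>Y\<in>Obj C. module k (HomM C X Y) \<and> carrier (HomM C X Y) = Arr C X Y) \<and>
     (\<forall>X\<in>Obj C. \<forall>Y\<in>Obj C. \<forall>Z\<in>Obj C.
        (\<forall>g\<in>Arr C Y Z. linear_map k (HomM C X Y) (HomM C X Z) (\<lambda>f. Comp C X Y Z g f)) \<and>
        (\<forall>f\<in>Arr C X Y. linear_map k (HomM C Y Z) (HomM C X Z) (\<lambda>g. Comp C X Y Z g f)))"

definition essentially_small :: "'u itself \<Rightarrow> ('o, 'm, 'z) cat_scheme \<Rightarrow> bool" where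
  "essentially_small U C \<longleftrightarrow>
     (\<forall>X\<in>Obj C. \<forall>Y\<in>Obj C. small U (Arr C X Y)) \<and>
     (\<exists>O\<^sub>0 \<subseteq> Obj C. small U O\<^sub>0 \<and> (\<forall>X\<in>Obj C. \<exists>Y\<in>O\<^sub>0. \<exists>f. is_iso C X Y f))"

definition opcat :: "('k, 'o, 'm) lincat \<Rightarrow> ('k, 'o, 'm) lincat" where
  "opcat C = \<lparr>Obj = Obj C, Arr = (\<lambda>X Y. Arr C Y X), Comp = (\<lambda>X Y Z g f. Comp C Z Y X f g),
              Ident = Ident C, HomM = (\<lambda>X Y. HomM C Y X)\<rparr>"

definition lin_functor ::
  "('k, 'c) ring_scheme \<Rightarrow> ('k, 'o, 'm) lincat \<Rightarrow> ('k, 'p, 'n) lincat \<Rightarrow> ('o, 'm, 'p, 'n) func \<Rightarrow> bool"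
  where
  "lin_functor k C D F \<longleftrightarrow> is_functor C D F \<and>
     (\<forall>X\<in>Obj C. \<forall>Y\<in>Obj C. linear_map k (HomM C X Y) (HomM D (fobj F X) (fobj F Y)) (fmap F X Y))"

definition lin_functor_cat ::
  "('k, 'c) ring_scheme \<Rightarrow> ('k, 'o, 'm) lincat \<Rightarrow> ('k, 'p, 'n) lincat \<Rightarrow>
   ('k, ('o, 'm, 'p, 'n) func, 'o \<Rightarrow> 'n) lincat" where
  "lin_functor_cat k C D =
     \<lparr>Obj = {F. lin_functor k C D F},
      Arr = nat_trans C D,
      Comp = (\<lambda>F G H \<theta> \<eta>. \<lambda>X\<in>Obj C. Comp D (fobj F X) (fobj G X) (fobj H X) (\<theta> X) (\<eta> X)),
      Ident = (\<lambda>F. \<lambda>X\<in>Obj C. Ident D (fobj F X)),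
      HomM = (\<lambda>F G. (prod_module (Obj C) (\<lambda>X. HomM D (fobj F X) (fobj G X)))
                       \<lparr>carrier := nat_trans C D F G\<rparr>)\<rparr>"

definition ModCat :: "('k, 'c) ring_scheme \<Rightarrow> ('k, ('k, 'u) module, 'u \<Rightarrow> 'u) lincat" where
  "ModCat k =
     \<lparr>Obj = {M. module k M \<and> small TYPE('u) (carrier M)},
      Arr = (\<lambda>M N. {f \<in> extensional (carrier M). linear_map k M N f}),
      Comp = (\<lambda>M N P g f. compose (carrier M) g f),
      Ident = (\<lambda>M. \<lambda>x\<in>carrier M. x),
      HomM = (\<lambda>M N. (prod_module (carrier M) (\<lambda>_. N))
                       \<lparr>carrier := {f \<in> extensional (carrier M). linear_map k M N f}\<rparr>)\<rparr>"


section \<open>Grothendieck categories\<close>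

definition is_kernel :: "('k, 'o, 'm) lincat \<Rightarrow> 'o \<Rightarrow> 'o \<Rightarrow> 'm \<Rightarrow> 'o \<Rightarrow> 'm \<Rightarrow> bool" where
  "is_kernel C X Y f K m \<longleftrightarrow> K \<in> Obj C \<and> m \<in> Arr C K X \<and> Comp C K X Y f m = \<zero>\<^bsub>HomM C K Y\<^esub> \<and>
     (\<forall>T\<in>Obj C. \<forall>t\<in>Arr C T X. Comp C T X Y f t = \<zero>\<^bsub>HomM C T Y\<^esub> \<longrightarrow>
        (\<exists>!u. u \<in> Arr C T K \<and> Comp C T K X m u = t))"

abbreviation is_cokernel :: "('k, 'o, 'm) lincat \<Rightarrow> 'o \<Rightarrow> 'o \<Rightarrow> 'm \<Rightarrow> 'o \<Rightarrow> 'm \<Rightarrow> bool" where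
  "is_cokernel C X Y f Q e \<equiv> is_kernel (opcat C) Y X f Q e"

abbreviation is_epi :: "('k, 'o, 'm) lincat \<Rightarrow> 'o \<Rightarrow> 'o \<Rightarrow> 'm \<Rightarrow> bool" where
  "is_epi C X Y f \<equiv> is_mono (opcat C) Y X f"

definition is_zero_object :: "('o, 'm, 'z) cat_scheme \<Rightarrow> 'o \<Rightarrow> bool" where
  "is_zero_object C Z \<longleftrightarrow> Z \<in> Obj C \<and>
     (\<forall>X\<in>Obj C. (\<exists>!f. f \<in> Arr C Z X) \<and> (\<exists>!f. f \<in> Arr C X Z))"

definition is_product :: "('o, 'm, 'z) cat_scheme \<Rightarrow> 'o \<Rightarrow> 'o \<Rightarrow> 'o \<Rightarrow> 'm \<Rightarrow> 'm \<Rightarrow> bool" where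
  "is_product C X Y P p q \<longleftrightarrow> P \<in> Obj C \<and> p \<in> Arr C P X \<and> q \<in> Arr C P Y \<and>
     (\<forall>T\<in>Obj C. \<forall>f\<in>Arr C T X. \<forall>g\<in>Arr C T Y.
        \<exists>!h. h \<in> Arr C T P \<and> Comp C T P X p h = f \<and> Comp C T P Y q h = g)"

definition abelian :: "('k, 'c) ring_scheme \<Rightarrow> ('k, 'o, 'm) lincat \<Rightarrow> bool" where
  "abelian k C \<longleftrightarrow> lin_category k C \<and>
     (\<exists>Z. is_zero_object C Z) \<and>
     (\<forall>X\<in>Obj C. \<forall>Y\<in>Obj C. \<exists>P p q. is_product C X Y P p q) \<and>
     (\<forall>X\<in>Obj C. \<forall>Y\<in>Obj C. \<forall>f\<in>Arr C X Y.
        (\<exists>K m. is_kernel C X Y f K m) \<and> (\<exists>Q e. is_cokernel C X Y f Q e)) \<and>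
     (\<forall>X\<in>Obj C. \<forall>Y\<in>Obj C. \<forall>f. is_mono C X Y f \<longrightarrow>
        (\<exists>Z\<in>Obj C. \<exists>g\<in>Arr C Y Z. is_kernel C Y Z g X f)) \<and>
     (\<forall>X\<in>Obj C. \<forall>Y\<in>Obj C. \<forall>f. is_epi C X Y f \<longrightarrow>
        (\<exists>Z\<in>Obj C. \<exists>g\<in>Arr C Z X. is_cokernel C Z X g Y f))"

definition short_exact :: "('k, 'o, 'm) lincat \<Rightarrow> 'o \<Rightarrow> 'o \<Rightarrow> 'o \<Rightarrow> 'm \<Rightarrow> 'm \<Rightarrow> bool" where
  "short_exact C X Y Z f g \<longleftrightarrow> is_kernel C Y Z g X f \<and> is_cokernel C X Y f Z g"

definition cocomplete :: "'u itself \<Rightarrow> ('o, 'm, 'z) cat_scheme \<Rightarrow> bool" where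
  "cocomplete (U :: 'u itself) C \<longleftrightarrow>
     (\<forall>(J :: ('u, 'u) cat) F. small_category U J \<and> is_functor J C F \<longrightarrow>
        (\<exists>L l. is_colimit J C F L l))"

definition exact_filtered_colimits :: "'u itself \<Rightarrow> ('k, 'o, 'm) lincat \<Rightarrow> bool" where
  "exact_filtered_colimits (U :: 'u itself) C \<longleftrightarrow>
     (\<forall>(J :: ('u, 'u) cat) F G H \<alpha> \<beta> L\<^sub>F L\<^sub>G L\<^sub>H l\<^sub>F l\<^sub>G l\<^sub>H a b.
        small_category U J \<and> filtered J \<and>
        is_functor J C F \<and> is_functor J C G \<and> is_functor J C H \<and>
        \<alpha> \<in> nat_trans J C F G \<and> \<beta> \<in> nat_trans J C G H \<and>
        (\<forall>j\<in>Obj J. short_exact C (fobj F j) (fobj G j) (fobj H j) (\<alpha> j) (\<beta> j)) \<and>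
        is_colimit J C F L\<^sub>F l\<^sub>F \<and> is_colimit J C G L\<^sub>G l\<^sub>G \<and> is_colimit J C H L\<^sub>H l\<^sub>H \<and>
        a \<in> Arr C L\<^sub>F L\<^sub>G \<and>
        (\<forall>j\<in>Obj J. Comp C (fobj F j) L\<^sub>F L\<^sub>G a (l\<^sub>F j) = Comp C (fobj F j) (fobj G j) L\<^sub>G (l\<^sub>G j) (\<alpha> j)) \<and>
        b \<in> Arr C L\<^sub>G L\<^sub>H \<and>
        (\<forall>j\<in>Obj J. Comp C (fobj G j) L\<^sub>G L\<^sub>H b (l\<^sub>G j) = Comp C (fobj G j) (fobj H j) L\<^sub>H (l\<^sub>H j) (\<beta> j))
        \<longrightarrow> short_exact C L\<^sub>F L\<^sub>G L\<^sub>H a b)"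

definition is_generator :: "('o, 'm, 'z) cat_scheme \<Rightarrow> 'o \<Rightarrow> bool" where
  "is_generator C G \<longleftrightarrow> G \<in> Obj C \<and>
     (\<forall>X\<in>Obj C. \<forall>Y\<in>Obj C. \<forall>f\<in>Arr C X Y. \<forall>g\<in>Arr C X Y. f \<noteq> g \<longrightarrow>
        (\<exists>h\<in>Arr C G X. Comp C G X Y f h \<noteq> Comp C G X Y g h))"

definition grothendieck_category ::
  "'u itself \<Rightarrow> ('k, 'c) ring_scheme \<Rightarrow> ('k, 'o, 'm) lincat \<Rightarrow> bool" where
  "grothendieck_category U k C \<longleftrightarrow> abelian k C \<and>
     (\<forall>X\<in>Obj C. \<forall>Y\<in>Obj C. small U (Arr C X Y)) \<and>
     cocomplete U C \<and> exact_filtered_colimits U C \<and> (\<exists>G. is_generator C G)"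


section \<open>Presheaves, sieves and sheaves\<close>

type_synonym ('k, 'o, 'u) presheaf = "('o, 'u, ('k, 'u) module, 'u \<Rightarrow> 'u) func"

definition PSh :: "('k, 'c) ring_scheme \<Rightarrow> ('k, 'o, 'u) lincat \<Rightarrow>
    ('k, ('k, 'o, 'u) presheaf, 'o \<Rightarrow> 'u \<Rightarrow> 'u) lincat" where
  "PSh k a = lin_functor_cat k (opcat a) (ModCat k)"

definition yoneda :: "('k, 'o, 'u) lincat \<Rightarrow> 'o \<Rightarrow> ('k, 'o, 'u) presheaf" where
  "yoneda a A = \<lparr>fobj = (\<lambda>B. HomM a B A),
                 fmap = (\<lambda>B C g. \<lambda>f\<in>Arr a B A. Comp a C B A f g)\<rparr>"

text \<open>A sieve is given by the underlying sets of its values.\<close>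

type_synonym ('o, 'u) sieve = "'o \<Rightarrow> 'u set"

definition is_sieve :: "('k, 'c) ring_scheme \<Rightarrow> ('k, 'o, 'u) lincat \<Rightarrow> 'o \<Rightarrow> ('o, 'u) sieve \<Rightarrow> bool" where
  "is_sieve k a A R \<longleftrightarrow>
     (\<forall>B\<in>Obj a. submodule (R B) k (HomM a B A)) \<and> (\<forall>B. B \<notin> Obj a \<longrightarrow> R B = {}) \<and>
     (\<forall>B\<in>Obj a. \<forall>C\<in>Obj a. \<forall>f\<in>R B. \<forall>g\<in>Arr a C B. Comp a C B A f g \<in> R C)"

definition sieve_presheaf ::
  "('k, 'o, 'u) lincat \<Rightarrow> 'o \<Rightarrow> ('o, 'u) sieve \<Rightarrow> ('k, 'o, 'u) presheaf" where
  "sieve_presheaf a A R =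
     \<lparr>fobj = (\<lambda>B. (fobj (yoneda a A) B)\<lparr>carrier := R B\<rparr>),
      fmap = (\<lambda>B C g. restrict (fmap (yoneda a A) B C g) (R B))\<rparr>"

definition yoneda_map ::
  "('k, 'o, 'u) lincat \<Rightarrow> ('k, 'o, 'u) presheaf \<Rightarrow> 'o \<Rightarrow> 'u \<Rightarrow> 'o \<Rightarrow> 'u \<Rightarrow> 'u" where
  "yoneda_map a F A x = (\<lambda>B\<in>Obj a. \<lambda>f\<in>Arr a B A. fmap F A B f x)"

definition sieve_restrict ::
  "('k, 'o, 'u) lincat \<Rightarrow> ('o, 'u) sieve \<Rightarrow> ('o \<Rightarrow> 'u \<Rightarrow> 'u) \<Rightarrow> 'o \<Rightarrow> 'u \<Rightarrow> 'u" where
  "sieve_restrict a R \<eta> = (\<lambda>B\<in>Obj a. restrict (\<eta> B) (R B))"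

definition Sh ::
  "('k, 'c) ring_scheme \<Rightarrow> ('k, 'o, 'u) lincat \<Rightarrow> ('o \<Rightarrow> ('o, 'u) sieve set) \<Rightarrow>
   ('k, ('k, 'o, 'u) presheaf, 'o \<Rightarrow> 'u \<Rightarrow> 'u) lincat" where
  "Sh k a T = full_subcat (PSh k a) (\<lambda>F. \<forall>A\<in>Obj a. \<forall>R\<in>T A.
     linear_map k (fobj F A) (HomM (PSh k a) (sieve_presheaf a A R) F)
       (\<lambda>x. sieve_restrict a R (yoneda_map a F A x)) \<and>
     bij_betw (\<lambda>x. sieve_restrict a R (yoneda_map a F A x))
       (carrier (fobj F A)) (carrier (HomM (PSh k a) (sieve_presheaf a A R) F)))"


section \<open>Formal morphisms and pretopologies\<close>

record ('i, 'o) fam =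
  idx :: "'i set"
  fob :: "'i \<Rightarrow> 'o"

definition is_fam :: "('k, 'o, 'u) lincat \<Rightarrow> ('i, 'o) fam \<Rightarrow> bool" where
  "is_fam a V \<longleftrightarrow> small TYPE('u) (idx V) \<and> fob V \<in> idx V \<rightarrow>\<^sub>E Obj a"

abbreviation one_fam :: "'o \<Rightarrow> (unit, 'o) fam" where
  "one_fam X \<equiv> \<lparr>idx = {()}, fob = (\<lambda>_. X)\<rparr>"

definition fsupp ::
  "('k, 'o, 'u) lincat \<Rightarrow> ('i, 'o) fam \<Rightarrow> ('j, 'o) fam \<Rightarrow> ('i \<Rightarrow> 'j \<Rightarrow> 'u) \<Rightarrow> 'i \<Rightarrow> 'j set" where
  "fsupp a V W f i = {j \<in> idx W. f i j \<noteq> \<zero>\<^bsub>HomM a (fob V i) (fob W j)\<^esub>}"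

definition fmor ::
  "('k, 'o, 'u) lincat \<Rightarrow> ('i, 'o) fam \<Rightarrow> ('j, 'o) fam \<Rightarrow> ('i \<Rightarrow> 'j \<Rightarrow> 'u) set" where
  "fmor a V W = {f \<in> (\<Pi>\<^sub>E i\<in>idx V. \<Pi>\<^sub>E j\<in>idx W. Arr a (fob V i) (fob W j)).
                   \<forall>i\<in>idx V. finite (fsupp a V W f i)}"

definition fzero :: "('k, 'o, 'u) lincat \<Rightarrow> ('i, 'o) fam \<Rightarrow> ('j, 'o) fam \<Rightarrow> 'i \<Rightarrow> 'j \<Rightarrow> 'u" where
  "fzero a V W = (\<lambda>i\<in>idx V. \<lambda>j\<in>idx W. \<zero>\<^bsub>HomM a (fob V i) (fob W j)\<^esub>)"

definition fcomp ::
  "('k, 'o, 'u) lincat \<Rightarrow> ('i, 'o) fam \<Rightarrow> ('j, 'o) fam \<Rightarrow> ('l, 'o) fam \<Rightarrow>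
   ('j \<Rightarrow> 'l \<Rightarrow> 'u) \<Rightarrow> ('i \<Rightarrow> 'j \<Rightarrow> 'u) \<Rightarrow> 'i \<Rightarrow> 'l \<Rightarrow> 'u" where
  "fcomp a U V W g f = (\<lambda>i\<in>idx U. \<lambda>l\<in>idx W.
     \<Oplus>\<^bsub>HomM a (fob U i) (fob W l)\<^esub>j\<in>fsupp a U V f i.
       Comp a (fob U i) (fob V j) (fob W l) (g j l) (f i j))"

abbreviation farr :: "'u \<Rightarrow> unit \<Rightarrow> unit \<Rightarrow> 'u" where
  "farr f \<equiv> (\<lambda>_ _. f)"

text \<open>
  A sequence \<open>Z \<rightarrow> Y \<rightarrow> X\<close> with maps \<open>p\<close>, \<open>q\<close> is the tuple \<open>(Z, Y, X, p, q)\<close>, and a formal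
  morphism \<open>v : V \<rightarrow> X\<close> to a single object is the triple \<open>(V, X, v)\<close>.
\<close>

type_synonym ('o, 'u) fseq =
  "('u, 'o) fam \<times> ('u, 'o) fam \<times> 'o \<times> ('u \<Rightarrow> 'u \<Rightarrow> 'u) \<times> ('u \<Rightarrow> unit \<Rightarrow> 'u)"

type_synonym ('o, 'u) cover = "('u, 'o) fam \<times> 'o \<times> ('u \<Rightarrow> unit \<Rightarrow> 'u)"

definition is_seq :: "('k, 'o, 'u) lincat \<Rightarrow> ('o, 'u) fseq \<Rightarrow> bool" where
  "is_seq a = (\<lambda>(Z, Y, X, p, q). is_fam a Z \<and> is_fam a Y \<and> X \<in> Obj a \<and>
     p \<in> fmor a Z Y \<and> q \<in> fmor a Y (one_fam X) \<and>
     fcomp a Z Y (one_fam X) q p = fzero a Z (one_fam X))"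

definition Co1 :: "('o, 'u) fseq set \<Rightarrow> ('o, 'u) cover set" where
  "Co1 S = {(Y, X, q). \<exists>Z p. (Z, Y, X, p, q) \<in> S}"

text \<open>
  Index sets are subsets of \<open>'u\<close>, so the index set of pairs \<open>(\<alpha>, \<delta>)\<close> of an iterated cover is
  replaced by an arbitrary \<open>I \<subseteq> 'u\<close> in bijection with it. Likewise an identity
  morphism may be indexed by any one-element subset of \<open>'u\<close>.
\<close>

fun Co :: "('k, 'o, 'u) lincat \<Rightarrow> ('o, 'u) fseq set \<Rightarrow> nat \<Rightarrow> ('o, 'u) cover set" where
  "Co a S 0 = {(\<lparr>idx = {i}, fob = (\<lambda>_\<in>{i}. X)\<rparr>, X, (\<lambda>_\<in>{i}. \<lambda>_. Ident a X)) | i X. X \<in> Obj a}"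
| "Co a S (Suc 0) = Co1 S"
| "Co a S (Suc (Suc n)) =
     {(\<lparr>idx = I, fob = (\<lambda>i\<in>I. fob (W (fst (\<phi> i))) (snd (\<phi> i)))\<rparr>, X,
       (\<lambda>i\<in>I. \<lambda>_. case \<phi> i of (\<alpha>, \<delta>) \<Rightarrow>
          Comp a (fob (W \<alpha>) \<delta>) (fob V \<alpha>) X (v \<alpha> ()) (w \<alpha> \<delta> ())))
      | I \<phi> V X v W w.
        (V, X, v) \<in> Co a S (Suc n) \<and> (\<forall>\<alpha>\<in>idx V. (W \<alpha>, fob V \<alpha>, w \<alpha>) \<in> Co1 S) \<and>
        bij_betw \<phi> I (SIGMA \<alpha>:idx V. idx (W \<alpha>))}"

definition Cotilde :: "('k, 'o, 'u) lincat \<Rightarrow> ('o, 'u) fseq set \<Rightarrow> ('o, 'u) cover set" where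
  "Cotilde a S = (\<Union>i. Co a S i)"

definition pretopology :: "('k, 'o, 'u) lincat \<Rightarrow> ('o, 'u) fseq set \<Rightarrow> bool" where
  "pretopology a S \<longleftrightarrow> (\<forall>s\<in>S. is_seq a s) \<and>
     (\<forall>(Y, X, q)\<in>Co1 S. \<forall>A\<in>Obj a. \<forall>f\<in>Arr a A X.
        \<exists>C q' f'. (C, A, q') \<in> Cotilde a S \<and> f' \<in> fmor a C Y \<and>
          fcomp a C Y (one_fam X) q f' = fcomp a C (one_fam A) (one_fam X) (farr f) q') \<and>
     (\<forall>(Z, Y, X, p, q)\<in>S. \<forall>A\<in>Obj a. \<forall>f\<in>fmor a (one_fam A) Y.
        fcomp a (one_fam A) Y (one_fam X) q f = fzero a (one_fam A) (one_fam X) \<longrightarrow>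
        (\<exists>B q' f'. (B, A, q') \<in> Cotilde a S \<and> f' \<in> fmor a B Z \<and>
          fcomp a B Z Y p f' = fcomp a B (one_fam A) Y f q'))"

definition gen_sieve ::
  "('k, 'c) ring_scheme \<Rightarrow> ('k, 'o, 'u) lincat \<Rightarrow> ('o, 'u) cover \<Rightarrow> ('o, 'u) sieve" where
  "gen_sieve k a = (\<lambda>(V, A, v) B.
     \<Inter>{R B | R. is_sieve k a A R \<and> (\<forall>\<alpha>\<in>idx V. v \<alpha> () \<in> R (fob V \<alpha>))})"

definition top_of ::
  "('k, 'c) ring_scheme \<Rightarrow> ('k, 'o, 'u) lincat \<Rightarrow> ('o, 'u) fseq set \<Rightarrow> 'o \<Rightarrow> ('o, 'u) sieve set" where
  "top_of k a S X = {R. is_sieve k a X R \<and>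
     (\<exists>V r. (V, X, r) \<in> Cotilde a S \<and> (\<forall>B. gen_sieve k a (V, X, r) B \<subseteq> R B))}"

definition sections :: "('k, 'o, 'u) presheaf \<Rightarrow> ('i, 'o) fam \<Rightarrow> ('k, 'i \<Rightarrow> 'u) module" where
  "sections F V = prod_module (idx V) (\<lambda>i. fobj F (fob V i))"

definition pull ::
  "('k, 'o, 'u) lincat \<Rightarrow> ('k, 'o, 'u) presheaf \<Rightarrow> ('i, 'o) fam \<Rightarrow> ('j, 'o) fam \<Rightarrow>
   ('i \<Rightarrow> 'j \<Rightarrow> 'u) \<Rightarrow> ('j \<Rightarrow> 'u) \<Rightarrow> 'i \<Rightarrow> 'u" where
  "pull a F V W f y = (\<lambda>i\<in>idx V.
     \<Oplus>\<^bsub>fobj F (fob V i)\<^esub>j\<in>fsupp a V W f i. fmap F (fob W j) (fob V i) (f i j) (y j))"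

definition left_exact_on ::
  "('k, 'o, 'u) lincat \<Rightarrow> ('k, 'o, 'u) presheaf \<Rightarrow> ('o, 'u) fseq \<Rightarrow> bool" where
  "left_exact_on a F = (\<lambda>(Z, Y, X, p, q).
     let Fq = (\<lambda>x. pull a F Y (one_fam X) q (\<lambda>_. x)); Fp = pull a F Z Y p in
     a_kernel (fobj F X) (sections F Y) Fq = {\<zero>\<^bsub>fobj F X\<^esub>} \<and>
     Fq ` carrier (fobj F X) = a_kernel (sections F Y) (sections F Z) Fp)"

definition ShS ::
  "('k, 'c) ring_scheme \<Rightarrow> ('k, 'o, 'u) lincat \<Rightarrow> ('o, 'u) fseq set \<Rightarrow>
   ('k, ('k, 'o, 'u) presheaf, 'o \<Rightarrow> 'u \<Rightarrow> 'u) lincat" where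
  "ShS k a S = full_subcat (PSh k a) (\<lambda>F. \<forall>s\<in>S. left_exact_on a F s)"

end

theory Submission
  imports Defs "HOL-Algebra.Free_Abelian_Groups"
begin

text \<open>
  Let \<open>cov\<close> be the topology generated by the families in \<open>Co1 S\<close> along well-founded trees; it contains
  \<open>top_of k a S\<close>. A presheaf exact on the sequences of \<open>S\<close> is a sheaf for \<open>cov\<close>, by induction on the
  tree, and then glues over \<open>top_of k a S\<close>. Conversely, if \<open>F\<close> glues over \<open>top_of k a S\<close>, then (PTb) shows that a
  family over the \<open>Y j\<close> annihilated by \<open>p\<close> is well defined on the sieve generated by \<open>q\<close>, so \<open>F\<close> is
  exact on \<open>S\<close>. Hence both categories consist of the sheaves for \<open>cov\<close>.

  For the sheaves on any linear topology, colimits are constructed by generators and relations: a section of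
  the associated sheaf over \<open>A\<close> is a maximal homomorphism from a dense part of the representable presheaf
  of \<open>A\<close> to generators modulo relations. It is determined locally, so a diagram of sheaves has a
  colimit in which every section is locally a finite sum of sections of the terms, and a section of a term
  vanishes iff it is locally a combination of relations. Over a filtered diagram the relations are detected in
  the colimit of abelian groups, which gives exactness of filtered colimits.
\<close>

section \<open>Small sets\<close>

text \<open>Linearity over k is encoded through endomorphisms. The scalar c acts on a section over A
  as restriction along c times the identity, and negation is restriction along minus the identity.
  Hence sieves, subpresheaves, matching families and graphs are described by zero, addition and
  restriction alone, and morphisms by additivity and naturality; scalars follow. Two obstacles shape
  the rest. Values of presheaves must be small and lie in \<open>'u\<close>. When \<open>'u\<close>
  is countable, small means finite and a free abelian group is too large to be a value, so only the
  quotients are embedded in \<open>'u\<close>; the objects of \<open>a\<close> are small only up to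
  isomorphism. Moreover, sheafification through matching families would have to identify families
  given on different covers and to be iterated. Maximal graphs are unique representatives: equality
  of sections is equality of sets, and a single pass gives a sheaf.\<close>

lemma small_mono: "small U B \<Longrightarrow> A \<subseteq> B \<Longrightarrow> small U A"
  unfolding small_def using card_of_mono1 ordLeq_ordLess_trans by blast

lemma small_image: "small U A \<Longrightarrow> small U (f ` A)"
  unfolding small_def using card_of_image ordLeq_ordLess_trans by blast

lemma small_inj_on: "inj_on f A \<Longrightarrow> small U (f ` A) \<Longrightarrow> small U A"
  by (metis small_image the_inv_into_onto)

lemma small_inj:
  assumes "small TYPE('u) A"
  obtains f :: "'x \<Rightarrow> 'u" where "inj_on f A"
  using assms unfolding small_def
  by (metis card_of_ordLeq ordLess_imp_ordLeq)

locale universe_type =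
  fixes U :: "'u itself"
  assumes universe: "universe U"
begin

text \<open>\<open>universe\<close> speaks of subsets of \<open>'u\<close> only; an injection into
  \<open>'u\<close> carries the bound over to sets of any type.\<close>

lemma small_Pow:
  assumes "small U A"
  shows "small U (Pow A)"
proof -
  obtain f :: "_ \<Rightarrow> 'u" where f: "inj_on f A"
    using assms small_inj by (metis small_def)
  have "small U (Pow (f ` A))"
    using universe assms small_image unfolding universe_def by blast
  then have "small U (image f ` Pow A)"
    by (simp add: image_Pow_surj)
  then show ?thesis
    using f small_inj_on inj_on_image_Pow by metis
qed

text \<open>If \<open>'u\<close> had n+1 elements, the n-element set \<open>A\<close> would be
  small, and the strong limit property would give 2^n < n+1.\<close>

lemma infinite_UNIV: "\<not> finite (UNIV :: 'u set)"
proof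
  assume fin: "finite (UNIV :: 'u set)"
  obtain x :: 'u where True by simp
  define A :: "'u set" where "A = UNIV - {x}"
  have A: "finite A" "card A < card (UNIV :: 'u set)" "card (UNIV :: 'u set) = Suc (card A)"
    using fin by (auto simp: A_def card_gt_0_iff)
  have "small U A"
    unfolding small_def by (rule finite_card_of_iff_card3[THEN iffD2]) (use fin A in auto)
  then have "small U (Pow A)"
    using universe unfolding universe_def by blast
  then have "card (Pow A) < card (UNIV :: 'u set)"
    unfolding small_def using finite_card_of_iff_card3[of "Pow A" "UNIV :: 'u set"] A fin by auto
  then have "2 ^ card A < Suc (card A)"
    using A by (simp add: card_Pow)
  then show False
    using less_exp[of "card A"] by linarith
qed

lemma small_finite: "finite A \<Longrightarrow> small U A"
  unfolding small_def by (rule finite_ordLess_infinite) (auto simp: infinite_UNIV card_of_Well_order)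

text \<open>An infinite regular cardinal is stable, that is, closed under sums of smaller sets over
  a smaller index set. Regularity enters here.\<close>

lemma small_Sigma:
  assumes "small U A" "\<And>x. x \<in> A \<Longrightarrow> small U (B x)"
  shows "small U (SIGMA x:A. B x)"
proof -
  have "stable |UNIV :: 'u set|"
    using universe infinite_UNIV unfolding universe_def
    by (intro regularCard_stable) (auto simp: card_of_Card_order Field_card_of)
  then show ?thesis
    using assms unfolding small_def by (intro stable_elim) auto
qed

lemma small_Times: "small U A \<Longrightarrow> small U B \<Longrightarrow> small U (A \<times> B)"
  by (rule small_Sigma)

text \<open>A function on \<open>A\<close> is determined by its graph, a subset of the dependent
  sum, so power sets and sums suffice.\<close>

lemma small_PiE:
  assumes "small U A" "\<And>x. x \<in> A \<Longrightarrow> small U (B x)"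
  shows "small U (PiE A B)"
proof (rule small_inj_on)
  show "inj_on (\<lambda>f. {(x, f x) | x. x \<in> A}) (PiE A B)"
  proof (rule inj_onI)
    fix f g assume fg: "f \<in> PiE A B" "g \<in> PiE A B" and "{(x, f x) | x. x \<in> A} = {(x, g x) | x. x \<in> A}"
    then have "f x = g x" if "x \<in> A" for x using that by blast
    then show "f = g" using fg by (intro PiE_ext) auto
  qed
  show "small U ((\<lambda>f. {(x, f x) | x. x \<in> A}) ` PiE A B)"
    by (rule small_mono[OF small_Pow[OF small_Sigma[OF assms]]]) auto
qed

end

section \<open>Finite sums in abelian groups\<close>

text \<open>Induction over a finite sum for an additive relation. With \<open>E\<close> the graph of
  a map it moves sums through the map, even if the map is defined on part of the group only.\<close>

lemma finsum_pair_closed: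
  assumes "abelian_group G" "abelian_group H" "finite A"
    and "(\<zero>\<^bsub>G\<^esub>, \<zero>\<^bsub>H\<^esub>) \<in> E" "E \<subseteq> carrier G \<times> carrier H"
    and "\<And>x y x' y'. (x, y) \<in> E \<Longrightarrow> (x', y') \<in> E \<Longrightarrow> (x \<oplus>\<^bsub>G\<^esub> x', y \<oplus>\<^bsub>H\<^esub> y') \<in> E"
    and "\<And>j. j \<in> A \<Longrightarrow> (f j, g j) \<in> E"
  shows "(finsum G f A, finsum H g A) \<in> E"
  using assms(3,7)
proof (induction rule: finite_induct)
  case empty
  interpret G: abelian_group G by fact
  interpret H: abelian_group H by fact
  show ?case using assms(4) by simp
next
  case (insert x A)
  interpret G: abelian_group G by fact
  interpret H: abelian_group H by fact
  have "f \<in> insert x A \<rightarrow> carrier G" "g \<in> insert x A \<rightarrow> carrier H"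
    using insert.prems assms(5) by blast+
  then show ?case
    using insert assms(6) by simp
qed

lemma finsum_hom:
  assumes "abelian_group G" "abelian_group H" "finite A"
    and "h \<in> carrier G \<rightarrow> carrier H" "\<And>x y. x \<in> carrier G \<Longrightarrow> y \<in> carrier G \<Longrightarrow> h (x \<oplus>\<^bsub>G\<^esub> y) = h x \<oplus>\<^bsub>H\<^esub> h y"
    and "f \<in> A \<rightarrow> carrier G"
  shows "h (finsum G f A) = finsum H (\<lambda>j. h (f j)) A"
proof -
  interpret G: abelian_group G by fact
  interpret H: abelian_group H by fact
  have "h \<zero>\<^bsub>G\<^esub> \<oplus>\<^bsub>H\<^esub> h \<zero>\<^bsub>G\<^esub> = h \<zero>\<^bsub>G\<^esub>"
    using assms(5)[of "\<zero>\<^bsub>G\<^esub>" "\<zero>\<^bsub>G\<^esub>"] by simp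
  then have z: "h \<zero>\<^bsub>G\<^esub> = \<zero>\<^bsub>H\<^esub>"
    by (metis G.zero_closed H.add.r_cancel_one' Pi_iff assms(4))
  have "(finsum G f A, finsum H (\<lambda>j. h (f j)) A) \<in> {(x, h x) | x. x \<in> carrier G}"
    by (rule finsum_pair_closed[OF assms(1-3)]) (use assms z in \<open>auto simp: Pi_iff\<close>)
  then show ?thesis by auto
qed

section \<open>Linear categories and presheaves, elementwise\<close>

locale linear_category = universe_type "TYPE('u)" +
  fixes k :: "'k ring" and a :: "('k, 'o, 'u) lincat"
  assumes cring: "cring k" and lin: "lin_category k a" and ess: "essentially_small TYPE('u) a"
begin

abbreviation "Ob \<equiv> Obj a"
abbreviation hplus :: "'o \<Rightarrow> 'o \<Rightarrow> 'u \<Rightarrow> 'u \<Rightarrow> 'u" where "hplus X Y f g \<equiv> f \<oplus>\<^bsub>HomM a X Y\<^esub> g"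
abbreviation hzero :: "'o \<Rightarrow> 'o \<Rightarrow> 'u" where "hzero X Y \<equiv> \<zero>\<^bsub>HomM a X Y\<^esub>"
abbreviation crr :: "('k, 'o, 'u) presheaf \<Rightarrow> 'o \<Rightarrow> 'u set" where "crr F A \<equiv> carrier (fobj F A)"
abbreviation psh :: "('k, 'o, 'u) presheaf \<Rightarrow> bool" where "psh F \<equiv> F \<in> Obj (PSh k a)"

lemma category_a: "category a" using lin by (simp add: lin_category_def)

lemma id_arr[simp]: "X \<in> Ob \<Longrightarrow> Ident a X \<in> Arr a X X"
  using category_a by (simp add: category_def)

lemma comp_arr[simp]:
  "f \<in> Arr a X Y \<Longrightarrow> g \<in> Arr a Y Z \<Longrightarrow> X \<in> Ob \<Longrightarrow> Y \<in> Ob \<Longrightarrow> Z \<in> Ob \<Longrightarrow> Comp a X Y Z g f \<in> Arr a X Z"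
  using category_a unfolding category_def by blast

lemma comp_id[simp]:
  assumes "X \<in> Ob" "Y \<in> Ob" "f \<in> Arr a X Y"
  shows "Comp a X X Y f (Ident a X) = f" "Comp a X Y Y (Ident a Y) f = f"
  using category_a assms unfolding category_def by blast+

lemma comp_assoc:
  assumes "W \<in> Ob" "X \<in> Ob" "Y \<in> Ob" "Z \<in> Ob" "f \<in> Arr a W X" "g \<in> Arr a X Y" "h \<in> Arr a Y Z"
  shows "Comp a W X Z (Comp a X Y Z h g) f = Comp a W Y Z h (Comp a W X Y g f)"
  using category_a assms unfolding category_def by metis

lemma hom_module: "X \<in> Ob \<Longrightarrow> Y \<in> Ob \<Longrightarrow> module k (HomM a X Y)"
  and carrier_hom[simp]: "X \<in> Ob \<Longrightarrow> Y \<in> Ob \<Longrightarrow> carrier (HomM a X Y) = Arr a X Y"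
  using lin unfolding lin_category_def by blast+

lemma hom_group: "X \<in> Ob \<Longrightarrow> Y \<in> Ob \<Longrightarrow> abelian_group (HomM a X Y)"
  using hom_module by (simp add: module_def)

lemma hplus_arr[simp]:
  "X \<in> Ob \<Longrightarrow> Y \<in> Ob \<Longrightarrow> f \<in> Arr a X Y \<Longrightarrow> g \<in> Arr a X Y \<Longrightarrow> hplus X Y f g \<in> Arr a X Y"
  using abelian_groupE(1)[OF hom_group] by simp

lemma hzero_arr[simp]: "X \<in> Ob \<Longrightarrow> Y \<in> Ob \<Longrightarrow> hzero X Y \<in> Arr a X Y"
  using abelian_groupE(2)[OF hom_group] by simp

lemma smult_arr[simp]:
  "X \<in> Ob \<Longrightarrow> Y \<in> Ob \<Longrightarrow> c \<in> carrier k \<Longrightarrow> f \<in> Arr a X Y \<Longrightarrow> c \<odot>\<^bsub>HomM a X Y\<^esub> f \<in> Arr a X Y"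
  using module.smult_closed[OF hom_module] by simp

lemma comp_plus_right:
  assumes "X \<in> Ob" "Y \<in> Ob" "Z \<in> Ob" "g \<in> Arr a Y Z" "f \<in> Arr a X Y" "f' \<in> Arr a X Y"
  shows "Comp a X Y Z g (hplus X Y f f') = hplus X Z (Comp a X Y Z g f) (Comp a X Y Z g f')"
  using lin assms unfolding lin_category_def linear_map_def by auto

lemma comp_plus_left:
  assumes "X \<in> Ob" "Y \<in> Ob" "Z \<in> Ob" "f \<in> Arr a X Y" "g \<in> Arr a Y Z" "g' \<in> Arr a Y Z"
  shows "Comp a X Y Z (hplus Y Z g g') f = hplus X Z (Comp a X Y Z g f) (Comp a X Y Z g' f)"
  using lin assms unfolding lin_category_def linear_map_def by auto

lemma comp_smult_right:
  assumes "X \<in> Ob" "Y \<in> Ob" "Z \<in> Ob" "g \<in> Arr a Y Z" "f \<in> Arr a X Y" "c \<in> carrier k"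
  shows "Comp a X Y Z g (c \<odot>\<^bsub>HomM a X Y\<^esub> f) = c \<odot>\<^bsub>HomM a X Z\<^esub> (Comp a X Y Z g f)"
  using lin assms unfolding lin_category_def linear_map_def by auto

lemma comp_smult_left:
  assumes "X \<in> Ob" "Y \<in> Ob" "Z \<in> Ob" "f \<in> Arr a X Y" "g \<in> Arr a Y Z" "c \<in> carrier k"
  shows "Comp a X Y Z (c \<odot>\<^bsub>HomM a Y Z\<^esub> g) f = c \<odot>\<^bsub>HomM a X Z\<^esub> (Comp a X Y Z g f)"
  using lin assms unfolding lin_category_def linear_map_def by auto

lemma comp_zero_right[simp]:
  assumes "X \<in> Ob" "Y \<in> Ob" "Z \<in> Ob" "g \<in> Arr a Y Z"
  shows "Comp a X Y Z g (hzero X Y) = hzero X Z"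
proof -
  interpret G: abelian_group "HomM a X Y" using assms hom_group by blast
  interpret H: abelian_group "HomM a X Z" using assms hom_group by blast
  have "Comp a X Y Z g (hplus X Y (hzero X Y) (hzero X Y)) = hplus X Z (Comp a X Y Z g (hzero X Y)) (Comp a X Y Z g (hzero X Y))"
    using assms by (intro comp_plus_right) auto
  then show ?thesis
    using assms G.zero_closed by (simp add: H.add.r_cancel_one')
qed

lemma comp_zero_left[simp]:
  assumes "X \<in> Ob" "Y \<in> Ob" "Z \<in> Ob" "f \<in> Arr a X Y"
  shows "Comp a X Y Z (hzero Y Z) f = hzero X Z"
proof -
  interpret G: abelian_group "HomM a Y Z" using assms hom_group by blast
  interpret H: abelian_group "HomM a X Z" using assms hom_group by blast
  have "Comp a X Y Z (hplus Y Z (hzero Y Z) (hzero Y Z)) f = hplus X Z (Comp a X Y Z (hzero Y Z) f) (Comp a X Y Z (hzero Y Z) f)"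
    using assms by (intro comp_plus_left) auto
  then show ?thesis
    using assms G.zero_closed by (simp add: H.add.r_cancel_one')
qed

text \<open>The scalar c as an endomorphism of \<open>A\<close>. A linear functor sends it to
  multiplication by c, which reduces statements about scalars to statements about
  composition.\<close>

definition sc :: "'k \<Rightarrow> 'o \<Rightarrow> 'u" where "sc c A = c \<odot>\<^bsub>HomM a A A\<^esub> Ident a A"

lemma sc_arr[simp]: "A \<in> Ob \<Longrightarrow> c \<in> carrier k \<Longrightarrow> sc c A \<in> Arr a A A"
  by (simp add: sc_def)

lemma comp_sc_right: "A \<in> Ob \<Longrightarrow> B \<in> Ob \<Longrightarrow> f \<in> Arr a A B \<Longrightarrow> c \<in> carrier k \<Longrightarrow> Comp a A A B f (sc c A) = c \<odot>\<^bsub>HomM a A B\<^esub> f"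
  and comp_sc_left: "A \<in> Ob \<Longrightarrow> B \<in> Ob \<Longrightarrow> f \<in> Arr a A B \<Longrightarrow> c \<in> carrier k \<Longrightarrow> Comp a A B B (sc c B) f = c \<odot>\<^bsub>HomM a A B\<^esub> f"
  unfolding sc_def by (simp_all add: comp_smult_right comp_smult_left)

text \<open>Minus the identity. Restriction along it negates sections, so closure under restriction
  includes closure under negatives.\<close>

definition hneg :: "'o \<Rightarrow> 'u" where "hneg A = \<ominus>\<^bsub>HomM a A A\<^esub> Ident a A"

lemma hneg_arr[simp]: "A \<in> Ob \<Longrightarrow> hneg A \<in> Arr a A A"
  unfolding hneg_def using abelian_group.a_inv_closed[OF hom_group, of A A "Ident a A"] by simp

lemma hneg_plus: "A \<in> Ob \<Longrightarrow> hplus A A (hneg A) (Ident a A) = hzero A A"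
  unfolding hneg_def using abelian_group.l_neg[OF hom_group, of A A "Ident a A"] by simp

lemma comp_hneg_plus: "A \<in> Ob \<Longrightarrow> B \<in> Ob \<Longrightarrow> f \<in> Arr a A B \<Longrightarrow> hplus A B (Comp a A A B f (hneg A)) f = hzero A B"
  using comp_plus_right[of A A B f "hneg A" "Ident a A"] by (simp add: hneg_plus)

lemma comp_hneg: "A \<in> Ob \<Longrightarrow> B \<in> Ob \<Longrightarrow> f \<in> Arr a A B \<Longrightarrow> Comp a A A B f (hneg A) = \<ominus>\<^bsub>HomM a A B\<^esub> f"
  using abelian_group.minus_equality[OF hom_group, of A B "Comp a A A B f (hneg A)" f] by (simp add: comp_hneg_plus)

lemma small_arr: "X \<in> Ob \<Longrightarrow> Y \<in> Ob \<Longrightarrow> small TYPE('u) (Arr a X Y)"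
  using ess unfolding essentially_small_def by blast

text \<open>A linear functor into modules is an additive functor for which restriction along
  \<open>sc c A\<close> is multiplication by c. The other compatibilities with scalars, in the arrow
  and in the section, follow by functoriality, because \<open>sc\<close> commutes with every
  arrow.\<close>

lemma psh_iff:
  "psh F \<longleftrightarrow>
    (\<forall>A\<in>Ob. module k (fobj F A) \<and> small TYPE('u) (crr F A)) \<and>
    (\<forall>A\<in>Ob. \<forall>B\<in>Ob. \<forall>f\<in>Arr a B A. fmap F A B f \<in> extensional (crr F A) \<and>
       fmap F A B f \<in> crr F A \<rightarrow> crr F B \<and>
       (\<forall>x\<in>crr F A. \<forall>y\<in>crr F A. fmap F A B f (x \<oplus>\<^bsub>fobj F A\<^esub> y) = fmap F A B f x \<oplus>\<^bsub>fobj F B\<^esub> fmap F A B f y)) \<and>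
    (\<forall>A\<in>Ob. \<forall>x\<in>crr F A. fmap F A A (Ident a A) x = x) \<and>
    (\<forall>A\<in>Ob. \<forall>B\<in>Ob. \<forall>C\<in>Ob. \<forall>f\<in>Arr a B A. \<forall>g\<in>Arr a C B. \<forall>x\<in>crr F A.
       fmap F A C (Comp a C B A f g) x = fmap F B C g (fmap F A B f x)) \<and>
    (\<forall>A\<in>Ob. \<forall>B\<in>Ob. \<forall>f\<in>Arr a B A. \<forall>g\<in>Arr a B A. \<forall>x\<in>crr F A.
       fmap F A B (hplus B A f g) x = fmap F A B f x \<oplus>\<^bsub>fobj F B\<^esub> fmap F A B g x) \<and>
    (\<forall>A\<in>Ob. \<forall>c\<in>carrier k. \<forall>x\<in>crr F A. fmap F A A (sc c A) x = c \<odot>\<^bsub>fobj F A\<^esub> x)"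
  (is "_ \<longleftrightarrow> ?M \<and> ?R \<and> ?I \<and> ?C \<and> ?P \<and> ?S")
proof
  assume "psh F"
  then have F: "lin_functor k (opcat a) (ModCat k) F"
    by (simp add: PSh_def lin_functor_cat_def)
  then have func: "is_functor (opcat a) (ModCat k) F" by (simp add: lin_functor_def)
  have M: ?M and R: ?R
    using func unfolding is_functor_def opcat_def ModCat_def linear_map_def by auto
  have I: ?I using func unfolding is_functor_def opcat_def ModCat_def by auto
  have C: ?C
  proof (intro ballI)
    fix A B C f g x assume *: "A \<in> Ob" "B \<in> Ob" "C \<in> Ob" "f \<in> Arr a B A" "g \<in> Arr a C B" "x \<in> crr F A"
    then have "fmap F A C (Comp a C B A f g) = compose (crr F A) (fmap F B C g) (fmap F A B f)"
      using func unfolding is_functor_def opcat_def ModCat_def by simp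
    with * show "fmap F A C (Comp a C B A f g) x = fmap F B C g (fmap F A B f x)"
      by (simp add: compose_def)
  qed
  have L: "linear_map k (HomM a B A) (HomM (ModCat k) (fobj F A) (fobj F B)) (fmap F A B)" if "A \<in> Ob" "B \<in> Ob" for A B
    using F that unfolding lin_functor_def opcat_def by auto
  have P: ?P
    using L unfolding linear_map_def ModCat_def prod_module_def by (simp)
  have S: ?S
  proof (intro ballI)
    fix A c x assume *: "A \<in> Ob" "c \<in> carrier k" "x \<in> crr F A"
    then have "fmap F A A (c \<odot>\<^bsub>HomM a A A\<^esub> Ident a A) = (\<lambda>x\<in>crr F A. c \<odot>\<^bsub>fobj F A\<^esub> fmap F A A (Ident a A) x)"
      using L[of A A] unfolding linear_map_def ModCat_def prod_module_def by simp
    with * I show "fmap F A A (sc c A) x = c \<odot>\<^bsub>fobj F A\<^esub> x"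
      by (simp add: sc_def)
  qed
  show "?M \<and> ?R \<and> ?I \<and> ?C \<and> ?P \<and> ?S" by (intro conjI M R I C P S)
next
  assume *: "?M \<and> ?R \<and> ?I \<and> ?C \<and> ?P \<and> ?S"
  have M: ?M using * by (elim conjE)
  have R: ?R using * by (elim conjE)
  have I: ?I using * by (elim conjE)
  have C: ?C using * by (elim conjE)
  have P: ?P using * by (elim conjE)
  have S: ?S using * by (elim conjE)
  \<comment> \<open>c times \<open>f\<close> is \<open>f\<close> precomposed with the scalar on
    \<open>B\<close>, which acts on the restricted section.\<close>
  have sm: "fmap F A B (c \<odot>\<^bsub>HomM a B A\<^esub> f) x = c \<odot>\<^bsub>fobj F B\<^esub> fmap F A B f x"
    if "A \<in> Ob" "B \<in> Ob" "c \<in> carrier k" "f \<in> Arr a B A" "x \<in> crr F A" for A B c f x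
  proof -
    have "fmap F A B (Comp a B B A f (sc c B)) x = fmap F B B (sc c B) (fmap F A B f x)"
      using that by (intro C[rule_format]) auto
    moreover have "fmap F A B f x \<in> crr F B" using R that by auto
    ultimately show ?thesis using that S by (simp add: comp_sc_right)
  qed
  \<comment> \<open>The same arrow, written as \<open>sc c A\<close> after \<open>f\<close>, lets
    the scalar act before the restriction.\<close>
  have sm': "fmap F A B f (c \<odot>\<^bsub>fobj F A\<^esub> x) = c \<odot>\<^bsub>fobj F B\<^esub> fmap F A B f x"
    if "A \<in> Ob" "B \<in> Ob" "c \<in> carrier k" "f \<in> Arr a B A" "x \<in> crr F A" for A B c f x
  proof -
    have "fmap F A B (Comp a B A A (sc c A) f) x = fmap F A B f (fmap F A A (sc c A) x)"
      using that by (intro C[rule_format]) auto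
    then show ?thesis using that S sm by (simp add: comp_sc_left)
  qed
  have R1: "fmap F A B f \<in> Arr (ModCat k) (fobj F A) (fobj F B)" if "A \<in> Ob" "B \<in> Ob" "f \<in> Arr a B A" for A B f
    using R sm' that unfolding ModCat_def linear_map_def by simp
  have "is_functor (opcat a) (ModCat k) F"
    unfolding is_functor_def
  proof (intro conjI ballI)
    fix X assume X: "X \<in> Obj (opcat a)"
    then have X: "X \<in> Ob" by (simp add: opcat_def)
    show "fobj F X \<in> Obj (ModCat k)" using M X by (simp add: ModCat_def)
    have "fmap F X X (Ident a X) = (\<lambda>x\<in>crr F X. x)"
      by (rule extensionalityI[of _ "crr F X"]) (use R I X in auto)
    then show "fmap F X X (Ident (opcat a) X) = Ident (ModCat k) (fobj F X)"
      by (simp add: opcat_def ModCat_def)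
  next
    fix X Y f assume "X \<in> Obj (opcat a)" "Y \<in> Obj (opcat a)" "f \<in> Arr (opcat a) X Y"
    then show "fmap F X Y f \<in> Arr (ModCat k) (fobj F X) (fobj F Y)"
      using R1 by (simp add: opcat_def)
  next
    fix X Y Z f g assume *: "X \<in> Obj (opcat a)" "Y \<in> Obj (opcat a)" "Z \<in> Obj (opcat a)" "f \<in> Arr (opcat a) X Y" "g \<in> Arr (opcat a) Y Z"
    have "fmap F X Z (Comp a Z Y X f g) = compose (crr F X) (fmap F Y Z g) (fmap F X Y f)"
      by (rule extensionalityI[of _ "crr F X"]) (use R C * in \<open>auto simp: opcat_def compose_def\<close>)
    then show "fmap F X Z (Comp (opcat a) X Y Z g f) =
       Comp (ModCat k) (fobj F X) (fobj F Y) (fobj F Z) (fmap F Y Z g) (fmap F X Y f)"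
      by (simp add: opcat_def ModCat_def)
  qed
  moreover have "linear_map k (HomM (opcat a) X Y) (HomM (ModCat k) (fobj F X) (fobj F Y)) (fmap F X Y)"
    if XY: "X \<in> Obj (opcat a)" "Y \<in> Obj (opcat a)" for X Y
    unfolding linear_map_def
  proof (intro conjI ballI)
    have XY: "X \<in> Ob" "Y \<in> Ob" using XY by (auto simp: opcat_def)
    note [simp] = XY
    have H: "HomM (opcat a) X Y = HomM a Y X" by (simp add: opcat_def)
    show "fmap F X Y \<in> carrier (HomM (opcat a) X Y) \<rightarrow> carrier (HomM (ModCat k) (fobj F X) (fobj F Y))"
      using R1[of X Y] by (auto simp: H) (simp add: ModCat_def)
    have ext: "fmap F X Y f \<in> extensional (crr F X)" if "f \<in> Arr a Y X" for f using R that by simp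
    show "fmap F X Y (f \<oplus>\<^bsub>HomM (opcat a) X Y\<^esub> g) = fmap F X Y f \<oplus>\<^bsub>HomM (ModCat k) (fobj F X) (fobj F Y)\<^esub> fmap F X Y g"
      if "f \<in> carrier (HomM (opcat a) X Y)" "g \<in> carrier (HomM (opcat a) X Y)" for f g
      by (rule extensionalityI[of _ "crr F X"]) (use that ext P in \<open>auto simp: H ModCat_def prod_module_def\<close>)
    show "fmap F X Y (c \<odot>\<^bsub>HomM (opcat a) X Y\<^esub> f) = c \<odot>\<^bsub>HomM (ModCat k) (fobj F X) (fobj F Y)\<^esub> fmap F X Y f"
      if "c \<in> carrier k" "f \<in> carrier (HomM (opcat a) X Y)" for c f
      by (rule extensionalityI[of _ "crr F X"]) (use that ext sm in \<open>auto simp: H ModCat_def prod_module_def\<close>)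
  qed
  ultimately show "psh F" by (simp add: PSh_def lin_functor_cat_def lin_functor_def)
qed

lemma
  assumes "psh F"
  shows psh_module: "\<And>A. A \<in> Ob \<Longrightarrow> module k (fobj F A)"
    and psh_small: "\<And>A. A \<in> Ob \<Longrightarrow> small TYPE('u) (crr F A)"
    and psh_ext: "\<And>A B f. A \<in> Ob \<Longrightarrow> B \<in> Ob \<Longrightarrow> f \<in> Arr a B A \<Longrightarrow> fmap F A B f \<in> extensional (crr F A)"
    and psh_closed: "\<And>A B f x. A \<in> Ob \<Longrightarrow> B \<in> Ob \<Longrightarrow> f \<in> Arr a B A \<Longrightarrow> x \<in> crr F A \<Longrightarrow> fmap F A B f x \<in> crr F B"
    and psh_add: "\<And>A B f x y. A \<in> Ob \<Longrightarrow> B \<in> Ob \<Longrightarrow> f \<in> Arr a B A \<Longrightarrow> x \<in> crr F A \<Longrightarrow> y \<in> crr F A \<Longrightarrow>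
        fmap F A B f (x \<oplus>\<^bsub>fobj F A\<^esub> y) = fmap F A B f x \<oplus>\<^bsub>fobj F B\<^esub> fmap F A B f y"
    and psh_id: "\<And>A x. A \<in> Ob \<Longrightarrow> x \<in> crr F A \<Longrightarrow> fmap F A A (Ident a A) x = x"
    and psh_comp: "\<And>A B C f g x. A \<in> Ob \<Longrightarrow> B \<in> Ob \<Longrightarrow> C \<in> Ob \<Longrightarrow> f \<in> Arr a B A \<Longrightarrow> g \<in> Arr a C B \<Longrightarrow> x \<in> crr F A \<Longrightarrow>
        fmap F A C (Comp a C B A f g) x = fmap F B C g (fmap F A B f x)"
    and psh_plus: "\<And>A B f g x. A \<in> Ob \<Longrightarrow> B \<in> Ob \<Longrightarrow> f \<in> Arr a B A \<Longrightarrow> g \<in> Arr a B A \<Longrightarrow> x \<in> crr F A \<Longrightarrow>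
        fmap F A B (hplus B A f g) x = fmap F A B f x \<oplus>\<^bsub>fobj F B\<^esub> fmap F A B g x"
    and psh_sc: "\<And>A c x. A \<in> Ob \<Longrightarrow> c \<in> carrier k \<Longrightarrow> x \<in> crr F A \<Longrightarrow> fmap F A A (sc c A) x = c \<odot>\<^bsub>fobj F A\<^esub> x"
  using assms unfolding psh_iff by (simp_all add: Pi_iff)

lemma psh_group: "psh F \<Longrightarrow> A \<in> Ob \<Longrightarrow> abelian_group (fobj F A)"
  using psh_module by (simp add: module_def)

lemma psh_plus_closed[simp]:
  "psh F \<Longrightarrow> A \<in> Ob \<Longrightarrow> x \<in> crr F A \<Longrightarrow> y \<in> crr F A \<Longrightarrow> x \<oplus>\<^bsub>fobj F A\<^esub> y \<in> crr F A"
  using abelian_groupE(1)[OF psh_group] .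

lemma psh_zero_closed[simp]: "psh F \<Longrightarrow> A \<in> Ob \<Longrightarrow> \<zero>\<^bsub>fobj F A\<^esub> \<in> crr F A"
  using abelian_groupE(2)[OF psh_group] .

lemma psh_zero_plus[simp]: "psh F \<Longrightarrow> A \<in> Ob \<Longrightarrow> x \<in> crr F A \<Longrightarrow> \<zero>\<^bsub>fobj F A\<^esub> \<oplus>\<^bsub>fobj F A\<^esub> x = x"
  "psh F \<Longrightarrow> A \<in> Ob \<Longrightarrow> x \<in> crr F A \<Longrightarrow> x \<oplus>\<^bsub>fobj F A\<^esub> \<zero>\<^bsub>fobj F A\<^esub> = x"
  using psh_group abelian_groupE(5) abelian_groupE(4) by fastforce+

lemma psh_plus_self: "psh F \<Longrightarrow> A \<in> Ob \<Longrightarrow> x \<in> crr F A \<Longrightarrow> x \<oplus>\<^bsub>fobj F A\<^esub> x = x \<Longrightarrow> x = \<zero>\<^bsub>fobj F A\<^esub>"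
proof -
  assume *: "psh F" "A \<in> Ob" "x \<in> crr F A" "x \<oplus>\<^bsub>fobj F A\<^esub> x = x"
  interpret abelian_group "fobj F A" using psh_group * by blast
  show ?thesis using * by simp
qed

lemma psh_zero[simp]:
  assumes "psh F" "A \<in> Ob" "B \<in> Ob" "f \<in> Arr a B A"
  shows "fmap F A B f \<zero>\<^bsub>fobj F A\<^esub> = \<zero>\<^bsub>fobj F B\<^esub>"
  using psh_add[OF assms psh_zero_closed psh_zero_closed] assms
  by (intro psh_plus_self) (auto simp: psh_closed)

lemma psh_hzero[simp]:
  assumes "psh F" "A \<in> Ob" "B \<in> Ob" "x \<in> crr F A"
  shows "fmap F A B (hzero B A) x = \<zero>\<^bsub>fobj F B\<^esub>"
proof -
  have "hplus B A (hzero B A) (hzero B A) = hzero B A"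
    using abelian_groupE(5)[OF hom_group[of B A]] assms by simp
  then show ?thesis
  using psh_plus[of F A B "hzero B A" "hzero B A" x] assms
  by (intro psh_plus_self) (auto simp: psh_closed)
qed

lemma psh_neg:
  assumes "psh F" "A \<in> Ob" "x \<in> crr F A"
  shows "fmap F A A (hneg A) x = \<ominus>\<^bsub>fobj F A\<^esub> x"
proof -
  have "fmap F A A (hneg A) x \<oplus>\<^bsub>fobj F A\<^esub> x = \<zero>\<^bsub>fobj F A\<^esub>"
    using psh_plus[of F A A "hneg A" "Ident a A" x] assms by (simp add: hneg_plus psh_id)
  then show ?thesis
    using assms abelian_group.minus_equality[OF psh_group, of F A "fmap F A A (hneg A) x" x] by (simp add: psh_closed)
qed

lemma psh_minus:
  assumes "psh F" "A \<in> Ob" "B \<in> Ob" "f \<in> Arr a B A" "x \<in> crr F A" "y \<in> crr F A"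
  shows "fmap F A B f (x \<ominus>\<^bsub>fobj F A\<^esub> y) = fmap F A B f x \<ominus>\<^bsub>fobj F B\<^esub> fmap F A B f y"
proof -
  interpret FA: abelian_group "fobj F A" using psh_group assms by blast
  interpret FB: abelian_group "fobj F B" using psh_group assms by blast
  have "fmap F A B f (x \<ominus>\<^bsub>fobj F A\<^esub> y) \<oplus>\<^bsub>fobj F B\<^esub> fmap F A B f y = fmap F A B f ((x \<ominus>\<^bsub>fobj F A\<^esub> y) \<oplus>\<^bsub>fobj F A\<^esub> y)"
    using assms by (simp add: psh_add)
  also have "(x \<ominus>\<^bsub>fobj F A\<^esub> y) \<oplus>\<^bsub>fobj F A\<^esub> y = x"
    using assms by (simp add: FA.minus_eq FA.a_assoc FA.l_neg)
  finally show ?thesis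
    using assms psh_closed[OF assms(1-4)] FA.minus_closed[OF assms(5,6)] by (simp add: FB.minus_eq FB.add.inv_solve_right)
qed

lemma psh_minus_zero_iff:
  "psh F \<Longrightarrow> A \<in> Ob \<Longrightarrow> x \<in> crr F A \<Longrightarrow> y \<in> crr F A \<Longrightarrow> x \<ominus>\<^bsub>fobj F A\<^esub> y = \<zero>\<^bsub>fobj F A\<^esub> \<longleftrightarrow> x = y"
proof -
  assume *: "psh F" "A \<in> Ob" "x \<in> crr F A" "y \<in> crr F A"
  interpret abelian_group "fobj F A" using psh_group * by blast
  show ?thesis
    using * add.inv_solve_right'[of "\<zero>\<^bsub>fobj F A\<^esub>" x y] by (auto simp: minus_eq r_neg)
qed

end

section \<open>Morphisms of presheaves\<close>

context linear_category
begin

abbreviation mor :: "('k, 'o, 'u) presheaf \<Rightarrow> ('k, 'o, 'u) presheaf \<Rightarrow> ('o \<Rightarrow> 'u \<Rightarrow> 'u) set" where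
  "mor F G \<equiv> Arr (PSh k a) F G"

text \<open>Linearity over k does not appear on the right-hand side: naturality with respect to
  \<open>sc c A\<close> supplies it.\<close>

lemma mor_iff:
  assumes "psh F" "psh G"
  shows "\<eta> \<in> mor F G \<longleftrightarrow> \<eta> \<in> extensional Ob \<and>
    (\<forall>A\<in>Ob. \<eta> A \<in> extensional (crr F A) \<and> (\<forall>x\<in>crr F A. \<eta> A x \<in> crr G A) \<and>
      (\<forall>x\<in>crr F A. \<forall>y\<in>crr F A. \<eta> A (x \<oplus>\<^bsub>fobj F A\<^esub> y) = \<eta> A x \<oplus>\<^bsub>fobj G A\<^esub> \<eta> A y)) \<and>
    (\<forall>A\<in>Ob. \<forall>B\<in>Ob. \<forall>f\<in>Arr a B A. \<forall>x\<in>crr F A. \<eta> B (fmap F A B f x) = fmap G A B f (\<eta> A x))"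
  (is "_ \<longleftrightarrow> ?E \<and> ?A \<and> ?N")
proof -
  have mor: "\<eta> \<in> mor F G \<longleftrightarrow> ?E \<and> (\<forall>A\<in>Ob. \<eta> A \<in> extensional (crr F A) \<and> linear_map k (fobj F A) (fobj G A) (\<eta> A)) \<and>
    (\<forall>A\<in>Ob. \<forall>B\<in>Ob. \<forall>f\<in>Arr a B A. compose (crr F A) (\<eta> B) (fmap F A B f) = compose (crr F A) (fmap G A B f) (\<eta> A))"
    unfolding PSh_def lin_functor_cat_def nat_trans_def ModCat_def opcat_def PiE_def by (auto simp: Pi_iff)
  show ?thesis
  proof
    assume "\<eta> \<in> mor F G"
    then have 1: ?E "\<forall>A\<in>Ob. \<eta> A \<in> extensional (crr F A) \<and> linear_map k (fobj F A) (fobj G A) (\<eta> A)"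
      and 2: "\<forall>A\<in>Ob. \<forall>B\<in>Ob. \<forall>f\<in>Arr a B A. compose (crr F A) (\<eta> B) (fmap F A B f) = compose (crr F A) (fmap G A B f) (\<eta> A)"
      unfolding mor by blast+
    have ?N
    proof (intro ballI)
      fix A B f x assume *: "A \<in> Ob" "B \<in> Ob" "f \<in> Arr a B A" "x \<in> crr F A"
      then have "compose (crr F A) (\<eta> B) (fmap F A B f) x = compose (crr F A) (fmap G A B f) (\<eta> A) x"
        using 2 by simp
      then show "\<eta> B (fmap F A B f x) = fmap G A B f (\<eta> A x)" using * by (simp add: compose_eq)
    qed
    moreover have ?A using 1 unfolding linear_map_def by blast
    ultimately show "?E \<and> ?A \<and> ?N" using 1 by blast
  next
    assume *: "?E \<and> ?A \<and> ?N"
    have "\<eta> A (c \<odot>\<^bsub>fobj F A\<^esub> x) = c \<odot>\<^bsub>fobj G A\<^esub> \<eta> A x" if "A \<in> Ob" "c \<in> carrier k" "x \<in> crr F A" for A c x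
    proof -
      have "\<eta> A (fmap F A A (sc c A) x) = fmap G A A (sc c A) (\<eta> A x)" using * that by simp
      then show ?thesis using that * assms by (simp add: psh_sc)
    qed
    then have "linear_map k (fobj F A) (fobj G A) (\<eta> A)" if "A \<in> Ob" for A
      using * that unfolding linear_map_def by auto
    moreover have "compose (crr F A) (\<eta> B) (fmap F A B f) = compose (crr F A) (fmap G A B f) (\<eta> A)"
      if "A \<in> Ob" "B \<in> Ob" "f \<in> Arr a B A" for A B f
      unfolding compose_def by (rule restrict_ext) (use * that in blast)
    ultimately show "\<eta> \<in> mor F G" unfolding mor using * by blast
  qed
qed

lemma
  assumes "\<eta> \<in> mor F G" "psh F" "psh G"
  shows mor_closed: "\<And>A x. A \<in> Ob \<Longrightarrow> x \<in> crr F A \<Longrightarrow> \<eta> A x \<in> crr G A"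
    and mor_add: "\<And>A x y. A \<in> Ob \<Longrightarrow> x \<in> crr F A \<Longrightarrow> y \<in> crr F A \<Longrightarrow> \<eta> A (x \<oplus>\<^bsub>fobj F A\<^esub> y) = \<eta> A x \<oplus>\<^bsub>fobj G A\<^esub> \<eta> A y"
    and mor_nat: "\<And>A B f x. A \<in> Ob \<Longrightarrow> B \<in> Ob \<Longrightarrow> f \<in> Arr a B A \<Longrightarrow> x \<in> crr F A \<Longrightarrow> \<eta> B (fmap F A B f x) = fmap G A B f (\<eta> A x)"
  using assms(1)[unfolded mor_iff[OF assms(2,3)]] by (simp_all)

lemma mor_zero: "\<eta> \<in> mor F G \<Longrightarrow> psh F \<Longrightarrow> psh G \<Longrightarrow> A \<in> Ob \<Longrightarrow> \<eta> A \<zero>\<^bsub>fobj F A\<^esub> = \<zero>\<^bsub>fobj G A\<^esub>"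
  using mor_nat[of \<eta> F G A A "hzero A A" "\<zero>\<^bsub>fobj F A\<^esub>"] by (simp add: mor_closed[of \<eta> F G])

lemma mor_minus:
  assumes "\<eta> \<in> mor F G" "psh F" "psh G" "A \<in> Ob" "x \<in> crr F A" "y \<in> crr F A"
  shows "\<eta> A (x \<ominus>\<^bsub>fobj F A\<^esub> y) = \<eta> A x \<ominus>\<^bsub>fobj G A\<^esub> \<eta> A y"
proof -
  have "x \<ominus>\<^bsub>fobj F A\<^esub> y = x \<oplus>\<^bsub>fobj F A\<^esub> fmap F A A (hneg A) y"
    using assms by (simp add: psh_neg a_minus_def)
  moreover have "\<eta> A x \<ominus>\<^bsub>fobj G A\<^esub> \<eta> A y = \<eta> A x \<oplus>\<^bsub>fobj G A\<^esub> fmap G A A (hneg A) (\<eta> A y)"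
    using assms by (simp add: psh_neg a_minus_def mor_closed[of \<eta> F G])
  ultimately show ?thesis using assms by (simp add: mor_add[OF assms(1-3)] psh_closed mor_nat[OF assms(1-3)])
qed

lemma mor_eqI:
  assumes "\<eta> \<in> mor F G" "\<theta> \<in> mor F G" "psh F" "psh G"
    and "\<And>A x. A \<in> Ob \<Longrightarrow> x \<in> crr F A \<Longrightarrow> \<eta> A x = \<theta> A x"
  shows "\<eta> = \<theta>"
proof (rule extensionalityI[of _ Ob])
  show "\<eta> A = \<theta> A" if "A \<in> Ob" for A
    by (rule extensionalityI[of _ "crr F A"]) (use assms that in \<open>auto simp: mor_iff\<close>)
qed (use assms in \<open>auto simp: mor_iff\<close>)

text \<open>Arrows of \<open>PSh k a\<close> are extensional both in the object and in the section.
  \<open>mk\<close> puts a family of maps into this normal form, so that morphisms agreeing on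
  sections are equal.\<close>

definition mk :: "('k, 'o, 'u) presheaf \<Rightarrow> ('o \<Rightarrow> 'u \<Rightarrow> 'u) \<Rightarrow> 'o \<Rightarrow> 'u \<Rightarrow> 'u" where
  "mk F h = (\<lambda>A\<in>Ob. \<lambda>x\<in>crr F A. h A x)"

lemma mk_apply[simp]: "A \<in> Ob \<Longrightarrow> x \<in> crr F A \<Longrightarrow> mk F h A x = h A x"
  by (simp add: mk_def)

lemma mk_mor:
  assumes "psh F" "psh G"
    and "\<And>A x. A \<in> Ob \<Longrightarrow> x \<in> crr F A \<Longrightarrow> h A x \<in> crr G A"
    and "\<And>A x y. A \<in> Ob \<Longrightarrow> x \<in> crr F A \<Longrightarrow> y \<in> crr F A \<Longrightarrow> h A (x \<oplus>\<^bsub>fobj F A\<^esub> y) = h A x \<oplus>\<^bsub>fobj G A\<^esub> h A y"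
    and "\<And>A B f x. A \<in> Ob \<Longrightarrow> B \<in> Ob \<Longrightarrow> f \<in> Arr a B A \<Longrightarrow> x \<in> crr F A \<Longrightarrow> h B (fmap F A B f x) = fmap G A B f (h A x)"
  shows "mk F h \<in> mor F G"
  unfolding mor_iff[OF assms(1,2)] using assms by (auto simp: mk_def psh_closed)

lemma Obj_opcat[simp]: "Obj (opcat C) = Obj C"
  by (simp add: opcat_def)

lemma op_extensional[simp]:
  "Comp (PSh k a) F G H \<theta> \<eta> \<in> extensional Ob" "Ident (PSh k a) F \<in> extensional Ob"
  "\<zero>\<^bsub>HomM (PSh k a) F G\<^esub> \<in> extensional Ob"
  "\<eta> \<oplus>\<^bsub>HomM (PSh k a) F G\<^esub> \<theta> \<in> extensional Ob"
  "c \<odot>\<^bsub>HomM (PSh k a) F G\<^esub> \<theta> \<in> extensional Ob"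
  "A \<in> Ob \<Longrightarrow> Comp (PSh k a) F G H \<theta> \<eta> A \<in> extensional (crr F A)"
  "A \<in> Ob \<Longrightarrow> Ident (PSh k a) F A \<in> extensional (crr F A)"
  "A \<in> Ob \<Longrightarrow> \<zero>\<^bsub>HomM (PSh k a) F G\<^esub> A \<in> extensional (crr F A)"
  "A \<in> Ob \<Longrightarrow> (\<eta> \<oplus>\<^bsub>HomM (PSh k a) F G\<^esub> \<theta>) A \<in> extensional (crr F A)"
  "A \<in> Ob \<Longrightarrow> (c \<odot>\<^bsub>HomM (PSh k a) F G\<^esub> \<theta>) A \<in> extensional (crr F A)"
  by (auto simp: PSh_def lin_functor_cat_def ModCat_def prod_module_def)

lemma comp_apply[simp]: "A \<in> Ob \<Longrightarrow> x \<in> crr F A \<Longrightarrow> Comp (PSh k a) F G H \<theta> \<eta> A x = \<theta> A (\<eta> A x)"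
  by (simp add: PSh_def lin_functor_cat_def ModCat_def compose_def)

lemma ident_apply[simp]: "A \<in> Ob \<Longrightarrow> x \<in> crr F A \<Longrightarrow> Ident (PSh k a) F A x = x"
  by (simp add: PSh_def lin_functor_cat_def ModCat_def)

lemma zero_apply[simp]: "A \<in> Ob \<Longrightarrow> x \<in> crr F A \<Longrightarrow> \<zero>\<^bsub>HomM (PSh k a) F G\<^esub> A x = \<zero>\<^bsub>fobj G A\<^esub>"
  by (simp add: PSh_def lin_functor_cat_def ModCat_def prod_module_def)

lemma plus_apply[simp]: "A \<in> Ob \<Longrightarrow> x \<in> crr F A \<Longrightarrow> (\<eta> \<oplus>\<^bsub>HomM (PSh k a) F G\<^esub> \<theta>) A x = \<eta> A x \<oplus>\<^bsub>fobj G A\<^esub> \<theta> A x"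
  by (simp add: PSh_def lin_functor_cat_def ModCat_def prod_module_def)

lemma smult_apply[simp]: "A \<in> Ob \<Longrightarrow> x \<in> crr F A \<Longrightarrow> (c \<odot>\<^bsub>HomM (PSh k a) F G\<^esub> \<theta>) A x = c \<odot>\<^bsub>fobj G A\<^esub> \<theta> A x"
  by (simp add: PSh_def lin_functor_cat_def ModCat_def prod_module_def)

lemma carrier_mor[simp]: "carrier (HomM (PSh k a) F G) = mor F G"
  by (simp add: PSh_def lin_functor_cat_def)

text \<open>Made for the operations of \<open>PSh k a\<close>: these are extensional by
  construction, so membership in \<open>mor\<close> reduces to \<open>mk_mor\<close> for a formula
  computing their values.\<close>

lemma mor_mkI:
  assumes "psh F" "psh G" "mk F h \<in> mor F G" "\<eta> \<in> extensional Ob" "\<And>A. A \<in> Ob \<Longrightarrow> \<eta> A \<in> extensional (crr F A)"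
    and "\<And>A x. A \<in> Ob \<Longrightarrow> x \<in> crr F A \<Longrightarrow> \<eta> A x = h A x"
  shows "\<eta> \<in> mor F G"
proof -
  have "\<eta> = mk F h"
  proof (rule extensionalityI[of _ Ob])
    show "\<eta> A = mk F h A" if "A \<in> Ob" for A
      by (rule extensionalityI[of _ "crr F A"]) (use assms that in \<open>auto simp: mk_def\<close>)
  qed (use assms in \<open>auto simp: mk_def\<close>)
  then show ?thesis using assms by simp
qed

lemma comp_mor[simp]:
  assumes "psh F" "psh G" "psh H" "\<eta> \<in> mor F G" "\<theta> \<in> mor G H"
  shows "Comp (PSh k a) F G H \<theta> \<eta> \<in> mor F H"
  by (rule mor_mkI[OF _ _ mk_mor[of F H "\<lambda>A x. \<theta> A (\<eta> A x)"]])
    (use assms in \<open>auto simp: mor_closed[of \<eta> F G] mor_closed[of \<theta> G H] mor_add[of \<eta> F G] mor_add[of \<theta> G H]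
      mor_nat[of \<eta> F G] mor_nat[of \<theta> G H]\<close>)

lemma ident_mor[simp]: "psh F \<Longrightarrow> Ident (PSh k a) F \<in> mor F F"
  by (rule mor_mkI[OF _ _ mk_mor[of F F "\<lambda>A x. x"]]) auto

lemma zero_mor[simp]: "psh F \<Longrightarrow> psh G \<Longrightarrow> \<zero>\<^bsub>HomM (PSh k a) F G\<^esub> \<in> mor F G"
  by (rule mor_mkI[OF _ _ mk_mor[of F G "\<lambda>A x. \<zero>\<^bsub>fobj G A\<^esub>"]])
    auto

lemma plus_mor[simp]:
  assumes "psh F" "psh G" "\<eta> \<in> mor F G" "\<theta> \<in> mor F G"
  shows "\<eta> \<oplus>\<^bsub>HomM (PSh k a) F G\<^esub> \<theta> \<in> mor F G"
proof (rule mor_mkI[OF _ _ mk_mor[of F G "\<lambda>A x. \<eta> A x \<oplus>\<^bsub>fobj G A\<^esub> \<theta> A x"]])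
  show "\<eta> A (x \<oplus>\<^bsub>fobj F A\<^esub> y) \<oplus>\<^bsub>fobj G A\<^esub> \<theta> A (x \<oplus>\<^bsub>fobj F A\<^esub> y) =
      \<eta> A x \<oplus>\<^bsub>fobj G A\<^esub> \<theta> A x \<oplus>\<^bsub>fobj G A\<^esub> (\<eta> A y \<oplus>\<^bsub>fobj G A\<^esub> \<theta> A y)"
    if "A \<in> Ob" "x \<in> crr F A" "y \<in> crr F A" for A x y
  proof -
    interpret abelian_group "fobj G A" using assms that psh_group by blast
    show ?thesis using assms that by (simp add: mor_add[of _ F G] mor_closed[of _ F G] a_ac)
  qed
qed (use assms in \<open>auto simp: mor_closed[of _ F G] mor_nat[of _ F G] psh_add\<close>)

lemma smult_mor[simp]:
  assumes "psh F" "psh G" "\<eta> \<in> mor F G" "c \<in> carrier k"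
  shows "c \<odot>\<^bsub>HomM (PSh k a) F G\<^esub> \<eta> \<in> mor F G"
proof (rule mor_mkI[OF _ _ mk_mor[of F G "\<lambda>A x. \<eta> A (c \<odot>\<^bsub>fobj F A\<^esub> x)"]])
  have m: "module k (fobj F A)" "module k (fobj G A)" if "A \<in> Ob" for A using psh_module assms that by blast+
  have l: "\<eta> A (c \<odot>\<^bsub>fobj F A\<^esub> x) = c \<odot>\<^bsub>fobj G A\<^esub> \<eta> A x" if "A \<in> Ob" "x \<in> crr F A" for A x
    using mor_nat[of \<eta> F G A A "sc c A" x] assms that by (simp add: psh_sc mor_closed[of _ F G])
  show "\<eta> A (c \<odot>\<^bsub>fobj F A\<^esub> x) \<in> crr G A" if "A \<in> Ob" "x \<in> crr F A" for A x
    using assms that by (simp add: mor_closed[of _ F G] module.smult_closed[OF m(1)])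
  show "\<eta> A (c \<odot>\<^bsub>fobj F A\<^esub> (x \<oplus>\<^bsub>fobj F A\<^esub> y)) = \<eta> A (c \<odot>\<^bsub>fobj F A\<^esub> x) \<oplus>\<^bsub>fobj G A\<^esub> \<eta> A (c \<odot>\<^bsub>fobj F A\<^esub> y)"
    if "A \<in> Ob" "x \<in> crr F A" "y \<in> crr F A" for A x y
    using assms that by (simp add: module.smult_r_distr[OF m(1)] module.smult_closed[OF m(1)] mor_add[of _ F G])
  show "\<eta> B (c \<odot>\<^bsub>fobj F B\<^esub> fmap F A B f x) = fmap G A B f (\<eta> A (c \<odot>\<^bsub>fobj F A\<^esub> x))"
    if "A \<in> Ob" "B \<in> Ob" "f \<in> Arr a B A" "x \<in> crr F A" for A B f x
  proof -
    have "c \<odot>\<^bsub>fobj F B\<^esub> fmap F A B f x = fmap F A B f (c \<odot>\<^bsub>fobj F A\<^esub> x)"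
      using assms that psh_comp[of F A B B f "sc c B" x] psh_comp[of F A A B "sc c A" f x]
      by (simp add: comp_sc_left comp_sc_right psh_sc psh_closed)
    then show ?thesis using assms that by (simp add: mor_nat[of _ F G] module.smult_closed[OF m(1)])
  qed
  show "(c \<odot>\<^bsub>HomM (PSh k a) F G\<^esub> \<eta>) A x = \<eta> A (c \<odot>\<^bsub>fobj F A\<^esub> x)" if "A \<in> Ob" "x \<in> crr F A" for A x
    using that by (simp add: l)
qed (use assms in auto)

lemma category_PSh: "category (PSh k a)"
  unfolding category_def
proof (intro conjI ballI)
  show "Comp (PSh k a) X X Y f (Ident (PSh k a) X) = f" "Comp (PSh k a) X Y Y (Ident (PSh k a) Y) f = f"
    if "psh X" "psh Y" "f \<in> mor X Y" for X Y f
    by (rule mor_eqI[of _ X Y]; use that in \<open>simp add: mor_closed[of _ X Y]\<close>)+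
  show "Comp (PSh k a) W Y Z h (Comp (PSh k a) W X Y g f) = Comp (PSh k a) W X Z (Comp (PSh k a) X Y Z h g) f"
    if "psh W" "psh X" "psh Y" "psh Z" "f \<in> mor W X" "g \<in> mor X Y" "h \<in> mor Y Z" for W X Y Z f g h
    by (rule mor_eqI[of _ W Z]) (use that in \<open>simp_all add: mor_closed[of f W X]\<close>)
qed auto

lemma mor_module:
  assumes F: "psh F" and G: "psh G"
  shows "module k (HomM (PSh k a) F G)"
proof -
  have g: "abelian_group (fobj G A)" and m: "module k (fobj G A)" if "A \<in> Ob" for A using that G psh_group psh_module by blast+
  note c = mor_closed[OF _ F G]
  note s = module.smult_closed[OF m]
  have one: "\<one>\<^bsub>k\<^esub> \<in> carrier k" "\<ominus>\<^bsub>k\<^esub> \<one>\<^bsub>k\<^esub> \<in> carrier k"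
    using cring by (simp_all add: abelian_group.a_inv_closed cring_def monoid.one_closed ring.is_monoid ring.is_abelian_group)
  show ?thesis
  proof (rule moduleI[OF cring abelian_groupI]; (unfold carrier_mor)?)
    show "\<exists>y\<in>mor F G. y \<oplus>\<^bsub>HomM (PSh k a) F G\<^esub> x = \<zero>\<^bsub>HomM (PSh k a) F G\<^esub>" if "x \<in> mor F G" for x
    proof (intro bexI[of _ "(\<ominus>\<^bsub>k\<^esub> \<one>\<^bsub>k\<^esub>) \<odot>\<^bsub>HomM (PSh k a) F G\<^esub> x"] mor_eqI[of _ F G])
      show "(\<ominus>\<^bsub>k\<^esub> \<one>\<^bsub>k\<^esub>) \<odot>\<^bsub>HomM (PSh k a) F G\<^esub> x \<in> mor F G" using that F G one by simp
      then show "(\<ominus>\<^bsub>k\<^esub> \<one>\<^bsub>k\<^esub>) \<odot>\<^bsub>HomM (PSh k a) F G\<^esub> x \<oplus>\<^bsub>HomM (PSh k a) F G\<^esub> x \<in> mor F G" using that F G by simp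
      show "((\<ominus>\<^bsub>k\<^esub> \<one>\<^bsub>k\<^esub>) \<odot>\<^bsub>HomM (PSh k a) F G\<^esub> x \<oplus>\<^bsub>HomM (PSh k a) F G\<^esub> x) A v = \<zero>\<^bsub>HomM (PSh k a) F G\<^esub> A v"
        if v: "A \<in> Ob" "v \<in> crr F A" for A v
        using that one c[OF \<open>x \<in> mor F G\<close> v] abelian_group.l_neg[OF g]
        by (simp add: module.smult_l_minus[OF m] module.smult_one[OF m])
    qed (use F G in auto)
  qed (auto intro!: mor_eqI[OF _ _ F G] simp: F G c s module.smult_l_distr[OF m] module.smult_r_distr[OF m]
      module.smult_assoc1[OF m] module.smult_one[OF m] abelian_monoid.a_assoc[OF abelian_group.axioms(1)[OF g]]
      abelian_monoid.a_comm[OF abelian_group.axioms(1)[OF g]] abelian_monoid.a_lcomm[OF abelian_group.axioms(1)[OF g]] cring.cring_simprules(1,5)[OF cring] one)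
qed

lemma lin_category_PSh: "lin_category k (PSh k a)"
  unfolding lin_category_def
proof (intro conjI ballI category_PSh)
  fix X Y Z assume *: "psh X" "psh Y" "psh Z"
  show "module k (HomM (PSh k a) X Y)" using * mor_module by blast
  have sm: "g A (c \<odot>\<^bsub>fobj Y A\<^esub> v) = c \<odot>\<^bsub>fobj Z A\<^esub> g A v" if "A \<in> Ob" "v \<in> crr Y A" "c \<in> carrier k" "g \<in> mor Y Z" for A v c g
    using mor_nat[of g Y Z A A "sc c A" v] * that by (simp add: psh_sc mor_closed[of g Y Z])
  show "linear_map k (HomM (PSh k a) X Y) (HomM (PSh k a) X Z) (Comp (PSh k a) X Y Z g)" if g: "g \<in> mor Y Z" for g
    unfolding linear_map_def
  proof (intro conjI ballI)
    show "Comp (PSh k a) X Y Z g (f \<oplus>\<^bsub>HomM (PSh k a) X Y\<^esub> f') =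
        Comp (PSh k a) X Y Z g f \<oplus>\<^bsub>HomM (PSh k a) X Z\<^esub> Comp (PSh k a) X Y Z g f'"
      if "f \<in> carrier (HomM (PSh k a) X Y)" "f' \<in> carrier (HomM (PSh k a) X Y)" for f f'
      by (rule mor_eqI[of _ X Z]) (use that * g in \<open>simp_all add: mor_closed[of _ X Y] mor_add[of g Y Z]\<close>)
    show "Comp (PSh k a) X Y Z g (c \<odot>\<^bsub>HomM (PSh k a) X Y\<^esub> f) =
        c \<odot>\<^bsub>HomM (PSh k a) X Z\<^esub> Comp (PSh k a) X Y Z g f"
      if "f \<in> carrier (HomM (PSh k a) X Y)" "c \<in> carrier k" for f c
      by (rule mor_eqI[of _ X Z]) (use that * g in \<open>simp_all add: mor_closed[of _ X Y] sm\<close>)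
  qed (use * g in auto)
  show "linear_map k (HomM (PSh k a) Y Z) (HomM (PSh k a) X Z) (\<lambda>g. Comp (PSh k a) X Y Z g f)" if f: "f \<in> mor X Y" for f
    unfolding linear_map_def
  proof (intro conjI ballI)
    show "Comp (PSh k a) X Y Z (g \<oplus>\<^bsub>HomM (PSh k a) Y Z\<^esub> g') f =
        Comp (PSh k a) X Y Z g f \<oplus>\<^bsub>HomM (PSh k a) X Z\<^esub> Comp (PSh k a) X Y Z g' f"
      if "g \<in> carrier (HomM (PSh k a) Y Z)" "g' \<in> carrier (HomM (PSh k a) Y Z)" for g g'
      by (rule mor_eqI[of _ X Z]) (use that * f in \<open>simp_all add: mor_closed[of _ X Y]\<close>)
    show "Comp (PSh k a) X Y Z (c \<odot>\<^bsub>HomM (PSh k a) Y Z\<^esub> g) f =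
        c \<odot>\<^bsub>HomM (PSh k a) X Z\<^esub> Comp (PSh k a) X Y Z g f"
      if "g \<in> carrier (HomM (PSh k a) Y Z)" "c \<in> carrier k" for g c
      by (rule mor_eqI[of _ X Z]) (use that * f in \<open>simp_all add: mor_closed[of _ X Y]\<close>)
  qed (use * f in auto)
qed auto

text \<open>A morphism is determined by its values over the small set \<open>O0\<close>: every
  \<open>A\<close> is a retract of some \<open>B\<close> in \<open>O0\<close>, so a section over
  \<open>A\<close> is a restriction of one over \<open>B\<close>, and naturality recovers the
  value.\<close>

lemma small_mor:
  assumes F: "psh F" and G: "psh G"
  shows "small TYPE('u) (mor F G)"
proof -
  obtain O0 where O0: "O0 \<subseteq> Ob" "small TYPE('u) O0" "\<And>X. X \<in> Ob \<Longrightarrow> \<exists>Y\<in>O0. \<exists>f. is_iso a X Y f"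
    using ess unfolding essentially_small_def by blast
  define \<Phi> where "\<Phi> \<eta> = {(A, x, \<eta> A x) | A x. A \<in> O0 \<and> x \<in> crr F A}" for \<eta> :: "'o \<Rightarrow> 'u \<Rightarrow> 'u"
  show ?thesis
  proof (rule small_inj_on[of \<Phi>])
    show "inj_on \<Phi> (mor F G)"
    proof (intro inj_onI mor_eqI[of _ F G])
      fix \<eta> \<theta> A x assume *: "\<eta> \<in> mor F G" "\<theta> \<in> mor F G" "\<Phi> \<eta> = \<Phi> \<theta>" and A: "A \<in> Ob" and x: "x \<in> crr F A"
      obtain B f g where B: "B \<in> O0" and f: "f \<in> Arr a A B" and g: "g \<in> Arr a B A" and id: "Comp a A B A g f = Ident a A"
        using O0(3)[OF A] unfolding is_iso_def by blast
      have BO: "B \<in> Ob" using B O0 by blast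
      define y where "y = fmap F A B g x"
      have y: "y \<in> crr F B" using F A BO g x by (simp add: y_def psh_closed)
      have fy: "fmap F B A f y = x" using psh_comp[OF F A BO A g f x] psh_id[OF F A x] by (simp add: id y_def)
      have "(B, y, \<eta> B y) \<in> \<Phi> \<theta>" using *(3) B y unfolding \<Phi>_def by blast
      then have "\<eta> B y = \<theta> B y" by (auto simp: \<Phi>_def)
      then show "\<eta> A x = \<theta> A x"
        using mor_nat[OF *(1) F G BO A f y] mor_nat[OF *(2) F G BO A f y] fy by simp
    qed (use F G in auto)
    have "\<Phi> ` mor F G \<subseteq> Pow (SIGMA A:O0. crr F A \<times> crr G A)"
      using O0 by (auto simp: \<Phi>_def mor_closed[OF _ F G] subset_iff)
    then show "small TYPE('u) (\<Phi> ` mor F G)"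
      by (rule small_mono[rotated]) (use F G O0 in \<open>auto intro!: small_Pow small_Sigma small_Times psh_small\<close>)
  qed
qed

end

lemma lin_category_full_subcat: "lin_category k C \<Longrightarrow> lin_category k (full_subcat C P)"
  unfolding lin_category_def category_def full_subcat_def by simp

section \<open>Sieves and topologies\<close>

context linear_category
begin

text \<open>Negatives and scalar multiples are composites with \<open>hneg\<close> and
  \<open>sc\<close>, so closure under sums and composition replaces the submodule condition of
  \<open>is_sieve\<close>. The zero arrows exclude empty values on \<open>Ob\<close>.\<close>

definition sieve :: "'o \<Rightarrow> ('o, 'u) sieve \<Rightarrow> bool" where
  "sieve A R \<longleftrightarrow> (\<forall>B. B \<notin> Ob \<longrightarrow> R B = {}) \<and>
    (\<forall>B\<in>Ob. R B \<subseteq> Arr a B A \<and> hzero B A \<in> R B \<and> (\<forall>f\<in>R B. \<forall>g\<in>R B. hplus B A f g \<in> R B)) \<and>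
    (\<forall>B\<in>Ob. \<forall>C\<in>Ob. \<forall>f\<in>R B. \<forall>g\<in>Arr a C B. Comp a C B A f g \<in> R C)"

definition maxs :: "'o \<Rightarrow> ('o, 'u) sieve" where
  "maxs A = (\<lambda>B. if B \<in> Ob then Arr a B A else {})"

definition pullback :: "'o \<Rightarrow> 'o \<Rightarrow> 'u \<Rightarrow> ('o, 'u) sieve \<Rightarrow> ('o, 'u) sieve" where
  "pullback A B f R = (\<lambda>C. if C \<in> Ob then {g \<in> Arr a C B. Comp a C B A f g \<in> R C} else {})"

lemma
  assumes "sieve A R"
  shows sieve_arr: "\<And>B f. B \<in> Ob \<Longrightarrow> f \<in> R B \<Longrightarrow> f \<in> Arr a B A"
    and sieve_zero: "\<And>B. B \<in> Ob \<Longrightarrow> hzero B A \<in> R B"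
    and sieve_plus: "\<And>B f g. B \<in> Ob \<Longrightarrow> f \<in> R B \<Longrightarrow> g \<in> R B \<Longrightarrow> hplus B A f g \<in> R B"
    and sieve_comp: "\<And>B C f g. B \<in> Ob \<Longrightarrow> C \<in> Ob \<Longrightarrow> f \<in> R B \<Longrightarrow> g \<in> Arr a C B \<Longrightarrow> Comp a C B A f g \<in> R C"
    and sieve_empty: "\<And>B. B \<notin> Ob \<Longrightarrow> R B = {}"
  using assms unfolding sieve_def by blast+

lemma is_sieve_iff: "A \<in> Ob \<Longrightarrow> is_sieve k a A R \<longleftrightarrow> sieve A R"
proof
  assume A: "A \<in> Ob" and R: "is_sieve k a A R"
  have "submodule (R B) k (HomM a B A)" if "B \<in> Ob" for B using R that by (simp add: is_sieve_def)
  then have "subgroup (R B) (add_monoid (HomM a B A))" if "B \<in> Ob" for B using that by (simp add: submodule_def)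
  then have "R B \<subseteq> Arr a B A" "hzero B A \<in> R B" "\<forall>f\<in>R B. \<forall>g\<in>R B. hplus B A f g \<in> R B" if "B \<in> Ob" for B
    using that A subgroup.subset[of "R B"] subgroup.one_closed[of "R B"] subgroup.m_closed[of "R B"] by fastforce+
  then show "sieve A R" using R unfolding is_sieve_def sieve_def by blast
next
  assume A: "A \<in> Ob" and R: "sieve A R"
  have "submodule (R B) k (HomM a B A)" if B: "B \<in> Ob" for B
  proof (rule module.submoduleI[OF hom_module[OF B A]])
    show "R B \<subseteq> carrier (HomM a B A)" using sieve_arr[OF R] A B by auto
    show "\<ominus>\<^bsub>HomM a B A\<^esub> f \<in> R B" if "f \<in> R B" for f
      using sieve_comp[OF R B B that, of "hneg B"] A B sieve_arr[OF R B that] by (simp add: comp_hneg)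
    show "c \<odot>\<^bsub>HomM a B A\<^esub> f \<in> R B" if "c \<in> carrier k" "f \<in> R B" for c f
      using sieve_comp[OF R B B that(2), of "sc c B"] A B sieve_arr[OF R B that(2)] that by (simp add: comp_sc_right)
  qed (use R B in \<open>auto simp: sieve_zero sieve_plus\<close>)
  then show "is_sieve k a A R" using R unfolding is_sieve_def sieve_def by blast
qed

lemma sieve_max[simp]: "A \<in> Ob \<Longrightarrow> sieve A (maxs A)"
  by (auto simp: sieve_def maxs_def)

lemma sieve_pullback[simp]:
  assumes "sieve A R" "A \<in> Ob" "B \<in> Ob" "f \<in> Arr a B A"
  shows "sieve B (pullback A B f R)"
  unfolding sieve_def
proof (intro conjI allI impI ballI)
  fix C assume C: "C \<in> Ob"
  show "pullback A B f R C \<subseteq> Arr a C B" using C by (auto simp: pullback_def)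
  show "hzero C B \<in> pullback A B f R C" using C assms by (simp add: pullback_def sieve_zero)
  fix g h assume "g \<in> pullback A B f R C" "h \<in> pullback A B f R C"
  then show "hplus C B g h \<in> pullback A B f R C"
    using C assms by (auto simp: pullback_def comp_plus_right sieve_plus)
next
  fix C D g h assume "C \<in> Ob" "D \<in> Ob" "g \<in> pullback A B f R C" "h \<in> Arr a D C"
  then show "Comp a D C B g h \<in> pullback A B f R D"
    using assms by (auto simp: pullback_def comp_assoc[symmetric] sieve_comp)
qed (auto simp: pullback_def)

lemma sieve_inter:
  assumes "sieve A R" "sieve A S"
  shows "sieve A (\<lambda>B. R B \<inter> S B)"
  using assms unfolding sieve_def by blast

lemma pullback_id: "sieve A R \<Longrightarrow> A \<in> Ob \<Longrightarrow> pullback A A (Ident a A) R = R"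
  unfolding pullback_def fun_eq_iff by (auto simp: sieve_arr sieve_empty)

lemma pullback_comp:
  "A \<in> Ob \<Longrightarrow> B \<in> Ob \<Longrightarrow> C \<in> Ob \<Longrightarrow> f \<in> Arr a B A \<Longrightarrow> g \<in> Arr a C B \<Longrightarrow>
   pullback A C (Comp a C B A f g) R = pullback B C g (pullback A B f R)"
  unfolding pullback_def fun_eq_iff by (auto simp: comp_assoc)

lemma pullback_max:
  assumes "sieve A R" "A \<in> Ob" "B \<in> Ob" "f \<in> R B"
  shows "pullback A B f R = maxs B"
  using assms sieve_comp[OF assms(1)] unfolding pullback_def maxs_def fun_eq_iff by auto

text \<open>A matching family: an additive natural map from the sieve \<open>R\<close> to
  \<open>F\<close>, with \<open>s B f\<close> its value at \<open>f\<close>. Compatibility with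
  scalars is again composition with \<open>sc\<close>.\<close>

definition compat :: "('k, 'o, 'u) presheaf \<Rightarrow> 'o \<Rightarrow> ('o, 'u) sieve \<Rightarrow> ('o \<Rightarrow> 'u \<Rightarrow> 'u) \<Rightarrow> bool" where
  "compat F A R s \<longleftrightarrow> (\<forall>B\<in>Ob. \<forall>f\<in>R B. s B f \<in> crr F B) \<and>
    (\<forall>B\<in>Ob. \<forall>f\<in>R B. \<forall>g\<in>R B. s B (hplus B A f g) = s B f \<oplus>\<^bsub>fobj F B\<^esub> s B g) \<and>
    (\<forall>B\<in>Ob. \<forall>C\<in>Ob. \<forall>f\<in>R B. \<forall>g\<in>Arr a C B. s C (Comp a C B A f g) = fmap F B C g (s B f))"

subsection \<open>Subpresheaves\<close>

text \<open>Restriction along \<open>hneg\<close> and \<open>sc\<close> produces negatives and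
  multiples, so the values are submodules.\<close>

definition subpresheaf :: "('k, 'o, 'u) presheaf \<Rightarrow> ('o \<Rightarrow> 'u set) \<Rightarrow> bool" where
  "subpresheaf F S \<longleftrightarrow> (\<forall>A\<in>Ob. S A \<subseteq> crr F A \<and> \<zero>\<^bsub>fobj F A\<^esub> \<in> S A \<and>
      (\<forall>x\<in>S A. \<forall>y\<in>S A. x \<oplus>\<^bsub>fobj F A\<^esub> y \<in> S A)) \<and>
    (\<forall>A\<in>Ob. \<forall>B\<in>Ob. \<forall>f\<in>Arr a B A. \<forall>x\<in>S A. fmap F A B f x \<in> S B)"

definition sub :: "('k, 'o, 'u) presheaf \<Rightarrow> ('o \<Rightarrow> 'u set) \<Rightarrow> ('k, 'o, 'u) presheaf" where
  "sub F S = \<lparr>fobj = (\<lambda>A. (fobj F A)\<lparr>carrier := S A\<rparr>), fmap = (\<lambda>A B f. restrict (fmap F A B f) (S A))\<rparr>"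

lemma sub_psh:
  assumes F: "psh F" and S: "subpresheaf F S"
  shows "psh (sub F S)"
proof -
  have S': "x \<in> crr F A" if "A \<in> Ob" "x \<in> S A" for A x using S that by (auto simp: subpresheaf_def)
  have "module k ((fobj F A)\<lparr>carrier := S A\<rparr>)" if A: "A \<in> Ob" for A
  proof (rule submodule.submodule_is_module)
    show "submodule (S A) k (fobj F A)"
    proof (rule module.submoduleI[OF psh_module[OF F A]])
      show "\<ominus>\<^bsub>fobj F A\<^esub> x \<in> S A" if "x \<in> S A" for x
        using psh_neg[OF F A] S A that by (metis S' hneg_arr subpresheaf_def)
      show "c \<odot>\<^bsub>fobj F A\<^esub> x \<in> S A" if "c \<in> carrier k" "x \<in> S A" for c x
        using psh_sc[OF F A] S A that by (metis S' sc_arr subpresheaf_def)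
    qed (use S A in \<open>auto simp: subpresheaf_def\<close>)
  qed (use F A psh_module in blast)
  moreover have "small TYPE('u) (S A)" if A: "A \<in> Ob" for A
    using S A psh_small[OF F A] by (auto simp: subpresheaf_def intro: small_mono)
  moreover have "fmap F A B f x \<in> S B" if "A \<in> Ob" "B \<in> Ob" "f \<in> Arr a B A" "x \<in> S A" for A B f x
    using S that by (simp add: subpresheaf_def)
  moreover have "x \<oplus>\<^bsub>fobj F A\<^esub> y \<in> S A" if "A \<in> Ob" "x \<in> S A" "y \<in> S A" for A x y
    using S that by (simp add: subpresheaf_def)
  ultimately show ?thesis
    unfolding psh_iff sub_def using F S'
    by (auto simp: psh_add psh_id psh_comp psh_plus psh_sc)
qed

lemma sub_simps[simp]:
  "crr (sub F S) A = S A" "x \<oplus>\<^bsub>fobj (sub F S) A\<^esub> y = x \<oplus>\<^bsub>fobj F A\<^esub> y" "\<zero>\<^bsub>fobj (sub F S) A\<^esub> = \<zero>\<^bsub>fobj F A\<^esub>"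
  "x \<in> S A \<Longrightarrow> fmap (sub F S) A B f x = fmap F A B f x"
  by (simp_all add: sub_def)

lemma incl_mor: "psh F \<Longrightarrow> subpresheaf F S \<Longrightarrow> mk (sub F S) (\<lambda>A x. x) \<in> mor (sub F S) F"
  by (rule mk_mor) (auto simp: sub_psh subpresheaf_def)

end

text \<open>The category of sheaves is studied for an arbitrary \<open>J\<close>; a pretopology
  enters later, through the instance \<open>cov\<close>.\<close>

locale linear_topology = linear_category k a
  for k :: "'k ring" and a :: "('k, 'o, 'u) lincat" +
  fixes J :: "'o \<Rightarrow> ('o, 'u) sieve \<Rightarrow> bool"
  assumes J_ob: "J A R \<Longrightarrow> A \<in> Obj a"
    and J_sieve: "J A R \<Longrightarrow> sieve A R"
    and J_max: "A \<in> Obj a \<Longrightarrow> J A (maxs A)"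
    and J_pullback: "J A R \<Longrightarrow> B \<in> Obj a \<Longrightarrow> f \<in> Arr a B A \<Longrightarrow> J B (pullback A B f R)"
    and J_local: "J A R \<Longrightarrow> sieve A S \<Longrightarrow> (\<And>B f. B \<in> Obj a \<Longrightarrow> f \<in> R B \<Longrightarrow> J B (pullback A B f S)) \<Longrightarrow> J A S"
begin

text \<open>Along an arrow of the smaller sieve, the larger one pulls back to the maximal
  sieve.\<close>

lemma J_mono:
  assumes "J A R" "sieve A S" "\<And>B. B \<in> Ob \<Longrightarrow> R B \<subseteq> S B"
  shows "J A S"
proof (rule J_local[OF assms(1,2)])
  fix B f assume B: "B \<in> Ob" "f \<in> R B"
  then have "pullback A B f S = maxs B"
    using assms pullback_max[of A S B f] J_ob by blast
  then show "J B (pullback A B f S)" using J_max B by simp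
qed

text \<open>Along an arrow of \<open>R\<close> the pullback of the intersection contains the
  pullback of \<open>S\<close>, so local character over \<open>R\<close> applies.\<close>

lemma J_inter:
  assumes "J A R" "J A S"
  shows "J A (\<lambda>B. R B \<inter> S B)"
proof (rule J_local[OF assms(1)])
  fix B f assume B: "B \<in> Ob" and f: "f \<in> R B"
  have A: "A \<in> Ob" and f': "f \<in> Arr a B A" using J_ob sieve_arr J_sieve assms(1) B f by blast+
  have "J B (pullback A B f S)" using J_pullback assms B f' by blast
  then show "J B (pullback A B f (\<lambda>B. R B \<inter> S B))"
  proof (rule J_mono)
    show "sieve B (pullback A B f (\<lambda>B. R B \<inter> S B))" using assms J_sieve sieve_inter A B f' by simp
    show "pullback A B f S C \<subseteq> pullback A B f (\<lambda>B. R B \<inter> S B) C" if "C \<in> Ob" for C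
      using sieve_comp[OF J_sieve[OF assms(1)] B that f] by (auto simp: pullback_def)
  qed
qed (use assms J_sieve sieve_inter in blast)

text \<open>The quantifier "on some covering sieve". Local statements are combined by
  \<open>locally_conj\<close>, \<open>locally_pullback\<close> and \<open>locally_mono\<close>, so
  that covers rarely have to be named. The predicate may fail to be closed under sums of arrows;
  where the arrows satisfying it do form a sieve, that sieve is covering by
  \<open>locally_sieve\<close>.\<close>

definition locally :: "'o \<Rightarrow> ('o \<Rightarrow> 'u \<Rightarrow> bool) \<Rightarrow> bool" where
  "locally A Q \<longleftrightarrow> (\<exists>R. J A R \<and> (\<forall>B\<in>Ob. \<forall>f\<in>R B. Q B f))"

lemma locally_mono:
  assumes "locally A P" "\<And>B f. B \<in> Ob \<Longrightarrow> f \<in> Arr a B A \<Longrightarrow> P B f \<Longrightarrow> Q B f"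
  shows "locally A Q"
  using assms J_sieve sieve_arr unfolding locally_def by blast

lemma locally_conj:
  assumes "locally A P" "locally A Q"
  shows "locally A (\<lambda>B f. P B f \<and> Q B f)"
proof -
  obtain R S where "J A R" "J A S" and *: "\<forall>B\<in>Ob. \<forall>f\<in>R B. P B f" "\<forall>B\<in>Ob. \<forall>f\<in>S B. Q B f"
    using assms unfolding locally_def by blast
  then have "J A (\<lambda>B. R B \<inter> S B)" by (simp add: J_inter)
  with * show ?thesis unfolding locally_def by (intro exI[of _ "\<lambda>B. R B \<inter> S B"]) simp
qed

lemma locally_all: "A \<in> Ob \<Longrightarrow> (\<And>B f. B \<in> Ob \<Longrightarrow> f \<in> Arr a B A \<Longrightarrow> Q B f) \<Longrightarrow> locally A Q"
  using J_max J_sieve sieve_arr unfolding locally_def by blast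

lemma locally_pullback:
  assumes "locally A Q" "B \<in> Ob" "f \<in> Arr a B A"
  shows "locally B (\<lambda>C g. Q C (Comp a C B A f g))"
proof -
  obtain R where R: "J A R" "\<forall>B\<in>Ob. \<forall>f\<in>R B. Q B f" using assms unfolding locally_def by blast
  show ?thesis
    unfolding locally_def
    by (rule exI[of _ "pullback A B f R"]) (use J_pullback[OF R(1) assms(2,3)] R in \<open>auto simp: pullback_def\<close>)
qed

lemma locally_ball_finite:
  assumes "finite I" "A \<in> Ob" "\<And>i. i \<in> I \<Longrightarrow> locally A (Q i)"
  shows "locally A (\<lambda>B f. \<forall>i\<in>I. Q i B f)"
  using assms(1,3)
proof (induction rule: finite_induct)
  case empty then show ?case using assms(2) by (simp add: locally_all)
next
  case (insert i I)
  then have "locally A (\<lambda>B f. Q i B f \<and> (\<forall>i\<in>I. Q i B f))" by (intro locally_conj) auto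
  then show ?case by (rule locally_mono) auto
qed

lemma locally_sieve:
  assumes "sieve A S" "locally A (\<lambda>B f. f \<in> S B)"
  shows "J A S"
  using assms J_mono unfolding locally_def by blast

lemma J_locally: "J A R \<Longrightarrow> (\<And>B f. B \<in> Ob \<Longrightarrow> f \<in> Arr a B A \<Longrightarrow> f \<in> R B \<Longrightarrow> Q B f) \<Longrightarrow> locally A Q"
  unfolding locally_def using J_sieve sieve_arr by blast

text \<open>Local character in terms of \<open>locally\<close>: a cover of each member of a cover
  yields one cover. In applications the work lies in showing that the arrows in question form a
  sieve, in particular that they are closed under sums.\<close>

lemma locally_trans:
  assumes S: "sieve A S" and loc: "locally A (\<lambda>B f. locally B (\<lambda>C g. Comp a C B A f g \<in> S C))"
  shows "J A S"
proof -
  obtain R where R: "J A R" "\<And>B f. B \<in> Ob \<Longrightarrow> f \<in> R B \<Longrightarrow> locally B (\<lambda>C g. Comp a C B A f g \<in> S C)"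
    using loc unfolding locally_def[of A] by blast
  show ?thesis
  proof (rule J_local[OF R(1) S])
    fix B f assume B: "B \<in> Ob" and f: "f \<in> R B"
    then have f': "f \<in> Arr a B A" using sieve_arr J_sieve R by blast
    have A: "A \<in> Ob" using J_ob R by blast
    show "J B (pullback A B f S)"
    proof (rule locally_sieve)
      show "locally B (\<lambda>C g. g \<in> pullback A B f S C)"
        using R(2)[OF B f] by (rule locally_mono) (auto simp: pullback_def)
    qed (use S A B f' in simp)
  qed
qed

section \<open>Sheaves\<close>

definition separated :: "('k, 'o, 'u) presheaf \<Rightarrow> bool" where
  "separated F \<longleftrightarrow> (\<forall>A\<in>Ob. \<forall>x\<in>crr F A. locally A (\<lambda>B f. fmap F A B f x = \<zero>\<^bsub>fobj F B\<^esub>) \<longrightarrow> x = \<zero>\<^bsub>fobj F A\<^esub>)"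

definition sheaf :: "('k, 'o, 'u) presheaf \<Rightarrow> bool" where
  "sheaf F \<longleftrightarrow> psh F \<and> separated F \<and>
    (\<forall>A R s. J A R \<longrightarrow> compat F A R s \<longrightarrow> (\<exists>x\<in>crr F A. \<forall>B\<in>Ob. \<forall>f\<in>R B. fmap F A B f x = s B f))"

lemma sheaf_psh[simp]: "sheaf F \<Longrightarrow> psh F"
  by (simp add: sheaf_def)

lemma separated_eq:
  assumes "psh F" "separated F" "A \<in> Ob" "x \<in> crr F A" "y \<in> crr F A"
    and "locally A (\<lambda>B f. fmap F A B f x = fmap F A B f y)"
  shows "x = y"
proof -
  have "locally A (\<lambda>B f. fmap F A B f (x \<ominus>\<^bsub>fobj F A\<^esub> y) = \<zero>\<^bsub>fobj F B\<^esub>)"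
    using assms(6) by (rule locally_mono) (use assms in \<open>simp add: psh_minus psh_minus_zero_iff psh_closed\<close>)
  then have "x \<ominus>\<^bsub>fobj F A\<^esub> y = \<zero>\<^bsub>fobj F A\<^esub>"
    using assms abelian_group.minus_closed[OF psh_group[OF assms(1,3)]] by (simp add: separated_def)
  then show ?thesis using assms by (simp add: psh_minus_zero_iff)
qed

lemma sheaf_eq:
  "sheaf F \<Longrightarrow> A \<in> Ob \<Longrightarrow> x \<in> crr F A \<Longrightarrow> y \<in> crr F A \<Longrightarrow>
   locally A (\<lambda>B f. fmap F A B f x = fmap F A B f y) \<Longrightarrow> x = y"
  by (rule separated_eq[of F A x y]) (auto simp: sheaf_def)

lemma sheaf_glue:
  assumes "sheaf F" "J A R" "compat F A R s"
  obtains x where "x \<in> crr F A" "\<And>B f. B \<in> Ob \<Longrightarrow> f \<in> R B \<Longrightarrow> fmap F A B f x = s B f"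
  using assms unfolding sheaf_def by blast

text \<open>By naturality the two values agree locally, and \<open>T\<close> is separated. This is
  the uniqueness that accompanies the existence in \<open>graph_extension\<close>.\<close>

lemma mor_eq_dense:
  assumes h: "h \<in> mor F T" "h' \<in> mor F T" and F: "psh F" and T: "sheaf T"
    and dense: "\<And>A x. A \<in> Ob \<Longrightarrow> x \<in> crr F A \<Longrightarrow> locally A (\<lambda>B f. h B (fmap F A B f x) = h' B (fmap F A B f x))"
  shows "h = h'"
proof (rule mor_eqI[OF h F sheaf_psh[OF T]])
  fix A x assume A: "A \<in> Ob" and x: "x \<in> crr F A"
  note c = mor_closed[OF _ F sheaf_psh[OF T] A x]
  show "h A x = h' A x"
  proof (rule sheaf_eq[OF T A c[OF h(1)] c[OF h(2)]])
    show "locally A (\<lambda>B f. fmap T A B f (h A x) = fmap T A B f (h' A x))"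
      using dense[OF A x]
      by (rule locally_mono) (use h F T A x in \<open>simp add: mor_nat[of _ F T]\<close>)
  qed
qed

text \<open>
  A morphism into a sheaf is given by its graph \<open>E\<close>, which only needs to be defined locally. All
  universal properties below are obtained from this.
\<close>

lemma graph_extension:
  assumes F: "psh F" and T: "sheaf T"
    and E: "\<And>A. A \<in> Ob \<Longrightarrow> E A \<subseteq> crr F A \<times> crr T A"
    and E_plus: "\<And>A x y x' y'. A \<in> Ob \<Longrightarrow> (x, y) \<in> E A \<Longrightarrow> (x', y') \<in> E A \<Longrightarrow>
      (x \<oplus>\<^bsub>fobj F A\<^esub> x', y \<oplus>\<^bsub>fobj T A\<^esub> y') \<in> E A"
    and E_res: "\<And>A B f x y. A \<in> Ob \<Longrightarrow> B \<in> Ob \<Longrightarrow> f \<in> Arr a B A \<Longrightarrow> (x, y) \<in> E A \<Longrightarrow> (fmap F A B f x, fmap T A B f y) \<in> E B"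
    and E_zero: "\<And>A y. A \<in> Ob \<Longrightarrow> (\<zero>\<^bsub>fobj F A\<^esub>, y) \<in> E A \<Longrightarrow> y = \<zero>\<^bsub>fobj T A\<^esub>"
    and dense: "\<And>A x. A \<in> Ob \<Longrightarrow> x \<in> crr F A \<Longrightarrow> locally A (\<lambda>B f. \<exists>y. (fmap F A B f x, y) \<in> E B)"
  obtains h where "h \<in> mor F T" "\<And>A x y. A \<in> Ob \<Longrightarrow> (x, y) \<in> E A \<Longrightarrow> h A x = y"
proof -
  have T': "psh T" using T by simp
  have Ec: "x \<in> crr F A" "y \<in> crr T A" if "A \<in> Ob" "(x, y) \<in> E A" for A x y using E that by blast+
  \<comment> \<open>Single-valuedness from \<open>E_zero\<close>: restricting \<open>(x, y')\<close>
    along minus the identity and adding it to \<open>(x, y)\<close> puts (0, y - y') into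
    \<open>E A\<close>.\<close>
  have Ef: "y = y'" if A: "A \<in> Ob" and y: "(x, y) \<in> E A" and y': "(x, y') \<in> E A" for A x y y'
  proof -
    interpret FA: abelian_group "fobj F A" using psh_group F A by blast
    have "(x \<oplus>\<^bsub>fobj F A\<^esub> fmap F A A (hneg A) x, y \<oplus>\<^bsub>fobj T A\<^esub> fmap T A A (hneg A) y') \<in> E A"
      using E_plus[OF A y E_res[OF A A _ y']] A by simp
    then have "(\<zero>\<^bsub>fobj F A\<^esub>, y \<ominus>\<^bsub>fobj T A\<^esub> y') \<in> E A"
      using Ec[OF A y] Ec[OF A y'] F T' A by (simp add: psh_neg FA.r_neg a_minus_def)
    then show ?thesis using E_zero[OF A] psh_minus_zero_iff T' A Ec(2) y y' by blast
  qed
  \<comment> \<open>The domain of the partial map at \<open>x\<close>: the arrows along which the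
    restriction of \<open>x\<close> has a partner.\<close>
  define R where "R A x = (\<lambda>B. if B \<in> Ob then {f \<in> Arr a B A. \<exists>y. (fmap F A B f x, y) \<in> E B} else {})" for A x
  have R_sieve: "sieve A (R A x)" if A: "A \<in> Ob" and x: "x \<in> crr F A" for A x
    unfolding sieve_def
  proof (intro conjI allI impI ballI)
    fix B assume B: "B \<in> Ob"
    show "R A x B \<subseteq> Arr a B A" using B by (auto simp: R_def)
    \<comment> \<open>Zero has a partner: every covering sieve contains the zero arrows, along which
      all sections restrict to zero.\<close>
    obtain y f where "B \<in> Ob \<and> (fmap F B B f (fmap F A B (hzero B A) x), y) \<in> E B" "f \<in> Arr a B B"
    proof -
      have "locally B (\<lambda>C f. \<exists>y. (fmap F B C f (fmap F A B (hzero B A) x), y) \<in> E C)"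
        using A B x F by (intro dense) (simp_all add: psh_closed)
      then obtain S where "J B S" and S: "\<forall>C\<in>Ob. \<forall>f\<in>S C. \<exists>y. (fmap F B C f (fmap F A B (hzero B A) x), y) \<in> E C"
        unfolding locally_def by blast
      then have "hzero B B \<in> S B" using sieve_zero J_sieve B by blast
      then show thesis using S B that[of "hzero B B"] by auto
    qed
    then have "(\<zero>\<^bsub>fobj F B\<^esub>, y) \<in> E B" using F A B x by simp
    then show "hzero B A \<in> R A x B" using A B F x by (auto simp: R_def)
    fix f g assume "f \<in> R A x B" "g \<in> R A x B"
    then show "hplus B A f g \<in> R A x B" using A B F x E_plus by (fastforce simp: R_def psh_plus)
  next
    fix B C f g assume "B \<in> Ob" "C \<in> Ob" "f \<in> R A x B" "g \<in> Arr a C B"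
    then show "Comp a C B A f g \<in> R A x C"
      using A F x E_res by (fastforce simp: R_def psh_comp)
  qed (simp add: R_def)
  have RJ: "J A (R A x)" if A: "A \<in> Ob" and x: "x \<in> crr F A" for A x
    by (rule locally_sieve[OF R_sieve[OF A x]], rule locally_mono[OF dense[OF A x]]) (simp add: R_def)
  \<comment> \<open>\<open>P A x v\<close> describes \<open>v\<close> by its restrictions along the
    domain of the partial map. As that domain is covering, separatedness makes the value chosen as
    \<open>h A x\<close> unique.\<close>
  define P where "P A x v \<longleftrightarrow> v \<in> crr T A \<and> (\<forall>B\<in>Ob. \<forall>f\<in>Arr a B A. \<forall>y. (fmap F A B f x, y) \<in> E B \<longrightarrow> fmap T A B f v = y)" for A x v
  have ex: "\<exists>v. P A x v" if A: "A \<in> Ob" and x: "x \<in> crr F A" for A x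
  proof -
    define s where "s B f = (THE y. (fmap F A B f x, y) \<in> E B)" for B f
    have s: "s B f = y" if "B \<in> Ob" "(fmap F A B f x, y) \<in> E B" for B f y
      unfolding s_def by (rule the_equality) (use Ef that in blast)+
    have "compat T A (R A x) s"
      unfolding compat_def
    proof (intro conjI ballI)
      fix B f assume B: "B \<in> Ob" and f: "f \<in> R A x B"
      then obtain y where f': "f \<in> Arr a B A" and y: "(fmap F A B f x, y) \<in> E B" by (auto simp: R_def)
      show "s B f \<in> crr T B" using s[OF B y] Ec[OF B y] by simp
      {
        fix g assume "g \<in> R A x B"
        then obtain z where g': "g \<in> Arr a B A" and z: "(fmap F A B g x, z) \<in> E B" using B by (auto simp: R_def)
        show "s B (hplus B A f g) = s B f \<oplus>\<^bsub>fobj T B\<^esub> s B g"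
          using s[OF B y] s[OF B z] E_plus[OF B y z] A B F x f' g' by (intro s) (simp_all add: psh_plus)
      next
        fix C g assume C: "C \<in> Ob" and g: "g \<in> Arr a C B"
        show "s C (Comp a C B A f g) = fmap T B C g (s B f)"
          using s[OF B y] E_res[OF B C g y] A B C F x f' g by (intro s) (simp_all add: psh_comp)
      }
    qed
    then obtain v where v: "v \<in> crr T A" "\<And>B f. B \<in> Ob \<Longrightarrow> f \<in> R A x B \<Longrightarrow> fmap T A B f v = s B f"
      using sheaf_glue[OF T RJ[OF A x]] by blast
    have "fmap T A B f v = y" if "B \<in> Ob" "f \<in> Arr a B A" "(fmap F A B f x, y) \<in> E B" for B f y
      using v(2)[of B f] s[of B f y] that by (auto simp: R_def)
    then show ?thesis unfolding P_def using v(1) by blast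
  qed
  define h where "h A x = (SOME v. P A x v)" for A x
  have h: "P A x (h A x)" if "A \<in> Ob" "x \<in> crr F A" for A x
    unfolding h_def using ex[OF that] by (rule someI_ex)
  have h_eq: "v = h A x" if A: "A \<in> Ob" and x: "x \<in> crr F A" and v: "v \<in> crr T A"
    and loc: "locally A (\<lambda>B f. (fmap F A B f x, fmap T A B f v) \<in> E B)" for A x v
  proof (rule sheaf_eq[OF T A v])
    show "locally A (\<lambda>B f. fmap T A B f v = fmap T A B f (h A x))"
      using loc by (rule locally_mono) (use h[OF A x] in \<open>auto simp: P_def\<close>)
  qed (use h[OF A x] in \<open>auto simp: P_def\<close>)
  have h_loc: "locally A (\<lambda>B f. (fmap F A B f x, fmap T A B f (h A x)) \<in> E B)" if A: "A \<in> Ob" and x: "x \<in> crr F A" for A x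
    using dense[OF A x] by (rule locally_mono) (use h[OF A x] in \<open>auto simp: P_def\<close>)
  have h_closed: "h A x \<in> crr T A" if "A \<in> Ob" "x \<in> crr F A" for A x using h[OF that] by (simp add: P_def)
  have "mk F h \<in> mor F T"
  proof (rule mk_mor[OF F T' h_closed])
    show "h A (x \<oplus>\<^bsub>fobj F A\<^esub> y) = h A x \<oplus>\<^bsub>fobj T A\<^esub> h A y" if A: "A \<in> Ob" and x: "x \<in> crr F A" and y: "y \<in> crr F A" for A x y
    proof (rule h_eq[symmetric])
      show "locally A (\<lambda>B f. (fmap F A B f (x \<oplus>\<^bsub>fobj F A\<^esub> y), fmap T A B f (h A x \<oplus>\<^bsub>fobj T A\<^esub> h A y)) \<in> E B)"
        using locally_conj[OF h_loc[OF A x] h_loc[OF A y]]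
        by (rule locally_mono) (use A x y h_closed F T' E_plus in \<open>simp add: psh_add\<close>)
    qed (use A x y h_closed F T' in auto)
    show "h B (fmap F A B f x) = fmap T A B f (h A x)"
      if A: "A \<in> Ob" and B: "B \<in> Ob" and f: "f \<in> Arr a B A" and x: "x \<in> crr F A" for A B f x
    proof (rule h_eq[symmetric])
      show "locally B (\<lambda>C g. (fmap F B C g (fmap F A B f x), fmap T B C g (fmap T A B f (h A x))) \<in> E C)"
        using locally_pullback[OF h_loc[OF A x] B f]
        by (rule locally_mono) (use A B f x h_closed F T' in \<open>simp add: psh_comp\<close>)
    qed (use A B f x h_closed F T' in \<open>auto simp: psh_closed\<close>)
  qed
  moreover have "mk F h A x = y" if A: "A \<in> Ob" and xy: "(x, y) \<in> E A" for A x y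
  proof -
    have "y = h A x"
      using E_res[OF A _ _ xy] A Ec[OF A xy] by (intro h_eq) (auto intro!: locally_all)
    then show ?thesis using Ec[OF A xy] A by simp
  qed
  ultimately show thesis using that by blast
qed

text \<open>A matching family is glued in \<open>F\<close>; the result restricts into
  \<open>S\<close> on the cover, hence belongs to \<open>S\<close> by \<open>loc\<close>.\<close>

lemma sub_sheaf:
  assumes F: "sheaf F" and S: "subpresheaf F S"
    and loc: "\<And>A x. A \<in> Ob \<Longrightarrow> x \<in> crr F A \<Longrightarrow> locally A (\<lambda>B f. fmap F A B f x \<in> S B) \<Longrightarrow> x \<in> S A"
  shows "sheaf (sub F S)"
  unfolding sheaf_def
proof (intro conjI allI impI)
  have S': "x \<in> crr F A" if "A \<in> Ob" "x \<in> S A" for A x using S that by (auto simp: subpresheaf_def)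
  show "psh (sub F S)" using sub_psh F S by simp
  show "separated (sub F S)" using F S' unfolding sheaf_def separated_def by simp
  fix A R s assume J: "J A R" and c: "compat (sub F S) A R s"
  have A: "A \<in> Ob" using J J_ob by blast
  have "compat F A R s" using c S' unfolding compat_def by simp
  then obtain x where x: "x \<in> crr F A" "\<And>B f. B \<in> Ob \<Longrightarrow> f \<in> R B \<Longrightarrow> fmap F A B f x = s B f"
    using sheaf_glue[OF F J] by blast
  have "x \<in> S A"
    by (rule loc[OF A x(1)], rule J_locally[OF J]) (use c x(2) in \<open>simp add: compat_def\<close>)
  then show "\<exists>x\<in>crr (sub F S) A. \<forall>B\<in>Ob. \<forall>f\<in>R B. fmap (sub F S) A B f x = s B f"
    using x by auto
qed

end

section \<open>Evaluation of formal morphisms\<close>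

context linear_category
begin

lemma psh_smult:
  assumes "psh F" "A \<in> Ob" "B \<in> Ob" "f \<in> Arr a B A" "x \<in> crr F A" "c \<in> carrier k"
  shows "fmap F A B f (c \<odot>\<^bsub>fobj F A\<^esub> x) = c \<odot>\<^bsub>fobj F B\<^esub> fmap F A B f x"
  using assms psh_comp[of F A B B f "sc c B" x] psh_comp[of F A A B "sc c A" f x]
  by (simp add: comp_sc_left comp_sc_right psh_sc psh_closed)

lemma yoneda_simps[simp]:
  "fobj (yoneda a X) A = HomM a A X" "x \<in> Arr a A X \<Longrightarrow> fmap (yoneda a X) A B f x = Comp a B A X x f"
  by (simp_all add: yoneda_def)

lemma yoneda_psh[simp]:
  assumes X: "X \<in> Ob"
  shows "psh (yoneda a X)"
  unfolding psh_iff
  using X hom_module small_arr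
  by (auto simp: comp_plus_left comp_plus_right comp_assoc comp_sc_right) (simp_all add: yoneda_def)

lemma sieve_finsum:
  assumes "sieve A R" "A \<in> Ob" "B \<in> Ob" "finite I" "\<And>i. i \<in> I \<Longrightarrow> f i \<in> R B"
  shows "finsum (HomM a B A) f I \<in> R B"
  using assms(4,5)
proof (induction rule: finite_induct)
  case empty
  then show ?case using assms by (simp add: abelian_monoid.finsum_empty[OF abelian_group.axioms(1)[OF hom_group]] sieve_zero)
next
  case (insert i I)
  have "f \<in> I \<rightarrow> Arr a B A" "f i \<in> Arr a B A" using insert assms sieve_arr by fastforce+
  then show ?case
    using insert assms by (simp add: abelian_monoid.finsum_insert[OF abelian_group.axioms(1)[OF hom_group]] sieve_plus)
qed

text \<open>An element of the direct sum of the \<open>a(B, Y j)\<close>, that is, a formal morphism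
  from the single object \<open>B\<close> to \<open>Y\<close>, without the one-point source
  index.\<close>

definition vec :: "('i, 'o) fam \<Rightarrow> 'o \<Rightarrow> ('i \<Rightarrow> 'u) set" where
  "vec Y B = {f. (\<forall>j\<in>idx Y. f j \<in> Arr a B (fob Y j)) \<and> finite {j \<in> idx Y. f j \<noteq> hzero B (fob Y j)}}"

text \<open>The pairing of a formal morphism \<open>f\<close> with a family \<open>y\<close> of
  sections. For a representable \<open>F\<close> it is composition of formal morphisms; in general
  it is a component of the map \<open>pull\<close>.\<close>

definition ev :: "('k, 'o, 'u) presheaf \<Rightarrow> ('i, 'o) fam \<Rightarrow> ('i \<Rightarrow> 'u) \<Rightarrow> 'o \<Rightarrow> ('i \<Rightarrow> 'u) \<Rightarrow> 'u" where
  "ev F Y y B f = (\<Oplus>\<^bsub>fobj F B\<^esub>j\<in>{j \<in> idx Y. f j \<noteq> hzero B (fob Y j)}. fmap F (fob Y j) B (f j) (y j))"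

lemma vec_arr: "f \<in> vec Y B \<Longrightarrow> j \<in> idx Y \<Longrightarrow> f j \<in> Arr a B (fob Y j)"
  and vec_finite: "f \<in> vec Y B \<Longrightarrow> finite {j \<in> idx Y. f j \<noteq> hzero B (fob Y j)}"
  by (simp_all add: vec_def)

lemma vec_plus:
  assumes "f \<in> vec Y B" "g \<in> vec Y B" "B \<in> Ob" "\<And>j. j \<in> idx Y \<Longrightarrow> fob Y j \<in> Ob"
  shows "(\<lambda>j. hplus B (fob Y j) (f j) (g j)) \<in> vec Y B"
proof -
  have "{j \<in> idx Y. hplus B (fob Y j) (f j) (g j) \<noteq> hzero B (fob Y j)} \<subseteq>
      {j \<in> idx Y. f j \<noteq> hzero B (fob Y j)} \<union> {j \<in> idx Y. g j \<noteq> hzero B (fob Y j)}"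
    using assms abelian_groupE(5)[OF hom_group[OF assms(3,4)]] by (auto simp: vec_def)
  then show ?thesis using assms by (auto simp: vec_def intro: finite_subset)
qed

lemma vec_comp:
  assumes "f \<in> vec Y B" "B \<in> Ob" "C \<in> Ob" "g \<in> Arr a C B" "\<And>j. j \<in> idx Y \<Longrightarrow> fob Y j \<in> Ob"
  shows "(\<lambda>j. Comp a C B (fob Y j) (f j) g) \<in> vec Y C"
proof -
  have "{j \<in> idx Y. Comp a C B (fob Y j) (f j) g \<noteq> hzero C (fob Y j)} \<subseteq> {j \<in> idx Y. f j \<noteq> hzero B (fob Y j)}"
    using assms by auto
  then show ?thesis using assms by (auto simp: vec_def intro: finite_subset)
qed

lemma vec_unit:
  assumes "B \<in> Ob" "\<And>j. j \<in> idx Y \<Longrightarrow> fob Y j \<in> Ob" "f \<in> Arr a B (fob Y i)" "i \<in> idx Y"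
  shows "(\<lambda>j. if j = i then f else hzero B (fob Y j)) \<in> vec Y B"
proof -
  have "{j \<in> idx Y. (if j = i then f else hzero B (fob Y j)) \<noteq> hzero B (fob Y j)} \<subseteq> {i}" by auto
  then show ?thesis using assms by (auto simp: vec_def intro: finite_subset)
qed

context
  fixes F :: "('k, 'o, 'u) presheaf" and Y :: "('i, 'o) fam" and y
  assumes F: "psh F" and Y: "\<And>j. j \<in> idx Y \<Longrightarrow> fob Y j \<in> Ob" and y: "\<And>j. j \<in> idx Y \<Longrightarrow> y j \<in> crr F (fob Y j)"
begin

text \<open>Any finite set containing the support may index the sum. Vectors can then be compared
  over a common set although the support of a sum or of a composite may shrink.\<close>

lemma ev_superset:
  assumes "B \<in> Ob" "f \<in> vec Y B" "finite A" "A \<subseteq> idx Y" "\<And>j. j \<in> idx Y - A \<Longrightarrow> f j = hzero B (fob Y j)"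
  shows "ev F Y y B f = (\<Oplus>\<^bsub>fobj F B\<^esub>j\<in>A. fmap F (fob Y j) B (f j) (y j))"
proof -
  interpret abelian_group "fobj F B" using psh_group F assms by blast
  show ?thesis
    unfolding ev_def
    by (rule add.finprod_mono_neutral_cong_left)
      (use assms F Y y in \<open>auto simp: psh_closed vec_arr subset_iff\<close>)
qed

lemma ev_closed:
  assumes "B \<in> Ob" "f \<in> vec Y B"
  shows "ev F Y y B f \<in> crr F B"
proof -
  interpret abelian_group "fobj F B" using psh_group F assms by blast
  show ?thesis unfolding ev_def
    by (rule finsum_closed) (use assms F Y y in \<open>auto simp: psh_closed vec_arr\<close>)
qed

lemma ev_plus:
  assumes B: "B \<in> Ob" and f: "f \<in> vec Y B" and g: "g \<in> vec Y B"
  shows "ev F Y y B (\<lambda>j. hplus B (fob Y j) (f j) (g j)) = ev F Y y B f \<oplus>\<^bsub>fobj F B\<^esub> ev F Y y B g"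
proof -
  interpret abelian_group "fobj F B" using psh_group F B by blast
  define A where "A = {j \<in> idx Y. f j \<noteq> hzero B (fob Y j)} \<union> {j \<in> idx Y. g j \<noteq> hzero B (fob Y j)}"
  have A: "finite A" "A \<subseteq> idx Y" using vec_finite f g by (auto simp: A_def)
  have "hplus B (fob Y j) (f j) (g j) = hzero B (fob Y j)" if "j \<in> idx Y - A" for j
    using that B Y abelian_groupE(5)[OF hom_group[of B "fob Y j"]] by (simp add: A_def)
  then have "ev F Y y B (\<lambda>j. hplus B (fob Y j) (f j) (g j)) =
      (\<Oplus>\<^bsub>fobj F B\<^esub>j\<in>A. fmap F (fob Y j) B (hplus B (fob Y j) (f j) (g j)) (y j))"
    by (intro ev_superset B A vec_plus f g Y)
  also have "\<dots> = (\<Oplus>\<^bsub>fobj F B\<^esub>j\<in>A. fmap F (fob Y j) B (f j) (y j) \<oplus>\<^bsub>fobj F B\<^esub> fmap F (fob Y j) B (g j) (y j))"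
    by (intro finsum_cong') (use A B F Y y f g in \<open>auto simp: psh_plus psh_closed vec_arr subset_iff\<close>)
  also have "\<dots> = (\<Oplus>\<^bsub>fobj F B\<^esub>j\<in>A. fmap F (fob Y j) B (f j) (y j)) \<oplus>\<^bsub>fobj F B\<^esub> (\<Oplus>\<^bsub>fobj F B\<^esub>j\<in>A. fmap F (fob Y j) B (g j) (y j))"
    by (rule finsum_addf) (use A B F Y y f g in \<open>auto simp: psh_closed vec_arr subset_iff\<close>)
  also have "\<dots> = ev F Y y B f \<oplus>\<^bsub>fobj F B\<^esub> ev F Y y B g"
    using ev_superset[OF B f A] ev_superset[OF B g A] by (auto simp: A_def)
  finally show ?thesis .
qed

lemma ev_comp:
  assumes B: "B \<in> Ob" and C: "C \<in> Ob" and f: "f \<in> vec Y B" and g: "g \<in> Arr a C B"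
  shows "ev F Y y C (\<lambda>j. Comp a C B (fob Y j) (f j) g) = fmap F B C g (ev F Y y B f)"
proof -
  interpret FC: abelian_group "fobj F C" using psh_group F C by blast
  define A where "A = {j \<in> idx Y. f j \<noteq> hzero B (fob Y j)}"
  have A: "finite A" "A \<subseteq> idx Y" using vec_finite f by (auto simp: A_def)
  have "ev F Y y C (\<lambda>j. Comp a C B (fob Y j) (f j) g) =
      (\<Oplus>\<^bsub>fobj F C\<^esub>j\<in>A. fmap F (fob Y j) C (Comp a C B (fob Y j) (f j) g) (y j))"
    using assms Y by (intro ev_superset A vec_comp) (auto simp: A_def)
  also have "\<dots> = (\<Oplus>\<^bsub>fobj F C\<^esub>j\<in>A. fmap F B C g (fmap F (fob Y j) B (f j) (y j)))"
    by (intro FC.finsum_cong') (use A B C F Y y f g in \<open>auto simp: psh_comp psh_closed vec_arr subset_iff\<close>)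
  also have "\<dots> = fmap F B C g (\<Oplus>\<^bsub>fobj F B\<^esub>j\<in>A. fmap F (fob Y j) B (f j) (y j))"
    by (rule finsum_hom[symmetric, OF psh_group psh_group])
      (use A B C F Y y f g in \<open>auto simp: psh_closed vec_arr psh_add subset_iff\<close>)
  also have "\<dots> = fmap F B C g (ev F Y y B f)"
    by (simp add: ev_def A_def)
  finally show ?thesis .
qed

lemma ev_zero:
  assumes B: "B \<in> Ob"
  shows "(\<lambda>j. hzero B (fob Y j)) \<in> vec Y B" "ev F Y y B (\<lambda>j. hzero B (fob Y j)) = \<zero>\<^bsub>fobj F B\<^esub>"
proof -
  interpret abelian_group "fobj F B" using psh_group F B by blast
  show "(\<lambda>j. hzero B (fob Y j)) \<in> vec Y B" "ev F Y y B (\<lambda>j. hzero B (fob Y j)) = \<zero>\<^bsub>fobj F B\<^esub>"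
    using B Y by (simp_all add: vec_def ev_def)
qed

lemma ev_cong:
  assumes B: "B \<in> Ob" and f: "f \<in> vec Y B" and fg: "\<And>j. j \<in> idx Y \<Longrightarrow> f j = g j"
  shows "g \<in> vec Y B" "ev F Y y B g = ev F Y y B f"
proof -
  interpret abelian_group "fobj F B" using psh_group F B by blast
  have supp: "{j \<in> idx Y. f j \<noteq> hzero B (fob Y j)} = {j \<in> idx Y. g j \<noteq> hzero B (fob Y j)}" using fg by auto
  show g: "g \<in> vec Y B" using f fg by (simp add: vec_def supp)
  show "ev F Y y B g = ev F Y y B f"
    unfolding ev_def supp by (intro finsum_cong') (use B F Y y g fg in \<open>auto simp: psh_closed vec_arr\<close>)
qed

lemma ev_unit:
  assumes B: "B \<in> Ob" and i: "i \<in> idx Y" and f: "f \<in> Arr a B (fob Y i)"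
  shows "ev F Y y B (\<lambda>j. if j = i then f else hzero B (fob Y j)) = fmap F (fob Y i) B f (y i)"
proof -
  interpret abelian_group "fobj F B" using psh_group F B by blast
  have "ev F Y y B (\<lambda>j. if j = i then f else hzero B (fob Y j)) =
      (\<Oplus>\<^bsub>fobj F B\<^esub>j\<in>{i}. fmap F (fob Y j) B (if j = i then f else hzero B (fob Y j)) (y j))"
    using assms Y by (intro ev_superset vec_unit) auto
  then show ?thesis using B i f F Y y by (simp add: psh_closed)
qed

text \<open>Additivity in the vector for finite sums. It serves to evaluate a composite with
  \<open>p\<close>, whose entries are finite sums over indices of \<open>Z\<close>.\<close>

lemma ev_sum:
  assumes B: "B \<in> Ob" and D: "finite D" and v: "\<And>d. d \<in> D \<Longrightarrow> v d \<in> vec Y B"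
  shows "(\<lambda>j. \<Oplus>\<^bsub>HomM a B (fob Y j)\<^esub>d\<in>D. v d j) \<in> vec Y B \<and>
    ev F Y y B (\<lambda>j. \<Oplus>\<^bsub>HomM a B (fob Y j)\<^esub>d\<in>D. v d j) = (\<Oplus>\<^bsub>fobj F B\<^esub>d\<in>D. ev F Y y B (v d))"
  using D v
proof (induction rule: finite_induct)
  case empty
  have "(\<lambda>j. hzero B (fob Y j)) \<in> vec Y B" using ev_zero B by blast
  moreover have "hzero B (fob Y j) = (\<Oplus>\<^bsub>HomM a B (fob Y j)\<^esub>d\<in>{}. v d j)" if "j \<in> idx Y" for j
    by (simp add: abelian_monoid.finsum_empty[OF abelian_group.axioms(1)[OF hom_group[OF B Y[OF that]]]])
  ultimately show ?case
    using ev_cong[OF B, of "\<lambda>j. hzero B (fob Y j)"] ev_zero(2)[OF B]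
    by (simp add: abelian_monoid.finsum_empty[OF abelian_group.axioms(1)[OF psh_group[OF F B]]])
next
  case (insert d D)
  have v: "v d' \<in> vec Y B" if "d' \<in> insert d D" for d' using insert.prems that by blast
  define w where "w = (\<lambda>j. \<Oplus>\<^bsub>HomM a B (fob Y j)\<^esub>d\<in>D. v d j)"
  have w: "w \<in> vec Y B" "ev F Y y B w = (\<Oplus>\<^bsub>fobj F B\<^esub>d\<in>D. ev F Y y B (v d))"
    using insert.IH v by (auto simp: w_def)
  have eq: "hplus B (fob Y j) (v d j) (w j) = (\<Oplus>\<^bsub>HomM a B (fob Y j)\<^esub>d\<in>insert d D. v d j)" if j: "j \<in> idx Y" for j
    unfolding w_def
    using abelian_monoid.finsum_insert[OF abelian_group.axioms(1)[OF hom_group[OF B Y[OF j]]], of D d "\<lambda>d. v d j"]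
      insert.hyps v j B Y by (simp add: vec_arr Pi_iff)
  have "(\<Oplus>\<^bsub>fobj F B\<^esub>d\<in>insert d D. ev F Y y B (v d)) = ev F Y y B (v d) \<oplus>\<^bsub>fobj F B\<^esub> ev F Y y B w"
    using abelian_monoid.finsum_insert[OF abelian_group.axioms(1)[OF psh_group[OF F B]], of D d "\<lambda>d. ev F Y y B (v d)"]
      insert.hyps v B by (simp add: ev_closed Pi_iff w)
  then show ?case
    using ev_cong[OF B vec_plus[OF v[of d] w(1) B Y] eq] ev_plus[OF B v[of d] w(1)] by simp
qed

text \<open>Both evaluations are sums over the same support, so an additive relation between the
  summands passes to the sums. \<open>E\<close> will be the graph of a restriction map or of a
  matching family.\<close>

lemma ev_related:
  assumes B: "B \<in> Ob" and X: "X \<in> Ob" and f: "f \<in> vec Y B"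
    and q: "\<And>j. j \<in> idx Y \<Longrightarrow> q j \<in> Arr a (fob Y j) X"
    and E: "E \<subseteq> Arr a B X \<times> crr F B" "(hzero B X, \<zero>\<^bsub>fobj F B\<^esub>) \<in> E"
      "\<And>g x h z. (g, x) \<in> E \<Longrightarrow> (h, z) \<in> E \<Longrightarrow> (hplus B X g h, x \<oplus>\<^bsub>fobj F B\<^esub> z) \<in> E"
    and fE: "\<And>j. j \<in> idx Y \<Longrightarrow> (Comp a B (fob Y j) X (q j) (f j), fmap F (fob Y j) B (f j) (y j)) \<in> E"
  shows "(ev (yoneda a X) Y q B f, ev F Y y B f) \<in> E"
  unfolding ev_def
proof (rule finsum_pair_closed)
  show "abelian_group (fobj (yoneda a X) B)" "abelian_group (fobj F B)" using F X B psh_group hom_group by auto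
  fix j assume "j \<in> {j \<in> idx Y. f j \<noteq> hzero B (fob Y j)}"
  then show "(fmap (yoneda a X) (fob Y j) B (f j) (q j), fmap F (fob Y j) B (f j) (y j)) \<in> E" using fE q by simp
qed (use vec_finite[OF f] E X B in auto)

end

end

section \<open>The topology generated by a pretopology\<close>

locale linear_pretopology = linear_category k a
  for k :: "'k ring" and a :: "('k, 'o, 'u) lincat" +
  fixes S :: "('o, 'u) fseq set"
  assumes pretop: "pretopology a S"
begin

text \<open>The composite of \<open>q\<close> with a vector, as an arrow into \<open>X\<close>:
  evaluation in the presheaf represented by \<open>X\<close>.\<close>

abbreviation Q :: "('u, 'o) fam \<Rightarrow> 'o \<Rightarrow> ('u \<Rightarrow> unit \<Rightarrow> 'u) \<Rightarrow> 'o \<Rightarrow> ('u \<Rightarrow> 'u) \<Rightarrow> 'u" where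
  "Q Y X q \<equiv> ev (yoneda a X) Y (\<lambda>j. q j ())"

lemma fcomp_eval:
  assumes "i \<in> idx V"
  shows "fcomp a V Y (one_fam X) q f i () =
    (\<Oplus>\<^bsub>HomM a (fob V i) X\<^esub>j\<in>{j \<in> idx Y. f i j \<noteq> hzero (fob V i) (fob Y j)}. Comp a (fob V i) (fob Y j) X (q j ()) (f i j))"
  using assms by (simp add: fcomp_def fsupp_def)

lemma fmor_vec:
  assumes "f \<in> fmor a V Y" "i \<in> idx V"
  shows "f i \<in> vec Y (fob V i)"
proof -
  have "f i \<in> (\<Pi>\<^sub>E j\<in>idx Y. Arr a (fob V i) (fob Y j))" using assms by (auto simp: fmor_def)
  then show ?thesis using assms by (auto simp: fmor_def vec_def fsupp_def)
qed

lemma fcomp_Q: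
  assumes "i \<in> idx V" "fob V i \<in> Ob" "X \<in> Ob" "\<And>j. j \<in> idx Y \<Longrightarrow> fob Y j \<in> Ob"
    "\<And>j. j \<in> idx Y \<Longrightarrow> q j () \<in> Arr a (fob Y j) X" "f i \<in> vec Y (fob V i)"
  shows "fcomp a V Y (one_fam X) q f i () = Q Y X q (fob V i) (f i)"
proof -
  interpret abelian_group "HomM a (fob V i) X" using hom_group assms by blast
  show ?thesis
    unfolding fcomp_eval[OF assms(1)] ev_def
    by (simp, intro finsum_cong') (use assms in \<open>auto simp: vec_arr\<close>)
qed

text \<open>The case split is due to the support, which omits a vanishing component; the empty sum
  is then the zero arrow, and so is the composite.\<close>

lemma fcomp_through_one:
  assumes "i \<in> idx V" "j \<in> idx Y" "fob V i \<in> Ob" "A \<in> Ob" "fob Y j \<in> Ob" "g i () \<in> Arr a (fob V i) A" "f () j \<in> Arr a A (fob Y j)"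
  shows "fcomp a V (one_fam A) Y f g i j = Comp a (fob V i) A (fob Y j) (f () j) (g i ())"
proof -
  interpret abelian_group "HomM a (fob V i) (fob Y j)" using hom_group assms by blast
  show ?thesis
  proof (cases "g i () = hzero (fob V i) A")
    case True
    then have "fsupp a V (one_fam A) g i = {}" by (auto simp: fsupp_def)
    then show ?thesis using assms True by (simp add: fcomp_def)
  next
    case False
    then have "fsupp a V (one_fam A) g i = {()}" by (auto simp: fsupp_def)
    then show ?thesis using assms by (simp add: fcomp_def)
  qed
qed

lemma
  assumes "(Z, Y, X, p, q) \<in> S"
  shows seq_X: "X \<in> Ob"
    and seq_Y: "\<And>j. j \<in> idx Y \<Longrightarrow> fob Y j \<in> Ob"
    and seq_Z: "\<And>c. c \<in> idx Z \<Longrightarrow> fob Z c \<in> Ob"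
    and seq_q: "\<And>j. j \<in> idx Y \<Longrightarrow> q j () \<in> Arr a (fob Y j) X"
    and seq_p: "\<And>c. c \<in> idx Z \<Longrightarrow> p c \<in> vec Y (fob Z c)"
    and seq_qp: "\<And>c. c \<in> idx Z \<Longrightarrow> Q Y X q (fob Z c) (p c) = hzero (fob Z c) X"
proof -
  have s: "is_seq a (Z, Y, X, p, q)" using assms pretop by (auto simp: pretopology_def)
  then show X: "X \<in> Ob" and Y: "\<And>j. j \<in> idx Y \<Longrightarrow> fob Y j \<in> Ob" and Z: "\<And>c. c \<in> idx Z \<Longrightarrow> fob Z c \<in> Ob"
    by (auto simp: is_seq_def is_fam_def)
  have "q \<in> fmor a Y (one_fam X)" "p \<in> fmor a Z Y" using s by (auto simp: is_seq_def)
  then show q: "\<And>j. j \<in> idx Y \<Longrightarrow> q j () \<in> Arr a (fob Y j) X" and p: "\<And>c. c \<in> idx Z \<Longrightarrow> p c \<in> vec Y (fob Z c)"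
    by (auto dest: fmor_vec simp: vec_def)
  have "fcomp a Z Y (one_fam X) q p = fzero a Z (one_fam X)" using s by (simp add: is_seq_def)
  then have "fcomp a Z Y (one_fam X) q p c () = hzero (fob Z c) X" if "c \<in> idx Z" for c
    using that by (simp add: fzero_def)
  then show "\<And>c. c \<in> idx Z \<Longrightarrow> Q Y X q (fob Z c) (p c) = hzero (fob Z c) X"
    using fcomp_Q[of _ Z X Y q p] X Y Z p q by simp
qed

lemma
  assumes "(Y, X, q) \<in> Co1 S"
  shows Co1_X: "X \<in> Ob"
    and Co1_Y: "\<And>j. j \<in> idx Y \<Longrightarrow> fob Y j \<in> Ob"
    and Co1_q: "\<And>j. j \<in> idx Y \<Longrightarrow> q j () \<in> Arr a (fob Y j) X"
  using assms seq_X seq_Y seq_q by (auto simp: Co1_def)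

lemma Co_typed:
  "(V, X, v) \<in> Co a S n \<Longrightarrow> X \<in> Ob \<and> (\<forall>i\<in>idx V. fob V i \<in> Ob \<and> v i () \<in> Arr a (fob V i) X)"
proof (induction n arbitrary: V X v rule: induct_nat_012)
  case 0 then show ?case by auto
next
  case 1 then show ?case using Co1_X Co1_Y Co1_q by auto
next
  case (ge2 n)
  then obtain I \<phi> V' v' W w where VX: "V = \<lparr>idx = I, fob = (\<lambda>i\<in>I. fob (W (fst (\<phi> i))) (snd (\<phi> i)))\<rparr>"
    "v = (\<lambda>i\<in>I. \<lambda>_. case \<phi> i of (\<alpha>, \<delta>) \<Rightarrow> Comp a (fob (W \<alpha>) \<delta>) (fob V' \<alpha>) X (v' \<alpha> ()) (w \<alpha> \<delta> ()))"
    and V': "(V', X, v') \<in> Co a S (Suc n)" and W: "\<forall>\<alpha>\<in>idx V'. (W \<alpha>, fob V' \<alpha>, w \<alpha>) \<in> Co1 S"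
    and \<phi>: "bij_betw \<phi> I (SIGMA \<alpha>:idx V'. idx (W \<alpha>))"
    by auto
  note IH = ge2.IH(2)[OF V']
  have "fob V i \<in> Ob \<and> v i () \<in> Arr a (fob V i) X" if "i \<in> idx V" for i
  proof -
    obtain \<alpha> \<delta> where ad: "\<phi> i = (\<alpha>, \<delta>)" by fastforce
    then have "\<alpha> \<in> idx V'" "\<delta> \<in> idx (W \<alpha>)" using \<phi> that VX(1) bij_betwE by fastforce+
    moreover from this have "(W \<alpha>, fob V' \<alpha>, w \<alpha>) \<in> Co1 S" using W by blast
    ultimately show ?thesis
      using Co1_Y[of "W \<alpha>" "fob V' \<alpha>" "w \<alpha>" \<delta>] Co1_q[of "W \<alpha>" "fob V' \<alpha>" "w \<alpha>" \<delta>] IH ad that VX by simp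
  qed
  then show ?case using IH by simp
qed

lemma
  assumes "(V, X, v) \<in> Cotilde a S"
  shows Cotilde_X: "X \<in> Ob"
    and Cotilde_V: "\<And>i. i \<in> idx V \<Longrightarrow> fob V i \<in> Ob"
    and Cotilde_v: "\<And>i. i \<in> idx V \<Longrightarrow> v i () \<in> Arr a (fob V i) X"
  using assms Co_typed by (fastforce simp: Cotilde_def)+

lemma PTa:
  assumes Y: "(Y, X, q) \<in> Co1 S" and A: "A \<in> Ob" and f: "f \<in> Arr a A X"
  obtains C r where "(C, A, r) \<in> Cotilde a S"
    "\<And>i. i \<in> idx C \<Longrightarrow> \<exists>v\<in>vec Y (fob C i). Comp a (fob C i) A X f (r i ()) = Q Y X q (fob C i) v"
proof -
  obtain C r f' where C: "(C, A, r) \<in> Cotilde a S" and f': "f' \<in> fmor a C Y"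
    and eq: "fcomp a C Y (one_fam X) q f' = fcomp a C (one_fam A) (one_fam X) (farr f) r"
    using assms pretop unfolding pretopology_def by blast
  have "Comp a (fob C i) A X f (r i ()) = Q Y X q (fob C i) (f' i)" if i: "i \<in> idx C" for i
  proof -
    have "fcomp a C (one_fam A) (one_fam X) (farr f) r i () = Comp a (fob C i) A X f (r i ())"
      using fcomp_through_one[of i C "()" "one_fam X" A r "farr f"] i A f Cotilde_V[OF C] Cotilde_v[OF C] Co1_X[OF Y] by simp
    moreover have "fcomp a C Y (one_fam X) q f' i () = Q Y X q (fob C i) (f' i)"
      by (rule fcomp_Q) (use i Cotilde_V[OF C] Co1_X[OF Y] Co1_Y[OF Y] Co1_q[OF Y] fmor_vec[OF f' i] in auto)
    ultimately show ?thesis using eq by simp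
  qed
  then show thesis using that[OF C] fmor_vec[OF f'] by blast
qed

text \<open>Made extensional, the vector \<open>f\<close> is a formal morphism out of a one-object
  family; the resulting equation of formal morphisms is then read off entry by entry.\<close>

lemma PTb:
  assumes s: "(Z, Y, X, p, q) \<in> S" and A: "A \<in> Ob" and f: "f \<in> vec Y A" and 0: "Q Y X q A f = hzero A X"
  obtains B r where "(B, A, r) \<in> Cotilde a S"
    "\<And>i. i \<in> idx B \<Longrightarrow> \<exists>w\<in>vec Z (fob B i). \<forall>j\<in>idx Y. Comp a (fob B i) A (fob Y j) (f j) (r i ()) =
      (\<Oplus>\<^bsub>HomM a (fob B i) (fob Y j)\<^esub>c\<in>{c \<in> idx Z. w c \<noteq> hzero (fob B i) (fob Z c)}.
        Comp a (fob B i) (fob Z c) (fob Y j) (p c j) (w c))"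
proof -
  define F where "F = (\<lambda>_::unit. restrict f (idx Y))"
  have supp: "fsupp a (one_fam A) Y F () = {j \<in> idx Y. f j \<noteq> hzero A (fob Y j)}" by (auto simp: fsupp_def F_def)
  have Ff: "F \<in> fmor a (one_fam A) Y"
    using f unfolding fmor_def by (auto simp: supp vec_finite[OF f] vec_arr) (auto simp: F_def vec_arr)
  have rf: "restrict f (idx Y) \<in> vec Y A" "Q Y X q A (restrict f (idx Y)) = Q Y X q A f"
    using ev_cong[of "yoneda a X" Y "\<lambda>j. q j ()" A f "restrict f (idx Y)"] s seq_X seq_Y seq_q A f by auto
  have "fcomp a (one_fam A) Y (one_fam X) q F () () = hzero A X"
    using fcomp_Q[of "()" "one_fam A" X Y q F] s seq_X seq_Y seq_q A rf 0 by (simp add: F_def)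
  then have "fcomp a (one_fam A) Y (one_fam X) q F = fzero a (one_fam A) (one_fam X)"
    unfolding fun_eq_iff by (simp add: fcomp_def fzero_def)
  then obtain B r f' where B: "(B, A, r) \<in> Cotilde a S" and f': "f' \<in> fmor a B Z"
    and eq: "fcomp a B Z Y p f' = fcomp a B (one_fam A) Y F r"
    using s A Ff pretop unfolding pretopology_def by blast
  have "Comp a (fob B i) A (fob Y j) (f j) (r i ()) =
      (\<Oplus>\<^bsub>HomM a (fob B i) (fob Y j)\<^esub>c\<in>{c \<in> idx Z. f' i c \<noteq> hzero (fob B i) (fob Z c)}.
        Comp a (fob B i) (fob Z c) (fob Y j) (p c j) (f' i c))" if i: "i \<in> idx B" and j: "j \<in> idx Y" for i j
  proof -
    have "fcomp a B (one_fam A) Y F r i j = Comp a (fob B i) A (fob Y j) (f j) (r i ())"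
      using fcomp_through_one[of i B j Y A r F] i j A Cotilde_V[OF B] Cotilde_v[OF B] seq_Y[OF s] vec_arr[OF f] by (simp add: F_def)
    moreover have "fcomp a B Z Y p f' i j = (\<Oplus>\<^bsub>HomM a (fob B i) (fob Y j)\<^esub>c\<in>{c \<in> idx Z. f' i c \<noteq> hzero (fob B i) (fob Z c)}.
        Comp a (fob B i) (fob Z c) (fob Y j) (p c j) (f' i c))"
      using i j by (simp add: fcomp_def fsupp_def)
    ultimately show ?thesis using eq by simp
  qed
  then show thesis using that[OF B] fmor_vec[OF f'] by blast
qed

text \<open>
  Covers are iterated along well-founded trees, whose branches may have unbounded length. The
  sieves of \<^const>\<open>top_of\<close> come from trees of constant height only, and need not satisfy
  the local character axiom.
\<close>

inductive cov :: "'o \<Rightarrow> ('o, 'u) sieve \<Rightarrow> bool" where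
  max: "X \<in> Obj a \<Longrightarrow> cov X (maxs X)"
| step: "(Y, X, q) \<in> Co1 S \<Longrightarrow> sieve X R \<Longrightarrow>
    (\<And>j. j \<in> idx Y \<Longrightarrow> cov (fob Y j) (pullback X (fob Y j) (q j ()) R)) \<Longrightarrow> cov X R"

lemma cov_ob: "cov X R \<Longrightarrow> X \<in> Ob"
  by (induction rule: cov.induct) (auto simp: Co1_X)

lemma cov_sieve: "cov X R \<Longrightarrow> sieve X R"
  by (induction rule: cov.induct) auto

text \<open>Grafting of trees. At a leaf the identity belongs to the maximal sieve, so
  \<open>T\<close> itself is covering; at a node the tree for \<open>T\<close> is assembled from
  trees over the objects of \<open>Y\<close>.\<close>

lemma cov_local:
  assumes "cov X R" "sieve X T" "\<And>B f. B \<in> Ob \<Longrightarrow> f \<in> R B \<Longrightarrow> cov B (pullback X B f T)"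
  shows "cov X T"
  using assms
proof (induction arbitrary: T rule: cov.induct)
  case (max X)
  then show ?case using max.prems(2)[of X "Ident a X"] pullback_id by (simp add: maxs_def)
next
  case (step Y X q R)
  show ?case
  proof (rule cov.step[OF step.hyps(1) step.prems(1)], rule step.IH)
    fix j assume j: "j \<in> idx Y"
    note t = Co1_X[OF step.hyps(1)] Co1_Y[OF step.hyps(1) j] Co1_q[OF step.hyps(1) j]
    show "sieve (fob Y j) (pullback X (fob Y j) (q j ()) T)" using step.prems(1) t by simp
    fix B f assume "B \<in> Ob" "f \<in> pullback X (fob Y j) (q j ()) R B"
    then show "cov B (pullback (fob Y j) B f (pullback X (fob Y j) (q j ()) T))"
      using t step.prems(2)[of B "Comp a B (fob Y j) X (q j ()) f"] by (simp add: pullback_def[of _ _ _ R] pullback_comp)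
  qed
qed

lemma cov_mono:
  assumes "cov A R" "sieve A T" "\<And>B. B \<in> Ob \<Longrightarrow> R B \<subseteq> T B"
  shows "cov A T"
proof (rule cov_local[OF assms(1,2)])
  fix B f assume B: "B \<in> Ob" "f \<in> R B"
  then have "pullback A B f T = maxs B"
    using assms pullback_max[of A T B f] cov_ob by blast
  then show "cov B (pullback A B f T)" using cov.max B by simp
qed

text \<open>\<open>Co\<close> adds families of \<open>Co1\<close> at the leaves, whereas
  \<open>cov\<close> adds them at the root. The induction strips the last layer and applies
  \<open>cov.step\<close> to it at each object of \<open>V'\<close>.\<close>

lemma cov_Co:
  assumes "(V, X, v) \<in> Co a S n" "sieve X R" "\<And>i. i \<in> idx V \<Longrightarrow> cov (fob V i) (pullback X (fob V i) (v i ()) R)"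
  shows "cov X R"
  using assms
proof (induction n arbitrary: V v rule: induct_nat_012)
  case 0
  then obtain i where V: "V = \<lparr>idx = {i}, fob = (\<lambda>_\<in>{i}. X)\<rparr>" "v = (\<lambda>_\<in>{i}. \<lambda>_. Ident a X)" "X \<in> Ob" by auto
  then show ?case using 0(3)[of i] 0(2) by (simp add: pullback_id)
next
  case 1
  then show ?case by (auto intro: cov.step)
next
  case (ge2 n)
  then obtain I \<phi> V' v' W w where VX: "V = \<lparr>idx = I, fob = (\<lambda>i\<in>I. fob (W (fst (\<phi> i))) (snd (\<phi> i)))\<rparr>"
    "v = (\<lambda>i\<in>I. \<lambda>_. case \<phi> i of (\<alpha>, \<delta>) \<Rightarrow> Comp a (fob (W \<alpha>) \<delta>) (fob V' \<alpha>) X (v' \<alpha> ()) (w \<alpha> \<delta> ()))"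
    and V': "(V', X, v') \<in> Co a S (Suc n)" and W: "\<forall>\<alpha>\<in>idx V'. (W \<alpha>, fob V' \<alpha>, w \<alpha>) \<in> Co1 S"
    and \<phi>: "bij_betw \<phi> I (SIGMA \<alpha>:idx V'. idx (W \<alpha>))"
    by auto
  note t = Co_typed[OF V']
  show ?case
  proof (rule ge2.IH(2)[OF V' ge2.prems(2)])
    fix \<alpha> assume \<alpha>: "\<alpha> \<in> idx V'"
    then have W': "(W \<alpha>, fob V' \<alpha>, w \<alpha>) \<in> Co1 S" using W by blast
    show "cov (fob V' \<alpha>) (pullback X (fob V' \<alpha>) (v' \<alpha> ()) R)"
    proof (rule cov.step[OF W'])
      show "sieve (fob V' \<alpha>) (pullback X (fob V' \<alpha>) (v' \<alpha> ()) R)" using t \<alpha> ge2.prems(2) by simp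
      fix \<delta> assume \<delta>: "\<delta> \<in> idx (W \<alpha>)"
      then obtain i where i: "i \<in> I" "\<phi> i = (\<alpha>, \<delta>)" using \<phi> \<alpha> by (metis SigmaI bij_betw_iff_bijections)
      have "cov (fob V i) (pullback X (fob V i) (v i ()) R)" using ge2.prems(3)[of i] i(1) VX(1) by simp
      then show "cov (fob (W \<alpha>) \<delta>) (pullback (fob V' \<alpha>) (fob (W \<alpha>) \<delta>) (w \<alpha> \<delta> ()) (pullback X (fob V' \<alpha>) (v' \<alpha> ()) R))"
        using i VX t \<alpha> Co1_Y[OF W' \<delta>] Co1_q[OF W' \<delta>] by (simp add: pullback_comp)
    qed
  qed
qed

lemma cov_Cotilde:
  "(V, X, v) \<in> Cotilde a S \<Longrightarrow> sieve X R \<Longrightarrow> (\<And>i. i \<in> idx V \<Longrightarrow> cov (fob V i) (pullback X (fob V i) (v i ()) R)) \<Longrightarrow> cov X R"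
  using cov_Co by (auto simp: Cotilde_def)

text \<open>Covering together with all pullbacks. (PTa) rewrites a composite into \<open>X\<close>
  as a finite sum through several objects of \<open>Y\<close>, so pulling back one node of a tree
  requires finite intersections of covers, and these require stability of the covers below that
  node. The notion carries this through the induction.\<close>

definition stable_cov :: "'o \<Rightarrow> ('o, 'u) sieve \<Rightarrow> bool" where
  "stable_cov X R \<longleftrightarrow> X \<in> Ob \<and> sieve X R \<and> (\<forall>B\<in>Ob. \<forall>f\<in>Arr a B X. cov B (pullback X B f R))"

lemma stable_cov_cov: "stable_cov X R \<Longrightarrow> cov X R"
  unfolding stable_cov_def using pullback_id id_arr by metis

lemma stable_cov_pullback: "stable_cov X R \<Longrightarrow> B \<in> Ob \<Longrightarrow> f \<in> Arr a B X \<Longrightarrow> stable_cov B (pullback X B f R)"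
  unfolding stable_cov_def by (simp add: pullback_comp[symmetric])

lemma stable_cov_max:
  assumes X: "X \<in> Ob"
  shows "stable_cov X (maxs X)"
proof -
  have "pullback X B f (maxs X) = maxs B" if "B \<in> Ob" "f \<in> Arr a B X" for B f
    by (rule pullback_max[OF sieve_max[OF X] X]) (use that in \<open>auto simp: maxs_def\<close>)
  then show ?thesis using X cov.max by (simp add: stable_cov_def)
qed

text \<open>Local character over \<open>R\<close>, with the pullbacks supplied by stability of
  \<open>T\<close>. Pulling back commutes with intersection, so the result is stable again.\<close>

lemma stable_cov_inter:
  assumes R: "stable_cov X R" and T: "stable_cov X T"
  shows "stable_cov X (\<lambda>B. R B \<inter> T B)"
proof -
  have main: "cov X (\<lambda>B. R B \<inter> T B)" if R: "stable_cov X R" and T: "stable_cov X T" for X R T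
  proof (rule cov_local[OF stable_cov_cov[OF R]])
    have X: "X \<in> Ob" and s: "sieve X R" "sieve X T" using R T by (auto simp: stable_cov_def)
    then show s': "sieve X (\<lambda>B. R B \<inter> T B)" using sieve_inter by blast
    fix B f assume B: "B \<in> Ob" and f: "f \<in> R B"
    have f': "f \<in> Arr a B X" using s B f sieve_arr by blast
    show "cov B (pullback X B f (\<lambda>B. R B \<inter> T B))"
    proof (rule cov_mono)
      show "cov B (pullback X B f T)" using T B f' by (simp add: stable_cov_def)
      show "pullback X B f T C \<subseteq> pullback X B f (\<lambda>B. R B \<inter> T B) C" if "C \<in> Ob" for C
        using sieve_comp[OF s(1) B that f] by (auto simp: pullback_def)
    qed (use s' X B f' in simp)
  qed
  have "pullback X B f (\<lambda>B. R B \<inter> T B) = (\<lambda>C. pullback X B f R C \<inter> pullback X B f T C)" for B f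
    by (auto simp: pullback_def fun_eq_iff)
  then show ?thesis
    using main[OF stable_cov_pullback[OF R] stable_cov_pullback[OF T]] R T
    unfolding stable_cov_def by (simp add: sieve_inter)
qed

lemma stable_cov_finite_inter:
  assumes "finite D" "B \<in> Ob" "\<And>j. j \<in> D \<Longrightarrow> stable_cov B (R j)"
  shows "\<exists>T. stable_cov B T \<and> (\<forall>C\<in>Ob. \<forall>g\<in>T C. \<forall>j\<in>D. g \<in> R j C)"
  using assms(1,3)
proof (induction rule: finite_induct)
  case empty
  have "stable_cov B (maxs B)" using assms(2) by (rule stable_cov_max)
  then show ?case by blast
next
  case (insert j D)
  then obtain T where T: "stable_cov B T" "\<forall>C\<in>Ob. \<forall>g\<in>T C. \<forall>j\<in>D. g \<in> R j C" by blast
  have "stable_cov B (\<lambda>C. R j C \<inter> T C)" using T insert stable_cov_inter by blast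
  with T(2) show ?case by (intro exI[of _ "\<lambda>C. R j C \<inter> T C"]) auto
qed

text \<open>At a node, (PTa) covers \<open>A\<close> by arrows whose composite with \<open>f\<close>
  is \<open>q\<close> after a vector \<open>v\<close>. Pulled back along such a composite,
  \<open>R\<close> contains the intersection, over the support of \<open>v\<close>, of pullbacks of
  the sieves over the objects of \<open>Y\<close>, and these are stable by induction.\<close>

lemma cov_stable: "cov X R \<Longrightarrow> stable_cov X R"
proof (induction rule: cov.induct)
  case (max X)
  then show ?case by (rule stable_cov_max)
next
  case (step Y X q R)
  note t = Co1_X[OF step.hyps(1)] Co1_Y[OF step.hyps(1)] Co1_q[OF step.hyps(1)]
  show ?case
    unfolding stable_cov_def
  proof (intro conjI ballI t(1) step.hyps(2))
    fix A f assume A: "A \<in> Ob" and f: "f \<in> Arr a A X"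
    obtain C r where C: "(C, A, r) \<in> Cotilde a S"
      and r: "\<And>i. i \<in> idx C \<Longrightarrow> \<exists>v\<in>vec Y (fob C i). Comp a (fob C i) A X f (r i ()) = Q Y X q (fob C i) v"
      using PTa[OF step.hyps(1) A f] by blast
    show "cov A (pullback X A f R)"
    proof (rule cov_Cotilde[OF C])
      show "sieve A (pullback X A f R)" using step.hyps(2) t(1) A f by simp
      fix i assume i: "i \<in> idx C"
      note ti = Cotilde_V[OF C i] Cotilde_v[OF C i]
      obtain v where v: "v \<in> vec Y (fob C i)" and fr: "Comp a (fob C i) A X f (r i ()) = Q Y X q (fob C i) v"
        using r[OF i] by blast
      define D where "D = {j \<in> idx Y. v j \<noteq> hzero (fob C i) (fob Y j)}"
      have "stable_cov (fob C i) (pullback (fob Y j) (fob C i) (v j) (pullback X (fob Y j) (q j ()) R))" if "j \<in> D" for j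
        by (rule stable_cov_pullback) (use that step.IH[of j] v ti in \<open>auto simp: D_def vec_arr\<close>)
      then obtain T where T: "stable_cov (fob C i) T"
        "\<forall>B\<in>Ob. \<forall>g\<in>T B. \<forall>j\<in>D. g \<in> pullback (fob Y j) (fob C i) (v j) (pullback X (fob Y j) (q j ()) R) B"
        using stable_cov_finite_inter[of D "fob C i" "\<lambda>j. pullback (fob Y j) (fob C i) (v j) (pullback X (fob Y j) (q j ()) R)"]
          ti vec_finite[OF v] unfolding D_def by blast
      show "cov (fob C i) (pullback A (fob C i) (r i ()) (pullback X A f R))"
      proof (rule cov_mono[OF stable_cov_cov[OF T(1)]])
        show "sieve (fob C i) (pullback A (fob C i) (r i ()) (pullback X A f R))" using step.hyps(2) t(1) A f ti by simp
        show "T B \<subseteq> pullback A (fob C i) (r i ()) (pullback X A f R) B" if B: "B \<in> Ob" for B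
        proof
          fix g assume g: "g \<in> T B"
          have g': "g \<in> Arr a B (fob C i)" using g B T(1) sieve_arr by (auto simp: stable_cov_def)
          have *: "Comp a B (fob Y j) X (q j ()) (Comp a B (fob C i) (fob Y j) (v j) g) \<in> R B" if j: "j \<in> D" for j
            using T(2) B g j by (auto simp: pullback_def)
          \<comment> \<open>Linearity of sieves is essential here: each summand of the composite
            lies in \<open>R\<close>, hence so does the sum.\<close>
          have "Comp a B (fob C i) X (Q Y X q (fob C i) v) g \<in> R B"
          proof -
            have "Comp a B (fob C i) X (Q Y X q (fob C i) v) g = fmap (yoneda a X) (fob C i) B g (Q Y X q (fob C i) v)"
              using ev_closed[of "yoneda a X" Y "\<lambda>j. q j ()" "fob C i" v] t ti v by simp
            also have "\<dots> = Q Y X q B (\<lambda>j. Comp a B (fob C i) (fob Y j) (v j) g)"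
              using ev_comp[of "yoneda a X" Y "\<lambda>j. q j ()" "fob C i" B v g] t ti v B g' by simp
            also have "\<dots> = (\<Oplus>\<^bsub>fobj (yoneda a X) B\<^esub>j\<in>D. fmap (yoneda a X) (fob Y j) B (Comp a B (fob C i) (fob Y j) (v j) g) (q j ()))"
              using vec_finite[OF v] t ti B g' v by (intro ev_superset vec_comp) (auto simp: D_def)
            also have "\<dots> \<in> R B"
              using sieve_finsum[OF step.hyps(2) t(1) B, of D "\<lambda>j. fmap (yoneda a X) (fob Y j) B (Comp a B (fob C i) (fob Y j) (v j) g) (q j ())"]
                vec_finite[OF v] * t(3) by (simp add: D_def)
            finally show ?thesis .
          qed
          then show "g \<in> pullback A (fob C i) (r i ()) (pullback X A f R) B"
            using g' B A t(1) f ti by (simp add: pullback_def comp_assoc[symmetric] fr)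
        qed
      qed
    qed
  qed
qed

sublocale linear_topology k a cov
proof
  show "cov A R \<Longrightarrow> A \<in> Obj a" for A R by (rule cov_ob)
  show "cov A R \<Longrightarrow> sieve A R" for A R by (rule cov_sieve)
  show "A \<in> Obj a \<Longrightarrow> cov A (maxs A)" for A by (rule cov.max)
  show "cov A R \<Longrightarrow> B \<in> Obj a \<Longrightarrow> f \<in> Arr a B A \<Longrightarrow> cov B (pullback A B f R)" for A B f R
    using cov_stable by (simp add: stable_cov_def)
  show "cov A R \<Longrightarrow> sieve A T \<Longrightarrow> (\<And>B f. B \<in> Obj a \<Longrightarrow> f \<in> R B \<Longrightarrow> cov B (pullback A B f T)) \<Longrightarrow> cov A T" for A R T
    by (rule cov_local)
qed

end

section \<open>Gluing along a single sieve\<close>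

context linear_category
begin

text \<open>A zero arrow is its own composite with a zero arrow, and restriction along a zero arrow
  annihilates.\<close>

lemma compat_zero:
  assumes "psh F" "A \<in> Ob" "sieve A R" "compat F A R s" "B \<in> Ob"
  shows "s B (hzero B A) = \<zero>\<^bsub>fobj F B\<^esub>"
proof -
  have z: "hzero B A \<in> R B" using assms sieve_zero by blast
  have "s B (hzero B A) = s B (Comp a B B A (hzero B A) (hzero B B))" using assms by simp
  also have "\<dots> = fmap F B B (hzero B B) (s B (hzero B A))"
    using assms(4)[unfolded compat_def] assms(5) z hzero_arr[of B B] by blast
  also have "\<dots> = \<zero>\<^bsub>fobj F B\<^esub>"
    using assms z unfolding compat_def by (intro psh_hzero) auto
  finally show ?thesis .
qed

lemma compat_pullback:
  assumes "compat F A R s" "A \<in> Ob" "B \<in> Ob" "f \<in> Arr a B A"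
  shows "compat F B (pullback A B f R) (\<lambda>C g. s C (Comp a C B A f g))"
  using assms unfolding compat_def by (simp add: pullback_def comp_plus_right comp_assoc[symmetric])

definition glues :: "('k, 'o, 'u) presheaf \<Rightarrow> 'o \<Rightarrow> ('o, 'u) sieve \<Rightarrow> bool" where
  "glues F A R \<longleftrightarrow> (\<forall>x\<in>crr F A. (\<forall>B\<in>Ob. \<forall>f\<in>R B. fmap F A B f x = \<zero>\<^bsub>fobj F B\<^esub>) \<longrightarrow> x = \<zero>\<^bsub>fobj F A\<^esub>) \<and>
    (\<forall>s. compat F A R s \<longrightarrow> (\<exists>x\<in>crr F A. \<forall>B\<in>Ob. \<forall>f\<in>R B. fmap F A B f x = s B f))"

lemma subpresheaf_sieve:
  assumes "A \<in> Ob" "sieve A R"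
  shows "subpresheaf (yoneda a A) R"
  unfolding subpresheaf_def using assms sieve_arr[OF assms(2)] sieve_zero[OF assms(2)] sieve_plus[OF assms(2)] sieve_comp[OF assms(2)]
  by auto

lemma sieve_presheaf_sub: "sieve_presheaf a A R = sub (yoneda a A) R"
  by (simp add: sieve_presheaf_def sub_def)

text \<open>Morphisms out of a sieve, seen as a presheaf, are its matching families. Injectivity and
  surjectivity of the comparison map thus become the two halves of \<open>glues\<close>; its
  linearity holds for every presheaf.\<close>

lemma glues_iff:
  assumes F: "psh F" and A: "A \<in> Ob" and R: "sieve A R"
  shows "(linear_map k (fobj F A) (HomM (PSh k a) (sieve_presheaf a A R) F)
       (\<lambda>x. sieve_restrict a R (yoneda_map a F A x)) \<and>
     bij_betw (\<lambda>x. sieve_restrict a R (yoneda_map a F A x))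
       (carrier (fobj F A)) (carrier (HomM (PSh k a) (sieve_presheaf a A R) F))) \<longleftrightarrow> glues F A R"
proof -
  define G where "G = sub (yoneda a A) R"
  have G: "psh G" unfolding G_def by (rule sub_psh[OF yoneda_psh[OF A] subpresheaf_sieve[OF A R]])
  have Gs[simp]: "crr G B = R B" "f \<oplus>\<^bsub>fobj G B\<^esub> g = hplus B A f g" for B f g by (simp_all add: G_def)
  have Gm[simp]: "fmap G B C g f = Comp a C B A f g" if "B \<in> Ob" "f \<in> R B" for B C f g
    using that sieve_arr[OF R] by (simp add: G_def)
  define \<Phi> where "\<Phi> x = sieve_restrict a R (yoneda_map a F A x)" for x
  have \<Phi>: "\<Phi> x = mk G (\<lambda>B f. fmap F A B f x)" for x
    unfolding \<Phi>_def sieve_restrict_def mk_def yoneda_map_def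
    by (rule restrict_ext) (use sieve_arr[OF R] in \<open>auto simp: fun_eq_iff restrict_def\<close>)
  have \<Phi>_app: "\<Phi> x B f = fmap F A B f x" if "B \<in> Ob" "f \<in> R B" for x B f
    using that by (simp add: \<Phi>)
  have \<Phi>_mor: "\<Phi> x \<in> mor G F" if x: "x \<in> crr F A" for x
    unfolding \<Phi> by (rule mk_mor[OF G F]) (use sieve_arr[OF R] x A F in \<open>auto simp: psh_closed psh_plus psh_comp\<close>)
  have lin: "linear_map k (fobj F A) (HomM (PSh k a) G F) \<Phi>"
    unfolding linear_map_def carrier_mor
  proof (intro conjI ballI)
    show "\<Phi> \<in> crr F A \<rightarrow> mor G F" using \<Phi>_mor by blast
    show "\<Phi> (x \<oplus>\<^bsub>fobj F A\<^esub> y) = \<Phi> x \<oplus>\<^bsub>HomM (PSh k a) G F\<^esub> \<Phi> y" if "x \<in> crr F A" "y \<in> crr F A" for x y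
      by (rule mor_eqI[of _ G F]) (use that A F G \<Phi>_mor sieve_arr[OF R] in \<open>auto simp: \<Phi>_app psh_add\<close>)
    show "\<Phi> (c \<odot>\<^bsub>fobj F A\<^esub> x) = c \<odot>\<^bsub>HomM (PSh k a) G F\<^esub> \<Phi> x" if "c \<in> carrier k" "x \<in> crr F A" for c x
      by (rule mor_eqI[of _ G F])
        (use that A F G \<Phi>_mor sieve_arr[OF R] in \<open>auto simp: \<Phi>_app psh_smult module.smult_closed[OF psh_module]\<close>)
  qed
  have inj: "inj_on \<Phi> (crr F A) \<longleftrightarrow> (\<forall>x\<in>crr F A. (\<forall>B\<in>Ob. \<forall>f\<in>R B. fmap F A B f x = \<zero>\<^bsub>fobj F B\<^esub>) \<longrightarrow> x = \<zero>\<^bsub>fobj F A\<^esub>)"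
  proof
    assume inj: "inj_on \<Phi> (crr F A)"
    show "\<forall>x\<in>crr F A. (\<forall>B\<in>Ob. \<forall>f\<in>R B. fmap F A B f x = \<zero>\<^bsub>fobj F B\<^esub>) \<longrightarrow> x = \<zero>\<^bsub>fobj F A\<^esub>"
    proof (intro ballI impI)
      fix x assume x: "x \<in> crr F A" "\<forall>B\<in>Ob. \<forall>f\<in>R B. fmap F A B f x = \<zero>\<^bsub>fobj F B\<^esub>"
      have "\<Phi> x = \<Phi> \<zero>\<^bsub>fobj F A\<^esub>"
        by (rule mor_eqI[of _ G F]) (use x A F G \<Phi>_mor sieve_arr[OF R] in \<open>auto simp: \<Phi>_app\<close>)
      then show "x = \<zero>\<^bsub>fobj F A\<^esub>" using inj x A F by (simp add: inj_on_def)
    qed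
  next
    assume *: "\<forall>x\<in>crr F A. (\<forall>B\<in>Ob. \<forall>f\<in>R B. fmap F A B f x = \<zero>\<^bsub>fobj F B\<^esub>) \<longrightarrow> x = \<zero>\<^bsub>fobj F A\<^esub>"
    show "inj_on \<Phi> (crr F A)"
    proof (rule inj_onI)
      fix x y assume xy: "x \<in> crr F A" "y \<in> crr F A" "\<Phi> x = \<Phi> y"
      have "fmap F A B f (x \<ominus>\<^bsub>fobj F A\<^esub> y) = \<zero>\<^bsub>fobj F B\<^esub>" if "B \<in> Ob" "f \<in> R B" for B f
      proof -
        have "fmap F A B f x = fmap F A B f y" using \<Phi>_app[OF that] xy(3) by metis
        then show ?thesis using xy that A F sieve_arr[OF R that] by (simp add: psh_minus psh_minus_zero_iff psh_closed)
      qed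
      then have "x \<ominus>\<^bsub>fobj F A\<^esub> y = \<zero>\<^bsub>fobj F A\<^esub>"
        using * abelian_group.minus_closed[OF psh_group[OF F A] xy(1,2)] by blast
      then show "x = y" using xy A F by (simp add: psh_minus_zero_iff)
    qed
  qed
  have surj: "\<Phi> ` crr F A = mor G F \<longleftrightarrow> (\<forall>s. compat F A R s \<longrightarrow> (\<exists>x\<in>crr F A. \<forall>B\<in>Ob. \<forall>f\<in>R B. fmap F A B f x = s B f))"
  proof
    assume im: "\<Phi> ` crr F A = mor G F"
    show "\<forall>s. compat F A R s \<longrightarrow> (\<exists>x\<in>crr F A. \<forall>B\<in>Ob. \<forall>f\<in>R B. fmap F A B f x = s B f)"
    proof (intro allI impI)
      fix s assume s: "compat F A R s"
      have "mk G s \<in> mor G F"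
        by (rule mk_mor[OF G F]) (use s in \<open>auto simp: compat_def\<close>)
      then obtain x where x: "x \<in> crr F A" "mk G s = \<Phi> x" using im by blast
      have "fmap F A B f x = s B f" if "B \<in> Ob" "f \<in> R B" for B f
        using \<Phi>_app[OF that, of x] mk_apply[of B f G s] that x by simp
      then show "\<exists>x\<in>crr F A. \<forall>B\<in>Ob. \<forall>f\<in>R B. fmap F A B f x = s B f" using x by blast
    qed
  next
    assume *: "\<forall>s. compat F A R s \<longrightarrow> (\<exists>x\<in>crr F A. \<forall>B\<in>Ob. \<forall>f\<in>R B. fmap F A B f x = s B f)"
    have "\<eta> \<in> \<Phi> ` crr F A" if \<eta>: "\<eta> \<in> mor G F" for \<eta>
    proof -
      have "compat F A R \<eta>"
        using mor_closed[OF \<eta> G F] mor_add[OF \<eta> G F] mor_nat[OF \<eta> G F] unfolding compat_def by simp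
      then obtain x where x: "x \<in> crr F A" "\<forall>B\<in>Ob. \<forall>f\<in>R B. fmap F A B f x = \<eta> B f" using * by blast
      have "\<eta> = \<Phi> x"
        by (rule mor_eqI[OF \<eta> \<Phi>_mor[OF x(1)] G F]) (use x in \<open>auto simp: \<Phi>_app\<close>)
      then show ?thesis using x by blast
    qed
    then show "\<Phi> ` crr F A = mor G F" using \<Phi>_mor by blast
  qed
  show ?thesis
    unfolding sieve_presheaf_sub G_def[symmetric] \<Phi>_def[symmetric] carrier_mor glues_def
    using lin inj surj by (simp add: bij_betw_def)
qed

lemma
  assumes A: "A \<in> Ob" and V: "\<And>i. i \<in> idx V \<Longrightarrow> fob V i \<in> Ob" "\<And>i. i \<in> idx V \<Longrightarrow> v i () \<in> Arr a (fob V i) A"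
  shows gen_sieve_le: "\<And>R B. sieve A R \<Longrightarrow> (\<And>i. i \<in> idx V \<Longrightarrow> v i () \<in> R (fob V i)) \<Longrightarrow> gen_sieve k a (V, A, v) B \<subseteq> R B"
    and gen_sieve_gen: "\<And>i. i \<in> idx V \<Longrightarrow> v i () \<in> gen_sieve k a (V, A, v) (fob V i)"
    and gen_sieve_sieve: "sieve A (gen_sieve k a (V, A, v))"
proof -
  have mem: "f \<in> gen_sieve k a (V, A, v) B \<longleftrightarrow> (\<forall>R. sieve A R \<longrightarrow> (\<forall>i\<in>idx V. v i () \<in> R (fob V i)) \<longrightarrow> f \<in> R B)" for f B
    unfolding gen_sieve_def using is_sieve_iff[OF A] by auto
  show le: "gen_sieve k a (V, A, v) B \<subseteq> R B" if "sieve A R" "\<And>i. i \<in> idx V \<Longrightarrow> v i () \<in> R (fob V i)" for R B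
    using that mem by blast
  show "v i () \<in> gen_sieve k a (V, A, v) (fob V i)" if "i \<in> idx V" for i
    unfolding gen_sieve_def using that by auto
  \<comment> \<open>The maximal sieve takes part in the intersection, which therefore consists of
    arrows into \<open>A\<close> and is empty outside \<open>Ob\<close>.\<close>
  have max: "gen_sieve k a (V, A, v) B \<subseteq> maxs A B" for B
    using V by (intro le sieve_max[OF A]) (auto simp: maxs_def)
  show "sieve A (gen_sieve k a (V, A, v))"
    unfolding sieve_def
  proof (intro conjI allI impI ballI)
    show "gen_sieve k a (V, A, v) B = {}" if "B \<notin> Ob" for B using max[of B] that by (simp add: maxs_def)
    show "gen_sieve k a (V, A, v) B \<subseteq> Arr a B A" if "B \<in> Ob" for B using max[of B] that by (simp add: maxs_def)
  qed (auto simp: mem sieve_zero sieve_plus sieve_comp)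
qed

end

section \<open>Sheaves for a pretopology\<close>

context linear_pretopology
begin

text \<open>The sieve contains the members of an iterated cover, so along each of them it pulls back
  to the maximal sieve.\<close>

lemma top_of_cov:
  assumes "R \<in> top_of k a S X" "X \<in> Ob"
  shows "cov X R"
proof -
  obtain V r where V: "(V, X, r) \<in> Cotilde a S" and R: "is_sieve k a X R" and le: "\<And>B. gen_sieve k a (V, X, r) B \<subseteq> R B"
    using assms unfolding top_of_def by blast
  have R': "sieve X R" using R is_sieve_iff[OF assms(2)] by simp
  note t = Cotilde_V[OF V] Cotilde_v[OF V]
  show ?thesis
  proof (rule cov_Cotilde[OF V R'])
    fix i assume i: "i \<in> idx V"
    then have "r i () \<in> R (fob V i)" using gen_sieve_gen[of X V r] t assms(2) le by blast
    then show "cov (fob V i) (pullback X (fob V i) (r i ()) R)"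
      using pullback_max[OF R' assms(2) t(1)[OF i]] cov.max[OF t(1)[OF i]] by simp
  qed
qed

text \<open>This is \<open>ev_related\<close> for the graph of the map sending an arrow g into
  \<open>X\<close> to the restriction of \<open>x\<close> along g.\<close>

lemma ev_restriction:
  assumes F: "psh F" and q: "\<And>j. j \<in> idx Y \<Longrightarrow> fob Y j \<in> Ob" "\<And>j. j \<in> idx Y \<Longrightarrow> q j () \<in> Arr a (fob Y j) X"
    and X: "X \<in> Ob" and B: "B \<in> Ob" and v: "v \<in> vec Y B" and x: "x \<in> crr F X"
    and y: "\<And>j. j \<in> idx Y \<Longrightarrow> fmap F X (fob Y j) (q j ()) x = y j"
  shows "fmap F X B (Q Y X q B v) x = ev F Y y B v"
proof -
  have "(Q Y X q B v, ev F Y y B v) \<in> {(g, fmap F X B g x) | g. g \<in> Arr a B X}"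
  proof (rule ev_related)
    show "y j \<in> crr F (fob Y j)" if "j \<in> idx Y" for j using y[OF that] q[OF that] F X x psh_closed by metis
    show "(Comp a B (fob Y j) X (q j ()) (v j), fmap F (fob Y j) B (v j) (y j)) \<in> {(g, fmap F X B g x) |g. g \<in> Arr a B X}"
      if "j \<in> idx Y" for j
      using that q F X B x vec_arr[OF v] y[OF that, symmetric] by (auto simp: psh_comp intro!: exI[of _ "Comp a B (fob Y j) X (q j ()) (v j)"])
  qed (use F X B q v x psh_closed in \<open>auto simp: psh_plus intro!: exI[of _ "hplus B X _ _"]\<close>)
  then show ?thesis by auto
qed

text \<open>Left exactness in elements. That the restrictions of a section over \<open>X\<close> are
  annihilated by \<open>p\<close> does not appear on the right-hand side: it follows from the
  vanishing of \<open>q\<close> after \<open>p\<close>.\<close>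

lemma left_exact_iff:
  assumes F: "psh F" and s: "(Z, Y, X, p, q) \<in> S"
  shows "left_exact_on a F (Z, Y, X, p, q) \<longleftrightarrow>
    (\<forall>x\<in>crr F X. (\<forall>j\<in>idx Y. fmap F X (fob Y j) (q j ()) x = \<zero>\<^bsub>fobj F (fob Y j)\<^esub>) \<longrightarrow> x = \<zero>\<^bsub>fobj F X\<^esub>) \<and>
    (\<forall>y. (\<forall>j\<in>idx Y. y j \<in> crr F (fob Y j)) \<longrightarrow> (\<forall>c\<in>idx Z. ev F Y y (fob Z c) (p c) = \<zero>\<^bsub>fobj F (fob Z c)\<^esub>) \<longrightarrow>
      (\<exists>x\<in>crr F X. \<forall>j\<in>idx Y. fmap F X (fob Y j) (q j ()) x = y j))"
proof -
  note t = seq_X[OF s] seq_Y[OF s] seq_Z[OF s] seq_q[OF s] seq_p[OF s]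
  have Fq: "pull a F Y (one_fam X) q (\<lambda>_. x) = (\<lambda>j\<in>idx Y. fmap F X (fob Y j) (q j ()) x)" if x: "x \<in> crr F X" for x
    unfolding pull_def
  proof (rule restrict_ext)
    fix j assume j: "j \<in> idx Y"
    interpret abelian_group "fobj F (fob Y j)" using psh_group F t(2)[OF j] by blast
    show "(\<Oplus>\<^bsub>fobj F (fob Y j)\<^esub>j'\<in>fsupp a Y (one_fam X) q j. fmap F (fob (one_fam X) j') (fob Y j) (q j j') x) =
        fmap F X (fob Y j) (q j ()) x"
    proof (cases "q j () = hzero (fob Y j) X")
      case True
      then have "fsupp a Y (one_fam X) q j = {}" by (auto simp: fsupp_def)
      then show ?thesis using True F x t(1) t(2)[OF j] by simp
    next
      case False
      then have "fsupp a Y (one_fam X) q j = {()}" by (auto simp: fsupp_def)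
      then show ?thesis using F x t(1) t(2,4)[OF j] by (simp add: psh_closed)
    qed
  qed
  have Fp: "pull a F Z Y p y = (\<lambda>c\<in>idx Z. ev F Y y (fob Z c) (p c))" for y
    unfolding pull_def ev_def fsupp_def by simp
  have cq: "fmap F X (fob Y j) (q j ()) x \<in> crr F (fob Y j)" if "j \<in> idx Y" "x \<in> crr F X" for j x
    using that t F by (simp add: psh_closed)
  have ker: "a_kernel (fobj F X) (sections F Y) (\<lambda>x. pull a F Y (one_fam X) q (\<lambda>_. x)) =
      {x \<in> crr F X. \<forall>j\<in>idx Y. fmap F X (fob Y j) (q j ()) x = \<zero>\<^bsub>fobj F (fob Y j)\<^esub>}"
    unfolding a_kernel_def' by (auto simp: Fq sections_def prod_module_def restrict_def fun_eq_iff)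
  have ker2: "a_kernel (sections F Y) (sections F Z) (pull a F Z Y p) =
      {y \<in> \<Pi>\<^sub>E j\<in>idx Y. crr F (fob Y j). \<forall>c\<in>idx Z. ev F Y y (fob Z c) (p c) = \<zero>\<^bsub>fobj F (fob Z c)\<^esub>}"
    unfolding a_kernel_def' by (auto simp: Fp sections_def prod_module_def restrict_def fun_eq_iff)
  have im: "(\<lambda>x. pull a F Y (one_fam X) q (\<lambda>_. x)) ` crr F X = (\<lambda>x. \<lambda>j\<in>idx Y. fmap F X (fob Y j) (q j ()) x) ` crr F X"
    by (rule image_cong) (auto simp: Fq)
  have sub: "(\<lambda>j\<in>idx Y. fmap F X (fob Y j) (q j ()) x) \<in>
      {y \<in> \<Pi>\<^sub>E j\<in>idx Y. crr F (fob Y j). \<forall>c\<in>idx Z. ev F Y y (fob Z c) (p c) = \<zero>\<^bsub>fobj F (fob Z c)\<^esub>}" if x: "x \<in> crr F X" for x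
  proof -
    have "ev F Y (\<lambda>j\<in>idx Y. fmap F X (fob Y j) (q j ()) x) (fob Z c) (p c) = \<zero>\<^bsub>fobj F (fob Z c)\<^esub>" if c: "c \<in> idx Z" for c
      using ev_restriction[of F Y q X "fob Z c" "p c" x "\<lambda>j\<in>idx Y. fmap F X (fob Y j) (q j ()) x"]
        F t x c seq_qp[OF s c] by simp
    then show ?thesis using cq x by auto
  qed
  show ?thesis (is "_ \<longleftrightarrow> ?inj \<and> ?surj")
  proof
    assume "left_exact_on a F (Z, Y, X, p, q)"
    then have 1: "{x \<in> crr F X. \<forall>j\<in>idx Y. fmap F X (fob Y j) (q j ()) x = \<zero>\<^bsub>fobj F (fob Y j)\<^esub>} = {\<zero>\<^bsub>fobj F X\<^esub>}"
      and 2: "(\<lambda>x. \<lambda>j\<in>idx Y. fmap F X (fob Y j) (q j ()) x) ` crr F X =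
        {y \<in> \<Pi>\<^sub>E j\<in>idx Y. crr F (fob Y j). \<forall>c\<in>idx Z. ev F Y y (fob Z c) (p c) = \<zero>\<^bsub>fobj F (fob Z c)\<^esub>}"
      unfolding left_exact_on_def by (simp_all add: Let_def ker ker2 im)
    have ?surj
    proof (intro allI impI)
      fix y assume y: "\<forall>j\<in>idx Y. y j \<in> crr F (fob Y j)" "\<forall>c\<in>idx Z. ev F Y y (fob Z c) (p c) = \<zero>\<^bsub>fobj F (fob Z c)\<^esub>"
      have "ev F Y (restrict y (idx Y)) (fob Z c) (p c) = ev F Y y (fob Z c) (p c)" if c: "c \<in> idx Z" for c
      proof -
        interpret abelian_group "fobj F (fob Z c)" using psh_group F t(3)[OF c] by blast
        show ?thesis unfolding ev_def
          by (rule finsum_cong') (use y F t c in \<open>auto simp: psh_closed vec_arr\<close>)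
      qed
      then have "restrict y (idx Y) \<in> (\<lambda>x. \<lambda>j\<in>idx Y. fmap F X (fob Y j) (q j ()) x) ` crr F X"
        using y unfolding 2 by auto
      then obtain x where x: "x \<in> crr F X" "restrict y (idx Y) = (\<lambda>j\<in>idx Y. fmap F X (fob Y j) (q j ()) x)" by blast
      have "fmap F X (fob Y j) (q j ()) x = y j" if "j \<in> idx Y" for j
        using fun_cong[OF x(2), of j] that by simp
      with x(1) show "\<exists>x\<in>crr F X. \<forall>j\<in>idx Y. fmap F X (fob Y j) (q j ()) x = y j" by blast
    qed
    with 1 show "?inj \<and> ?surj" by blast
  next
    assume *: "?inj \<and> ?surj"
    have 1: "{x \<in> crr F X. \<forall>j\<in>idx Y. fmap F X (fob Y j) (q j ()) x = \<zero>\<^bsub>fobj F (fob Y j)\<^esub>} = {\<zero>\<^bsub>fobj F X\<^esub>}"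
      using * F t by auto
    have "y \<in> (\<lambda>x. \<lambda>j\<in>idx Y. fmap F X (fob Y j) (q j ()) x) ` crr F X"
      if y: "y \<in> (\<Pi>\<^sub>E j\<in>idx Y. crr F (fob Y j))" "\<forall>c\<in>idx Z. ev F Y y (fob Z c) (p c) = \<zero>\<^bsub>fobj F (fob Z c)\<^esub>" for y
    proof -
      have "\<exists>x\<in>crr F X. \<forall>j\<in>idx Y. fmap F X (fob Y j) (q j ()) x = y j"
        by (rule conjunct2[OF *, rule_format]) (use y in auto)
      then obtain x where x: "x \<in> crr F X" "\<forall>j\<in>idx Y. fmap F X (fob Y j) (q j ()) x = y j" by blast
      have "y = (\<lambda>j\<in>idx Y. fmap F X (fob Y j) (q j ()) x)"
        by (rule extensionalityI[of _ "idx Y"]) (use x y in \<open>auto simp: PiE_iff\<close>)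
      then show ?thesis using x by blast
    qed
    then have 2: "(\<lambda>x. \<lambda>j\<in>idx Y. fmap F X (fob Y j) (q j ()) x) ` crr F X =
        {y \<in> \<Pi>\<^sub>E j\<in>idx Y. crr F (fob Y j). \<forall>c\<in>idx Z. ev F Y y (fob Z c) (p c) = \<zero>\<^bsub>fobj F (fob Z c)\<^esub>}"
      using sub by blast
    show "left_exact_on a F (Z, Y, X, p, q)"
      unfolding left_exact_on_def by (simp add: Let_def ker ker2 im 1 2)
  qed
qed

text \<open>Induction along the tree: the injectivity half of exactness passes vanishing from the
  objects of \<open>Y\<close> to \<open>X\<close>.\<close>

lemma exact_separated:
  assumes F: "psh F" and ex: "\<forall>s\<in>S. left_exact_on a F s"
  shows "cov X R \<Longrightarrow> x \<in> crr F X \<Longrightarrow> (\<And>B f. B \<in> Ob \<Longrightarrow> f \<in> R B \<Longrightarrow> fmap F X B f x = \<zero>\<^bsub>fobj F B\<^esub>) \<Longrightarrow> x = \<zero>\<^bsub>fobj F X\<^esub>"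
proof (induction arbitrary: x rule: cov.induct)
  case (max X)
  then show ?case using max.prems(2)[of X "Ident a X"] F by (simp add: maxs_def psh_id)
next
  case (step Y X q R)
  obtain Z p where s: "(Z, Y, X, p, q) \<in> S" using step.hyps(1) by (auto simp: Co1_def)
  note t = seq_X[OF s] seq_Y[OF s] seq_q[OF s]
  have "fmap F X (fob Y j) (q j ()) x = \<zero>\<^bsub>fobj F (fob Y j)\<^esub>" if j: "j \<in> idx Y" for j
  proof (rule step.IH[OF j])
    show "fmap F X (fob Y j) (q j ()) x \<in> crr F (fob Y j)" using F t j step.prems by (simp add: psh_closed)
    show "fmap F (fob Y j) B f (fmap F X (fob Y j) (q j ()) x) = \<zero>\<^bsub>fobj F B\<^esub>"
      if "B \<in> Ob" "f \<in> pullback X (fob Y j) (q j ()) R B" for B f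
      using F t j step.prems that by (simp add: pullback_def psh_comp[symmetric])
  qed
  then show ?case using left_exact_iff[OF F s] ex s step.prems(1) by blast
qed

text \<open>Induction along the tree. Gluing over each object of \<open>Y\<close> gives a family
  \<open>y\<close>; it is annihilated by \<open>p\<close> because \<open>q\<close> after
  \<open>p\<close> is zero and \<open>F\<close> is separated, so exactness yields \<open>x\<close>.
  It remains to compare \<open>x\<close> with \<open>s\<close> on all of \<open>R\<close> and not
  just on arrows through \<open>q\<close>, which is done with (PTa).\<close>

lemma exact_glues:
  assumes F: "psh F" and ex: "\<forall>s\<in>S. left_exact_on a F s"
  shows "cov X R \<Longrightarrow> compat F X R s \<Longrightarrow> \<exists>x\<in>crr F X. \<forall>B\<in>Ob. \<forall>f\<in>R B. fmap F X B f x = s B f"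
proof (induction arbitrary: s rule: cov.induct)
  case (max X)
  have "fmap F X B f (s X (Ident a X)) = s B f" if "B \<in> Ob" "f \<in> maxs X B" for B f
    using max that unfolding compat_def by (auto simp: maxs_def) (metis comp_id(2) id_arr)
  moreover have "s X (Ident a X) \<in> crr F X" using max unfolding compat_def by (simp add: maxs_def)
  ultimately show ?case by blast
next
  case (step Y X q R)
  have sep: "separated F"
    unfolding separated_def locally_def using exact_separated[OF F ex] by blast
  obtain Z p where sq: "(Z, Y, X, p, q) \<in> S" using step.hyps(1) by (auto simp: Co1_def)
  note t = seq_X[OF sq] seq_Y[OF sq] seq_q[OF sq]
  note R = step.hyps(2)
  have "\<exists>y. y \<in> crr F (fob Y j) \<and> (\<forall>B\<in>Ob. \<forall>g\<in>pullback X (fob Y j) (q j ()) R B. fmap F (fob Y j) B g y = s B (Comp a B (fob Y j) X (q j ()) g))"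
    if j: "j \<in> idx Y" for j
    using step.IH[OF j, OF compat_pullback[OF step.prems t(1) t(2)[OF j] t(3)[OF j]]] by blast
  then obtain y where y: "\<And>j. j \<in> idx Y \<Longrightarrow> y j \<in> crr F (fob Y j)"
    and ys: "\<And>j B g. j \<in> idx Y \<Longrightarrow> B \<in> Ob \<Longrightarrow> g \<in> pullback X (fob Y j) (q j ()) R B \<Longrightarrow>
      fmap F (fob Y j) B g (y j) = s B (Comp a B (fob Y j) X (q j ()) g)"
    by metis
  \<comment> \<open>For every vector \<open>v\<close> the composite with \<open>q\<close> lies
    locally in \<open>R\<close>, and there \<open>s\<close> is computed by \<open>y\<close>. Only
    the finite support of \<open>v\<close> matters, so the covers over the objects of
    \<open>Y\<close>, pulled back along the entries of \<open>v\<close>, can be intersected.\<close>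
  have loc: "locally A (\<lambda>B g. Comp a B A X (Q Y X q A v) g \<in> R B \<and> s B (Comp a B A X (Q Y X q A v) g) = fmap F A B g (ev F Y y A v))"
    if A: "A \<in> Ob" and v: "v \<in> vec Y A" for A v
  proof -
    define D where "D = {j \<in> idx Y. v j \<noteq> hzero A (fob Y j)}"
    have "locally A (\<lambda>B g. \<forall>j\<in>D. g \<in> pullback (fob Y j) A (v j) (pullback X (fob Y j) (q j ()) R) B)"
    proof (rule locally_ball_finite)
      show "finite D" using vec_finite[OF v] by (simp add: D_def)
      fix j assume "j \<in> D"
      then have j: "j \<in> idx Y" by (simp add: D_def)
      have "cov A (pullback (fob Y j) A (v j) (pullback X (fob Y j) (q j ()) R))"
        using J_pullback[OF step.hyps(3)[OF j] A vec_arr[OF v j]] .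
      then show "locally A (\<lambda>B g. g \<in> pullback (fob Y j) A (v j) (pullback X (fob Y j) (q j ()) R) B)"
        by (rule J_locally)
    qed (rule A)
    then show ?thesis
    proof (rule locally_mono)
      fix B g assume B: "B \<in> Ob" and g: "g \<in> Arr a B A"
        and D: "\<forall>j\<in>D. g \<in> pullback (fob Y j) A (v j) (pullback X (fob Y j) (q j ()) R) B"
      note vg = vec_comp[OF v A B g t(2)]
      \<comment> \<open>\<open>ev_related\<close> with \<open>E\<close> the graph of
        \<open>s\<close> on \<open>R\<close>. Indices outside \<open>D\<close> contribute zero, and
        the graph contains the pair of zeros by \<open>compat_zero\<close>.\<close>
      have "(Q Y X q B (\<lambda>j. Comp a B A (fob Y j) (v j) g), ev F Y y B (\<lambda>j. Comp a B A (fob Y j) (v j) g)) \<in> {(h, s B h) | h. h \<in> R B}"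
      proof (rule ev_related[OF F t(2) y B t(1) vg t(3)])
        show "{(h, s B h) |h. h \<in> R B} \<subseteq> Arr a B X \<times> crr F B"
          using sieve_arr[OF R B] step.prems B by (auto simp: compat_def)
        show "(hzero B X, \<zero>\<^bsub>fobj F B\<^esub>) \<in> {(h, s B h) |h. h \<in> R B}"
          using sieve_zero[OF R B] compat_zero[OF F t(1) R step.prems B] by force
        show "(hplus B X g h, x \<oplus>\<^bsub>fobj F B\<^esub> z) \<in> {(h, s B h) |h. h \<in> R B}"
          if "(g, x) \<in> {(h, s B h) |h. h \<in> R B}" "(h, z) \<in> {(h, s B h) |h. h \<in> R B}" for g x h z
          using that step.prems sieve_plus[OF R B] B by (auto simp: compat_def)
        show "(Comp a B (fob Y j) X (q j ()) (Comp a B A (fob Y j) (v j) g), fmap F (fob Y j) B (Comp a B A (fob Y j) (v j) g) (y j))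
            \<in> {(h, s B h) |h. h \<in> R B}" if j: "j \<in> idx Y" for j
        proof (cases "j \<in> D")
          case True
          then have "Comp a B A (fob Y j) (v j) g \<in> pullback X (fob Y j) (q j ()) R B"
            using D B by (auto simp: pullback_def)
          then show ?thesis using ys[OF j B] B by (auto simp: pullback_def)
        next
          case False
          then have "v j = hzero A (fob Y j)" using j by (simp add: D_def)
          then show ?thesis
            using sieve_zero[OF R B] compat_zero[OF F t(1) R step.prems B] F y[OF j] t j A B g by force
        qed
      qed auto
      moreover have "Q Y X q B (\<lambda>j. Comp a B A (fob Y j) (v j) g) = Comp a B A X (Q Y X q A v) g"
        using ev_comp[of "yoneda a X" Y "\<lambda>j. q j ()" A B v g] ev_closed[of "yoneda a X" Y "\<lambda>j. q j ()" A v] t A B v g by simp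
      moreover have "ev F Y y B (\<lambda>j. Comp a B A (fob Y j) (v j) g) = fmap F A B g (ev F Y y A v)"
        using ev_comp[OF F t(2) y A B v g] by simp
      ultimately show "Comp a B A X (Q Y X q A v) g \<in> R B \<and> s B (Comp a B A X (Q Y X q A v) g) = fmap F A B g (ev F Y y A v)"
        by auto
    qed
  qed
  \<comment> \<open>In \<open>loc\<close> the vector is now a row of \<open>p\<close>, whose
    composite with \<open>q\<close> is zero, so the evaluation vanishes locally and hence
    globally.\<close>
  have "ev F Y y (fob Z c) (p c) = \<zero>\<^bsub>fobj F (fob Z c)\<^esub>" if c: "c \<in> idx Z" for c
  proof -
    note tc = seq_Z[OF sq c] seq_p[OF sq c]
    have "locally (fob Z c) (\<lambda>B g. fmap F (fob Z c) B g (ev F Y y (fob Z c) (p c)) = \<zero>\<^bsub>fobj F B\<^esub>)"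
      using loc[OF tc] by (rule locally_mono)
        (use tc seq_qp[OF sq c] compat_zero[OF F t(1) R step.prems] t in simp)
    moreover have "ev F Y y (fob Z c) (p c) \<in> crr F (fob Z c)" using ev_closed[OF F t(2) y tc] by simp
    ultimately show ?thesis using sep tc by (simp add: separated_def)
  qed
  then obtain x where x: "x \<in> crr F X" and xy: "\<forall>j\<in>idx Y. fmap F X (fob Y j) (q j ()) x = y j"
    using left_exact_iff[OF F sq] ex sq y by blast
  have "fmap F X A f x = s A f" if A: "A \<in> Ob" and f: "f \<in> R A" for A f
  proof (rule separated_eq[OF F sep A])
    have f': "f \<in> Arr a A X" using sieve_arr[OF R A f] .
    show c: "fmap F X A f x \<in> crr F A" "s A f \<in> crr F A" using F t x A f' step.prems f by (auto simp: psh_closed compat_def)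
    \<comment> \<open>The arrows along which the two candidates agree. They form a sieve, and it is
      covering because (PTa) refines \<open>f\<close> by arrows that factor through
      \<open>q\<close>.\<close>
    define T where "T = (\<lambda>B. if B \<in> Ob then {g \<in> Arr a B A. fmap F A B g (fmap F X A f x) = fmap F A B g (s A f)} else {})"
    have T: "sieve A T"
      unfolding sieve_def T_def using A F c by (auto simp: psh_plus psh_comp)
    obtain C r where C: "(C, A, r) \<in> Cotilde a S"
      and r: "\<And>i. i \<in> idx C \<Longrightarrow> \<exists>v\<in>vec Y (fob C i). Comp a (fob C i) A X f (r i ()) = Q Y X q (fob C i) v"
      using PTa[OF step.hyps(1) A f'] by blast
    have "cov A T"
    proof (rule cov_Cotilde[OF C T])
      fix i assume i: "i \<in> idx C"
      note ti = Cotilde_V[OF C i] Cotilde_v[OF C i]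
      obtain v where v: "v \<in> vec Y (fob C i)" and fr: "Comp a (fob C i) A X f (r i ()) = Q Y X q (fob C i) v"
        using r[OF i] by blast
      show "cov (fob C i) (pullback A (fob C i) (r i ()) T)"
      proof (rule locally_sieve)
        show "sieve (fob C i) (pullback A (fob C i) (r i ()) T)" using T A ti by simp
        show "locally (fob C i) (\<lambda>B g. g \<in> pullback A (fob C i) (r i ()) T B)"
          using loc[OF ti(1) v]
        proof (rule locally_mono)
          fix B g assume B: "B \<in> Ob" and g: "g \<in> Arr a B (fob C i)"
            and *: "Comp a B (fob C i) X (Q Y X q (fob C i) v) g \<in> R B \<and>
              s B (Comp a B (fob C i) X (Q Y X q (fob C i) v) g) = fmap F (fob C i) B g (ev F Y y (fob C i) v)"
          have "fmap F (fob C i) B g (ev F Y y (fob C i) v) = fmap F (fob C i) B g (fmap F X (fob C i) (Q Y X q (fob C i) v) x)"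
            using ev_restriction[of F Y q X "fob C i" v x y] F t ti(1) v x xy by simp
          also have "\<dots> = fmap F A B (Comp a B (fob C i) A (r i ()) g) (fmap F X A f x)"
            using F t ti A B g f' x c by (simp add: fr[symmetric] psh_comp psh_closed)
          finally have 1: "fmap F A B (Comp a B (fob C i) A (r i ()) g) (fmap F X A f x) = s B (Comp a B (fob C i) X (Q Y X q (fob C i) v) g)"
            using * by simp
          have "s B (Comp a B (fob C i) X (Q Y X q (fob C i) v) g) = s B (Comp a B A X f (Comp a B (fob C i) A (r i ()) g))"
            using t ti A B g f' by (simp add: fr[symmetric] comp_assoc)
          also have "\<dots> = fmap F A B (Comp a B (fob C i) A (r i ()) g) (s A f)"
            using step.prems A B f ti g by (simp add: compat_def)
          finally show "g \<in> pullback A (fob C i) (r i ()) T B"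
            using 1 B g ti A by (simp add: pullback_def T_def)
        qed
      qed
    qed
    then show "locally A (\<lambda>B g. fmap F A B g (fmap F X A f x) = fmap F A B g (s A f))"
      by (rule J_locally) (simp add: T_def)
  qed
  with x show ?case by blast
qed

lemma exact_sheaf: "psh F \<and> (\<forall>s\<in>S. left_exact_on a F s) \<Longrightarrow> sheaf F"
  unfolding sheaf_def separated_def locally_def using exact_separated exact_glues by blast

lemma sheaf_glues:
  assumes "sheaf F" "cov A R"
  shows "glues F A R"
  unfolding glues_def
proof (intro conjI ballI allI impI)
  fix x assume "x \<in> crr F A" "\<forall>B\<in>Ob. \<forall>f\<in>R B. fmap F A B f x = \<zero>\<^bsub>fobj F B\<^esub>"
  then show "x = \<zero>\<^bsub>fobj F A\<^esub>"
    using assms J_ob unfolding sheaf_def separated_def locally_def by blast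
next
  fix s assume "compat F A R s"
  then show "\<exists>x\<in>crr F A. \<forall>B\<in>Ob. \<forall>f\<in>R B. fmap F A B f x = s B f"
    using assms unfolding sheaf_def by blast
qed

text \<open>Injectivity comes from gluing over the sieve generated by \<open>q\<close>. For
  surjectivity, a family annihilated by \<open>p\<close> must define a matching family on that
  sieve: its elements are composites of \<open>q\<close> with vectors \<open>v\<close>, and the
  value \<open>ev F Y y B v\<close> has to depend on the composite alone.\<close>

lemma glues_exact:
  assumes F: "psh F" and gl: "\<And>A R. A \<in> Ob \<Longrightarrow> R \<in> top_of k a S A \<Longrightarrow> glues F A R" and s: "(Z, Y, X, p, q) \<in> S"
  shows "left_exact_on a F (Z, Y, X, p, q)"
proof -
  note t = seq_X[OF s] seq_Y[OF s] seq_q[OF s]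
  have gs: "glues F A (gen_sieve k a (V, A, r))" if V: "(V, A, r) \<in> Cotilde a S" for V A r
    using Cotilde_X[OF V] Cotilde_V[OF V] Cotilde_v[OF V]
    by (intro gl) (auto simp: top_of_def is_sieve_iff gen_sieve_sieve intro!: V)
  \<comment> \<open>The arrows annihilating \<open>w\<close> form a sieve, so if they include the
    members of an iterated cover, they include the sieve generated by it.\<close>
  have sep: "w = \<zero>\<^bsub>fobj F A\<^esub>" if V: "(V, A, r) \<in> Cotilde a S" and w: "w \<in> crr F A"
    and r0: "\<And>i. i \<in> idx V \<Longrightarrow> fmap F A (fob V i) (r i ()) w = \<zero>\<^bsub>fobj F (fob V i)\<^esub>" for V A r w
  proof -
    note tv = Cotilde_X[OF V] Cotilde_V[OF V] Cotilde_v[OF V]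
    define T where "T = (\<lambda>B. if B \<in> Ob then {g \<in> Arr a B A. fmap F A B g w = \<zero>\<^bsub>fobj F B\<^esub>} else {})"
    have "sieve A T" unfolding sieve_def T_def using tv F w by (auto simp: psh_plus psh_comp)
    then have "gen_sieve k a (V, A, r) B \<subseteq> T B" for B
      using gen_sieve_le[of A V r T B] tv r0 by (simp add: T_def)
    then have "f \<in> T B" if "f \<in> gen_sieve k a (V, A, r) B" for f B using that by blast
    then have "\<forall>B\<in>Ob. \<forall>f\<in>gen_sieve k a (V, A, r) B. fmap F A B f w = \<zero>\<^bsub>fobj F B\<^esub>"
      unfolding T_def by (metis (mono_tags, lifting) mem_Collect_eq)
    then show ?thesis using gs[OF V] w unfolding glues_def by blast
  qed
  have C1: "(Y, X, q) \<in> Cotilde a S"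
    unfolding Cotilde_def using s by (intro UN_I[of "Suc 0"]) (auto simp: Co1_def)
  show ?thesis
    unfolding left_exact_iff[OF F s]
  proof (intro conjI ballI allI impI)
    fix x assume "x \<in> crr F X" "\<forall>j\<in>idx Y. fmap F X (fob Y j) (q j ()) x = \<zero>\<^bsub>fobj F (fob Y j)\<^esub>"
    then show "x = \<zero>\<^bsub>fobj F X\<^esub>" using sep[OF C1] by blast
  next
    fix y assume y: "\<forall>j\<in>idx Y. y j \<in> crr F (fob Y j)"
      and py: "\<forall>c\<in>idx Z. ev F Y y (fob Z c) (p c) = \<zero>\<^bsub>fobj F (fob Z c)\<^esub>"
    note y' = bspec[OF y]
    note evy = ev_closed[OF F t(2) y'] ev_plus[OF F t(2) y'] ev_comp[OF F t(2) y']
    have yo: "psh (yoneda a X)" "\<And>j. j \<in> idx Y \<Longrightarrow> q j () \<in> crr (yoneda a X) (fob Y j)" using t by simp_all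
    have Qc: "Q Y X q A v \<in> Arr a A X" if "A \<in> Ob" "v \<in> vec Y A" for A v
      using ev_closed[OF yo(1) t(2) yo(2) that] that t by simp
    have Qp: "Q Y X q A (\<lambda>j. hplus A (fob Y j) (v j) (w j)) = hplus A X (Q Y X q A v) (Q Y X q A w)"
      if "A \<in> Ob" "v \<in> vec Y A" "w \<in> vec Y A" for A v w
      using ev_plus[OF yo(1) t(2) yo(2) that] that t by simp
    have Qm: "Q Y X q B (\<lambda>j. Comp a B A (fob Y j) (v j) g) = Comp a B A X (Q Y X q A v) g"
      if "A \<in> Ob" "B \<in> Ob" "v \<in> vec Y A" "g \<in> Arr a B A" for A B v g
      using ev_comp[OF yo(1) t(2) yo(2) that] that t Qc by simp
    \<comment> \<open>If the composite with \<open>q\<close> vanishes, then by (PTb) the vector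
      factors through \<open>p\<close> after restriction to a cover, and \<open>p\<close>
      annihilates \<open>y\<close>.\<close>
    have zero: "ev F Y y A v = \<zero>\<^bsub>fobj F A\<^esub>" if A: "A \<in> Ob" and v: "v \<in> vec Y A" and 0: "Q Y X q A v = hzero A X" for A v
    proof -
      obtain B r where B: "(B, A, r) \<in> Cotilde a S"
        and r: "\<And>i. i \<in> idx B \<Longrightarrow> \<exists>w\<in>vec Z (fob B i). \<forall>j\<in>idx Y. Comp a (fob B i) A (fob Y j) (v j) (r i ()) =
          (\<Oplus>\<^bsub>HomM a (fob B i) (fob Y j)\<^esub>c\<in>{c \<in> idx Z. w c \<noteq> hzero (fob B i) (fob Z c)}.
            Comp a (fob B i) (fob Z c) (fob Y j) (p c j) (w c))"
        using PTb[OF s A v 0] by blast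
      show ?thesis
      proof (rule sep[OF B evy(1)[OF _ _ A v]])
        fix i assume i: "i \<in> idx B"
        note ti = Cotilde_V[OF B i] Cotilde_v[OF B i]
        obtain w where w: "w \<in> vec Z (fob B i)" and vr: "\<And>j. j \<in> idx Y \<Longrightarrow> Comp a (fob B i) A (fob Y j) (v j) (r i ()) =
          (\<Oplus>\<^bsub>HomM a (fob B i) (fob Y j)\<^esub>c\<in>{c \<in> idx Z. w c \<noteq> hzero (fob B i) (fob Z c)}.
            Comp a (fob B i) (fob Z c) (fob Y j) (p c j) (w c))"
          using r[OF i] by blast
        define D where "D = {c \<in> idx Z. w c \<noteq> hzero (fob B i) (fob Z c)}"
        define u where "u c j = Comp a (fob B i) (fob Z c) (fob Y j) (p c j) (w c)" for c j
        have D: "finite D" "\<And>c. c \<in> D \<Longrightarrow> c \<in> idx Z" using vec_finite[OF w] by (auto simp: D_def)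
        have u: "u c \<in> vec Y (fob B i)" "ev F Y y (fob B i) (u c) = \<zero>\<^bsub>fobj F (fob B i)\<^esub>" if "c \<in> D" for c
        proof -
          note tc = seq_Z[OF s D(2)[OF that]] seq_p[OF s D(2)[OF that]] vec_arr[OF w D(2)[OF that]]
          show "u c \<in> vec Y (fob B i)" unfolding u_def using tc ti t by (intro vec_comp) auto
          show "ev F Y y (fob B i) (u c) = \<zero>\<^bsub>fobj F (fob B i)\<^esub>"
            unfolding u_def using evy(3)[of "fob Z c" "fob B i" "p c" "w c"] tc ti py D(2)[OF that] F by simp
        qed
        have sum: "(\<lambda>j. \<Oplus>\<^bsub>HomM a (fob B i) (fob Y j)\<^esub>c\<in>D. u c j) \<in> vec Y (fob B i)"
          "ev F Y y (fob B i) (\<lambda>j. \<Oplus>\<^bsub>HomM a (fob B i) (fob Y j)\<^esub>c\<in>D. u c j) = (\<Oplus>\<^bsub>fobj F (fob B i)\<^esub>c\<in>D. ev F Y y (fob B i) (u c))"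
          using ev_sum[OF F t(2) y' ti(1) D(1), of u] u by auto
        interpret FB: abelian_group "fobj F (fob B i)" using psh_group F ti by blast
        have "(\<Oplus>\<^bsub>fobj F (fob B i)\<^esub>c\<in>D. ev F Y y (fob B i) (u c)) = \<zero>\<^bsub>fobj F (fob B i)\<^esub>"
          by (rule FB.add.finprod_one_eqI) (use u in auto)
        moreover have "fmap F A (fob B i) (r i ()) (ev F Y y A v) = ev F Y y (fob B i) (\<lambda>j. Comp a (fob B i) A (fob Y j) (v j) (r i ()))"
          using evy(3)[of A "fob B i" v "r i ()"] A ti v by simp
        moreover have "\<dots> = ev F Y y (fob B i) (\<lambda>j. \<Oplus>\<^bsub>HomM a (fob B i) (fob Y j)\<^esub>c\<in>D. u c j)"
          by (rule ev_cong(2)[OF F t(2) y' ti(1) sum(1)]) (auto simp: vr D_def u_def)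
        ultimately show "fmap F A (fob B i) (r i ()) (ev F Y y A v) = \<zero>\<^bsub>fobj F (fob B i)\<^esub>" using sum(2) by simp
      qed auto
    qed
    \<comment> \<open>Reduction to \<open>zero\<close> by the difference of two vectors, with the
      minus sign realised by composition with \<open>hneg\<close>.\<close>
    have single: "ev F Y y A v = ev F Y y A w" if A: "A \<in> Ob" and v: "v \<in> vec Y A" and w: "w \<in> vec Y A" and eq: "Q Y X q A v = Q Y X q A w" for A v w
    proof -
      define w' where "w' = (\<lambda>j. Comp a A A (fob Y j) (w j) (hneg A))"
      have w': "w' \<in> vec Y A" unfolding w'_def using w A t by (intro vec_comp) auto
      have "Q Y X q A (\<lambda>j. hplus A (fob Y j) (v j) (w' j)) = hplus A X (Q Y X q A v) (Comp a A A X (Q Y X q A w) (hneg A))"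
        unfolding w'_def[symmetric] Qp[OF A v w'] using Qm[OF A A w, of "hneg A"] A by (simp add: w'_def)
      also have "\<dots> = hzero A X"
        using comp_hneg[OF A t(1) Qc[OF A w]] abelian_group.r_neg[OF hom_group[OF A t(1)], of "Q Y X q A w"] Qc[OF A w] A t eq by simp
      finally have "ev F Y y A (\<lambda>j. hplus A (fob Y j) (v j) (w' j)) = \<zero>\<^bsub>fobj F A\<^esub>"
        using vec_plus[OF v w' A t(2)] by (intro zero A) auto
      moreover have "ev F Y y A w' = \<ominus>\<^bsub>fobj F A\<^esub> ev F Y y A w"
        unfolding w'_def using evy(3)[of A A w "hneg A"] evy(1)[of A w] A w F by (simp add: psh_neg)
      ultimately have "ev F Y y A v \<ominus>\<^bsub>fobj F A\<^esub> ev F Y y A w = \<zero>\<^bsub>fobj F A\<^esub>"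
        using evy(2)[of A v w'] A v w' by (simp add: a_minus_def)
      then show ?thesis using psh_minus_zero_iff[OF F A] evy(1)[of A] A v w by simp
    qed
    \<comment> \<open>All composites with \<open>q\<close>. They form a sieve that contains the
      generators, so every element of the generated sieve is such a composite.\<close>
    define T where "T = (\<lambda>B. if B \<in> Ob then Q Y X q B ` vec Y B else {})"
    have T: "sieve X T"
      unfolding sieve_def T_def
    proof (intro conjI allI impI ballI)
      fix B assume B: "B \<in> Ob"
      show "(if B \<in> Ob then Q Y X q B ` vec Y B else {}) \<subseteq> Arr a B X" using Qc B by auto
      show "hzero B X \<in> (if B \<in> Ob then Q Y X q B ` vec Y B else {})"
        using ev_zero[OF yo(1) t(2) yo(2) B] B t(1) by simp (metis imageI)
      fix f g assume "f \<in> (if B \<in> Ob then Q Y X q B ` vec Y B else {})" "g \<in> (if B \<in> Ob then Q Y X q B ` vec Y B else {})"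
      then obtain v w where "v \<in> vec Y B" "w \<in> vec Y B" "f = Q Y X q B v" "g = Q Y X q B w" using B by auto
      then show "hplus B X f g \<in> (if B \<in> Ob then Q Y X q B ` vec Y B else {})"
        using Qp[OF B, of v w, symmetric] vec_plus[of v Y B w] B t by auto
    next
      fix B C f g assume B: "B \<in> Ob" and C: "C \<in> Ob" and f: "f \<in> (if B \<in> Ob then Q Y X q B ` vec Y B else {})" and g: "g \<in> Arr a C B"
      then obtain v where "v \<in> vec Y B" "f = Q Y X q B v" by auto
      then show "Comp a C B X f g \<in> (if C \<in> Ob then Q Y X q C ` vec Y C else {})"
        using Qm[OF B C _ g, of v, symmetric] vec_comp[of v Y B C g] B C g t by auto
    qed auto
    have unit: "(\<lambda>i. if i = j then Ident a (fob Y j) else hzero (fob Y j) (fob Y i)) \<in> vec Y (fob Y j)"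
      "Q Y X q (fob Y j) (\<lambda>i. if i = j then Ident a (fob Y j) else hzero (fob Y j) (fob Y i)) = q j ()"
      "ev F Y y (fob Y j) (\<lambda>i. if i = j then Ident a (fob Y j) else hzero (fob Y j) (fob Y i)) = y j" if j: "j \<in> idx Y" for j
      using vec_unit[of "fob Y j" Y "Ident a (fob Y j)" j] ev_unit[OF yo(1) t(2) yo(2), of "fob Y j" j "Ident a (fob Y j)"]
        ev_unit[OF F t(2) y', of "fob Y j" j "Ident a (fob Y j)"] j t F y by (simp_all add: psh_id)
    have qT: "q j () \<in> T (fob Y j)" if "j \<in> idx Y" for j
      unfolding T_def using unit[OF that] t that by (auto intro: image_eqI[rotated])
    define G where "G = gen_sieve k a (Y, X, q)"
    have GT: "G B \<subseteq> T B" for B unfolding G_def using gen_sieve_le[of X Y q T B] t T qT by blast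
    have Gq: "q j () \<in> G (fob Y j)" if "j \<in> idx Y" for j unfolding G_def using gen_sieve_gen[of X Y q] t that by blast
    \<comment> \<open>By \<open>single\<close> the result does not depend on the vector that is
      chosen.\<close>
    define \<eta> where "\<eta> B f = ev F Y y B (SOME v. v \<in> vec Y B \<and> Q Y X q B v = f)" for B f
    have \<eta>: "\<eta> B (Q Y X q B v) = ev F Y y B v" if "B \<in> Ob" "v \<in> vec Y B" for B v
      unfolding \<eta>_def using someI[of "\<lambda>v'. v' \<in> vec Y B \<and> Q Y X q B v' = Q Y X q B v" v] that
      by (intro single) auto
    have "compat F X G \<eta>"
      unfolding compat_def
    proof (intro conjI ballI)
      fix B f assume B: "B \<in> Ob" and "f \<in> G B"
      then obtain v where v: "v \<in> vec Y B" and f: "f = Q Y X q B v" using GT[of B] by (auto simp: T_def)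
      show "\<eta> B f \<in> crr F B" using \<eta>[OF B v] evy(1)[of B v] B v f by simp
      {
        fix g assume "g \<in> G B"
        then obtain w where w: "w \<in> vec Y B" and g: "g = Q Y X q B w" using GT[of B] B by (auto simp: T_def)
        show "\<eta> B (hplus B X f g) = \<eta> B f \<oplus>\<^bsub>fobj F B\<^esub> \<eta> B g"
          using \<eta>[OF B v] \<eta>[OF B w] \<eta>[OF B vec_plus[OF v w B t(2)]] Qp[OF B v w] evy(2)[of B v w] B v w f g by simp
      next
        fix C g assume C: "C \<in> Ob" and g: "g \<in> Arr a C B"
        show "\<eta> C (Comp a C B X f g) = fmap F B C g (\<eta> B f)"
          using \<eta>[OF B v] \<eta>[OF C vec_comp[OF v B C g t(2)]] Qm[OF B C v g] evy(3)[of B C v g] B C v f g by simp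
      }
    qed
    then obtain x where x: "x \<in> crr F X" "\<forall>B\<in>Ob. \<forall>f\<in>G B. fmap F X B f x = \<eta> B f"
      using gs[OF C1] unfolding glues_def G_def by blast
    have "fmap F X (fob Y j) (q j ()) x = y j" if j: "j \<in> idx Y" for j
      using x(2) Gq[OF j] t(2)[OF j] \<eta>[OF t(2)[OF j] unit(1)[OF j]] unit(2,3)[OF j] by auto
    with x(1) show "\<exists>x\<in>crr F X. \<forall>j\<in>idx Y. fmap F X (fob Y j) (q j ()) x = y j" by blast
  qed
qed

text \<open>A cycle of implications: exactness on \<open>S\<close>, the sheaf property for
  \<open>cov\<close>, gluing over \<open>top_of k a S\<close>, and exactness on \<open>S\<close>
  again.\<close>

lemma ShS_sheaf: "ShS k a S = full_subcat (PSh k a) sheaf"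
  and Sh_sheaf: "Sh k a (top_of k a S) = full_subcat (PSh k a) sheaf"
proof -
  have 1: "\<forall>s\<in>S. left_exact_on a F s" if "psh F" "\<forall>A\<in>Ob. \<forall>R\<in>top_of k a S A. glues F A R" for F
    using glues_exact[of F] that by (metis prod_cases5)
  have 2: "sheaf F" if "psh F" "\<forall>s\<in>S. left_exact_on a F s" for F using exact_sheaf that by blast
  have 3: "\<forall>A\<in>Ob. \<forall>R\<in>top_of k a S A. glues F A R" if "sheaf F" for F using sheaf_glues top_of_cov that by blast
  have 4: "(\<forall>A\<in>Ob. \<forall>R\<in>top_of k a S A.
      linear_map k (fobj F A) (HomM (PSh k a) (sieve_presheaf a A R) F) (\<lambda>x. sieve_restrict a R (yoneda_map a F A x)) \<and>
      bij_betw (\<lambda>x. sieve_restrict a R (yoneda_map a F A x)) (carrier (fobj F A)) (carrier (HomM (PSh k a) (sieve_presheaf a A R) F)))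
    \<longleftrightarrow> (\<forall>A\<in>Ob. \<forall>R\<in>top_of k a S A. glues F A R)" if "psh F" for F
    using glues_iff[OF that] is_sieve_iff by (auto simp: top_of_def)
  have eq: "full_subcat (PSh k a) P = full_subcat (PSh k a) Q" if "\<And>F. psh F \<Longrightarrow> P F \<longleftrightarrow> Q F" for P Q
  proof -
    have "{F \<in> Obj (PSh k a). P F} = {F \<in> Obj (PSh k a). Q F}" using that by blast
    then show ?thesis by (simp add: full_subcat_def)
  qed
  show "ShS k a S = full_subcat (PSh k a) sheaf"
    unfolding ShS_def by (rule eq) (use 1 2 3 in blast)
  show "Sh k a (top_of k a S) = full_subcat (PSh k a) sheaf"
    unfolding Sh_def by (rule eq, subst 4) (use 1 2 3 in blast)+
qed

end

section \<open>Sheaves from presentations\<close>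

context linear_category
begin

text \<open>The groups may have any type, but the values of a presheaf have carriers in
  \<open>'u\<close>, so they are transported along injections \<open>e A\<close>. The module
  structure comes for free from the additivity of \<open>r\<close> in the arrow: c acts as
  \<open>r A A (sc c A)\<close>.\<close>

lemma presheaf_from_groups:
  fixes G :: "'o \<Rightarrow> 'w monoid" and r :: "'o \<Rightarrow> 'o \<Rightarrow> 'u \<Rightarrow> 'w \<Rightarrow> 'w"
  assumes G: "\<And>A. A \<in> Ob \<Longrightarrow> comm_group (G A)" "\<And>A. A \<in> Ob \<Longrightarrow> small TYPE('u) (carrier (G A))"
    and r_closed: "\<And>A B f x. A \<in> Ob \<Longrightarrow> B \<in> Ob \<Longrightarrow> f \<in> Arr a B A \<Longrightarrow> x \<in> carrier (G A) \<Longrightarrow> r A B f x \<in> carrier (G B)"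
    and r_hom: "\<And>A B f x y. A \<in> Ob \<Longrightarrow> B \<in> Ob \<Longrightarrow> f \<in> Arr a B A \<Longrightarrow> x \<in> carrier (G A) \<Longrightarrow> y \<in> carrier (G A) \<Longrightarrow>
      r A B f (x \<otimes>\<^bsub>G A\<^esub> y) = r A B f x \<otimes>\<^bsub>G B\<^esub> r A B f y"
    and r_id: "\<And>A x. A \<in> Ob \<Longrightarrow> x \<in> carrier (G A) \<Longrightarrow> r A A (Ident a A) x = x"
    and r_comp: "\<And>A B C f g x. A \<in> Ob \<Longrightarrow> B \<in> Ob \<Longrightarrow> C \<in> Ob \<Longrightarrow> f \<in> Arr a B A \<Longrightarrow> g \<in> Arr a C B \<Longrightarrow> x \<in> carrier (G A) \<Longrightarrow>
      r A C (Comp a C B A f g) x = r B C g (r A B f x)"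
    and r_plus: "\<And>A B f g x. A \<in> Ob \<Longrightarrow> B \<in> Ob \<Longrightarrow> f \<in> Arr a B A \<Longrightarrow> g \<in> Arr a B A \<Longrightarrow> x \<in> carrier (G A) \<Longrightarrow>
      r A B (hplus B A f g) x = r A B f x \<otimes>\<^bsub>G B\<^esub> r A B g x"
  obtains F e where "psh F" "\<And>A. A \<in> Ob \<Longrightarrow> bij_betw (e A) (carrier (G A)) (crr F A)"
    "\<And>A x y. A \<in> Ob \<Longrightarrow> x \<in> carrier (G A) \<Longrightarrow> y \<in> carrier (G A) \<Longrightarrow> e A (x \<otimes>\<^bsub>G A\<^esub> y) = e A x \<oplus>\<^bsub>fobj F A\<^esub> e A y"
    "\<And>A B f x. A \<in> Ob \<Longrightarrow> B \<in> Ob \<Longrightarrow> f \<in> Arr a B A \<Longrightarrow> x \<in> carrier (G A) \<Longrightarrow> e B (r A B f x) = fmap F A B f (e A x)"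
proof -
  have "\<exists>e. inj_on e (carrier (G A)) \<and> range e \<subseteq> (UNIV :: 'u set)" if "A \<in> Ob" for A
    using small_inj[OF G(2)[OF that]] by blast
  then obtain e :: "'o \<Rightarrow> 'w \<Rightarrow> 'u" where e: "\<And>A. A \<in> Ob \<Longrightarrow> inj_on (e A) (carrier (G A))" by metis
  define d where "d A = the_inv_into (carrier (G A)) (e A)" for A
  have de[simp]: "d A (e A x) = x" if "A \<in> Ob" "x \<in> carrier (G A)" for A x
    using the_inv_into_f_f[OF e[OF that(1)] that(2)] by (simp add: d_def)
  define F :: "('k, 'o, 'u) presheaf" where
    "F = \<lparr>fobj = (\<lambda>A. \<lparr>carrier = e A ` carrier (G A), mult = undefined, one = undefined, ring.zero = e A \<one>\<^bsub>G A\<^esub>,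
             ring.add = (\<lambda>x y. e A (d A x \<otimes>\<^bsub>G A\<^esub> d A y)), module.smult = (\<lambda>c x. e A (r A A (sc c A) (d A x)))\<rparr>),
          fmap = (\<lambda>A B f. \<lambda>x\<in>e A ` carrier (G A). e B (r A B f (d A x)))\<rparr>"
  have F_simps: "crr F A = e A ` carrier (G A)" "x \<oplus>\<^bsub>fobj F A\<^esub> y = e A (d A x \<otimes>\<^bsub>G A\<^esub> d A y)"
    "\<zero>\<^bsub>fobj F A\<^esub> = e A \<one>\<^bsub>G A\<^esub>" "c \<odot>\<^bsub>fobj F A\<^esub> x = e A (r A A (sc c A) (d A x))"
    "fmap F A B f = (\<lambda>x\<in>e A ` carrier (G A). e B (r A B f (d A x)))" for A B f x y c
    by (simp_all add: F_def)
  have sc_id: "sc \<one>\<^bsub>k\<^esub> A = Ident a A" if "A \<in> Ob" for A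
    using module.smult_one[OF hom_module[OF that that]] that by (simp add: sc_def)
  have sc_plus: "sc (b \<oplus>\<^bsub>k\<^esub> c) A = hplus A A (sc b A) (sc c A)" if "A \<in> Ob" "b \<in> carrier k" "c \<in> carrier k" for A b c
    using module.smult_l_distr[OF hom_module[OF that(1) that(1)]] that by (simp add: sc_def)
  \<comment> \<open>In this order of composition the contravariant \<open>r\<close> lets
    \<open>b\<close> act after \<open>c\<close>.\<close>
  have sc_mult: "sc (b \<otimes>\<^bsub>k\<^esub> c) A = Comp a A A A (sc c A) (sc b A)" if "A \<in> Ob" "b \<in> carrier k" "c \<in> carrier k" for A b c
    using module.smult_assoc1[OF hom_module[OF that(1) that(1)]] that by (simp add: comp_sc_right) (simp add: sc_def)
  have mod: "module k (fobj F A)" if A: "A \<in> Ob" for A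
  proof -
    interpret comm_group "G A" using G A by blast
    show ?thesis
    proof (rule moduleI[OF cring abelian_groupI])
      fix x assume "x \<in> crr F A"
      then obtain x' where x': "x' \<in> carrier (G A)" "x = e A x'" by (auto simp: F_simps)
      show "\<exists>y\<in>crr F A. y \<oplus>\<^bsub>fobj F A\<^esub> x = \<zero>\<^bsub>fobj F A\<^esub>"
        using A x' by (intro bexI[of _ "e A (inv\<^bsub>G A\<^esub> x')"]) (auto simp: F_simps)
    qed (use A in \<open>auto simp: F_simps m_assoc r_closed r_hom r_id sc_id sc_plus sc_mult r_plus r_comp intro: m_comm
          intro!: arg_cong[of _ _ "e A"]\<close>)
  qed
  have sm: "small TYPE('u) (crr F A)" if "A \<in> Ob" for A
    unfolding F_simps using small_image G(2) that by blast
  have m: "x \<otimes>\<^bsub>G A\<^esub> y \<in> carrier (G A)" if "A \<in> Ob" "x \<in> carrier (G A)" "y \<in> carrier (G A)" for A x y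
    using G(1)[OF that(1)] that by (meson comm_groupE(1))
  have "psh F"
    unfolding psh_iff using mod sm by (auto simp: F_simps r_closed r_hom r_id r_comp r_plus m)
  moreover have "bij_betw (e A) (carrier (G A)) (crr F A)" if "A \<in> Ob" for A
    using e[OF that] by (simp add: F_simps bij_betw_def)
  moreover have "e A (x \<otimes>\<^bsub>G A\<^esub> y) = e A x \<oplus>\<^bsub>fobj F A\<^esub> e A y" if "A \<in> Ob" "x \<in> carrier (G A)" "y \<in> carrier (G A)" for A x y
    using that by (simp add: F_simps)
  moreover have "e B (r A B f x) = fmap F A B f (e A x)" if "A \<in> Ob" "x \<in> carrier (G A)" for A B f x
    using that by (simp add: F_simps)
  ultimately show thesis using that by blast
qed

lemma hplus_zero[simp]:
  assumes "A \<in> Ob" "B \<in> Ob" "f \<in> Arr a A B"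
  shows "hplus A B f (hzero A B) = f" "hplus A B (hzero A B) f = f"
  using abelian_monoid.r_zero[OF abelian_group.axioms(1)[OF hom_group]] abelian_monoid.l_zero[OF abelian_group.axioms(1)[OF hom_group]] assms
  by simp_all

end

text \<open>
  Generators \<open>P\<close> modulo relations \<open>N0\<close>. A section over \<open>A\<close> of the associated sheaf is
  represented by the graph of the largest homomorphism that induces it: a set \<open>\<Gamma>\<close> of pairs
  \<open>(f, z)\<close> saying that the restriction along \<open>f\<close> is the class of \<open>z\<close>.
  \<open>Rep\<close> is only used to bound the size of the quotients.
\<close>

locale presentation = linear_topology k a J
  for k :: "'k ring" and a :: "('k, 'o, 'u) lincat" and J +
  fixes P :: "'o \<Rightarrow> 'v::ab_group_add set" and res :: "'o \<Rightarrow> 'o \<Rightarrow> 'u \<Rightarrow> 'v \<Rightarrow> 'v" and N0 :: "'o \<Rightarrow> 'v set" and Rep :: "'o \<Rightarrow> 'v set"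
  assumes P_zero[simp]: "A \<in> Obj a \<Longrightarrow> 0 \<in> P A"
    and P_diff[simp]: "A \<in> Obj a \<Longrightarrow> z \<in> P A \<Longrightarrow> w \<in> P A \<Longrightarrow> z - w \<in> P A"
    and N0_P: "A \<in> Obj a \<Longrightarrow> N0 A \<subseteq> P A"
    and N0_zero[simp]: "A \<in> Obj a \<Longrightarrow> 0 \<in> N0 A"
    and N0_diff: "A \<in> Obj a \<Longrightarrow> z \<in> N0 A \<Longrightarrow> w \<in> N0 A \<Longrightarrow> z - w \<in> N0 A"
    and res_P[simp]: "A \<in> Obj a \<Longrightarrow> B \<in> Obj a \<Longrightarrow> f \<in> Arr a B A \<Longrightarrow> z \<in> P A \<Longrightarrow> res A B f z \<in> P B"
    and res_diff: "A \<in> Obj a \<Longrightarrow> B \<in> Obj a \<Longrightarrow> f \<in> Arr a B A \<Longrightarrow> z \<in> P A \<Longrightarrow> w \<in> P A \<Longrightarrow> res A B f (z - w) = res A B f z - res A B f w"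
    and res_id[simp]: "A \<in> Obj a \<Longrightarrow> z \<in> P A \<Longrightarrow> res A A (Ident a A) z = z"
    and res_comp: "A \<in> Obj a \<Longrightarrow> B \<in> Obj a \<Longrightarrow> C \<in> Obj a \<Longrightarrow> f \<in> Arr a B A \<Longrightarrow> g \<in> Arr a C B \<Longrightarrow> z \<in> P A \<Longrightarrow>
      res A C (Comp a C B A f g) z = res B C g (res A B f z)"
    and res_plus: "A \<in> Obj a \<Longrightarrow> B \<in> Obj a \<Longrightarrow> f \<in> Arr a B A \<Longrightarrow> g \<in> Arr a B A \<Longrightarrow> z \<in> P A \<Longrightarrow>
      res A B (f \<oplus>\<^bsub>HomM a B A\<^esub> g) z - res A B f z - res A B g z \<in> N0 B"
    and res_N0: "A \<in> Obj a \<Longrightarrow> B \<in> Obj a \<Longrightarrow> f \<in> Arr a B A \<Longrightarrow> z \<in> N0 A \<Longrightarrow> res A B f z \<in> N0 B"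
    and Rep: "A \<in> Obj a \<Longrightarrow> small TYPE('u) (Rep A)" "A \<in> Obj a \<Longrightarrow> Rep A \<subseteq> P A"
      "A \<in> Obj a \<Longrightarrow> z \<in> P A \<Longrightarrow> \<exists>w\<in>Rep A. z - w \<in> N0 A"
begin

lemma P_plus[simp]: "A \<in> Ob \<Longrightarrow> z \<in> P A \<Longrightarrow> w \<in> P A \<Longrightarrow> z + w \<in> P A"
  using P_diff[of A z "0 - w"] P_diff[of A 0 w] by simp

lemma N0_plus: "A \<in> Ob \<Longrightarrow> z \<in> N0 A \<Longrightarrow> w \<in> N0 A \<Longrightarrow> z + w \<in> N0 A"
  using N0_diff[of A z "0 - w"] N0_diff[of A 0 w] by simp

lemma res_zero[simp]: "A \<in> Ob \<Longrightarrow> B \<in> Ob \<Longrightarrow> f \<in> Arr a B A \<Longrightarrow> res A B f 0 = 0"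
  using res_diff[of A B f 0 0] by simp

lemma res_add: "A \<in> Ob \<Longrightarrow> B \<in> Ob \<Longrightarrow> f \<in> Arr a B A \<Longrightarrow> z \<in> P A \<Longrightarrow> w \<in> P A \<Longrightarrow> res A B f (z + w) = res A B f z + res A B f w"
  using res_diff[of A B f z "0 - w"] res_diff[of A B f 0 w] P_diff[of A 0 w] by simp

lemma res_hzero: "A \<in> Ob \<Longrightarrow> B \<in> Ob \<Longrightarrow> z \<in> P A \<Longrightarrow> res A B (hzero B A) z \<in> N0 B"
  using res_plus[of A B "hzero B A" "hzero B A" z] N0_diff[of B 0 "- res A B (hzero B A) z"] by simp

text \<open>Elements that become relations on a cover: the kernel of the map from \<open>P\<close>
  to the associated sheaf.\<close>

definition N :: "'o \<Rightarrow> 'v set" where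
  "N A = {z \<in> P A. locally A (\<lambda>B f. res A B f z \<in> N0 B)}"

lemma N_P: "z \<in> N A \<Longrightarrow> z \<in> P A"
  by (simp add: N_def)

lemma N0_N: "A \<in> Ob \<Longrightarrow> z \<in> N0 A \<Longrightarrow> z \<in> N A"
proof -
  assume A: "A \<in> Ob" and z: "z \<in> N0 A"
  have "locally A (\<lambda>B f. res A B f z \<in> N0 B)" using A z res_N0 by (intro locally_all) auto
  then show ?thesis using subsetD[OF N0_P[OF A] z] by (simp add: N_def)
qed

lemma N_zero[simp]: "A \<in> Ob \<Longrightarrow> 0 \<in> N A"
  by (simp add: N0_N)

lemma N_diff: "A \<in> Ob \<Longrightarrow> z \<in> N A \<Longrightarrow> w \<in> N A \<Longrightarrow> z - w \<in> N A"
proof -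
  assume A: "A \<in> Ob" and z: "z \<in> N A" and w: "w \<in> N A"
  have "locally A (\<lambda>B f. res A B f z \<in> N0 B \<and> res A B f w \<in> N0 B)"
    using z w by (simp add: N_def locally_conj)
  then have "locally A (\<lambda>B f. res A B f (z - w) \<in> N0 B)"
    by (rule locally_mono) (use A z w in \<open>simp add: N_P res_diff N0_diff\<close>)
  then show ?thesis using A z w by (simp add: N_def)
qed

lemma N_plus: "A \<in> Ob \<Longrightarrow> z \<in> N A \<Longrightarrow> w \<in> N A \<Longrightarrow> z + w \<in> N A"
  using N_diff[of A z "0 - w"] N_diff[of A 0 w] by simp

lemma N_res: "A \<in> Ob \<Longrightarrow> B \<in> Ob \<Longrightarrow> f \<in> Arr a B A \<Longrightarrow> z \<in> N A \<Longrightarrow> res A B f z \<in> N B"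
proof -
  assume *: "A \<in> Ob" "B \<in> Ob" "f \<in> Arr a B A" "z \<in> N A"
  then have "locally B (\<lambda>C g. res A C (Comp a C B A f g) z \<in> N0 C)"
    by (intro locally_pullback[of A "\<lambda>B f. res A B f z \<in> N0 B"]) (auto simp: N_def)
  then have "locally B (\<lambda>C g. res B C g (res A B f z) \<in> N0 C)"
    by (rule locally_mono) (use * in \<open>simp add: N_P res_comp\<close>)
  then show ?thesis using * by (simp add: N_def)
qed

text \<open>The arrows along which \<open>z\<close> becomes a relation are closed under sums, since
  \<open>res\<close> is additive in the arrow modulo \<open>N0\<close>. They therefore form a sieve,
  and \<open>locally_trans\<close> applies.\<close>

lemma N_local:
  assumes A: "A \<in> Ob" and z: "z \<in> P A" and loc: "locally A (\<lambda>B f. res A B f z \<in> N B)"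
  shows "z \<in> N A"
proof -
  define S where "S = (\<lambda>B. if B \<in> Ob then {f \<in> Arr a B A. res A B f z \<in> N0 B} else {})"
  have "sieve A S"
    unfolding sieve_def S_def
  proof (intro conjI allI impI ballI)
    fix B f g assume B: "B \<in> Ob" "f \<in> (if B \<in> Ob then {f \<in> Arr a B A. res A B f z \<in> N0 B} else {})"
      "g \<in> (if B \<in> Ob then {f \<in> Arr a B A. res A B f z \<in> N0 B} else {})"
    then have "(res A B (hplus B A f g) z - res A B f z - res A B g z) + (res A B f z + res A B g z) \<in> N0 B"
      using A z by (intro N0_plus res_plus) auto
    then show "hplus B A f g \<in> (if B \<in> Ob then {f \<in> Arr a B A. res A B f z \<in> N0 B} else {})"
      using A B by simp
  qed (use A z in \<open>auto simp: res_hzero res_comp res_N0\<close>)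
  then have "J A S"
  proof (rule locally_trans)
    show "locally A (\<lambda>B f. locally B (\<lambda>C g. Comp a C B A f g \<in> S C))"
      using loc by (rule locally_mono) (use A z in \<open>auto simp: N_def S_def res_comp elim!: locally_mono\<close>)
  qed
  then show ?thesis using z unfolding N_def by (auto simp: S_def split: if_splits intro: J_locally)
qed

lemma res_hneg: "A \<in> Ob \<Longrightarrow> z \<in> P A \<Longrightarrow> res A A (hneg A) z + z \<in> N A"
proof -
  assume A: "A \<in> Ob" and z: "z \<in> P A"
  have "res A A (hplus A A (hneg A) (Ident a A)) z - res A A (hneg A) z - z \<in> N0 A"
    using res_plus[of A A "hneg A" "Ident a A" z] A z by simp
  moreover have "res A A (hplus A A (hneg A) (Ident a A)) z \<in> N0 A" using A z by (simp add: hneg_plus res_hzero)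
  ultimately have "res A A (hplus A A (hneg A) (Ident a A)) z - (res A A (hplus A A (hneg A) (Ident a A)) z - res A A (hneg A) z - z) \<in> N0 A"
    using N0_diff A by blast
  then show ?thesis using N0_N[OF A] by (simp add: add.commute)
qed

declare N_P[simp]

subsection \<open>Graphs of local homomorphisms\<close>

text \<open>An additive and natural relation between arrows into \<open>A\<close> and generators.
  The condition at the zero arrows makes it a map modulo \<open>N\<close>, and the last one says
  that its domain covers \<open>A\<close>.\<close>

definition graph :: "'o \<Rightarrow> ('o \<Rightarrow> ('u \<times> 'v) set) \<Rightarrow> bool" where
  "graph A \<Gamma> \<longleftrightarrow> (\<forall>B. B \<notin> Ob \<longrightarrow> \<Gamma> B = {}) \<and>
    (\<forall>B\<in>Ob. \<Gamma> B \<subseteq> Arr a B A \<times> P B) \<and>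
    (\<forall>B\<in>Ob. \<forall>f z g w. (f, z) \<in> \<Gamma> B \<longrightarrow> (g, w) \<in> \<Gamma> B \<longrightarrow> (hplus B A f g, z + w) \<in> \<Gamma> B) \<and>
    (\<forall>B\<in>Ob. \<forall>C\<in>Ob. \<forall>f z. \<forall>g\<in>Arr a C B. (f, z) \<in> \<Gamma> B \<longrightarrow> (Comp a C B A f g, res B C g z) \<in> \<Gamma> C) \<and>
    (\<forall>B\<in>Ob. \<forall>z. (hzero B A, z) \<in> \<Gamma> B \<longrightarrow> z \<in> N B) \<and>
    locally A (\<lambda>B f. \<exists>z. (f, z) \<in> \<Gamma> B)"

text \<open>The maximal graphs: they contain all of \<open>N\<close> at the zero arrows and every
  pair that belongs to them locally. Two of them sharing pairs on a cover are equal
  (\<open>section_eqI\<close>), which replaces a quotient of families.\<close>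

definition lsection :: "'o \<Rightarrow> ('o \<Rightarrow> ('u \<times> 'v) set) \<Rightarrow> bool" where
  "lsection A \<Gamma> \<longleftrightarrow> graph A \<Gamma> \<and> (\<forall>B\<in>Ob. \<forall>z\<in>N B. (hzero B A, z) \<in> \<Gamma> B) \<and>
    (\<forall>B\<in>Ob. \<forall>f\<in>Arr a B A. \<forall>z\<in>P B. locally B (\<lambda>C g. (Comp a C B A f g, res B C g z) \<in> \<Gamma> C) \<longrightarrow> (f, z) \<in> \<Gamma> B)"

lemma
  assumes "graph A \<Gamma>"
  shows graph_ob: "\<And>B f z. (f, z) \<in> \<Gamma> B \<Longrightarrow> B \<in> Ob"
    and graph_arr: "\<And>B f z. (f, z) \<in> \<Gamma> B \<Longrightarrow> f \<in> Arr a B A"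
    and graph_P: "\<And>B f z. (f, z) \<in> \<Gamma> B \<Longrightarrow> z \<in> P B"
    and graph_plus: "\<And>B f z g w. (f, z) \<in> \<Gamma> B \<Longrightarrow> (g, w) \<in> \<Gamma> B \<Longrightarrow> (hplus B A f g, z + w) \<in> \<Gamma> B"
    and graph_res: "\<And>B C f z g. (f, z) \<in> \<Gamma> B \<Longrightarrow> C \<in> Ob \<Longrightarrow> g \<in> Arr a C B \<Longrightarrow> (Comp a C B A f g, res B C g z) \<in> \<Gamma> C"
    and graph_zero: "\<And>B z. (hzero B A, z) \<in> \<Gamma> B \<Longrightarrow> z \<in> N B"
    and graph_dense: "locally A (\<lambda>B f. \<exists>z. (f, z) \<in> \<Gamma> B)"
proof -
  show ob: "B \<in> Ob" if "(f, z) \<in> \<Gamma> B" for B f z using assms that unfolding graph_def by blast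
  show "f \<in> Arr a B A" "z \<in> P B" if "(f, z) \<in> \<Gamma> B" for B f z using assms that ob[OF that] unfolding graph_def by blast+
  show "(hplus B A f g, z + w) \<in> \<Gamma> B" if "(f, z) \<in> \<Gamma> B" "(g, w) \<in> \<Gamma> B" for B f z g w
    using assms that ob unfolding graph_def by blast
  show "(Comp a C B A f g, res B C g z) \<in> \<Gamma> C" if "(f, z) \<in> \<Gamma> B" "C \<in> Ob" "g \<in> Arr a C B" for B C f z g
    using assms that ob unfolding graph_def by blast
  show "z \<in> N B" if "(hzero B A, z) \<in> \<Gamma> B" for B z using assms that ob unfolding graph_def by blast
  show "locally A (\<lambda>B f. \<exists>z. (f, z) \<in> \<Gamma> B)" using assms unfolding graph_def by blast
qed

lemma section_graph: "lsection A \<Gamma> \<Longrightarrow> graph A \<Gamma>"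
  by (simp add: lsection_def)

lemma section_N: "lsection A \<Gamma> \<Longrightarrow> B \<in> Ob \<Longrightarrow> z \<in> N B \<Longrightarrow> (hzero B A, z) \<in> \<Gamma> B"
  by (simp add: lsection_def)

lemma section_local:
  "lsection A \<Gamma> \<Longrightarrow> B \<in> Ob \<Longrightarrow> f \<in> Arr a B A \<Longrightarrow> z \<in> P B \<Longrightarrow>
   locally B (\<lambda>C g. (Comp a C B A f g, res B C g z) \<in> \<Gamma> C) \<Longrightarrow> (f, z) \<in> \<Gamma> B"
  by (simp add: lsection_def)

text \<open>Restricting one pair along \<open>hneg\<close> and adding it to the other gives a pair
  at the zero arrow.\<close>

lemma graph_single:
  assumes \<Gamma>: "graph A \<Gamma>" and A: "A \<in> Ob" and z: "(f, z) \<in> \<Gamma> B" and w: "(f, w) \<in> \<Gamma> B"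
  shows "z - w \<in> N B"
proof -
  note B = graph_ob[OF \<Gamma> z] and f = graph_arr[OF \<Gamma> z] and P = graph_P[OF \<Gamma> z] graph_P[OF \<Gamma> w]
  have "(hplus B A (Comp a B B A f (hneg B)) f, res B B (hneg B) w + z) \<in> \<Gamma> B"
    using graph_plus[OF \<Gamma> graph_res[OF \<Gamma> w B hneg_arr[OF B]] z] .
  then have "res B B (hneg B) w + z \<in> N B"
    using graph_zero[OF \<Gamma>] comp_hneg_plus[OF B A f] by simp
  then have "(res B B (hneg B) w + z) - (res B B (hneg B) w + w) \<in> N B"
    using N_diff[OF B] res_hneg[OF B P(2)] by blast
  then show ?thesis by simp
qed

lemma section_shift:
  assumes \<Gamma>: "lsection A \<Gamma>" and A: "A \<in> Ob" and z: "(f, z) \<in> \<Gamma> B" and w: "w \<in> P B" and zw: "w - z \<in> N B"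
  shows "(f, w) \<in> \<Gamma> B"
proof -
  note g = section_graph[OF \<Gamma>]
  note B = graph_ob[OF g z]
  have "(hplus B A f (hzero B A), z + (w - z)) \<in> \<Gamma> B"
    using graph_plus[OF g z section_N[OF \<Gamma> B zw]] .
  then show ?thesis using graph_arr[OF g z] A B by simp
qed

text \<open>A pair of \<open>\<Gamma>\<close> is locally, up to \<open>N\<close>, a pair of
  \<open>\<Delta>\<close>, and \<open>\<Delta>\<close> is closed under both corrections. The laws
  for the operations on sections are proved in this way, by exhibiting common local
  representatives.\<close>

lemma section_eqI:
  assumes A: "A \<in> Ob" and \<Gamma>: "lsection A \<Gamma>" and \<Delta>: "lsection A \<Delta>"
    and loc: "locally A (\<lambda>B f. \<exists>z. (f, z) \<in> \<Gamma> B \<and> (f, z) \<in> \<Delta> B)"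
  shows "\<Gamma> = \<Delta>"
proof -
  have le: "(f, z) \<in> \<Delta> B"
    if \<Gamma>: "lsection A \<Gamma>" and \<Delta>: "lsection A \<Delta>" and loc: "locally A (\<lambda>B f. \<exists>z. (f, z) \<in> \<Gamma> B \<and> (f, z) \<in> \<Delta> B)"
      and fz: "(f, z) \<in> \<Gamma> B" for \<Gamma> \<Delta> B f z
  proof -
    note g = section_graph[OF \<Gamma>]
    note B = graph_ob[OF g fz] and f = graph_arr[OF g fz] and z = graph_P[OF g fz]
    show ?thesis
    proof (rule section_local[OF \<Delta> B f z])
      show "locally B (\<lambda>C h. (Comp a C B A f h, res B C h z) \<in> \<Delta> C)"
        using locally_pullback[OF loc B f]
      proof (rule locally_mono)
        fix C h assume C: "C \<in> Ob" and h: "h \<in> Arr a C B"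
          and "\<exists>z. (Comp a C B A f h, z) \<in> \<Gamma> C \<and> (Comp a C B A f h, z) \<in> \<Delta> C"
        then obtain w where w: "(Comp a C B A f h, w) \<in> \<Gamma> C" "(Comp a C B A f h, w) \<in> \<Delta> C" by blast
        have "res B C h z - w \<in> N C" using graph_single[OF g A graph_res[OF g fz C h] w(1)] .
        then show "(Comp a C B A f h, res B C h z) \<in> \<Delta> C"
          using section_shift[OF \<Delta> A w(2)] B C h z by simp
      qed
    qed
  qed
  have loc': "locally A (\<lambda>B f. \<exists>z. (f, z) \<in> \<Delta> B \<and> (f, z) \<in> \<Gamma> B)" using loc by (rule locally_mono) blast
  have "(f, z) \<in> \<Gamma> B \<longleftrightarrow> (f, z) \<in> \<Delta> B" for f z B
    using le[OF \<Gamma> \<Delta> loc, of f z B] le[OF \<Delta> \<Gamma> loc', of f z B] by blast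
  then show ?thesis by (simp add: fun_eq_iff set_eq_iff)
qed

text \<open>The largest graph extending a given graph \<open>\<Gamma>\<close>: a pair in any larger
  one agrees modulo \<open>N\<close> with \<open>\<Gamma>\<close> wherever \<open>\<Gamma>\<close>
  is defined, and that is on a cover.\<close>

definition closure :: "'o \<Rightarrow> ('o \<Rightarrow> ('u \<times> 'v) set) \<Rightarrow> 'o \<Rightarrow> ('u \<times> 'v) set" where
  "closure A \<Gamma> = (\<lambda>B. if B \<in> Ob then {(f, z). f \<in> Arr a B A \<and> z \<in> P B \<and>
     locally B (\<lambda>C g. \<exists>w. (Comp a C B A f g, w) \<in> \<Gamma> C \<and> res B C g z - w \<in> N C)} else {})"

lemma closure_extends:
  assumes \<Gamma>: "graph A \<Gamma>" and fz: "(f, z) \<in> \<Gamma> B"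
  shows "(f, z) \<in> closure A \<Gamma> B"
proof -
  note B = graph_ob[OF \<Gamma> fz]
  have "locally B (\<lambda>C g. \<exists>w. (Comp a C B A f g, w) \<in> \<Gamma> C \<and> res B C g z - w \<in> N C)"
  proof (rule locally_all[OF B])
    fix C g assume "C \<in> Ob" "g \<in> Arr a C B"
    then show "\<exists>w. (Comp a C B A f g, w) \<in> \<Gamma> C \<and> res B C g z - w \<in> N C"
      using graph_res[OF \<Gamma> fz] by (intro exI[of _ "res B C g z"]) simp
  qed
  then show ?thesis using B graph_arr[OF \<Gamma> fz] graph_P[OF \<Gamma> fz] by (simp add: closure_def)
qed

text \<open>The covering sieve on which the graph is defined contains all zero arrows.\<close>

lemma graph_nonempty:
  assumes \<Gamma>: "graph A \<Gamma>" and B: "B \<in> Ob"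
  obtains w where "(hzero B A, w) \<in> \<Gamma> B" "w \<in> N B"
proof -
  obtain R where "J A R" "\<forall>B\<in>Ob. \<forall>f\<in>R B. \<exists>z. (f, z) \<in> \<Gamma> B"
    using graph_dense[OF \<Gamma>] unfolding locally_def by blast
  then show thesis using that sieve_zero[OF J_sieve B] graph_zero[OF \<Gamma>] B by blast
qed

text \<open>Each axiom is checked on a cover where values of \<open>\<Gamma>\<close> are available.
  The errors lie in \<open>N\<close>, which is closed under sums and restriction and, by
  \<open>N_local\<close>, under local membership.\<close>

lemma closure_section:
  assumes A: "A \<in> Ob" and \<Gamma>: "graph A \<Gamma>"
  shows "lsection A (closure A \<Gamma>)"
proof -
  define Q where "Q B f z C g \<longleftrightarrow> (\<exists>w. (Comp a C B A f g, w) \<in> \<Gamma> C \<and> res B C g z - w \<in> N C)" for B f z C g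
  have cl: "(f, z) \<in> closure A \<Gamma> B \<longleftrightarrow> B \<in> Ob \<and> f \<in> Arr a B A \<and> z \<in> P B \<and> locally B (Q B f z)" for B f z
    by (simp add: closure_def Q_def[abs_def])
  have g: "graph A (closure A \<Gamma>)"
    unfolding graph_def
  proof (intro conjI ballI allI impI)
    show "closure A \<Gamma> B = {}" if "B \<notin> Ob" for B using that by (simp add: closure_def)
    show "closure A \<Gamma> B \<subseteq> Arr a B A \<times> P B" for B by (auto simp: cl)
    show "(hplus B A f h, z + w) \<in> closure A \<Gamma> B"
      if B: "B \<in> Ob" and f: "(f, z) \<in> closure A \<Gamma> B" and h: "(h, w) \<in> closure A \<Gamma> B" for B f z h w
    proof -
      have "locally B (\<lambda>C g. Q B f z C g \<and> Q B h w C g)" using f h by (intro locally_conj) (auto simp: cl)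
      then have "locally B (Q B (hplus B A f h) (z + w))"
      proof (rule locally_mono)
        fix C g assume C: "C \<in> Ob" and g: "g \<in> Arr a C B" and *: "Q B f z C g \<and> Q B h w C g"
        then obtain u v where u: "(Comp a C B A f g, u) \<in> \<Gamma> C" "res B C g z - u \<in> N C"
          and v: "(Comp a C B A h g, v) \<in> \<Gamma> C" "res B C g w - v \<in> N C" by (auto simp: Q_def)
        have "(Comp a C B A (hplus B A f h) g, u + v) \<in> \<Gamma> C"
          using graph_plus[OF \<Gamma> u(1) v(1)] A B C f h g by (simp add: cl comp_plus_left)
        moreover have eq: "res B C g (z + w) - (u + v) = (res B C g z - u) + (res B C g w - v)"
          using B C g f h by (simp add: cl res_add)
        have "res B C g (z + w) - (u + v) \<in> N C" unfolding eq by (rule N_plus[OF C u(2) v(2)])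
        ultimately show "Q B (hplus B A f h) (z + w) C g" unfolding Q_def by blast
      qed
      then show ?thesis using A B f h by (simp add: cl)
    qed
    show "(Comp a C B A f g, res B C g z) \<in> closure A \<Gamma> C"
      if B: "B \<in> Ob" and C: "C \<in> Ob" and g: "g \<in> Arr a C B" and f: "(f, z) \<in> closure A \<Gamma> B" for B C f z g
    proof -
      have "locally C (\<lambda>D h. Q B f z D (Comp a D C B g h))" using f locally_pullback[OF _ C g] by (simp add: cl)
      then have "locally C (Q C (Comp a C B A f g) (res B C g z))"
        by (rule locally_mono) (use A B C f g in \<open>simp add: cl Q_def comp_assoc res_comp\<close>)
      then show ?thesis using A B C f g by (simp add: cl)
    qed
    show "z \<in> N B" if B: "B \<in> Ob" and z: "(hzero B A, z) \<in> closure A \<Gamma> B" for B z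
    proof (rule N_local[OF B])
      show "z \<in> P B" using z by (simp add: cl)
      have "locally B (Q B (hzero B A) z)" using z by (simp add: cl)
      then show "locally B (\<lambda>C g. res B C g z \<in> N C)"
      proof (rule locally_mono)
        fix C g assume C: "C \<in> Ob" and g: "g \<in> Arr a C B" and "Q B (hzero B A) z C g"
        then obtain w where "(hzero C A, w) \<in> \<Gamma> C" "res B C g z - w \<in> N C" using A B by (auto simp: Q_def)
        then show "res B C g z \<in> N C" using N_plus[OF C _ graph_zero[OF \<Gamma>]] by fastforce
      qed
    qed
    show "locally A (\<lambda>B f. \<exists>z. (f, z) \<in> closure A \<Gamma> B)"
      using graph_dense[OF \<Gamma>] by (rule locally_mono) (use closure_extends[OF \<Gamma>] in blast)
  qed
  show ?thesis
    unfolding lsection_def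
  proof (intro conjI ballI impI g)
    show "(hzero B A, z) \<in> closure A \<Gamma> B" if B: "B \<in> Ob" and z: "z \<in> N B" for B z
    proof -
      have "Q B (hzero B A) z C g" if C: "C \<in> Ob" and g: "g \<in> Arr a C B" for C g
      proof -
        obtain w where "(hzero C A, w) \<in> \<Gamma> C" "w \<in> N C" using graph_nonempty[OF \<Gamma> C] .
        then show ?thesis unfolding Q_def using N_diff[OF C N_res[OF B C g z]] A B C g by auto
      qed
      then show ?thesis using B A z by (simp add: cl locally_all)
    qed
    show "(f, z) \<in> closure A \<Gamma> B" if B: "B \<in> Ob" and f: "f \<in> Arr a B A" and z: "z \<in> P B"
      and loc: "locally B (\<lambda>C g. (Comp a C B A f g, res B C g z) \<in> closure A \<Gamma> C)" for B f z
    proof -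
      \<comment> \<open>The pair is represented in \<open>\<Gamma>\<close> only after two successive
        covers. Collecting the good arrows in a sieve lets \<open>locally_trans\<close> merge the
        two; closure under sums uses \<open>res_plus\<close>.\<close>
      define S where "S = (\<lambda>C. if C \<in> Ob then {g \<in> Arr a C B. Q B f z C g} else {})"
      have "sieve B S"
        unfolding sieve_def
      proof (intro conjI allI impI ballI)
        fix C assume C: "C \<in> Ob"
        show "S C \<subseteq> Arr a C B" using C by (simp add: S_def)
        obtain w where "(hzero C A, w) \<in> \<Gamma> C" "w \<in> N C" using graph_nonempty[OF \<Gamma> C] .
        then have "Q B f z C (hzero C B)" unfolding Q_def using N_diff[OF C N0_N[OF C res_hzero[OF B C z]]] A B C f by auto
        then show "hzero C B \<in> S C" using B C by (simp add: S_def)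
        fix g h assume "g \<in> S C" "h \<in> S C"
        then obtain u v where gh: "g \<in> Arr a C B" "h \<in> Arr a C B" and u: "(Comp a C B A f g, u) \<in> \<Gamma> C" "res B C g z - u \<in> N C"
          and v: "(Comp a C B A f h, v) \<in> \<Gamma> C" "res B C h z - v \<in> N C" using C by (auto simp: S_def Q_def)
        have "(Comp a C B A f (hplus C B g h), u + v) \<in> \<Gamma> C"
          using graph_plus[OF \<Gamma> u(1) v(1)] A B C f gh by (simp add: comp_plus_right)
        moreover have "(res B C (hplus C B g h) z - res B C g z - res B C h z) + ((res B C g z - u) + (res B C h z - v)) \<in> N C"
          using B C gh z by (intro N_plus N0_N res_plus u(2) v(2)) auto
        then have "res B C (hplus C B g h) z - (u + v) \<in> N C" by (simp add: algebra_simps)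
        ultimately show "hplus C B g h \<in> S C" using B C gh by (auto simp: S_def Q_def)
      next
        fix C D g h assume C: "C \<in> Ob" and D: "D \<in> Ob" and "g \<in> S C" and h: "h \<in> Arr a D C"
        then obtain u where g: "g \<in> Arr a C B" and u: "(Comp a C B A f g, u) \<in> \<Gamma> C" "res B C g z - u \<in> N C"
          by (auto simp: S_def Q_def)
        have "(Comp a D B A f (Comp a D C B g h), res C D h u) \<in> \<Gamma> D"
          using graph_res[OF \<Gamma> u(1) D h] A B C D f g h by (simp add: comp_assoc)
        moreover have "res B D (Comp a D C B g h) z - res C D h u \<in> N D"
          using N_res[OF C D h u(2)] B C D g h z graph_P[OF \<Gamma> u(1)] by (simp add: res_comp res_diff)
        ultimately show "Comp a D C B g h \<in> S D" using B C D g h by (auto simp: S_def Q_def)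
      qed (simp add: S_def)
      then have "J B S"
      proof (rule locally_trans)
        show "locally B (\<lambda>C g. locally C (\<lambda>D h. Comp a D C B g h \<in> S D))"
          using loc
        proof (rule locally_mono)
          fix C g assume C: "C \<in> Ob" and g: "g \<in> Arr a C B" and "(Comp a C B A f g, res B C g z) \<in> closure A \<Gamma> C"
          then have "locally C (Q C (Comp a C B A f g) (res B C g z))" by (simp add: cl)
          then show "locally C (\<lambda>D h. Comp a D C B g h \<in> S D)"
            by (rule locally_mono) (use A B C f g z in \<open>simp add: Q_def S_def comp_assoc res_comp\<close>)
        qed
      qed
      then have "locally B (Q B f z)" by (rule J_locally) (simp add: S_def)
      then show ?thesis using B f z by (simp add: cl)
    qed
  qed
qed

end

section \<open>The group of sections and its restriction maps\<close>

context presentation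
begin

text \<open>The section induced by an element over \<open>A\<close>: it sends \<open>f\<close> to
  the restriction of \<open>z\<close> along \<open>f\<close>, up to \<open>N\<close>.\<close>

definition unit :: "'o \<Rightarrow> 'v \<Rightarrow> 'o \<Rightarrow> ('u \<times> 'v) set" where
  "unit A z = (\<lambda>B. if B \<in> Ob then {(f, w). f \<in> Arr a B A \<and> w \<in> P B \<and> w - res A B f z \<in> N B} else {})"

text \<open>Values are added where both graphs are defined. This common domain is still covering but
  may be smaller than either one, hence the closure.\<close>

definition lplus :: "'o \<Rightarrow> ('o \<Rightarrow> ('u \<times> 'v) set) \<Rightarrow> ('o \<Rightarrow> ('u \<times> 'v) set) \<Rightarrow> 'o \<Rightarrow> ('u \<times> 'v) set" where
  "lplus A \<Gamma> \<Delta> = closure A (\<lambda>B. {(f, z + w) | f z w. (f, z) \<in> \<Gamma> B \<and> (f, w) \<in> \<Delta> B})"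

definition lres :: "'o \<Rightarrow> 'o \<Rightarrow> 'u \<Rightarrow> ('o \<Rightarrow> ('u \<times> 'v) set) \<Rightarrow> 'o \<Rightarrow> ('u \<times> 'v) set" where
  "lres A B h \<Gamma> = (\<lambda>C. if C \<in> Ob then {(g, z). g \<in> Arr a C B \<and> (Comp a C B A h g, z) \<in> \<Gamma> C} else {})"

lemma unit_res: "A \<in> Ob \<Longrightarrow> B \<in> Ob \<Longrightarrow> f \<in> Arr a B A \<Longrightarrow> z \<in> P A \<Longrightarrow> (f, res A B f z) \<in> unit A z B"
  by (simp add: unit_def)

lemma unit_graph:
  assumes A: "A \<in> Ob" and z: "z \<in> P A"
  shows "graph A (unit A z)"
  unfolding graph_def
proof (intro conjI ballI allI impI)
  show "unit A z B = {}" if "B \<notin> Ob" for B using that by (simp add: unit_def)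
  fix B assume B: "B \<in> Ob"
  show "unit A z B \<subseteq> Arr a B A \<times> P B" by (auto simp: unit_def)
  show "(hplus B A f g, v + w) \<in> unit A z B" if f: "(f, v) \<in> unit A z B" and g: "(g, w) \<in> unit A z B" for f v g w
  proof -
    have "((v - res A B f z) + (w - res A B g z)) - (res A B (hplus B A f g) z - res A B f z - res A B g z) \<in> N B"
      using f g B by (intro N_diff[OF B N_plus[OF B] N0_N[OF B res_plus[OF A B _ _ z]]]) (simp_all add: unit_def)
    then have "v + w - res A B (hplus B A f g) z \<in> N B" by (simp add: algebra_simps)
    then show ?thesis using A B f g by (auto simp: unit_def)
  qed
  show "w \<in> N B" if "(hzero B A, w) \<in> unit A z B" for w
    using that N_plus[OF B _ N0_N[OF B res_hzero[OF A B z]], of "w - res A B (hzero B A) z"] B by (simp add: unit_def)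
next
  fix B C f w g assume B: "B \<in> Ob" and C: "C \<in> Ob" and g: "g \<in> Arr a C B" and f: "(f, w) \<in> unit A z B"
  then have "res B C g (w - res A B f z) \<in> N C" by (intro N_res) (auto simp: unit_def)
  then show "(Comp a C B A f g, res B C g w) \<in> unit A z C"
    using A B C f g z by (simp add: unit_def res_comp res_diff)
next
  show "locally A (\<lambda>B f. \<exists>w. (f, w) \<in> unit A z B)"
    using unit_res A z by (intro locally_all) blast+
qed

lemma unit_section:
  assumes A: "A \<in> Ob" and z: "z \<in> P A"
  shows "lsection A (unit A z)"
  unfolding lsection_def
proof (intro conjI ballI impI unit_graph A z)
  show "(hzero B A, w) \<in> unit A z B" if B: "B \<in> Ob" and w: "w \<in> N B" for B w
    using N_diff[OF B w N0_N[OF B res_hzero[OF A B z]]] A B w by (simp add: unit_def)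
  show "(f, w) \<in> unit A z B" if B: "B \<in> Ob" and f: "f \<in> Arr a B A" and w: "w \<in> P B"
    and loc: "locally B (\<lambda>C g. (Comp a C B A f g, res B C g w) \<in> unit A z C)" for B f w
  proof -
    have "w - res A B f z \<in> N B"
    proof (rule N_local[OF B])
      show "locally B (\<lambda>C g. res B C g (w - res A B f z) \<in> N C)"
        using loc by (rule locally_mono) (use A B f z w in \<open>simp add: unit_def res_comp res_diff\<close>)
    qed (use A B f z w in simp)
    then show ?thesis using B f w by (simp add: unit_def)
  qed
qed

lemma lplus_graph:
  assumes A: "A \<in> Ob" and \<Gamma>: "graph A \<Gamma>" and \<Delta>: "graph A \<Delta>"
  shows "graph A (\<lambda>B. {(f, z + w) | f z w. (f, z) \<in> \<Gamma> B \<and> (f, w) \<in> \<Delta> B})"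
  unfolding graph_def
proof (intro conjI ballI allI impI)
  show "{(f, z + w) | f z w. (f, z) \<in> \<Gamma> B \<and> (f, w) \<in> \<Delta> B} = {}" if "B \<notin> Ob" for B using that graph_ob[OF \<Gamma>] by blast
  fix B assume B: "B \<in> Ob"
  show "{(f, z + w) | f z w. (f, z) \<in> \<Gamma> B \<and> (f, w) \<in> \<Delta> B} \<subseteq> Arr a B A \<times> P B"
    using B graph_arr[OF \<Gamma>] graph_P[OF \<Gamma>] graph_P[OF \<Delta>] by auto
  show "(hplus B A f g, u + v) \<in> {(f, z + w) | f z w. (f, z) \<in> \<Gamma> B \<and> (f, w) \<in> \<Delta> B}"
    if f: "(f, u) \<in> {(f, z + w) | f z w. (f, z) \<in> \<Gamma> B \<and> (f, w) \<in> \<Delta> B}"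
      and g: "(g, v) \<in> {(f, z + w) | f z w. (f, z) \<in> \<Gamma> B \<and> (f, w) \<in> \<Delta> B}" for f u g v
  proof -
    obtain z w z' w' where f: "(f, z) \<in> \<Gamma> B" "(f, w) \<in> \<Delta> B" "u = z + w" and g: "(g, z') \<in> \<Gamma> B" "(g, w') \<in> \<Delta> B" "v = z' + w'"
      using f g by blast
    have "u + v = (z + z') + (w + w')" by (simp add: f g algebra_simps)
    then show ?thesis using graph_plus[OF \<Gamma> f(1) g(1)] graph_plus[OF \<Delta> f(2) g(2)] by blast
  qed
  show "u \<in> N B" if "(hzero B A, u) \<in> {(f, z + w) | f z w. (f, z) \<in> \<Gamma> B \<and> (f, w) \<in> \<Delta> B}" for u
    using that graph_zero[OF \<Gamma>] graph_zero[OF \<Delta>] N_plus[OF B] by blast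
next
  fix B C f u g assume B: "B \<in> Ob" and C: "C \<in> Ob" and g: "g \<in> Arr a C B"
    and "(f, u) \<in> {(f, z + w) | f z w. (f, z) \<in> \<Gamma> B \<and> (f, w) \<in> \<Delta> B}"
  then obtain z w where f: "(f, z) \<in> \<Gamma> B" "(f, w) \<in> \<Delta> B" "u = z + w" by blast
  have "res B C g u = res B C g z + res B C g w"
    using B C g graph_P[OF \<Gamma> f(1)] graph_P[OF \<Delta> f(2)] by (simp add: f res_add)
  then show "(Comp a C B A f g, res B C g u) \<in> {(f, z + w) | f z w. (f, z) \<in> \<Gamma> C \<and> (f, w) \<in> \<Delta> C}"
    using graph_res[OF \<Gamma> f(1) C g] graph_res[OF \<Delta> f(2) C g] by blast
next
  have "locally A (\<lambda>B f. (\<exists>z. (f, z) \<in> \<Gamma> B) \<and> (\<exists>w. (f, w) \<in> \<Delta> B))"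
    by (intro locally_conj graph_dense \<Gamma> \<Delta>)
  then show "locally A (\<lambda>B f. \<exists>u. (f, u) \<in> {(f, z + w) | f z w. (f, z) \<in> \<Gamma> B \<and> (f, w) \<in> \<Delta> B})"
    by (rule locally_mono) blast
qed

lemma lplus_section: "A \<in> Ob \<Longrightarrow> lsection A \<Gamma> \<Longrightarrow> lsection A \<Delta> \<Longrightarrow> lsection A (lplus A \<Gamma> \<Delta>)"
  unfolding lplus_def by (intro closure_section lplus_graph section_graph)

lemma lplus_memI: "A \<in> Ob \<Longrightarrow> lsection A \<Gamma> \<Longrightarrow> lsection A \<Delta> \<Longrightarrow> (f, z) \<in> \<Gamma> B \<Longrightarrow> (f, w) \<in> \<Delta> B \<Longrightarrow> (f, z + w) \<in> lplus A \<Gamma> \<Delta> B"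
  unfolding lplus_def by (rule closure_extends[OF lplus_graph[OF _ section_graph section_graph]]) blast+

lemma lres_section:
  assumes A: "A \<in> Ob" and B: "B \<in> Ob" and h: "h \<in> Arr a B A" and \<Gamma>: "lsection A \<Gamma>"
  shows "lsection B (lres A B h \<Gamma>)"
proof -
  note g = section_graph[OF \<Gamma>]
  have gr: "graph B (lres A B h \<Gamma>)"
    unfolding graph_def
  proof (intro conjI ballI allI impI)
    show "locally B (\<lambda>C g. \<exists>z. (g, z) \<in> lres A B h \<Gamma> C)"
      using locally_pullback[OF graph_dense[OF g] B h] by (rule locally_mono) (simp add: lres_def)
    show "(hplus C B f f', z + w) \<in> lres A B h \<Gamma> C"
      if "C \<in> Ob" "(f, z) \<in> lres A B h \<Gamma> C" "(f', w) \<in> lres A B h \<Gamma> C" for C f z f' w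
      using that graph_plus[OF g] A B h by (simp add: lres_def comp_plus_right)
    show "(Comp a D C B f f', res C D f' z) \<in> lres A B h \<Gamma> D"
      if "C \<in> Ob" "D \<in> Ob" "f' \<in> Arr a D C" "(f, z) \<in> lres A B h \<Gamma> C" for C D f z f'
      using that graph_res[OF g, of "Comp a C B A h f" z C D f'] A B h by (simp add: lres_def comp_assoc)
    show "z \<in> N C" if "C \<in> Ob" "(hzero C B, z) \<in> lres A B h \<Gamma> C" for C z
      using that graph_zero[OF g] A B h by (simp add: lres_def)
  qed (use graph_P[OF g] in \<open>auto simp: lres_def\<close>)
  show ?thesis
    unfolding lsection_def
  proof (intro conjI ballI impI gr)
    show "(hzero C B, z) \<in> lres A B h \<Gamma> C" if "C \<in> Ob" "z \<in> N C" for C z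
      using section_N[OF \<Gamma> that] that A B h by (simp add: lres_def)
    show "(f, z) \<in> lres A B h \<Gamma> C" if C: "C \<in> Ob" and f: "f \<in> Arr a C B" and z: "z \<in> P C"
      and loc: "locally C (\<lambda>D g. (Comp a D C B f g, res C D g z) \<in> lres A B h \<Gamma> D)" for C f z
    proof -
      have "(Comp a C B A h f, z) \<in> \<Gamma> C"
      proof (rule section_local[OF \<Gamma> C _ z])
        show "locally C (\<lambda>D g. (Comp a D C A (Comp a C B A h f) g, res C D g z) \<in> \<Gamma> D)"
          using loc by (rule locally_mono) (use A B C h f in \<open>simp add: lres_def comp_assoc\<close>)
      qed (use A B C h f in simp)
      then show ?thesis using C f by (simp add: lres_def)
    qed
  qed
qed

lemma lres_mem: "C \<in> Ob \<Longrightarrow> g \<in> Arr a C B \<Longrightarrow> (g, z) \<in> lres A B h \<Gamma> C \<longleftrightarrow> (Comp a C B A h g, z) \<in> \<Gamma> C"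
  by (simp add: lres_def)

definition LG :: "'o \<Rightarrow> ('o \<Rightarrow> ('u \<times> 'v) set) monoid" where
  "LG A = \<lparr>carrier = {\<Gamma>. lsection A \<Gamma>}, mult = lplus A, one = unit A 0\<rparr>"

lemma LG_simps[simp]: "\<Gamma> \<in> carrier (LG A) \<longleftrightarrow> lsection A \<Gamma>" "\<Gamma> \<otimes>\<^bsub>LG A\<^esub> \<Delta> = lplus A \<Gamma> \<Delta>" "\<one>\<^bsub>LG A\<^esub> = unit A 0"
  by (simp_all add: LG_def)

lemma section_dense: "lsection A \<Gamma> \<Longrightarrow> locally A (\<lambda>B f. \<exists>z. (f, z) \<in> \<Gamma> B)"
  by (rule graph_dense[OF section_graph])

lemma unit_zero_mem: "A \<in> Ob \<Longrightarrow> B \<in> Ob \<Longrightarrow> f \<in> Arr a B A \<Longrightarrow> (f, 0) \<in> unit A 0 B"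
  using unit_res[of A B f 0] by simp

text \<open>Additivity of the graph \<open>\<Gamma>\<close> itself: its values at \<open>f\<close>
  after \<open>h\<close> and at \<open>g\<close> after \<open>h\<close> add up to a value at their
  sum.\<close>

lemma lres_plus:
  assumes A: "A \<in> Ob" and B: "B \<in> Ob" and f: "f \<in> Arr a B A" and g: "g \<in> Arr a B A" and \<Gamma>: "lsection A \<Gamma>"
  shows "lres A B (hplus B A f g) \<Gamma> = lplus B (lres A B f \<Gamma>) (lres A B g \<Gamma>)"
proof (rule section_eqI[OF B])
  have s: "lsection B (lres A B h \<Gamma>)" if "h \<in> Arr a B A" for h using lres_section[OF A B that \<Gamma>] .
  show "lsection B (lres A B (hplus B A f g) \<Gamma>)" "lsection B (lplus B (lres A B f \<Gamma>) (lres A B g \<Gamma>))"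
    using s A B f g by (auto intro!: lplus_section)
  have "locally B (\<lambda>C h. (\<exists>z. (h, z) \<in> lres A B f \<Gamma> C) \<and> (\<exists>w. (h, w) \<in> lres A B g \<Gamma> C))"
    by (intro locally_conj section_dense s f g)
  then show "locally B (\<lambda>C h. \<exists>z. (h, z) \<in> lres A B (hplus B A f g) \<Gamma> C \<and> (h, z) \<in> lplus B (lres A B f \<Gamma>) (lres A B g \<Gamma>) C)"
  proof (rule locally_mono)
    fix C h assume C: "C \<in> Ob" and h: "h \<in> Arr a C B" and "(\<exists>z. (h, z) \<in> lres A B f \<Gamma> C) \<and> (\<exists>w. (h, w) \<in> lres A B g \<Gamma> C)"
    then obtain z w where zw: "(h, z) \<in> lres A B f \<Gamma> C" "(h, w) \<in> lres A B g \<Gamma> C" by blast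
    have "(hplus C A (Comp a C B A f h) (Comp a C B A g h), z + w) \<in> \<Gamma> C"
      using graph_plus[OF section_graph[OF \<Gamma>]] zw C h by (simp add: lres_mem)
    then have "(h, z + w) \<in> lres A B (hplus B A f g) \<Gamma> C" using A B C f g h by (simp add: lres_mem comp_plus_left)
    then show "\<exists>z. (h, z) \<in> lres A B (hplus B A f g) \<Gamma> C \<and> (h, z) \<in> lplus B (lres A B f \<Gamma>) (lres A B g \<Gamma>) C"
      using lplus_memI[OF B s[OF f] s[OF g] zw] by blast
  qed
qed

lemma lres_lplus:
  assumes A: "A \<in> Ob" and B: "B \<in> Ob" and f: "f \<in> Arr a B A" and \<Gamma>: "lsection A \<Gamma>" and \<Delta>: "lsection A \<Delta>"
  shows "lres A B f (lplus A \<Gamma> \<Delta>) = lplus B (lres A B f \<Gamma>) (lres A B f \<Delta>)"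
proof (rule section_eqI[OF B])
  note s = lres_section[OF A B f]
  show "lsection B (lres A B f (lplus A \<Gamma> \<Delta>))" "lsection B (lplus B (lres A B f \<Gamma>) (lres A B f \<Delta>))"
    by (intro s lplus_section A B \<Gamma> \<Delta>)+
  have "locally B (\<lambda>C h. (\<exists>z. (h, z) \<in> lres A B f \<Gamma> C) \<and> (\<exists>w. (h, w) \<in> lres A B f \<Delta> C))"
    by (intro locally_conj section_dense s \<Gamma> \<Delta>)
  then show "locally B (\<lambda>C h. \<exists>z. (h, z) \<in> lres A B f (lplus A \<Gamma> \<Delta>) C \<and> (h, z) \<in> lplus B (lres A B f \<Gamma>) (lres A B f \<Delta>) C)"
  proof (rule locally_mono)
    fix C h assume C: "C \<in> Ob" and h: "h \<in> Arr a C B" and "(\<exists>z. (h, z) \<in> lres A B f \<Gamma> C) \<and> (\<exists>w. (h, w) \<in> lres A B f \<Delta> C)"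
    then obtain z w where zw: "(h, z) \<in> lres A B f \<Gamma> C" "(h, w) \<in> lres A B f \<Delta> C" by blast
    have "(h, z + w) \<in> lres A B f (lplus A \<Gamma> \<Delta>) C"
      using lplus_memI[OF A \<Gamma> \<Delta>] zw C h by (simp add: lres_mem)
    then show "\<exists>z. (h, z) \<in> lres A B f (lplus A \<Gamma> \<Delta>) C \<and> (h, z) \<in> lplus B (lres A B f \<Gamma>) (lres A B f \<Delta>) C"
      using lplus_memI[OF B s[OF \<Gamma>] s[OF \<Delta>] zw] by blast
  qed
qed

lemma lres_id: "A \<in> Ob \<Longrightarrow> lsection A \<Gamma> \<Longrightarrow> lres A A (Ident a A) \<Gamma> = \<Gamma>"
proof (rule section_eqI)
  assume A: "A \<in> Ob" and \<Gamma>: "lsection A \<Gamma>"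
  show "locally A (\<lambda>B f. \<exists>z. (f, z) \<in> lres A A (Ident a A) \<Gamma> B \<and> (f, z) \<in> \<Gamma> B)"
    using section_dense[OF \<Gamma>] by (rule locally_mono) (use A in \<open>simp add: lres_mem\<close>)
qed (simp_all add: lres_section)

lemma lres_comp:
  assumes A: "A \<in> Ob" and B: "B \<in> Ob" and C: "C \<in> Ob" and f: "f \<in> Arr a B A" and g: "g \<in> Arr a C B" and \<Gamma>: "lsection A \<Gamma>"
  shows "lres A C (Comp a C B A f g) \<Gamma> = lres B C g (lres A B f \<Gamma>)"
proof (rule section_eqI[OF C])
  show 1: "lsection C (lres A C (Comp a C B A f g) \<Gamma>)" "lsection C (lres B C g (lres A B f \<Gamma>))"
    using assms by (simp_all add: lres_section)
  show "locally C (\<lambda>D h. \<exists>z. (h, z) \<in> lres A C (Comp a C B A f g) \<Gamma> D \<and> (h, z) \<in> lres B C g (lres A B f \<Gamma>) D)"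
    using section_dense[OF 1(1)] by (rule locally_mono) (use assms in \<open>simp add: lres_mem comp_assoc\<close>)
qed

lemma lres_hzero:
  assumes A: "A \<in> Ob" and B: "B \<in> Ob" and \<Gamma>: "lsection A \<Gamma>"
  shows "lres A B (hzero B A) \<Gamma> = unit B 0"
proof (rule section_eqI[OF B])
  show "locally B (\<lambda>C g. \<exists>z. (g, z) \<in> lres A B (hzero B A) \<Gamma> C \<and> (g, z) \<in> unit B 0 C)"
  proof (rule locally_all[OF B])
    fix C g assume "C \<in> Ob" "g \<in> Arr a C B"
    then show "\<exists>z. (g, z) \<in> lres A B (hzero B A) \<Gamma> C \<and> (g, z) \<in> unit B 0 C"
      using A B section_N[OF \<Gamma>, of C 0] by (intro exI[of _ 0]) (simp add: lres_mem unit_zero_mem)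
  qed
qed (use A B \<Gamma> in \<open>simp_all add: lres_section unit_section\<close>)

lemma LG_comm_group:
  assumes A: "A \<in> Ob"
  shows "comm_group (LG A)"
proof (rule comm_groupI; simp only: LG_simps)
  show "lsection A (lplus A \<Gamma> \<Delta>)" if "lsection A \<Gamma>" "lsection A \<Delta>" for \<Gamma> \<Delta>
    using lplus_section[OF A that] .
  show "lsection A (unit A 0)" using A by (simp add: unit_section)
  show "lplus A (lplus A \<Gamma> \<Delta>) \<Theta> = lplus A \<Gamma> (lplus A \<Delta> \<Theta>)"
    if \<Gamma>: "lsection A \<Gamma>" and \<Delta>: "lsection A \<Delta>" and \<Theta>: "lsection A \<Theta>" for \<Gamma> \<Delta> \<Theta>
  proof (rule section_eqI[OF A])
    have "locally A (\<lambda>B f. (\<exists>z. (f, z) \<in> \<Gamma> B) \<and> (\<exists>z. (f, z) \<in> \<Delta> B) \<and> (\<exists>z. (f, z) \<in> \<Theta> B))"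
      by (intro locally_conj section_dense that)
    then show "locally A (\<lambda>B f. \<exists>z. (f, z) \<in> lplus A (lplus A \<Gamma> \<Delta>) \<Theta> B \<and> (f, z) \<in> lplus A \<Gamma> (lplus A \<Delta> \<Theta>) B)"
    proof (rule locally_mono)
      fix B f assume "(\<exists>z. (f, z) \<in> \<Gamma> B) \<and> (\<exists>z. (f, z) \<in> \<Delta> B) \<and> (\<exists>z. (f, z) \<in> \<Theta> B)"
      then obtain u v w where "(f, u) \<in> \<Gamma> B" "(f, v) \<in> \<Delta> B" "(f, w) \<in> \<Theta> B" by blast
      then have "(f, u + v + w) \<in> lplus A (lplus A \<Gamma> \<Delta>) \<Theta> B" "(f, u + (v + w)) \<in> lplus A \<Gamma> (lplus A \<Delta> \<Theta>) B"
        using A that by (simp_all add: lplus_memI lplus_section)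
      then show "\<exists>z. (f, z) \<in> lplus A (lplus A \<Gamma> \<Delta>) \<Theta> B \<and> (f, z) \<in> lplus A \<Gamma> (lplus A \<Delta> \<Theta>) B"
        by (metis add.assoc)
    qed
  qed (intro lplus_section A that)+
  show "lplus A \<Gamma> \<Delta> = lplus A \<Delta> \<Gamma>" if \<Gamma>: "lsection A \<Gamma>" and \<Delta>: "lsection A \<Delta>" for \<Gamma> \<Delta>
  proof (rule section_eqI[OF A])
    have "locally A (\<lambda>B f. (\<exists>z. (f, z) \<in> \<Gamma> B) \<and> (\<exists>z. (f, z) \<in> \<Delta> B))"
      by (intro locally_conj section_dense that)
    then show "locally A (\<lambda>B f. \<exists>z. (f, z) \<in> lplus A \<Gamma> \<Delta> B \<and> (f, z) \<in> lplus A \<Delta> \<Gamma> B)"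
    proof (rule locally_mono)
      fix B f assume "(\<exists>z. (f, z) \<in> \<Gamma> B) \<and> (\<exists>z. (f, z) \<in> \<Delta> B)"
      then obtain u v where "(f, u) \<in> \<Gamma> B" "(f, v) \<in> \<Delta> B" by blast
      then have "(f, u + v) \<in> lplus A \<Gamma> \<Delta> B" "(f, v + u) \<in> lplus A \<Delta> \<Gamma> B"
        using A that by (simp_all add: lplus_memI)
      then show "\<exists>z. (f, z) \<in> lplus A \<Gamma> \<Delta> B \<and> (f, z) \<in> lplus A \<Delta> \<Gamma> B"
        by (metis add.commute)
    qed
  qed (intro lplus_section A that)+
  show "lplus A (unit A 0) \<Gamma> = \<Gamma>" if \<Gamma>: "lsection A \<Gamma>" for \<Gamma>
  proof (rule section_eqI[OF A])
    show "locally A (\<lambda>B f. \<exists>z. (f, z) \<in> lplus A (unit A 0) \<Gamma> B \<and> (f, z) \<in> \<Gamma> B)"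
      using section_dense[OF \<Gamma>]
    proof (rule locally_mono)
      fix B f assume B: "B \<in> Ob" "f \<in> Arr a B A" and "\<exists>z. (f, z) \<in> \<Gamma> B"
      then obtain z where z: "(f, z) \<in> \<Gamma> B" by blast
      have "(f, 0 + z) \<in> lplus A (unit A 0) \<Gamma> B"
        using A B \<Gamma> z by (intro lplus_memI unit_section unit_zero_mem) auto
      then show "\<exists>z. (f, z) \<in> lplus A (unit A 0) \<Gamma> B \<and> (f, z) \<in> \<Gamma> B" using z by auto
    qed
  qed (use A \<Gamma> in \<open>simp_all add: lplus_section unit_section\<close>)
  show "\<exists>\<Delta>\<in>carrier (LG A). lplus A \<Delta> \<Gamma> = unit A 0" if \<Gamma>: "lsection A \<Gamma>" for \<Gamma>
  \<comment> \<open>The inverse is restriction along minus the identity: restriction is additive in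
    the arrow, and restriction along zero gives the zero section.\<close>
  proof (rule bexI[of _ "lres A A (hneg A) \<Gamma>"])
    have "lplus A (lres A A (hneg A) \<Gamma>) (lres A A (Ident a A) \<Gamma>) = lres A A (hplus A A (hneg A) (Ident a A)) \<Gamma>"
      using A \<Gamma> by (simp add: lres_plus)
    then show "lplus A (lres A A (hneg A) \<Gamma>) \<Gamma> = unit A 0"
      using A \<Gamma> by (simp add: lres_id hneg_plus lres_hzero)
  qed (use A \<Gamma> in \<open>simp add: lres_section\<close>)
qed

text \<open>A section is determined by its pairs over the small set \<open>O0\<close> whose second
  component lies in \<open>Rep\<close>. A pair over another object is restricted to a
  \<open>C\<close> in \<open>O0\<close> of which that object is a retract, \<open>z\<close> is
  replaced there by a representative modulo \<open>N0\<close>, and restricting back recovers the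
  pair.\<close>

lemma small_LG:
  assumes A: "A \<in> Ob"
  shows "small TYPE('u) (carrier (LG A))"
proof -
  obtain O0 where O0: "O0 \<subseteq> Ob" "small TYPE('u) O0" "\<And>X. X \<in> Ob \<Longrightarrow> \<exists>Y\<in>O0. \<exists>f. is_iso a X Y f"
    using ess unfolding essentially_small_def by blast
  define \<Phi> where "\<Phi> \<Gamma> = {(B, f, q). B \<in> O0 \<and> q \<in> Rep B \<and> (f, q) \<in> \<Gamma> B}" for \<Gamma> :: "'o \<Rightarrow> ('u \<times> 'v) set"
  have le: "(f, z) \<in> \<Delta> B" if \<Gamma>: "lsection A \<Gamma>" and \<Delta>: "lsection A \<Delta>" and eq: "\<Phi> \<Gamma> = \<Phi> \<Delta>" and fz: "(f, z) \<in> \<Gamma> B" for \<Gamma> \<Delta> B f z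
  proof -
    note g = section_graph[OF \<Gamma>] and d = section_graph[OF \<Delta>]
    note B = graph_ob[OF g fz] and f = graph_arr[OF g fz] and z = graph_P[OF g fz]
    obtain C u v where C: "C \<in> O0" and u: "u \<in> Arr a B C" and v: "v \<in> Arr a C B" and vu: "Comp a B C B v u = Ident a B"
      using O0(3)[OF B] unfolding is_iso_def by blast
    have CO: "C \<in> Ob" using C O0 by blast
    have fv: "(Comp a C B A f v, res B C v z) \<in> \<Gamma> C" using graph_res[OF g fz CO v] .
    have zP: "res B C v z \<in> P C" using B CO v z by simp
    obtain q where q: "q \<in> Rep C" "res B C v z - q \<in> N0 C" using Rep(3)[OF CO zP] by blast
    have qP: "q \<in> P C" using Rep(2)[OF CO] q by blast
    have "0 - (res B C v z - q) \<in> N0 C" using N0_diff[OF CO N0_zero q(2)] CO by simp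
    then have "(Comp a C B A f v, q) \<in> \<Gamma> C"
      using section_shift[OF \<Gamma> A fv qP] N0_N[OF CO] by simp
    then have "(C, Comp a C B A f v, q) \<in> \<Phi> \<Gamma>" using C q by (simp add: \<Phi>_def)
    then have "(C, Comp a C B A f v, q) \<in> \<Phi> \<Delta>" by (simp only: eq)
    then have "(Comp a C B A f v, q) \<in> \<Delta> C" by (simp add: \<Phi>_def)
    then have "(Comp a C B A f v, res B C v z) \<in> \<Delta> C"
      using section_shift[OF \<Delta> A _ zP N0_N[OF CO q(2)]] by blast
    then have "(Comp a B C A (Comp a C B A f v) u, res C B u (res B C v z)) \<in> \<Delta> B"
      using graph_res[OF d _ B u] by blast
    moreover have "Comp a B C A (Comp a C B A f v) u = f"
      using comp_assoc[OF B CO B A u v f] vu A B f by simp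
    moreover have "res C B u (res B C v z) = z"
      using res_comp[OF B CO B v u z] vu B z by simp
    ultimately show ?thesis by simp
  qed
  show ?thesis
  proof (rule small_inj_on[of \<Phi>])
    show "inj_on \<Phi> (carrier (LG A))"
    proof (rule inj_onI)
      fix \<Gamma> \<Delta> assume *: "\<Gamma> \<in> carrier (LG A)" "\<Delta> \<in> carrier (LG A)" and eq: "\<Phi> \<Gamma> = \<Phi> \<Delta>"
      then have "(f, z) \<in> \<Gamma> B \<longleftrightarrow> (f, z) \<in> \<Delta> B" for f z B
        using le[of \<Gamma> \<Delta> f z B] le[of \<Delta> \<Gamma> f z B] by auto
      then show "\<Gamma> = \<Delta>" by (simp add: fun_eq_iff set_eq_iff)
    qed
    have "\<Phi> ` carrier (LG A) \<subseteq> Pow (SIGMA B:O0. Arr a B A \<times> Rep B)"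
      using graph_arr[OF section_graph] by (auto simp: \<Phi>_def)
    then show "small TYPE('u) (\<Phi> ` carrier (LG A))"
      by (rule small_mono[rotated]) (use A O0 in \<open>auto intro!: small_Pow small_Sigma small_Times small_arr Rep(1)\<close>)
  qed
qed

lemma unit_plus:
  assumes A: "A \<in> Ob" and z: "z \<in> P A" and w: "w \<in> P A"
  shows "unit A (z + w) = lplus A (unit A z) (unit A w)"
proof (rule section_eqI[OF A])
  show "locally A (\<lambda>B f. \<exists>y. (f, y) \<in> unit A (z + w) B \<and> (f, y) \<in> lplus A (unit A z) (unit A w) B)"
  proof (rule locally_all[OF A])
    fix B f assume B: "B \<in> Ob" and f: "f \<in> Arr a B A"
    have "(f, res A B f z + res A B f w) \<in> lplus A (unit A z) (unit A w) B"
      using assms B f by (intro lplus_memI unit_section unit_res)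
    moreover have "(f, res A B f z + res A B f w) \<in> unit A (z + w) B"
      using unit_res[OF A B f, of "z + w"] assms B f by (simp add: res_add)
    ultimately show "\<exists>y. (f, y) \<in> unit A (z + w) B \<and> (f, y) \<in> lplus A (unit A z) (unit A w) B" by blast
  qed
qed (use assms in \<open>simp_all add: unit_section lplus_section\<close>)

text \<open>The dictionary between graphs and sections: a pair says that the restriction along the
  arrow is the section induced by the generator.\<close>

lemma unit_mem_iff:
  assumes A: "A \<in> Ob" and \<Gamma>: "lsection A \<Gamma>" and B: "B \<in> Ob" and f: "f \<in> Arr a B A" and z: "z \<in> P B"
  shows "(f, z) \<in> \<Gamma> B \<longleftrightarrow> lres A B f \<Gamma> = unit B z"
proof
  assume fz: "(f, z) \<in> \<Gamma> B"
  show "lres A B f \<Gamma> = unit B z"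
  proof (rule section_eqI[OF B])
    show "locally B (\<lambda>C g. \<exists>w. (g, w) \<in> lres A B f \<Gamma> C \<and> (g, w) \<in> unit B z C)"
    proof (rule locally_all[OF B])
      fix C g assume "C \<in> Ob" "g \<in> Arr a C B"
      then show "\<exists>w. (g, w) \<in> lres A B f \<Gamma> C \<and> (g, w) \<in> unit B z C"
        using graph_res[OF section_graph[OF \<Gamma>] fz] unit_res[OF B] z by (intro exI[of _ "res B C g z"]) (simp add: lres_mem)
    qed
  qed (use assms in \<open>simp_all add: lres_section unit_section\<close>)
next
  assume "lres A B f \<Gamma> = unit B z"
  then have "(Ident a B, z) \<in> lres A B f \<Gamma> B" using unit_res[OF B B id_arr[OF B] z] B z by simp
  then show "(f, z) \<in> \<Gamma> B" using A B f by (simp add: lres_mem)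
qed

lemma unit_eq_zero_iff:
  assumes A: "A \<in> Ob" and z: "z \<in> P A"
  shows "unit A z = unit A 0 \<longleftrightarrow> z \<in> N A"
proof
  assume "unit A z = unit A 0"
  then have "(Ident a A, z) \<in> unit A 0 A" using unit_res[OF A A id_arr[OF A] z] A z by simp
  then show "z \<in> N A" using A by (simp add: unit_def)
next
  assume N: "z \<in> N A"
  show "unit A z = unit A 0"
  proof (rule section_eqI[OF A])
    show "locally A (\<lambda>B f. \<exists>w. (f, w) \<in> unit A z B \<and> (f, w) \<in> unit A 0 B)"
    proof (rule locally_all[OF A])
      fix B f assume "B \<in> Ob" "f \<in> Arr a B A"
      then show "\<exists>w. (f, w) \<in> unit A z B \<and> (f, w) \<in> unit A 0 B"
        using A z N_res[OF A _ _ N] by (intro exI[of _ "res A B f z"]) (simp add: unit_def)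
    qed
  qed (use A z in \<open>simp_all add: unit_section\<close>)
qed

lemma lres_unit: "A \<in> Ob \<Longrightarrow> B \<in> Ob \<Longrightarrow> f \<in> Arr a B A \<Longrightarrow> z \<in> P A \<Longrightarrow> lres A B f (unit A z) = unit B (res A B f z)"
  using unit_mem_iff[of A "unit A z" B f "res A B f z"] by (simp add: unit_section unit_res)

text \<open>The glued graph relates \<open>f\<close> in \<open>R\<close> to the elements over
  \<open>B\<close> that induce \<open>s B f\<close>. There may be none over \<open>B\<close> itself,
  but there are some on a cover, so the domain is still covering; the closure is the glued
  section.\<close>

lemma section_glue:
  assumes R: "J A R" and s: "\<And>B f. B \<in> Ob \<Longrightarrow> f \<in> R B \<Longrightarrow> lsection B (s B f)"
    and s_plus: "\<And>B f g. B \<in> Ob \<Longrightarrow> f \<in> R B \<Longrightarrow> g \<in> R B \<Longrightarrow> s B (hplus B A f g) = lplus B (s B f) (s B g)"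
    and s_res: "\<And>B C f g. B \<in> Ob \<Longrightarrow> C \<in> Ob \<Longrightarrow> f \<in> R B \<Longrightarrow> g \<in> Arr a C B \<Longrightarrow> s C (Comp a C B A f g) = lres B C g (s B f)"
  obtains \<Gamma> where "lsection A \<Gamma>" "\<And>B f. B \<in> Ob \<Longrightarrow> f \<in> R B \<Longrightarrow> lres A B f \<Gamma> = s B f"
proof -
  have A: "A \<in> Ob" and sv: "sieve A R" using R J_ob J_sieve by blast+
  define \<Gamma> where "\<Gamma> B = (if B \<in> Ob then {(f, z). f \<in> R B \<and> (Ident a B, z) \<in> s B f B} else {})" for B
  have \<Gamma>I: "(Comp a C B A f g, z) \<in> \<Gamma> C" if "B \<in> Ob" "C \<in> Ob" "f \<in> R B" "g \<in> Arr a C B" "(g, z) \<in> s B f C" for B C f g z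
    using that s_res[OF that(1-4)] sieve_comp[OF sv that(1-4)] by (simp add: \<Gamma>_def lres_mem)
  have "graph A \<Gamma>"
  proof -
    have plus: "(hplus B A f g, z + w) \<in> \<Gamma> B" if B: "B \<in> Ob" and f: "(f, z) \<in> \<Gamma> B" and g: "(g, w) \<in> \<Gamma> B" for B f z g w
    proof -
      have "(Ident a B, z + w) \<in> lplus B (s B f) (s B g) B" using f g B s by (intro lplus_memI) (auto simp: \<Gamma>_def)
      then show ?thesis using f g B sieve_plus[OF sv] s_plus by (auto simp: \<Gamma>_def)
    qed
    have res: "(Comp a C B A f g, res B C g z) \<in> \<Gamma> C" if B: "B \<in> Ob" and C: "C \<in> Ob" and g: "g \<in> Arr a C B" and f: "(f, z) \<in> \<Gamma> B" for B C f z g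
    proof -
      have f': "f \<in> R B" "(Ident a B, z) \<in> s B f B" using f B by (auto simp: \<Gamma>_def)
      have "(g, res B C g z) \<in> s B f C" using graph_res[OF section_graph[OF s[OF B f'(1)]] f'(2) C g] B C g by simp
      then show ?thesis using \<Gamma>I[OF B C f'(1) g] by blast
    qed
    have s0: "s B (hzero B A) = unit B 0" if B: "B \<in> Ob" for B
      using s_res[OF B B sieve_zero[OF sv B], of "hzero B B"] lres_hzero[OF B B s[OF B sieve_zero[OF sv B]]] A B by simp
    define D where "D B = {f. \<exists>z. (f, z) \<in> \<Gamma> B}" for B
    have "sieve A D"
      unfolding sieve_def
    proof (intro conjI allI impI ballI)
      fix B assume B: "B \<in> Ob"
      show "D B \<subseteq> Arr a B A" using sieve_arr[OF sv B] B by (auto simp: D_def \<Gamma>_def)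
      show "hzero B A \<in> D B" using sieve_zero[OF sv B] s0[OF B] unit_zero_mem[OF B B id_arr[OF B]] B by (auto simp: D_def \<Gamma>_def)
      show "hplus B A f g \<in> D B" if "f \<in> D B" "g \<in> D B" for f g
      proof -
        obtain z w where "(f, z) \<in> \<Gamma> B" "(g, w) \<in> \<Gamma> B" using \<open>f \<in> D B\<close> \<open>g \<in> D B\<close> by (auto simp: D_def)
        then show ?thesis unfolding D_def using plus[OF B] by blast
      qed
    next
      show "Comp a C B A f g \<in> D C" if "B \<in> Ob" "C \<in> Ob" "f \<in> D B" "g \<in> Arr a C B" for B C f g
      proof -
        obtain z where "(f, z) \<in> \<Gamma> B" using \<open>f \<in> D B\<close> by (auto simp: D_def)
        then show ?thesis unfolding D_def using res[OF that(1,2,4)] by blast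
      qed
    qed (simp add: D_def \<Gamma>_def)
    then have "J A D"
    proof (rule locally_trans)
      show "locally A (\<lambda>B f. locally B (\<lambda>C g. Comp a C B A f g \<in> D C))"
      proof (rule J_locally[OF R])
        fix B f assume B: "B \<in> Ob" and f: "f \<in> R B"
        show "locally B (\<lambda>C g. Comp a C B A f g \<in> D C)"
          using section_dense[OF s[OF B f]] by (rule locally_mono) (use \<Gamma>I[OF B _ f] in \<open>unfold D_def, blast\<close>)
      qed
    qed
    then have dense: "locally A (\<lambda>B f. \<exists>z. (f, z) \<in> \<Gamma> B)" by (rule J_locally) (simp add: D_def)
    show ?thesis
      unfolding graph_def
    proof (intro conjI ballI allI impI dense)
      show "\<Gamma> B = {}" if "B \<notin> Ob" for B using that by (simp add: \<Gamma>_def)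
      show "\<Gamma> B \<subseteq> Arr a B A \<times> P B" if "B \<in> Ob" for B
        using that sieve_arr[OF sv that] graph_P[OF section_graph[OF s[OF that]]] by (auto simp: \<Gamma>_def)
      show "z \<in> N B" if "B \<in> Ob" "(hzero B A, z) \<in> \<Gamma> B" for B z
        using that s0[OF that(1)] by (simp add: \<Gamma>_def unit_def)
    qed (use plus res in blast)+
  qed
  note g = this
  show thesis
  proof (rule that[of "closure A \<Gamma>"])
    show cs: "lsection A (closure A \<Gamma>)" by (rule closure_section[OF A g])
    fix B f assume B: "B \<in> Ob" and f: "f \<in> R B"
    have f': "f \<in> Arr a B A" using sieve_arr[OF sv B f] .
    show "lres A B f (closure A \<Gamma>) = s B f"
    proof (rule section_eqI[OF B lres_section[OF A B f' cs] s[OF B f]])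
      show "locally B (\<lambda>C g. \<exists>z. (g, z) \<in> lres A B f (closure A \<Gamma>) C \<and> (g, z) \<in> s B f C)"
        using section_dense[OF s[OF B f]]
      proof (rule locally_mono)
        fix C h assume C: "C \<in> Ob" and h: "h \<in> Arr a C B" and "\<exists>z. (h, z) \<in> s B f C"
        then obtain z where z: "(h, z) \<in> s B f C" by blast
        have "(Comp a C B A f h, z) \<in> closure A \<Gamma> C" by (rule closure_extends[OF g \<Gamma>I[OF B C f h z]])
        then show "\<exists>z. (h, z) \<in> lres A B f (closure A \<Gamma>) C \<and> (h, z) \<in> s B f C"
          using z C h by (intro exI[of _ z]) (simp add: lres_mem)
      qed
    qed
  qed
qed

text \<open>Sheafification of \<open>P\<close> modulo \<open>N0\<close>, described by what later
  proofs use: the kernel of \<open>\<iota>\<close> is \<open>N\<close>, and every section is locally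
  in the image of \<open>\<iota>\<close>.\<close>

theorem associated_sheaf:
  obtains F \<iota> where "sheaf F" "\<And>A z. A \<in> Ob \<Longrightarrow> z \<in> P A \<Longrightarrow> \<iota> A z \<in> crr F A"
    "\<And>A z w. A \<in> Ob \<Longrightarrow> z \<in> P A \<Longrightarrow> w \<in> P A \<Longrightarrow> \<iota> A (z + w) = \<iota> A z \<oplus>\<^bsub>fobj F A\<^esub> \<iota> A w"
    "\<And>A B f z. A \<in> Ob \<Longrightarrow> B \<in> Ob \<Longrightarrow> f \<in> Arr a B A \<Longrightarrow> z \<in> P A \<Longrightarrow> \<iota> B (res A B f z) = fmap F A B f (\<iota> A z)"
    "\<And>A z. A \<in> Ob \<Longrightarrow> z \<in> P A \<Longrightarrow> \<iota> A z = \<zero>\<^bsub>fobj F A\<^esub> \<longleftrightarrow> z \<in> N A"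
    "\<And>A x. A \<in> Ob \<Longrightarrow> x \<in> crr F A \<Longrightarrow> locally A (\<lambda>B f. \<exists>z\<in>P B. fmap F A B f x = \<iota> B z)"
proof -
  obtain F e where F: "psh F" and bij: "\<And>A. A \<in> Ob \<Longrightarrow> bij_betw (e A) (carrier (LG A)) (crr F A)"
    and e_plus: "\<And>A x y. A \<in> Ob \<Longrightarrow> x \<in> carrier (LG A) \<Longrightarrow> y \<in> carrier (LG A) \<Longrightarrow> e A (x \<otimes>\<^bsub>LG A\<^esub> y) = e A x \<oplus>\<^bsub>fobj F A\<^esub> e A y"
    and e_res: "\<And>A B f x. A \<in> Ob \<Longrightarrow> B \<in> Ob \<Longrightarrow> f \<in> Arr a B A \<Longrightarrow> x \<in> carrier (LG A) \<Longrightarrow> e B (lres A B f x) = fmap F A B f (e A x)"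
    by (rule presheaf_from_groups[of LG lres, OF LG_comm_group small_LG])
      ((rule that; assumption) | simp add: lres_section lres_lplus lres_id lres_comp lres_plus)+
  have e_mem: "e A \<Gamma> \<in> crr F A" if "A \<in> Ob" "lsection A \<Gamma>" for A \<Gamma>
    using bij[OF that(1)] that by (auto simp: bij_betw_def)
  have e_inj: "e A \<Gamma> = e A \<Delta> \<longleftrightarrow> \<Gamma> = \<Delta>" if "A \<in> Ob" "lsection A \<Gamma>" "lsection A \<Delta>" for A \<Gamma> \<Delta>
    using bij[OF that(1)] that by (auto simp: bij_betw_def inj_on_def)
  have e_surj: "\<exists>\<Gamma>. lsection A \<Gamma> \<and> x = e A \<Gamma>" if "A \<in> Ob" "x \<in> crr F A" for A x
  proof -
    have "x \<in> e A ` carrier (LG A)" using bij[OF that(1)] that(2) by (simp add: bij_betw_def)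
    then show ?thesis by auto
  qed
  have e_zero: "e A (unit A 0) = \<zero>\<^bsub>fobj F A\<^esub>" if A: "A \<in> Ob" for A
    using e_plus[OF A, of "unit A 0" "unit A 0"] unit_plus[OF A, of 0 0] A F
    by (intro psh_plus_self) (simp_all add: unit_section e_mem)
  have "sheaf F"
    unfolding sheaf_def separated_def
  proof (intro conjI ballI allI impI F)
    fix A x assume A: "A \<in> Ob" and x: "x \<in> crr F A" and loc: "locally A (\<lambda>B f. fmap F A B f x = \<zero>\<^bsub>fobj F B\<^esub>)"
    obtain \<Gamma> where \<Gamma>: "lsection A \<Gamma>" "x = e A \<Gamma>" using e_surj[OF A x] by blast
    have "\<Gamma> = unit A 0"
    proof (rule section_eqI[OF A \<Gamma>(1)])
      show "locally A (\<lambda>B f. \<exists>z. (f, z) \<in> \<Gamma> B \<and> (f, z) \<in> unit A 0 B)"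
        using loc
      proof (rule locally_mono)
        fix B f assume B: "B \<in> Ob" and f: "f \<in> Arr a B A" and "fmap F A B f x = \<zero>\<^bsub>fobj F B\<^esub>"
        then have "e B (lres A B f \<Gamma>) = e B (unit B 0)"
          using e_res[OF A B f] e_zero[OF B] \<Gamma> by simp
        then have "lres A B f \<Gamma> = unit B 0"
          using e_inj[OF B lres_section[OF A B f \<Gamma>(1)] unit_section[OF B P_zero[OF B]]] by simp
        then have "(f, 0) \<in> \<Gamma> B" using unit_mem_iff[OF A \<Gamma>(1) B f] B by simp
        then show "\<exists>z. (f, z) \<in> \<Gamma> B \<and> (f, z) \<in> unit A 0 B" using unit_zero_mem[OF A B f] by blast
      qed
    qed (use A in \<open>simp add: unit_section\<close>)
    then show "x = \<zero>\<^bsub>fobj F A\<^esub>" using \<Gamma> e_zero[OF A] by simp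
  next
    fix A R s assume R: "J A R" and s: "compat F A R s"
    have A: "A \<in> Ob" using R J_ob by blast
    note sv = J_sieve[OF R]
    \<comment> \<open>The given family with values in \<open>'u\<close> is decoded to sections,
      glued as graphs, and the result is encoded again by \<open>e\<close>.\<close>
    define t where "t B f = (SOME \<Gamma>. lsection B \<Gamma> \<and> s B f = e B \<Gamma>)" for B f
    have t: "lsection B (t B f)" "s B f = e B (t B f)" if "B \<in> Ob" "f \<in> R B" for B f
      using someI_ex[OF e_surj[of B "s B f"]] that s unfolding t_def compat_def by auto
    obtain \<Gamma> where \<Gamma>: "lsection A \<Gamma>" "\<And>B f. B \<in> Ob \<Longrightarrow> f \<in> R B \<Longrightarrow> lres A B f \<Gamma> = t B f"
    proof (rule section_glue[OF R t(1)])
      show "t B (hplus B A f g) = lplus B (t B f) (t B g)" if B: "B \<in> Ob" and f: "f \<in> R B" and g: "g \<in> R B" for B f g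
      proof -
        have "e B (t B (hplus B A f g)) = e B (lplus B (t B f) (t B g))"
          using s t(2)[OF B f] t(2)[OF B g] t(2)[OF B sieve_plus[OF sv B f g]] e_plus[OF B, of "t B f" "t B g"] t(1) B f g
          by (simp add: compat_def)
        then show ?thesis
          using e_inj[OF B t(1)[OF B sieve_plus[OF sv B f g]] lplus_section[OF B t(1)[OF B f] t(1)[OF B g]]] by simp
      qed
      show "t C (Comp a C B A f g) = lres B C g (t B f)" if B: "B \<in> Ob" and C: "C \<in> Ob" and f: "f \<in> R B" and g: "g \<in> Arr a C B" for B C f g
      proof -
        have "e C (t C (Comp a C B A f g)) = e C (lres B C g (t B f))"
          using s t(2)[OF B f] t(2)[OF C sieve_comp[OF sv B C f g]] e_res[OF B C g, of "t B f"] t(1) B C f g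
          by (simp add: compat_def)
        then show ?thesis
          using e_inj[OF C t(1)[OF C sieve_comp[OF sv B C f g]] lres_section[OF B C g t(1)[OF B f]]] by simp
      qed
    qed blast+
    have "fmap F A B f (e A \<Gamma>) = s B f" if "B \<in> Ob" "f \<in> R B" for B f
      using e_res[OF A that(1) sieve_arr[OF sv that], of \<Gamma>] \<Gamma> t(2)[OF that] that by simp
    then show "\<exists>x\<in>crr F A. \<forall>B\<in>Ob. \<forall>f\<in>R B. fmap F A B f x = s B f" using e_mem[OF A \<Gamma>(1)] by blast
  qed
  moreover define \<iota> where "\<iota> A z = e A (unit A z)" for A z
  moreover have "\<iota> A z \<in> crr F A" if "A \<in> Ob" "z \<in> P A" for A z
    using that by (simp add: \<iota>_def e_mem unit_section)
  moreover have "\<iota> A (z + w) = \<iota> A z \<oplus>\<^bsub>fobj F A\<^esub> \<iota> A w" if "A \<in> Ob" "z \<in> P A" "w \<in> P A" for A z w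
    using e_plus[of A "unit A z" "unit A w"] that by (simp add: \<iota>_def unit_plus unit_section)
  moreover have "\<iota> B (res A B f z) = fmap F A B f (\<iota> A z)" if "A \<in> Ob" "B \<in> Ob" "f \<in> Arr a B A" "z \<in> P A" for A B f z
    using e_res[of A B f "unit A z"] that by (simp add: \<iota>_def lres_unit unit_section)
  moreover have "\<iota> A z = \<zero>\<^bsub>fobj F A\<^esub> \<longleftrightarrow> z \<in> N A" if "A \<in> Ob" "z \<in> P A" for A z
    using e_inj[of A "unit A z" "unit A 0"] e_zero[of A] unit_eq_zero_iff[of A z] that by (simp add: \<iota>_def unit_section)
  moreover have "locally A (\<lambda>B f. \<exists>z\<in>P B. fmap F A B f x = \<iota> B z)" if A: "A \<in> Ob" and x: "x \<in> crr F A" for A x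
  proof -
    obtain \<Gamma> where \<Gamma>: "lsection A \<Gamma>" "x = e A \<Gamma>" using e_surj[OF A x] by blast
    show ?thesis
      using section_dense[OF \<Gamma>(1)]
    proof (rule locally_mono)
      fix B f assume B: "B \<in> Ob" and f: "f \<in> Arr a B A" and "\<exists>z. (f, z) \<in> \<Gamma> B"
      then obtain z where z: "(f, z) \<in> \<Gamma> B" by blast
      have zP: "z \<in> P B" using graph_P[OF section_graph[OF \<Gamma>(1)] z] .
      have "lres A B f \<Gamma> = unit B z" using unit_mem_iff[OF A \<Gamma>(1) B f zP] z by simp
      then show "\<exists>z\<in>P B. fmap F A B f x = \<iota> B z" using zP e_res[OF A B f, of \<Gamma>] \<Gamma> by (intro bexI[of _ z]) (simp_all add: \<iota>_def)
    qed
  qed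
  ultimately show thesis using that by blast
qed

end

section \<open>Colimits of sheaves\<close>

text \<open>A sum of presheaves with identifications \<open>Rel\<close>, which may be an arbitrary
  restriction-stable set of pairs. The instances are: one term whose subobject becomes zero
  (cokernels), no term (zero object), two terms without identifications (products), diagrams over a
  category, and the representables (generator).\<close>

locale presheaf_diagram = linear_topology k a J
  for k :: "'k ring" and a :: "('k, 'o, 'u) lincat" and J +
  fixes I :: "'i set" and D :: "'i \<Rightarrow> ('k, 'o, 'u) presheaf" and Rel :: "'o \<Rightarrow> (('i \<times> 'u) \<times> ('i \<times> 'u)) set"
  assumes small_I: "small TYPE('u) I"
    and D_psh: "i \<in> I \<Longrightarrow> D i \<in> Obj (PSh k a)"
    and Rel_mem: "A \<in> Obj a \<Longrightarrow> ((i, x), (j, y)) \<in> Rel A \<Longrightarrow>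
      i \<in> I \<and> j \<in> I \<and> x \<in> carrier (fobj (D i) A) \<and> y \<in> carrier (fobj (D j) A)"
    and Rel_res: "A \<in> Obj a \<Longrightarrow> B \<in> Obj a \<Longrightarrow> f \<in> Arr a B A \<Longrightarrow> ((i, x), (j, y)) \<in> Rel A \<Longrightarrow>
      ((i, fmap (D i) A B f x), (j, fmap (D j) A B f y)) \<in> Rel B"
begin

definition gens :: "'o \<Rightarrow> ('i \<times> 'u) set" where
  "gens A = (SIGMA i:I. crr (D i) A)"

definition pre :: "'o \<Rightarrow> ('i \<times> 'u \<Rightarrow>\<^sub>0 int) set" where
  "pre A = {z. Poly_Mapping.keys z \<subseteq> gens A}"

definition pres :: "'o \<Rightarrow> 'o \<Rightarrow> 'u \<Rightarrow> ('i \<times> 'u \<Rightarrow>\<^sub>0 int) \<Rightarrow> ('i \<times> 'u \<Rightarrow>\<^sub>0 int)" where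
  "pres A B f = frag_extend (\<lambda>(i, x). frag_of (i, fmap (D i) A B f x))"

text \<open>The subgroup that cuts the free group down to the sum of the groups \<open>D i A\<close>
  modulo the identifications. Local relations are added only by \<open>N\<close>.\<close>

inductive_set rels :: "'o \<Rightarrow> ('i \<times> 'u \<Rightarrow>\<^sub>0 int) set" for A :: 'o where
  zero: "0 \<in> rels A"
| add: "i \<in> I \<Longrightarrow> x \<in> carrier (fobj (D i) A) \<Longrightarrow> y \<in> carrier (fobj (D i) A) \<Longrightarrow>
    frag_of (i, x \<oplus>\<^bsub>fobj (D i) A\<^esub> y) - frag_of (i, x) - frag_of (i, y) \<in> rels A"
| rel: "((i, x), (j, y)) \<in> Rel A \<Longrightarrow> frag_of (i, x) - frag_of (j, y) \<in> rels A"
| diff: "z \<in> rels A \<Longrightarrow> w \<in> rels A \<Longrightarrow> z - w \<in> rels A"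

text \<open>Modulo \<open>rels\<close> all terms with the same index merge into one with coefficient
  1, so sums with at most one term per index represent every class. They form a small set, while the
  free group is infinite as soon as there is a generator, and an infinite set is not small when
  \<open>'u\<close> is countable.\<close>

definition reps :: "'o \<Rightarrow> ('i \<times> 'u \<Rightarrow>\<^sub>0 int) set" where
  "reps A = {(\<Sum>i\<in>K. frag_of (i, y i)) | K y. finite K \<and> K \<subseteq> I \<and> y \<in> (\<Pi>\<^sub>E i\<in>I. crr (D i) A)}"

lemma pre_diff: "z \<in> pre A \<Longrightarrow> w \<in> pre A \<Longrightarrow> z - w \<in> pre A"
  using keys_diff[of z w] by (auto simp: pre_def)

lemma pre_zero[simp]: "0 \<in> pre A"
  by (simp add: pre_def)

lemma frag_pre[simp]: "i \<in> I \<Longrightarrow> x \<in> crr (D i) A \<Longrightarrow> frag_of (i, x) \<in> pre A"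
  by (simp add: pre_def gens_def keys_frag_of)

lemma pre_induct[consumes 1, case_names zero frag diff]:
  assumes "z \<in> pre A" "Q 0" "\<And>i x. i \<in> I \<Longrightarrow> x \<in> crr (D i) A \<Longrightarrow> Q (frag_of (i, x))"
    "\<And>z w. z \<in> pre A \<Longrightarrow> w \<in> pre A \<Longrightarrow> Q z \<Longrightarrow> Q w \<Longrightarrow> Q (z - w)"
  shows "Q z"
  using assms(1)[unfolded pre_def mem_Collect_eq]
  by (rule free_Abelian_group_induct) (use assms in \<open>auto simp: pre_def gens_def\<close>)

lemma pres_frag[simp]: "pres A B f (frag_of (i, x)) = frag_of (i, fmap (D i) A B f x)"
  by (simp add: pres_def)

lemma pres_diff: "pres A B f (z - w) = pres A B f z - pres A B f w"
  by (simp add: pres_def frag_extend_diff)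

lemma pres_zero[simp]: "pres A B f 0 = 0"
  by (simp add: pres_def)

lemma pres_pre:
  assumes "A \<in> Ob" "B \<in> Ob" "f \<in> Arr a B A" "z \<in> pre A"
  shows "pres A B f z \<in> pre B"
  using assms(4,1-3) by (induction z rule: pre_induct) (auto simp: D_psh psh_closed pres_diff pre_diff)

lemma rels_pre:
  assumes "A \<in> Ob" "z \<in> rels A"
  shows "z \<in> pre A"
  using assms(2,1) by (induction z rule: rels.induct) (use Rel_mem in \<open>auto intro!: pre_diff frag_pre simp: D_psh\<close>)

lemma rels_plus: "z \<in> rels A \<Longrightarrow> w \<in> rels A \<Longrightarrow> z + w \<in> rels A"
  using rels.diff[OF _ rels.diff[OF rels.zero], of z A w] by simp

text \<open>The new term is merged with the term of index \<open>i\<close>, or with a zero term if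
  that index does not occur.\<close>

lemma reps_step:
  assumes A: "A \<in> Ob" and w: "w \<in> reps A" and i: "i \<in> I" and x: "x \<in> crr (D i) A"
  shows "\<exists>w'\<in>reps A. w + frag_of (i, x) - w' \<in> rels A" "\<exists>w'\<in>reps A. w - frag_of (i, x) - w' \<in> rels A"
proof -
  interpret Di: abelian_group "fobj (D i) A" using psh_group[OF D_psh[OF i] A] .
  obtain K y where K: "finite K" "K \<subseteq> I" and y: "y \<in> (\<Pi>\<^sub>E i\<in>I. crr (D i) A)" and w: "w = (\<Sum>i\<in>K. frag_of (i, y i))"
    using w by (auto simp: reps_def)
  define y0 where "y0 = (if i \<in> K then y i else \<zero>\<^bsub>fobj (D i) A\<^esub>)"
  define w0 where "w0 = (\<Sum>j\<in>K - {i}. frag_of (j, y j))"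
  have y0: "y0 \<in> crr (D i) A" using y i by (auto simp: y0_def)
  \<comment> \<open>The additivity relation for 0 + 0 is minus this generator.\<close>
  have f0: "frag_of (i, \<zero>\<^bsub>fobj (D i) A\<^esub>) \<in> rels A"
    using rels.diff[OF rels.zero rels.add[OF i Di.zero_closed Di.zero_closed]] by simp
  have w_eq: "w - (w0 + frag_of (i, y0)) \<in> rels A"
  proof (cases "i \<in> K")
    case True
    then have "w = frag_of (i, y i) + w0" unfolding w w0_def using K by (simp add: sum.remove)
    then show ?thesis using True by (simp add: y0_def rels.zero)
  next
    case False
    then have "w = w0" by (simp add: w w0_def)
    then show ?thesis using False rels.diff[OF rels.zero f0] by (simp add: y0_def)
  qed
  have upd: "w0 + frag_of (i, v) \<in> reps A" if v: "v \<in> crr (D i) A" for v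
  proof -
    have "w0 + frag_of (i, v) = (\<Sum>j\<in>insert i K. frag_of (j, (y(i := v)) j))"
    proof -
      have "(\<Sum>j\<in>insert i K. frag_of (j, (y(i := v)) j)) = frag_of (i, v) + (\<Sum>j\<in>K - {i}. frag_of (j, (y(i := v)) j))"
        using K by (simp add: sum.insert_remove)
      also have "(\<Sum>j\<in>K - {i}. frag_of (j, (y(i := v)) j)) = w0"
        unfolding w0_def by (rule sum.cong) auto
      finally show ?thesis by (simp add: add.commute)
    qed
    moreover have "y(i := v) \<in> (\<Pi>\<^sub>E i\<in>I. crr (D i) A)" using y i v by (auto simp: PiE_iff extensional_def)
    ultimately show ?thesis unfolding reps_def using K i by blast
  qed
  show "\<exists>w'\<in>reps A. w + frag_of (i, x) - w' \<in> rels A"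
  proof (rule bexI[OF _ upd])
    show "y0 \<oplus>\<^bsub>fobj (D i) A\<^esub> x \<in> crr (D i) A" using y0 x by simp
    have "(w - (w0 + frag_of (i, y0))) - (frag_of (i, y0 \<oplus>\<^bsub>fobj (D i) A\<^esub> x) - frag_of (i, y0) - frag_of (i, x)) \<in> rels A"
      by (rule rels.diff[OF w_eq rels.add[OF i y0 x]])
    then show "w + frag_of (i, x) - (w0 + frag_of (i, y0 \<oplus>\<^bsub>fobj (D i) A\<^esub> x)) \<in> rels A"
      by (simp add: algebra_simps)
  qed
  show "\<exists>w'\<in>reps A. w - frag_of (i, x) - w' \<in> rels A"
  proof (rule bexI[OF _ upd])
    show m: "y0 \<ominus>\<^bsub>fobj (D i) A\<^esub> x \<in> crr (D i) A" using y0 x by simp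
    have "(y0 \<ominus>\<^bsub>fobj (D i) A\<^esub> x) \<oplus>\<^bsub>fobj (D i) A\<^esub> x = y0"
      using y0 x by (simp add: Di.minus_eq Di.a_assoc Di.l_neg)
    then have "(w - (w0 + frag_of (i, y0))) + (frag_of (i, y0) - frag_of (i, y0 \<ominus>\<^bsub>fobj (D i) A\<^esub> x) - frag_of (i, x)) \<in> rels A"
      using rels_plus[OF w_eq rels.add[OF i m x]] by simp
    then show "w - frag_of (i, x) - (w0 + frag_of (i, y0 \<ominus>\<^bsub>fobj (D i) A\<^esub> x)) \<in> rels A"
      by (simp add: algebra_simps)
  qed
qed

lemma reps_exist:
  assumes A: "A \<in> Ob" and z: "z \<in> pre A"
  shows "\<exists>w\<in>reps A. z - w \<in> rels A"
proof -
  \<comment> \<open>\<open>pre_induct\<close> builds elements by differences, for which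
    \<open>M z\<close> alone is too weak. The induction shows that the elements satisfying
    \<open>M\<close> are stable under adding and under subtracting \<open>z\<close>.\<close>
  define M where "M v \<longleftrightarrow> (\<exists>w\<in>reps A. v - w \<in> rels A)" for v
  have "(\<forall>v. M v \<longrightarrow> M (v + z)) \<and> (\<forall>v. M v \<longrightarrow> M (v - z))"
    using z
  proof (induction z rule: pre_induct)
    case (frag i x)
    have "M (v + frag_of (i, x))" "M (v - frag_of (i, x))" if "M v" for v
    proof -
      obtain w where w: "w \<in> reps A" "v - w \<in> rels A" using \<open>M v\<close> by (auto simp: M_def)
      obtain w' where w': "w' \<in> reps A" "w + frag_of (i, x) - w' \<in> rels A" using reps_step(1)[OF A w(1) frag] by blast
      have "v + frag_of (i, x) - w' \<in> rels A" using rels_plus[OF w(2) w'(2)] by (simp add: algebra_simps)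
      then show "M (v + frag_of (i, x))" using w'(1) by (auto simp: M_def)
      obtain u where u: "u \<in> reps A" "w - frag_of (i, x) - u \<in> rels A" using reps_step(2)[OF A w(1) frag] by blast
      have "v - frag_of (i, x) - u \<in> rels A" using rels_plus[OF w(2) u(2)] by (simp add: algebra_simps)
      then show "M (v - frag_of (i, x))" using u(1) by (auto simp: M_def)
    qed
    then show ?case by blast
  next
    case (diff z w)
    have "v + (z - w) = (v + z) - w" "v - (z - w) = (v - z) + w" for v by (simp_all add: algebra_simps)
    then show ?case using diff by metis
  qed simp
  moreover have "M 0"
  proof -
    have "(\<lambda>i\<in>I. \<zero>\<^bsub>fobj (D i) A\<^esub>) \<in> (\<Pi>\<^sub>E i\<in>I. crr (D i) A)" using A by (simp add: D_psh)
    then have "(\<Sum>i\<in>{}. frag_of (i, (\<lambda>i\<in>I. \<zero>\<^bsub>fobj (D i) A\<^esub>) i)) \<in> reps A" unfolding reps_def by blast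
    then have "0 \<in> reps A" by simp
    then show ?thesis unfolding M_def using rels.zero by (intro bexI[of _ 0]) auto
  qed
  ultimately have "M (0 + z)" by blast
  then show ?thesis by (simp add: M_def)
qed

sublocale presentation k a J pre pres rels reps
proof
  fix A assume A: "A \<in> Obj a"
  show "rels A \<subseteq> pre A" using rels_pre A by blast
  show "pres A A (Ident a A) z = z" if "z \<in> pre A" for z
    using that by (induction z rule: pre_induct) (use A in \<open>auto simp: pres_diff D_psh psh_id\<close>)
  show "small TYPE('u) (reps A)"
  proof (rule small_mono[OF small_image])
    show "reps A \<subseteq> (\<lambda>(K, y). \<Sum>i\<in>K. frag_of (i, y i)) ` (Pow I \<times> (\<Pi>\<^sub>E i\<in>I. crr (D i) A))"
      by (force simp: reps_def)
    show "small TYPE('u) (Pow I \<times> (\<Pi>\<^sub>E i\<in>I. crr (D i) A))"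
      using A by (intro small_Times small_Pow small_PiE small_I psh_small D_psh)
  qed
  show "reps A \<subseteq> pre A"
  proof
    fix z assume "z \<in> reps A"
    then obtain K y where K: "finite K" "K \<subseteq> I" and y: "y \<in> (\<Pi>\<^sub>E i\<in>I. crr (D i) A)" and z: "z = (\<Sum>i\<in>K. frag_of (i, y i))"
      by (auto simp: reps_def)
    have "(\<Sum>i\<in>K. frag_of (i, y i)) \<in> carrier (free_Abelian_group (gens A))"
      using K y by (intro sum_closed_free_Abelian_group) (auto simp: gens_def)
    then show "z \<in> pre A" by (simp add: z pre_def)
  qed
  show "\<exists>w\<in>reps A. z - w \<in> rels A" if "z \<in> pre A" for z using reps_exist A that .
next
  fix A B f z assume *: "A \<in> Obj a" "B \<in> Obj a" "f \<in> Arr a B A"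
  show "pres A B f z \<in> rels B" if "z \<in> rels A"
    using that
  proof (induction z rule: rels.induct)
    case (add i x y)
    then show ?case using rels.add[of i "fmap (D i) A B f x" B "fmap (D i) A B f y"] * 
      by (simp add: pres_diff D_psh psh_add psh_closed)
  next
    case (rel i x j y)
    then show ?case using rels.rel[OF Rel_res[OF * rel]] by (simp add: pres_diff)
  qed (auto simp: pres_diff intro: rels.zero rels.diff)
next
  fix A B f g z assume *: "A \<in> Obj a" "B \<in> Obj a" "f \<in> Arr a B A" "g \<in> Arr a B A" and z: "z \<in> pre A"
  show "pres A B (hplus B A f g) z - pres A B f z - pres A B g z \<in> rels B"
    using z
  proof (induction z rule: pre_induct)
    \<comment> \<open>On a generator, additivity of \<open>D i\<close> in the arrow becomes an
      instance of the relation \<open>add\<close>.\<close>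
    case (frag i x)
    then show ?case using rels.add[of i "fmap (D i) A B f x" B "fmap (D i) A B g x"] *
      by (simp add: D_psh psh_plus psh_closed)
  next
    case (diff z w)
    then show ?case using rels.diff[OF diff.IH] by (simp add: pres_diff algebra_simps)
  qed (simp add: rels.zero)
next
  fix A B C f g z assume *: "A \<in> Obj a" "B \<in> Obj a" "C \<in> Obj a" "f \<in> Arr a B A" "g \<in> Arr a C B" and z: "z \<in> pre A"
  show "pres A C (Comp a C B A f g) z = pres B C g (pres A B f z)"
    using z by (induction z rule: pre_induct) (use * in \<open>auto simp: pres_diff D_psh psh_comp\<close>)
qed (auto simp: pre_diff pres_pre pres_diff intro: rels.zero rels.diff)

lemma hom_diff:
  assumes C: "comm_group C" and h: "h \<in> hom (free_Abelian_group (gens A)) C" and z: "z \<in> pre A" and w: "w \<in> pre A"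
  shows "h (z - w) = h z \<otimes>\<^bsub>C\<^esub> inv\<^bsub>C\<^esub> h w"
proof -
  interpret C: comm_group C by fact
  have m: "z - w \<in> carrier (free_Abelian_group (gens A))" "w \<in> carrier (free_Abelian_group (gens A))"
    using z w pre_diff[OF z w] by (auto simp: pre_def)
  have "h (z - w) \<otimes>\<^bsub>C\<^esub> h w = h ((z - w) + w)" using hom_mult[OF h m] by simp
  then show ?thesis using C.inv_solve_right[of "h (z - w)" "h z" "h w"] hom_in_carrier[OF h m(1)] hom_in_carrier[OF h m(2)]
      hom_in_carrier[OF h, of z] z by (simp add: pre_def)
qed

text \<open>The homomorphism on the free group with values \<open>c\<close> kills each generating
  relation, hence all of \<open>rels\<close>.\<close>

lemma extend_to_relations:
  assumes C: "comm_group C" and A: "A \<in> Ob" and c: "\<And>i x. i \<in> I \<Longrightarrow> x \<in> crr (D i) A \<Longrightarrow> c i x \<in> carrier C"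
    and c_add: "\<And>i x y. i \<in> I \<Longrightarrow> x \<in> crr (D i) A \<Longrightarrow> y \<in> crr (D i) A \<Longrightarrow> c i (x \<oplus>\<^bsub>fobj (D i) A\<^esub> y) = c i x \<otimes>\<^bsub>C\<^esub> c i y"
    and c_rel: "\<And>i x j y. ((i, x), (j, y)) \<in> Rel A \<Longrightarrow> c i x = c j y"
  obtains h where "h \<in> hom (free_Abelian_group (gens A)) C" "\<And>i x. i \<in> I \<Longrightarrow> x \<in> crr (D i) A \<Longrightarrow> h (frag_of (i, x)) = c i x"
    "\<And>z. z \<in> rels A \<Longrightarrow> h z = \<one>\<^bsub>C\<^esub>"
proof -
  interpret C: comm_group C by fact
  have "(\<lambda>(i, x). c i x) ` gens A \<subseteq> carrier C" using c by (auto simp: gens_def)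
  from C.free_Abelian_group_universal[OF this] obtain h where h: "h \<in> hom (free_Abelian_group (gens A)) C"
    and hf: "\<And>p. p \<in> gens A \<Longrightarrow> h (frag_of p) = (\<lambda>(i, x). c i x) p" by metis
  have hf: "h (frag_of (i, x)) = c i x" if "i \<in> I" "x \<in> crr (D i) A" for i x using hf[of "(i, x)"] that by (simp add: gens_def)
  note hd = hom_diff[OF C h]
  have "h z = \<one>\<^bsub>C\<^esub>" if "z \<in> rels A" for z
    using that
  proof (induction z rule: rels.induct)
    case zero
    show ?case using hd[of 0 0] hom_in_carrier[OF h, of 0] by simp
  next
    case (add i x y)
    have "x \<oplus>\<^bsub>fobj (D i) A\<^esub> y \<in> crr (D i) A" using add A by (simp add: D_psh)
    then have "h (frag_of (i, x \<oplus>\<^bsub>fobj (D i) A\<^esub> y) - frag_of (i, x) - frag_of (i, y)) =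
        c i x \<otimes>\<^bsub>C\<^esub> c i y \<otimes>\<^bsub>C\<^esub> inv\<^bsub>C\<^esub> c i x \<otimes>\<^bsub>C\<^esub> inv\<^bsub>C\<^esub> c i y"
      using add c_add by (simp add: hd pre_diff hf)
    also have "\<dots> = (c i x \<otimes>\<^bsub>C\<^esub> c i y) \<otimes>\<^bsub>C\<^esub> inv\<^bsub>C\<^esub> (c i x \<otimes>\<^bsub>C\<^esub> c i y)"
      using c[OF add(1,2)] c[OF add(1,3)] by (simp add: C.inv_mult C.m_assoc)
    also have "\<dots> = \<one>\<^bsub>C\<^esub>" using c[OF add(1,2)] c[OF add(1,3)] by (simp add: C.r_inv)
    finally show ?case .
  next
    case (rel i x j y)
    then show ?case using Rel_mem[OF A rel] c c_rel[OF rel] by (simp add: hd hf)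
  next
    case (diff z w)
    then show ?case using rels_pre A by (simp add: hd)
  qed
  with h hf show thesis using that by blast
qed

text \<open>A necessary condition for membership in \<open>rels\<close>: the generator dies in every
  commutative group to which the terms map compatibly. The group is chosen to fit, a quotient for
  cokernels and a colimit of groups for filtered diagrams.\<close>

lemma relations_kernel:
  assumes "comm_group C" "A \<in> Ob" "\<And>i x. i \<in> I \<Longrightarrow> x \<in> crr (D i) A \<Longrightarrow> c i x \<in> carrier C"
    and "\<And>i x y. i \<in> I \<Longrightarrow> x \<in> crr (D i) A \<Longrightarrow> y \<in> crr (D i) A \<Longrightarrow> c i (x \<oplus>\<^bsub>fobj (D i) A\<^esub> y) = c i x \<otimes>\<^bsub>C\<^esub> c i y"
    and "\<And>i x j y. ((i, x), (j, y)) \<in> Rel A \<Longrightarrow> c i x = c j y"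
    and "i \<in> I" "x \<in> crr (D i) A" "frag_of (i, x) \<in> rels A"
  shows "c i x = \<one>\<^bsub>C\<^esub>"
proof -
  obtain h where "\<And>i x. i \<in> I \<Longrightarrow> x \<in> crr (D i) A \<Longrightarrow> h (frag_of (i, x)) = c i x" "\<And>z. z \<in> rels A \<Longrightarrow> h z = \<one>\<^bsub>C\<^esub>"
    by (rule extend_to_relations[OF assms(1-5)]) (assumption | (rule that; assumption))+
  then show ?thesis using assms(6-8) by metis
qed

text \<open>The universal property is split into existence and uniqueness. The last two clauses give
  access to sections: one coming from a term vanishes only if it is locally a relation, and the
  clause about \<open>S\<close> is an induction principle saying that every section lies locally in
  the subgroup generated by the terms.\<close>

theorem sheaf_colimit:
  obtains L l where "sheaf L" "\<forall>i\<in>I. l i \<in> mor (D i) L"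
    "\<forall>A\<in>Ob. \<forall>i x j y. ((i, x), (j, y)) \<in> Rel A \<longrightarrow> l i A x = l j A y"
    "\<forall>T t. sheaf T \<longrightarrow> (\<forall>i\<in>I. t i \<in> mor (D i) T) \<longrightarrow>
       (\<forall>A\<in>Ob. \<forall>i x j y. ((i, x), (j, y)) \<in> Rel A \<longrightarrow> t i A x = t j A y) \<longrightarrow>
       (\<exists>h\<in>mor L T. \<forall>i\<in>I. \<forall>A\<in>Ob. \<forall>x\<in>crr (D i) A. h A (l i A x) = t i A x)"
    "\<forall>T h h'. sheaf T \<longrightarrow> h \<in> mor L T \<longrightarrow> h' \<in> mor L T \<longrightarrow>
       (\<forall>i\<in>I. \<forall>A\<in>Ob. \<forall>x\<in>crr (D i) A. h A (l i A x) = h' A (l i A x)) \<longrightarrow> h = h'"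
    "\<forall>A\<in>Ob. \<forall>i\<in>I. \<forall>x\<in>crr (D i) A. l i A x = \<zero>\<^bsub>fobj L A\<^esub> \<longrightarrow>
       locally A (\<lambda>B f. frag_of (i, fmap (D i) A B f x) \<in> rels B)"
    "\<forall>S. \<forall>A\<in>Ob. \<forall>x\<in>crr L A. (\<forall>B\<in>Ob. \<zero>\<^bsub>fobj L B\<^esub> \<in> S B) \<longrightarrow>
       (\<forall>B\<in>Ob. \<forall>i\<in>I. \<forall>y\<in>crr (D i) B. l i B y \<in> S B) \<longrightarrow>
       (\<forall>B\<in>Ob. \<forall>u\<in>S B. \<forall>v\<in>S B. u \<ominus>\<^bsub>fobj L B\<^esub> v \<in> S B) \<longrightarrow>
       locally A (\<lambda>B f. fmap L A B f x \<in> S B)"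
proof -
  obtain L \<iota> where L: "sheaf L" and \<iota>_mem: "\<And>A z. A \<in> Ob \<Longrightarrow> z \<in> pre A \<Longrightarrow> \<iota> A z \<in> crr L A"
    and \<iota>_plus: "\<And>A z w. A \<in> Ob \<Longrightarrow> z \<in> pre A \<Longrightarrow> w \<in> pre A \<Longrightarrow> \<iota> A (z + w) = \<iota> A z \<oplus>\<^bsub>fobj L A\<^esub> \<iota> A w"
    and \<iota>_res: "\<And>A B f z. A \<in> Ob \<Longrightarrow> B \<in> Ob \<Longrightarrow> f \<in> Arr a B A \<Longrightarrow> z \<in> pre A \<Longrightarrow> \<iota> B (pres A B f z) = fmap L A B f (\<iota> A z)"
    and \<iota>_zero: "\<And>A z. A \<in> Ob \<Longrightarrow> z \<in> pre A \<Longrightarrow> \<iota> A z = \<zero>\<^bsub>fobj L A\<^esub> \<longleftrightarrow> z \<in> N A"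
    and \<iota>_dense: "\<And>A x. A \<in> Ob \<Longrightarrow> x \<in> crr L A \<Longrightarrow> locally A (\<lambda>B f. \<exists>z\<in>pre B. fmap L A B f x = \<iota> B z)"
    by (rule associated_sheaf) (rule that; assumption)
  have L': "psh L" using L by simp
  have \<iota>_minus: "\<iota> A (z - w) = \<iota> A z \<ominus>\<^bsub>fobj L A\<^esub> \<iota> A w" if A: "A \<in> Ob" and z: "z \<in> pre A" and w: "w \<in> pre A" for A z w
  proof -
    interpret LA: abelian_group "fobj L A" using psh_group[OF L' A] .
    have "\<iota> A (z - w) \<oplus>\<^bsub>fobj L A\<^esub> \<iota> A w = \<iota> A z"
      using \<iota>_plus[OF A pre_diff[OF z w] w] by simp
    then show ?thesis
      using \<iota>_mem[OF A z] \<iota>_mem[OF A w] \<iota>_mem[OF A pre_diff[OF z w]] by (auto simp: LA.minus_eq LA.add.inv_solve_right)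
  qed
  have \<iota>_eq: "\<iota> A z = \<iota> A w" if A: "A \<in> Ob" and z: "z \<in> pre A" and w: "w \<in> pre A" and r: "z - w \<in> rels A" for A z w
    using \<iota>_zero[OF A pre_diff[OF z w]] N0_N[OF A r] \<iota>_minus[OF A z w] psh_minus_zero_iff[OF L' A] \<iota>_mem[OF A] z w by simp
  define l where "l i = mk (D i) (\<lambda>A x. \<iota> A (frag_of (i, x)))" for i
  have l_apply: "l i A x = \<iota> A (frag_of (i, x))" if "A \<in> Ob" "x \<in> crr (D i) A" for i A x
    using that by (simp add: l_def)
  have l_mor: "l i \<in> mor (D i) L" if i: "i \<in> I" for i
    unfolding l_def
  proof (rule mk_mor[OF D_psh[OF i] L'])
    show "\<iota> A (frag_of (i, x \<oplus>\<^bsub>fobj (D i) A\<^esub> y)) = \<iota> A (frag_of (i, x)) \<oplus>\<^bsub>fobj L A\<^esub> \<iota> A (frag_of (i, y))"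
      if A: "A \<in> Ob" and x: "x \<in> crr (D i) A" and y: "y \<in> crr (D i) A" for A x y
      using \<iota>_eq[OF A, of "frag_of (i, x \<oplus>\<^bsub>fobj (D i) A\<^esub> y)" "frag_of (i, x) + frag_of (i, y)"] rels.add[OF i x y]
        \<iota>_plus[OF A, of "frag_of (i, x)" "frag_of (i, y)"] D_psh[OF i] A i x y by (simp add: algebra_simps)
    show "\<iota> B (frag_of (i, fmap (D i) A B f x)) = fmap L A B f (\<iota> A (frag_of (i, x)))"
      if "A \<in> Ob" "B \<in> Ob" "f \<in> Arr a B A" "x \<in> crr (D i) A" for A B f x
      using \<iota>_res[OF that(1-3), of "frag_of (i, x)"] that i by simp
  qed (use \<iota>_mem i in auto)
  have l_rel: "l i A x = l j A y" if A: "A \<in> Ob" and r: "((i, x), (j, y)) \<in> Rel A" for A i x j y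
    using \<iota>_eq[OF A _ _ rels.rel[OF r]] Rel_mem[OF A r] l_apply[OF A] by simp
  have dense: "locally A (\<lambda>B f. fmap L A B f x \<in> S B)"
    if A: "A \<in> Ob" and x: "x \<in> crr L A" and S: "\<And>B. B \<in> Ob \<Longrightarrow> \<zero>\<^bsub>fobj L B\<^esub> \<in> S B"
      "\<And>B i y. B \<in> Ob \<Longrightarrow> i \<in> I \<Longrightarrow> y \<in> crr (D i) B \<Longrightarrow> l i B y \<in> S B"
      "\<And>B u v. B \<in> Ob \<Longrightarrow> u \<in> S B \<Longrightarrow> v \<in> S B \<Longrightarrow> u \<ominus>\<^bsub>fobj L B\<^esub> v \<in> S B" for S A x
  proof -
    have "\<iota> B z \<in> S B" if B: "B \<in> Ob" and z: "z \<in> pre B" for B z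
      using z
    proof (induction z rule: pre_induct)
      case zero
      then show ?case using S(1)[OF B] \<iota>_zero[OF B, of 0] N_zero[OF B] by simp
    next
      case (frag i x)
      then show ?case using S(2)[OF B] l_apply[OF B] by metis
    next
      case (diff z w)
      then show ?case using S(3)[OF B] \<iota>_minus[OF B] by simp
    qed
    then show ?thesis by (intro locally_mono[OF \<iota>_dense[OF A x]]) auto
  qed
  have univ: "\<exists>h\<in>mor L T. \<forall>i\<in>I. \<forall>A\<in>Ob. \<forall>x\<in>crr (D i) A. h A (l i A x) = t i A x"
    if T: "sheaf T" and t: "\<And>i. i \<in> I \<Longrightarrow> t i \<in> mor (D i) T"
      and t_rel: "\<And>A i x j y. A \<in> Ob \<Longrightarrow> ((i, x), (j, y)) \<in> Rel A \<Longrightarrow> t i A x = t j A y" for T t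
  proof -
    have T': "psh T" using T by simp
    note t_closed = mor_closed[OF t D_psh T'] and t_add = mor_add[OF t D_psh T'] and t_nat = mor_nat[OF t D_psh T']
    have "\<exists>h. h \<in> hom (free_Abelian_group (gens A)) (add_monoid (fobj T A)) \<and>
      (\<forall>i\<in>I. \<forall>x\<in>crr (D i) A. h (frag_of (i, x)) = t i A x) \<and> (\<forall>z\<in>rels A. h z = \<zero>\<^bsub>fobj T A\<^esub>)" if A: "A \<in> Ob" for A
    proof (rule extend_to_relations[of "add_monoid (fobj T A)" A "\<lambda>i. t i A"])
      fix h assume "h \<in> hom (free_Abelian_group (gens A)) (add_monoid (fobj T A))"
        "\<And>i x. i \<in> I \<Longrightarrow> x \<in> crr (D i) A \<Longrightarrow> h (frag_of (i, x)) = t i A x"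
        "\<And>z. z \<in> rels A \<Longrightarrow> h z = \<one>\<^bsub>add_monoid (fobj T A)\<^esub>"
      then show ?thesis by auto
    qed (use abelian_group.a_comm_group[OF psh_group[OF T' A]] A t_closed[OF _ _ A] t_add[OF _ _ A] t_rel[OF A] in auto)
    then obtain \<tau> where \<tau>: "\<And>A. A \<in> Ob \<Longrightarrow> \<tau> A \<in> hom (free_Abelian_group (gens A)) (add_monoid (fobj T A))"
      and \<tau>_frag: "\<And>A i x. A \<in> Ob \<Longrightarrow> i \<in> I \<Longrightarrow> x \<in> crr (D i) A \<Longrightarrow> \<tau> A (frag_of (i, x)) = t i A x"
      and \<tau>_rels: "\<And>A z. A \<in> Ob \<Longrightarrow> z \<in> rels A \<Longrightarrow> \<tau> A z = \<zero>\<^bsub>fobj T A\<^esub>" by metis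
    have \<tau>_mem: "\<tau> A z \<in> crr T A" if "A \<in> Ob" "z \<in> pre A" for A z
      using hom_in_carrier[OF \<tau>[OF that(1)], of z] that by (simp add: pre_def)
    have \<tau>_plus: "\<tau> A (z + w) = \<tau> A z \<oplus>\<^bsub>fobj T A\<^esub> \<tau> A w" if "A \<in> Ob" "z \<in> pre A" "w \<in> pre A" for A z w
      using hom_mult[OF \<tau>[OF that(1)], of z w] that by (simp add: pre_def)
    have \<tau>_minus: "\<tau> A (z - w) = \<tau> A z \<ominus>\<^bsub>fobj T A\<^esub> \<tau> A w" if "A \<in> Ob" "z \<in> pre A" "w \<in> pre A" for A z w
      using hom_diff[OF abelian_group.a_comm_group[OF psh_group[OF T' that(1)]] \<tau>[OF that(1)] that(2,3)]
      by (simp add: a_minus_def a_inv_def)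
    have \<tau>_res: "\<tau> B (pres A B f z) = fmap T A B f (\<tau> A z)" if A: "A \<in> Ob" and B: "B \<in> Ob" and f: "f \<in> Arr a B A" and z: "z \<in> pre A" for A B f z
      using z
    proof (induction z rule: pre_induct)
      case zero
      then show ?case using \<tau>_rels[OF _ rels.zero] A B f T' by simp
    next
      case (frag i x)
      then show ?case using \<tau>_frag[OF A] \<tau>_frag[OF B] t_nat A B f D_psh[OF frag(1)] psh_closed by simp
    next
      case (diff z w)
      then show ?case using \<tau>_minus[OF A] \<tau>_minus[OF B] \<tau>_mem[OF A] A B f T'
        by (simp add: pres_diff pres_pre psh_minus)
    qed
    \<comment> \<open>The graph of the induced map on sections that come from the free group. It is
      defined locally by \<open>\<iota>_dense\<close>, and single-valued because
      \<open>\<tau>\<close> kills \<open>rels\<close> and \<open>T\<close> is separated.\<close>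
    define E where "E A = {(\<iota> A z, \<tau> A z) | z. z \<in> pre A}" for A
    obtain h where h: "h \<in> mor L T" and hE: "\<And>A x y. A \<in> Ob \<Longrightarrow> (x, y) \<in> E A \<Longrightarrow> h A x = y"
    proof (rule graph_extension[OF L' T, of E])
      show "E A \<subseteq> crr L A \<times> crr T A" if "A \<in> Ob" for A using \<iota>_mem \<tau>_mem that by (auto simp: E_def)
      show "(x \<oplus>\<^bsub>fobj L A\<^esub> x', y \<oplus>\<^bsub>fobj T A\<^esub> y') \<in> E A" if A: "A \<in> Ob" and xy: "(x, y) \<in> E A" "(x', y') \<in> E A" for A x y x' y'
      proof -
        obtain z w where "z \<in> pre A" "w \<in> pre A" "x = \<iota> A z" "y = \<tau> A z" "x' = \<iota> A w" "y' = \<tau> A w" using xy by (auto simp: E_def)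
        then show ?thesis unfolding E_def using \<iota>_plus[OF A, of z w] \<tau>_plus[OF A, of z w] P_plus[OF A, of z w] by force
      qed
      show "(fmap L A B f x, fmap T A B f y) \<in> E B" if A: "A \<in> Ob" and B: "B \<in> Ob" and f: "f \<in> Arr a B A" and xy: "(x, y) \<in> E A" for A B f x y
      proof -
        obtain z where "z \<in> pre A" "x = \<iota> A z" "y = \<tau> A z" using xy by (auto simp: E_def)
        then show ?thesis unfolding E_def using \<iota>_res[OF A B f, of z] \<tau>_res[OF A B f, of z] pres_pre[OF A B f, of z] by force
      qed
      show "y = \<zero>\<^bsub>fobj T A\<^esub>" if A: "A \<in> Ob" and xy: "(\<zero>\<^bsub>fobj L A\<^esub>, y) \<in> E A" for A y
      proof -
        obtain z where z: "z \<in> pre A" "\<zero>\<^bsub>fobj L A\<^esub> = \<iota> A z" "y = \<tau> A z" using xy by (auto simp: E_def)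
        have "z \<in> N A" using \<iota>_zero[OF A z(1)] z(2) by simp
        then have "locally A (\<lambda>B f. pres A B f z \<in> rels B)" unfolding N_def by blast
        then have "locally A (\<lambda>B f. fmap T A B f y = fmap T A B f \<zero>\<^bsub>fobj T A\<^esub>)"
          by (rule locally_mono) (use A z T' \<tau>_rels \<tau>_res[OF A _ _ z(1)] in force)
        then show ?thesis using sheaf_eq[OF T A] \<tau>_mem[OF A z(1)] T' A z by simp
      qed
      show "locally A (\<lambda>B f. \<exists>y. (fmap L A B f x, y) \<in> E B)" if "A \<in> Ob" "x \<in> crr L A" for A x
        using \<iota>_dense[OF that] by (rule locally_mono) (auto simp: E_def)
    qed blast
    have "h A (l i A x) = t i A x" if i: "i \<in> I" and A: "A \<in> Ob" and x: "x \<in> crr (D i) A" for i A x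
    proof (rule hE[OF A])
      show "(l i A x, t i A x) \<in> E A"
        unfolding E_def using l_apply[OF A x] \<tau>_frag[OF A i x] frag_pre[OF i x] by force
    qed
    then show ?thesis using h by blast
  qed
  have uniq: "h = h'" if T: "sheaf T" and h: "h \<in> mor L T" "h' \<in> mor L T"
    and eq: "\<And>i A x. i \<in> I \<Longrightarrow> A \<in> Ob \<Longrightarrow> x \<in> crr (D i) A \<Longrightarrow> h A (l i A x) = h' A (l i A x)" for T h h'
  proof (rule mor_eq_dense[OF h L' T])
    have T': "psh T" using T by simp
    fix A x assume A: "A \<in> Ob" and x: "x \<in> crr L A"
    have "locally A (\<lambda>B f. fmap L A B f x \<in> {y \<in> crr L B. h B y = h' B y})"
    proof (rule dense[OF A x])
      fix B assume B: "B \<in> Ob"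
      show "\<zero>\<^bsub>fobj L B\<^esub> \<in> {y \<in> crr L B. h B y = h' B y}" using B L' T' h by (simp add: mor_zero[of _ L T])
      show "l i B y \<in> {y \<in> crr L B. h B y = h' B y}" if "i \<in> I" "y \<in> crr (D i) B" for i y
        using that B eq mor_closed[OF l_mor D_psh L'] by simp
      show "u \<ominus>\<^bsub>fobj L B\<^esub> v \<in> {y \<in> crr L B. h B y = h' B y}"
        if "u \<in> {y \<in> crr L B. h B y = h' B y}" "v \<in> {y \<in> crr L B. h B y = h' B y}" for u v
        using that B L' T' h abelian_group.minus_closed[OF psh_group[OF L' B]] by (simp add: mor_minus[of _ L T])
    qed
    then show "locally A (\<lambda>B f. h B (fmap L A B f x) = h' B (fmap L A B f x))"
      by (rule locally_mono) simp
  qed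
  have ker: "locally A (\<lambda>B f. frag_of (i, fmap (D i) A B f x) \<in> rels B)"
    if A: "A \<in> Ob" and i: "i \<in> I" and x: "x \<in> crr (D i) A" and 0: "l i A x = \<zero>\<^bsub>fobj L A\<^esub>" for A i x
  proof -
    have "frag_of (i, x) \<in> N A" using \<iota>_zero[OF A frag_pre[OF i x]] 0 l_apply[OF A x] by simp
    then have "locally A (\<lambda>B f. pres A B f (frag_of (i, x)) \<in> rels B)" unfolding N_def by blast
    then show ?thesis by simp
  qed
  show thesis
  proof (rule that[OF L, of l])
    show "\<forall>T t. sheaf T \<longrightarrow> (\<forall>i\<in>I. t i \<in> mor (D i) T) \<longrightarrow>
       (\<forall>A\<in>Ob. \<forall>i x j y. ((i, x), (j, y)) \<in> Rel A \<longrightarrow> t i A x = t j A y) \<longrightarrow>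
       (\<exists>h\<in>mor L T. \<forall>i\<in>I. \<forall>A\<in>Ob. \<forall>x\<in>crr (D i) A. h A (l i A x) = t i A x)"
      by (intro allI impI, rule univ) auto
    show "\<forall>T h h'. sheaf T \<longrightarrow> h \<in> mor L T \<longrightarrow> h' \<in> mor L T \<longrightarrow>
       (\<forall>i\<in>I. \<forall>A\<in>Ob. \<forall>x\<in>crr (D i) A. h A (l i A x) = h' A (l i A x)) \<longrightarrow> h = h'"
      by (intro allI impI, rule uniq) auto
    show "\<forall>S. \<forall>A\<in>Ob. \<forall>x\<in>crr L A. (\<forall>B\<in>Ob. \<zero>\<^bsub>fobj L B\<^esub> \<in> S B) \<longrightarrow>
       (\<forall>B\<in>Ob. \<forall>i\<in>I. \<forall>y\<in>crr (D i) B. l i B y \<in> S B) \<longrightarrow>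
       (\<forall>B\<in>Ob. \<forall>u\<in>S B. \<forall>v\<in>S B. u \<ominus>\<^bsub>fobj L B\<^esub> v \<in> S B) \<longrightarrow>
       locally A (\<lambda>B f. fmap L A B f x \<in> S B)"
      by (intro allI ballI impI, rule dense) auto
  qed (use l_mor l_rel ker in auto)
qed

end

section \<open>The category of sheaves is abelian\<close>

context linear_topology
begin

abbreviation SH where "SH \<equiv> full_subcat (PSh k a) sheaf"

lemma SH_simps[simp]:
  "X \<in> Obj SH \<longleftrightarrow> sheaf X" "Arr SH = Arr (PSh k a)" "Comp SH = Comp (PSh k a)" "Ident SH = Ident (PSh k a)" "HomM SH = HomM (PSh k a)"
  by (auto simp: full_subcat_def)

lemma lin_category_SH: "lin_category k SH"
  by (rule lin_category_full_subcat[OF lin_category_PSh])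

section \<open>Kernels and cokernels in terms of sections\<close>

definition inj_mor :: "('k, 'o, 'u) presheaf \<Rightarrow> ('o \<Rightarrow> 'u \<Rightarrow> 'u) \<Rightarrow> bool" where
  "inj_mor X f \<longleftrightarrow> (\<forall>A\<in>Ob. inj_on (f A) (crr X A))"

text \<open>Surjectivity after passing to a cover, the elementwise form of an epimorphism of
  sheaves.\<close>

definition lsurj :: "('k, 'o, 'u) presheaf \<Rightarrow> ('k, 'o, 'u) presheaf \<Rightarrow> ('o \<Rightarrow> 'u \<Rightarrow> 'u) \<Rightarrow> bool" where
  "lsurj Y Z g \<longleftrightarrow> (\<forall>A\<in>Ob. \<forall>z\<in>crr Z A. locally A (\<lambda>B h. fmap Z A B h z \<in> g B ` crr Y B))"

lemma inj_morI:
  assumes "psh X" "psh Y" "f \<in> mor X Y" "\<And>A x. A \<in> Ob \<Longrightarrow> x \<in> crr X A \<Longrightarrow> f A x = \<zero>\<^bsub>fobj Y A\<^esub> \<Longrightarrow> x = \<zero>\<^bsub>fobj X A\<^esub>"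
  shows "inj_mor X f"
  unfolding inj_mor_def
proof (intro ballI inj_onI)
  fix A x y assume A: "A \<in> Ob" and x: "x \<in> crr X A" and y: "y \<in> crr X A" and eq: "f A x = f A y"
  have "x \<ominus>\<^bsub>fobj X A\<^esub> y \<in> crr X A" using abelian_group.minus_closed[OF psh_group[OF assms(1) A] x y] .
  moreover have "f A (x \<ominus>\<^bsub>fobj X A\<^esub> y) = \<zero>\<^bsub>fobj Y A\<^esub>"
    using mor_minus[OF assms(3,1,2) A x y] eq psh_minus_zero_iff[OF assms(2) A] mor_closed[OF assms(3,1,2) A] x y by simp
  ultimately show "x = y" using assms(4)[OF A] psh_minus_zero_iff[OF assms(1) A x y] by blast
qed

lemma inj_morD: "inj_mor X f \<Longrightarrow> A \<in> Ob \<Longrightarrow> x \<in> crr X A \<Longrightarrow> y \<in> crr X A \<Longrightarrow> f A x = f A y \<Longrightarrow> x = y"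
  unfolding inj_mor_def inj_on_def by blast

text \<open>The factorisation is found section by section; injectivity of \<open>f\<close> makes the
  chosen preimages additive and natural.\<close>

lemma is_kernelI:
  assumes X: "sheaf X" and Y: "sheaf Y" and Z: "sheaf Z" and f: "f \<in> mor X Y" and g: "g \<in> mor Y Z" and inj: "inj_mor X f"
    and ex: "\<And>A y. A \<in> Ob \<Longrightarrow> y \<in> crr Y A \<Longrightarrow> g A y = \<zero>\<^bsub>fobj Z A\<^esub> \<longleftrightarrow> y \<in> f A ` crr X A"
  shows "is_kernel SH Y Z g X f"
  unfolding is_kernel_def SH_simps
proof (intro conjI ballI impI X f)
  note P = sheaf_psh[OF X] sheaf_psh[OF Y] sheaf_psh[OF Z]
  note fc = mor_closed[OF f P(1,2)]
  show "Comp (PSh k a) X Y Z g f = \<zero>\<^bsub>HomM (PSh k a) X Z\<^esub>"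
    by (rule mor_eqI[of _ X Z]) (use P f g ex fc in auto)
  fix T t assume "T \<in> Obj SH" and t: "t \<in> mor T Y" and 0: "Comp (PSh k a) T Y Z g t = \<zero>\<^bsub>HomM (PSh k a) T Z\<^esub>"
  then have T: "psh T" by simp
  note tc = mor_closed[OF t T P(2)]
  have "\<exists>v\<in>crr X A. f A v = t A x" if "A \<in> Ob" "x \<in> crr T A" for A x
  proof -
    have "g A (t A x) = \<zero>\<^bsub>fobj Z A\<^esub>" using comp_apply[OF that, of Y Z g t] 0 that by simp
    then show ?thesis using ex[OF that(1) tc[OF that]] by force
  qed
  then obtain u where u: "\<And>A x. A \<in> Ob \<Longrightarrow> x \<in> crr T A \<Longrightarrow> u A x \<in> crr X A \<and> f A (u A x) = t A x" by metis
  have um: "mk T u \<in> mor T X"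
  proof (rule mk_mor[OF T P(1)])
    show "u A (x \<oplus>\<^bsub>fobj T A\<^esub> y) = u A x \<oplus>\<^bsub>fobj X A\<^esub> u A y" if "A \<in> Ob" "x \<in> crr T A" "y \<in> crr T A" for A x y
      by (rule inj_morD[OF inj that(1)]) (use that u T P mor_add[OF f P(1,2)] mor_add[OF t T P(2)] in auto)
    show "u B (fmap T A B h x) = fmap X A B h (u A x)" if "A \<in> Ob" "B \<in> Ob" "h \<in> Arr a B A" "x \<in> crr T A" for A B h x
      by (rule inj_morD[OF inj that(2)]) (use that u T P mor_nat[OF f P(1,2)] mor_nat[OF t T P(2)] psh_closed in auto)
  qed (use u in auto)
  show "\<exists>!u. u \<in> mor T X \<and> Comp (PSh k a) T X Y f u = t"
  proof (rule ex1I[of _ "mk T u"])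
    show "mk T u \<in> mor T X \<and> Comp (PSh k a) T X Y f (mk T u) = t"
      by (intro conjI um mor_eqI[of _ T Y]) (use um T P f t u in auto)
    fix v assume v: "v \<in> mor T X \<and> Comp (PSh k a) T X Y f v = t"
    show "v = mk T u"
    proof (rule mor_eqI[of _ T X])
      fix A x assume A: "A \<in> Ob" "x \<in> crr T A"
      have "f A (v A x) = t A x" using v comp_apply[OF A, of X Y f v] by simp
      then show "v A x = mk T u A x"
        using inj_morD[OF inj A(1)] mor_closed[OF _ T P(1) A, of v] u[OF A] v A by simp
    qed (use v um T P in auto)
  qed
qed

text \<open>The kernel computed section by section is already a sheaf: a section that lies in it
  locally lies in it, because \<open>Y\<close> is separated.\<close>

lemma kernel_exists:
  assumes X: "sheaf X" and Y: "sheaf Y" and f: "f \<in> mor X Y"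
  obtains K m where "sheaf K" "m \<in> mor K X" "inj_mor K m"
    "\<And>A x. A \<in> Ob \<Longrightarrow> x \<in> crr X A \<Longrightarrow> f A x = \<zero>\<^bsub>fobj Y A\<^esub> \<longleftrightarrow> x \<in> m A ` crr K A"
proof -
  note P = sheaf_psh[OF X] sheaf_psh[OF Y]
  define S where "S A = {x \<in> crr X A. f A x = \<zero>\<^bsub>fobj Y A\<^esub>}" for A
  have S: "subpresheaf X S"
    unfolding subpresheaf_def S_def using P mor_zero[OF f P] mor_add[OF f P] mor_nat[OF f P] by (auto simp: psh_closed)
  have "sheaf (sub X S)"
  proof (rule sub_sheaf[OF X S])
    fix A x assume A: "A \<in> Ob" and x: "x \<in> crr X A" and loc: "locally A (\<lambda>B h. fmap X A B h x \<in> S B)"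
    have "f A x = \<zero>\<^bsub>fobj Y A\<^esub>"
    proof (rule sheaf_eq[OF Y A])
      show "locally A (\<lambda>B h. fmap Y A B h (f A x) = fmap Y A B h \<zero>\<^bsub>fobj Y A\<^esub>)"
        using loc by (rule locally_mono) (use A x P mor_nat[OF f P] in \<open>simp add: S_def\<close>)
    qed (use A x P mor_closed[OF f P] in auto)
    then show "x \<in> S A" using x by (simp add: S_def)
  qed
  moreover note m = incl_mor[OF P(1) S]
  moreover have "inj_mor (sub X S) (mk (sub X S) (\<lambda>A x. x))"
    unfolding inj_mor_def by (auto intro!: inj_onI)
  moreover have "f A x = \<zero>\<^bsub>fobj Y A\<^esub> \<longleftrightarrow> x \<in> mk (sub X S) (\<lambda>A x. x) A ` crr (sub X S) A" if "A \<in> Ob" "x \<in> crr X A" for A x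
    using that by (force simp: S_def mk_def)
  ultimately show thesis using that by blast
qed

text \<open>The universal property speaks of arrows between sheaves. A section is brought into play
  through a concrete kernel that contains it: the kernel of \<open>f\<close> for injectivity, and
  the kernel of \<open>g\<close> for the description of the image.\<close>

lemma is_kernelD:
  assumes X: "sheaf X" and Y: "sheaf Y" and Z: "sheaf Z" and g: "g \<in> mor Y Z" and ker: "is_kernel SH Y Z g X f"
  shows "f \<in> mor X Y" "inj_mor X f" "\<And>A y. A \<in> Ob \<Longrightarrow> y \<in> crr Y A \<Longrightarrow> g A y = \<zero>\<^bsub>fobj Z A\<^esub> \<longleftrightarrow> y \<in> f A ` crr X A"
proof -
  note P = sheaf_psh[OF X] sheaf_psh[OF Y] sheaf_psh[OF Z]
  show f: "f \<in> mor X Y" using ker by (simp add: is_kernel_def)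
  have gf: "Comp (PSh k a) X Y Z g f = \<zero>\<^bsub>HomM (PSh k a) X Z\<^esub>" using ker by (simp add: is_kernel_def)
  have gf0: "g A (f A x) = \<zero>\<^bsub>fobj Z A\<^esub>" if "A \<in> Ob" "x \<in> crr X A" for A x
    using comp_apply[OF that, of Y Z g f] gf that by simp
  have uniq: "u = v" if "sheaf T" "u \<in> mor T X" "v \<in> mor T X" "Comp (PSh k a) T X Y f u = Comp (PSh k a) T X Y f v" for T u v
  proof -
    have "Comp (PSh k a) T Y Z g (Comp (PSh k a) T X Y f u) = \<zero>\<^bsub>HomM (PSh k a) T Z\<^esub>"
      by (rule mor_eqI[of _ T Z]) (use that P f g gf0 mor_closed[OF that(2) _ P(1)] mor_closed[OF that(3) _ P(1)] in auto)
    moreover have "Comp (PSh k a) T X Y f u \<in> mor T Y" using that P f by simp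
    ultimately have "\<exists>!w. w \<in> mor T X \<and> Comp (PSh k a) T X Y f w = Comp (PSh k a) T X Y f u"
      using ker that(1) unfolding is_kernel_def by simp
    then show ?thesis using that by metis
  qed
  show "inj_mor X f"
  proof (rule inj_morI[OF P(1,2) f])
    fix A x assume A: "A \<in> Ob" and x: "x \<in> crr X A" and 0: "f A x = \<zero>\<^bsub>fobj Y A\<^esub>"
    obtain K m where K: "sheaf K" "m \<in> mor K X" "inj_mor K m" and m: "\<And>A x. A \<in> Ob \<Longrightarrow> x \<in> crr X A \<Longrightarrow> f A x = \<zero>\<^bsub>fobj Y A\<^esub> \<longleftrightarrow> x \<in> m A ` crr K A"
      using kernel_exists[OF X Y f] by blast
    note mc = mor_closed[OF K(2) sheaf_psh[OF K(1)] P(1)]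
    have "Comp (PSh k a) K X Y f m = Comp (PSh k a) K X Y f \<zero>\<^bsub>HomM (PSh k a) K X\<^esub>"
    proof (rule mor_eqI[of _ K Y])
      fix A v assume A: "A \<in> Ob" and v: "v \<in> crr K A"
      have "f A (m A v) = \<zero>\<^bsub>fobj Y A\<^esub>" using m[OF A mc[OF A v]] v by blast
      then show "Comp (PSh k a) K X Y f m A v = Comp (PSh k a) K X Y f \<zero>\<^bsub>HomM (PSh k a) K X\<^esub> A v"
        using A v mor_zero[OF f P(1,2) A] by simp
    qed (use P K f in auto)
    then have eq: "m = \<zero>\<^bsub>HomM (PSh k a) K X\<^esub>"
      by (rule uniq[OF K(1,2), rotated]) (use K P in simp)
    obtain v where v: "v \<in> crr K A" "x = m A v" using m[OF A x] 0 by blast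
    then show "x = \<zero>\<^bsub>fobj X A\<^esub>" using eq A by simp
  qed
  show "g A y = \<zero>\<^bsub>fobj Z A\<^esub> \<longleftrightarrow> y \<in> f A ` crr X A" if A: "A \<in> Ob" and y: "y \<in> crr Y A" for A y
  proof
    assume 0: "g A y = \<zero>\<^bsub>fobj Z A\<^esub>"
    obtain K m where K: "sheaf K" "m \<in> mor K Y" "inj_mor K m" and m: "\<And>A x. A \<in> Ob \<Longrightarrow> x \<in> crr Y A \<Longrightarrow> g A x = \<zero>\<^bsub>fobj Z A\<^esub> \<longleftrightarrow> x \<in> m A ` crr K A"
      using kernel_exists[OF Y Z g] by blast
    note mc = mor_closed[OF K(2) sheaf_psh[OF K(1)] P(2)]
    have "Comp (PSh k a) K Y Z g m = \<zero>\<^bsub>HomM (PSh k a) K Z\<^esub>"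
      by (rule mor_eqI[of _ K Z]) (use P K g m mc in auto)
    moreover have "\<forall>T\<in>Obj SH. \<forall>t\<in>mor T Y. Comp (PSh k a) T Y Z g t = \<zero>\<^bsub>HomM (PSh k a) T Z\<^esub> \<longrightarrow>
        (\<exists>!u. u \<in> mor T X \<and> Comp (PSh k a) T X Y f u = t)"
      using ker unfolding is_kernel_def SH_simps by (elim conjE)
    ultimately have "\<exists>!u. u \<in> mor K X \<and> Comp (PSh k a) K X Y f u = m" using K(1,2) by simp
    then obtain u where u: "u \<in> mor K X" "Comp (PSh k a) K X Y f u = m" by blast
    obtain v where v: "v \<in> crr K A" "y = m A v" using m[OF A y] 0 by blast
    have "y = f A (u A v)" using u(2) v comp_apply[OF A v(1), of X Y f u] by simp
    then show "y \<in> f A ` crr X A" using mor_closed[OF u(1) sheaf_psh[OF K(1)] P(1) A v(1)] by blast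
  qed (use gf0 A in auto)
qed

text \<open>The map out of \<open>Z\<close> is given by the graph of all pairs
  \<open>(g A y, t A y)\<close>. It is defined locally since \<open>g\<close> is locally surjective,
  and single-valued since \<open>t\<close> vanishes on the image of \<open>f\<close> and
  \<open>T\<close> is separated.\<close>

lemma is_cokernelI:
  assumes X: "sheaf X" and Y: "sheaf Y" and Z: "sheaf Z" and f: "f \<in> mor X Y" and g: "g \<in> mor Y Z" and surj: "lsurj Y Z g"
    and gf: "\<And>A x. A \<in> Ob \<Longrightarrow> x \<in> crr X A \<Longrightarrow> g A (f A x) = \<zero>\<^bsub>fobj Z A\<^esub>"
    and ex: "\<And>A y. A \<in> Ob \<Longrightarrow> y \<in> crr Y A \<Longrightarrow> g A y = \<zero>\<^bsub>fobj Z A\<^esub> \<Longrightarrow> locally A (\<lambda>B h. fmap Y A B h y \<in> f B ` crr X B)"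
  shows "is_cokernel SH X Y f Z g"
proof -
  note P = sheaf_psh[OF X] sheaf_psh[OF Y] sheaf_psh[OF Z]
  note gc = mor_closed[OF g P(2,3)]
  have gf0: "Comp (PSh k a) X Y Z g f = \<zero>\<^bsub>HomM (PSh k a) X Z\<^esub>"
    by (rule mor_eqI[of _ X Z]) (use P f g gf in auto)
  have uni: "\<exists>!u. u \<in> mor Z T \<and> Comp (PSh k a) Y Z T u g = t"
    if T: "sheaf T" and t: "t \<in> mor Y T" and 0: "Comp (PSh k a) X Y T t f = \<zero>\<^bsub>HomM (PSh k a) X T\<^esub>" for T t
  proof -
    have T': "psh T" using T by simp
    note tc = mor_closed[OF t P(2) T']
    have tf: "t A (f A x) = \<zero>\<^bsub>fobj T A\<^esub>" if "A \<in> Ob" "x \<in> crr X A" for A x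
      using comp_apply[OF that, of Y T t f] 0 that by simp
    define E where "E A = (\<lambda>y. (g A y, t A y)) ` crr Y A" for A
    obtain h where h: "h \<in> mor Z T" and hE: "\<And>A x y. A \<in> Ob \<Longrightarrow> (x, y) \<in> E A \<Longrightarrow> h A x = y"
    proof (rule graph_extension[OF P(3) T, of E])
      show "E A \<subseteq> crr Z A \<times> crr T A" if "A \<in> Ob" for A using gc tc that by (auto simp: E_def)
      show "(x \<oplus>\<^bsub>fobj Z A\<^esub> x', y \<oplus>\<^bsub>fobj T A\<^esub> y') \<in> E A" if A: "A \<in> Ob" and xy: "(x, y) \<in> E A" "(x', y') \<in> E A" for A x y x' y'
      proof -
        obtain v w where "v \<in> crr Y A" "w \<in> crr Y A" "x = g A v" "y = t A v" "x' = g A w" "y' = t A w" using xy by (auto simp: E_def)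
        then show ?thesis unfolding E_def using A P mor_add[OF g P(2,3) A] mor_add[OF t P(2) T' A]
          by (intro image_eqI[of _ _ "v \<oplus>\<^bsub>fobj Y A\<^esub> w"]) auto
      qed
      show "(fmap Z A B f x, fmap T A B f y) \<in> E B" if A: "A \<in> Ob" and B: "B \<in> Ob" and f: "f \<in> Arr a B A" and xy: "(x, y) \<in> E A" for A B f x y
      proof -
        obtain v where "v \<in> crr Y A" "x = g A v" "y = t A v" using xy by (auto simp: E_def)
        then show ?thesis unfolding E_def using A B f P mor_nat[OF g P(2,3) A B f] mor_nat[OF t P(2) T' A B f]
          by (intro image_eqI[of _ _ "fmap Y A B f v"]) (auto simp: psh_closed)
      qed
      show "y = \<zero>\<^bsub>fobj T A\<^esub>" if A: "A \<in> Ob" and xy: "(\<zero>\<^bsub>fobj Z A\<^esub>, y) \<in> E A" for A y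
      proof -
        obtain v where v: "v \<in> crr Y A" "\<zero>\<^bsub>fobj Z A\<^esub> = g A v" "y = t A v" using xy by (auto simp: E_def)
        have "locally A (\<lambda>B h. fmap Y A B h v \<in> f B ` crr X B)" using ex[OF A v(1)] v(2) by simp
        then have "locally A (\<lambda>B h. fmap T A B h y = fmap T A B h \<zero>\<^bsub>fobj T A\<^esub>)"
        proof (rule locally_mono)
          fix B h assume B: "B \<in> Ob" "h \<in> Arr a B A" and "fmap Y A B h v \<in> f B ` crr X B"
          then obtain w where w: "w \<in> crr X B" "fmap Y A B h v = f B w" by blast
          have "fmap T A B h y = t B (fmap Y A B h v)" using mor_nat[OF t P(2) T' A B v(1)] v(3) by simp
          then show "fmap T A B h y = fmap T A B h \<zero>\<^bsub>fobj T A\<^esub>" using w tf B A T' by simp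
        qed
        then show ?thesis using sheaf_eq[OF T A] tc[OF A v(1)] v(3) T' A by simp
      qed
      show "locally A (\<lambda>B h. \<exists>y. (fmap Z A B h x, y) \<in> E B)" if "A \<in> Ob" "x \<in> crr Z A" for A x
      proof -
        have "locally A (\<lambda>B h. fmap Z A B h x \<in> g B ` crr Y B)" using surj that by (simp add: lsurj_def)
        then show ?thesis by (rule locally_mono) (auto simp: E_def)
      qed
    qed blast
    have hg: "h A (g A y) = t A y" if "A \<in> Ob" "y \<in> crr Y A" for A y
      using hE[OF that(1)] that(2) by (auto simp: E_def)
    show ?thesis
    proof (rule ex1I[of _ h])
      show "h \<in> mor Z T \<and> Comp (PSh k a) Y Z T h g = t"
        by (intro conjI h mor_eqI[of _ Y T]) (use P T' h g t hg in auto)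
      fix u assume u: "u \<in> mor Z T \<and> Comp (PSh k a) Y Z T u g = t"
      have ug: "u A (g A y) = t A y" if "A \<in> Ob" "y \<in> crr Y A" for A y
        using u comp_apply[OF that, of Z T u g] by simp
      show "u = h"
      proof (rule mor_eq_dense[OF _ h P(3) T])
        fix A x assume "A \<in> Ob" "x \<in> crr Z A"
        then have "locally A (\<lambda>B h. fmap Z A B h x \<in> g B ` crr Y B)" using surj by (simp add: lsurj_def)
        then show "locally A (\<lambda>B f. u B (fmap Z A B f x) = h B (fmap Z A B f x))"
          by (rule locally_mono) (use ug hg in auto)
      qed (use u in blast)
    qed
  qed
  show ?thesis
    unfolding is_kernel_def using Z g gf0 uni by (simp add: opcat_def)
qed

text \<open>One copy of \<open>Y\<close>, with each value of \<open>f\<close> identified with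
  zero.\<close>

lemma cokernel_exists:
  assumes X: "sheaf X" and Y: "sheaf Y" and f: "f \<in> mor X Y"
  obtains Q e where "sheaf Q" "e \<in> mor Y Q" "lsurj Y Q e" "\<And>A x. A \<in> Ob \<Longrightarrow> x \<in> crr X A \<Longrightarrow> e A (f A x) = \<zero>\<^bsub>fobj Q A\<^esub>"
    "\<And>A y. A \<in> Ob \<Longrightarrow> y \<in> crr Y A \<Longrightarrow> e A y = \<zero>\<^bsub>fobj Q A\<^esub> \<Longrightarrow> locally A (\<lambda>B h. fmap Y A B h y \<in> f B ` crr X B)"
proof -
  note P = sheaf_psh[OF X] sheaf_psh[OF Y]
  note fc = mor_closed[OF f P]
  define R where "R A = {(((), f A x), ((), \<zero>\<^bsub>fobj Y A\<^esub>)) | x. x \<in> crr X A}" for A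
  interpret cd: presheaf_diagram k a J "UNIV :: unit set" "\<lambda>_. Y" R
  proof
    show "small TYPE('u) (UNIV :: unit set)" by (simp add: small_finite)
    show "((i, fmap Y A B g x), (j, fmap Y A B g y)) \<in> R B"
      if "A \<in> Ob" "B \<in> Ob" "g \<in> Arr a B A" "((i, x), (j, y)) \<in> R A" for A B g i x j y
    proof -
      obtain v where "v \<in> crr X A" "x = f A v" "y = \<zero>\<^bsub>fobj Y A\<^esub>" using \<open>((i, x), (j, y)) \<in> R A\<close> by (auto simp: R_def)
      then show ?thesis
        using that(1-3) P mor_nat[OF f P that(1-3), of v, symmetric] psh_closed[OF P(1) that(1-3), of v] by (auto simp: R_def)
    qed
  qed (use P fc in \<open>auto simp: R_def\<close>)
  obtain Q l where Q: "sheaf Q" and l: "\<forall>i\<in>UNIV. l i \<in> mor Y Q"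
    and l_rel: "\<forall>A\<in>Ob. \<forall>i x j y. ((i, x), (j, y)) \<in> R A \<longrightarrow> l i A x = l j A y"
    and ker: "\<forall>A\<in>Ob. \<forall>i\<in>UNIV. \<forall>x\<in>crr Y A. l i A x = \<zero>\<^bsub>fobj Q A\<^esub> \<longrightarrow>
       locally A (\<lambda>B h. frag_of (i, fmap Y A B h x) \<in> cd.rels B)"
    and dense: "\<forall>S. \<forall>A\<in>Ob. \<forall>x\<in>crr Q A. (\<forall>B\<in>Ob. \<zero>\<^bsub>fobj Q B\<^esub> \<in> S B) \<longrightarrow>
       (\<forall>B\<in>Ob. \<forall>i\<in>UNIV. \<forall>y\<in>crr Y B. l i B y \<in> S B) \<longrightarrow>
       (\<forall>B\<in>Ob. \<forall>u\<in>S B. \<forall>v\<in>S B. u \<ominus>\<^bsub>fobj Q B\<^esub> v \<in> S B) \<longrightarrow>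
       locally A (\<lambda>B h. fmap Q A B h x \<in> S B)"
    by (rule cd.sheaf_colimit) (rule that; assumption)
  define e where "e = l ()"
  have e: "e \<in> mor Y Q" using l by (simp add: e_def)
  have Q': "psh Q" using Q by simp
  have "lsurj Y Q e"
    unfolding lsurj_def
  proof (intro ballI)
    fix A z assume "A \<in> Ob" "z \<in> crr Q A"
    then show "locally A (\<lambda>B h. fmap Q A B h z \<in> e B ` crr Y B)"
    proof (rule dense[rule_format])
      fix B assume B: "B \<in> Ob"
      show "\<zero>\<^bsub>fobj Q B\<^esub> \<in> e B ` crr Y B" using mor_zero[OF e P(2) Q' B] psh_zero_closed[OF P(2) B] by (metis imageI)
      show "l i B y \<in> e B ` crr Y B" if "y \<in> crr Y B" for i y using that by (simp add: e_def)
      show "u \<ominus>\<^bsub>fobj Q B\<^esub> v \<in> e B ` crr Y B" if "u \<in> e B ` crr Y B" "v \<in> e B ` crr Y B" for u v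
      proof -
        obtain u' v' where "u' \<in> crr Y B" "v' \<in> crr Y B" "u = e B u'" "v = e B v'"
          using \<open>u \<in> e B ` crr Y B\<close> \<open>v \<in> e B ` crr Y B\<close> by blast
        then show ?thesis
          using mor_minus[OF e P(2) Q' B, of u' v'] abelian_group.minus_closed[OF psh_group[OF P(2) B], of u' v']
          by (intro image_eqI[of _ _ "u' \<ominus>\<^bsub>fobj Y B\<^esub> v'"]) simp_all
      qed
    qed
  qed
  moreover have "e A (f A x) = \<zero>\<^bsub>fobj Q A\<^esub>" if "A \<in> Ob" "x \<in> crr X A" for A x
    using l_rel[rule_format, OF that(1), of "()" "f A x" "()" "\<zero>\<^bsub>fobj Y A\<^esub>"] that mor_zero[OF e P(2) Q' that(1)] by (auto simp: R_def e_def)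
  moreover have "locally A (\<lambda>B h. fmap Y A B h y \<in> f B ` crr X B)"
    if A: "A \<in> Ob" and y: "y \<in> crr Y A" and 0: "e A y = \<zero>\<^bsub>fobj Q A\<^esub>" for A y
  proof -
    have "locally A (\<lambda>B h. frag_of ((), fmap Y A B h y) \<in> cd.rels B)" using ker[rule_format, OF A UNIV_I y] 0 by (simp add: e_def)
    then show ?thesis
    proof (rule locally_mono)
      fix B h assume B: "B \<in> Ob" and h: "h \<in> Arr a B A" and r: "frag_of ((), fmap Y A B h y) \<in> cd.rels B"
      define G where "G = add_monoid (fobj Y B)"
      interpret G: comm_group G unfolding G_def using abelian_group.a_comm_group[OF psh_group[OF P(2) B]] .
      define H where "H = f B ` crr X B"
      have Gs: "carrier G = crr Y B" "\<And>u v. u \<otimes>\<^bsub>G\<^esub> v = u \<oplus>\<^bsub>fobj Y B\<^esub> v" "\<one>\<^bsub>G\<^esub> = \<zero>\<^bsub>fobj Y B\<^esub>" by (simp_all add: G_def)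
      have "group_hom (add_monoid (fobj X B)) G (f B)"
        unfolding group_hom_def group_hom_axioms_def
        using abelian_group.a_group[OF psh_group[OF P(1) B]] G.is_group mor_add[OF f P B] fc[OF B]
        by (auto simp: hom_def Gs)
      then have H: "subgroup H G" using group_hom.img_is_subgroup[of "add_monoid (fobj X B)" G "f B"] by (simp add: H_def)
      interpret N: normal H G using G.subgroup_imp_normal[OF H] .
      \<comment> \<open>The test group is the quotient of the sections of \<open>Y\<close> over
        \<open>B\<close> by the image of \<open>f\<close>. A generator in \<open>rels\<close> has
        trivial coset there, so it lies in the image.\<close>
      have "H #>\<^bsub>G\<^esub> (fmap Y A B h y) = \<one>\<^bsub>G Mod H\<^esub>"
      proof (rule cd.relations_kernel[OF G.abelian_FactGroup[OF H] B, where i = "()" and c = "\<lambda>_ v. H #>\<^bsub>G\<^esub> v"])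
        note hom = N.r_coset_hom_Mod
        show "H #>\<^bsub>G\<^esub> v \<in> carrier (G Mod H)" if "v \<in> crr Y B" for v
          using hom_in_carrier[OF hom, of v] that by (simp add: Gs)
        show "H #>\<^bsub>G\<^esub> (u \<oplus>\<^bsub>fobj Y B\<^esub> v) = (H #>\<^bsub>G\<^esub> u) \<otimes>\<^bsub>G Mod H\<^esub> (H #>\<^bsub>G\<^esub> v)" if "u \<in> crr Y B" "v \<in> crr Y B" for u v
          using hom_mult[OF hom, of u v] that by (simp add: Gs)
        show "H #>\<^bsub>G\<^esub> u = H #>\<^bsub>G\<^esub> v" if "((i, u), (j, v)) \<in> R B" for i u j v
        proof -
          have "u \<in> H" "v = \<one>\<^bsub>G\<^esub>" using that by (auto simp: R_def H_def Gs)
          then show ?thesis using G.coset_join2[OF _ H, of u] G.coset_mult_one[OF N.subset] N.mem_carrier by simp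
        qed
        show "fmap Y A B h y \<in> crr Y B" using psh_closed[OF P(2) A B h y] .
      qed (use r in auto)
      then have "H #>\<^bsub>G\<^esub> (fmap Y A B h y) = H" by (simp add: FactGroup_def)
      then show "fmap Y A B h y \<in> f B ` crr X B"
        using G.coset_join1[of H "fmap Y A B h y"] H psh_closed[OF P(2) A B h y] by (simp add: H_def Gs)
    qed
  qed
  ultimately show thesis using that Q e by blast
qed

text \<open>Injectivity makes local preimages unique, hence compatible. They glue in
  \<open>X\<close>, and the image of the result is \<open>y\<close> because \<open>Y\<close> is
  separated.\<close>

lemma image_local:
  assumes X: "sheaf X" and Y: "sheaf Y" and f: "f \<in> mor X Y" and inj: "inj_mor X f"
    and A: "A \<in> Ob" and y: "y \<in> crr Y A" and loc: "locally A (\<lambda>B h. fmap Y A B h y \<in> f B ` crr X B)"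
  shows "y \<in> f A ` crr X A"
proof -
  note P = sheaf_psh[OF X] sheaf_psh[OF Y]
  note fc = mor_closed[OF f P] and fa = mor_add[OF f P] and fn = mor_nat[OF f P]
  obtain R where R: "J A R" and "\<forall>B\<in>Ob. \<forall>h\<in>R B. fmap Y A B h y \<in> f B ` crr X B" using loc unfolding locally_def by blast
  then have "\<forall>B\<in>Ob. \<forall>h\<in>R B. \<exists>x. x \<in> crr X B \<and> fmap Y A B h y = f B x" by blast
  then obtain s where s: "\<And>B h. B \<in> Ob \<Longrightarrow> h \<in> R B \<Longrightarrow> s B h \<in> crr X B \<and> fmap Y A B h y = f B (s B h)" by metis
  note sv = J_sieve[OF R]
  have "compat X A R s"
    unfolding compat_def
  proof (intro conjI ballI)
    fix B h assume B: "B \<in> Ob" and h: "h \<in> R B"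
    have h': "h \<in> Arr a B A" using sieve_arr[OF sv B h] .
    show "s B h \<in> crr X B" using s[OF B h] by blast
    {
      fix g assume g: "g \<in> R B"
      have g': "g \<in> Arr a B A" using sieve_arr[OF sv B g] .
      show "s B (hplus B A h g) = s B h \<oplus>\<^bsub>fobj X B\<^esub> s B g"
      proof (rule inj_morD[OF inj B])
        show "f B (s B (hplus B A h g)) = f B (s B h \<oplus>\<^bsub>fobj X B\<^esub> s B g)"
          using s[OF B h] s[OF B g] s[OF B sieve_plus[OF sv B h g]] psh_plus[OF P(2) A B h' g' y] fa[OF B] by simp
      qed (use s[OF B h] s[OF B g] s[OF B sieve_plus[OF sv B h g]] P B in auto)
    next
      fix C g assume C: "C \<in> Ob" and g: "g \<in> Arr a C B"
      show "s C (Comp a C B A h g) = fmap X B C g (s B h)"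
      proof (rule inj_morD[OF inj C])
        show "f C (s C (Comp a C B A h g)) = f C (fmap X B C g (s B h))"
          using s[OF B h] s[OF C sieve_comp[OF sv B C h g]] psh_comp[OF P(2) A B C h' g y] fn[OF B C g] by simp
      qed (use s[OF B h] s[OF C sieve_comp[OF sv B C h g]] P B C g psh_closed in auto)
    }
  qed
  then obtain x where x: "x \<in> crr X A" "\<And>B h. B \<in> Ob \<Longrightarrow> h \<in> R B \<Longrightarrow> fmap X A B h x = s B h"
    using sheaf_glue[OF X R] by blast
  have "y = f A x"
  proof (rule sheaf_eq[OF Y A y fc[OF A x(1)]])
    show "locally A (\<lambda>B h. fmap Y A B h y = fmap Y A B h (f A x))"
    proof (rule J_locally[OF R])
      fix B h assume B: "B \<in> Ob" and h': "h \<in> Arr a B A" and h: "h \<in> R B"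
      show "fmap Y A B h y = fmap Y A B h (f A x)"
        using s[OF B h] x(2)[OF B h] fn[OF A B h' x(1)] by simp
    qed
  qed
  then show ?thesis using x by blast
qed

text \<open>The cokernel map \<open>e\<close> and the zero map have the same composite with
  \<open>f\<close>, so \<open>e\<close> is zero. Every section of \<open>Y\<close> is then killed by
  \<open>e\<close>, hence locally in the image of \<open>f\<close>.\<close>

lemma epi_lsurj:
  assumes X: "sheaf X" and Y: "sheaf Y" and epi: "is_epi SH X Y f"
  shows "f \<in> mor X Y" "lsurj X Y f"
proof -
  note P = sheaf_psh[OF X] sheaf_psh[OF Y]
  show f: "f \<in> mor X Y" using epi by (simp add: is_mono_def opcat_def)
  obtain Q e where Q: "sheaf Q" "e \<in> mor Y Q" "\<And>A x. A \<in> Ob \<Longrightarrow> x \<in> crr X A \<Longrightarrow> e A (f A x) = \<zero>\<^bsub>fobj Q A\<^esub>"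
    "\<And>A y. A \<in> Ob \<Longrightarrow> y \<in> crr Y A \<Longrightarrow> e A y = \<zero>\<^bsub>fobj Q A\<^esub> \<Longrightarrow> locally A (\<lambda>B h. fmap Y A B h y \<in> f B ` crr X B)"
    by (rule cokernel_exists[OF X Y f]) (rule that; assumption)
  have "Comp (PSh k a) X Y Q e f = Comp (PSh k a) X Y Q \<zero>\<^bsub>HomM (PSh k a) Y Q\<^esub> f"
    by (rule mor_eqI[of _ X Q]) (use P Q f mor_closed[OF f P] in auto)
  then have "e = \<zero>\<^bsub>HomM (PSh k a) Y Q\<^esub>"
    using epi Q(1,2) P unfolding is_mono_def by (simp add: opcat_def)
  then show "lsurj X Y f" unfolding lsurj_def using Q(4) by simp
qed

text \<open>Uniqueness in the universal property makes any cokernel an epimorphism, to which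
  \<open>epi_lsurj\<close> applies.\<close>

lemma cokernel_epi:
  assumes X: "sheaf X" and Y: "sheaf Y" and Z: "sheaf Z" and f: "f \<in> mor X Y" and coker: "is_cokernel SH X Y f Z g"
  shows "g \<in> mor Y Z" "lsurj Y Z g"
proof -
  note P = sheaf_psh[OF X] sheaf_psh[OF Y] sheaf_psh[OF Z]
  show g: "g \<in> mor Y Z" using coker by (simp add: is_kernel_def opcat_def)
  have gf: "Comp (PSh k a) X Y Z g f = \<zero>\<^bsub>HomM (PSh k a) X Z\<^esub>" using coker by (simp add: is_kernel_def opcat_def)
  have "is_epi SH Y Z g"
    unfolding is_mono_def
  proof (intro conjI ballI impI)
    show "g \<in> Arr (opcat SH) Z Y" using g by (simp add: opcat_def)
    fix T u v assume "T \<in> Obj (opcat SH)" "u \<in> Arr (opcat SH) T Z" "v \<in> Arr (opcat SH) T Z"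
      and "Comp (opcat SH) T Z Y g u = Comp (opcat SH) T Z Y g v"
    then have T: "sheaf T" and u: "u \<in> mor Z T" and v: "v \<in> mor Z T" and eq: "Comp (PSh k a) Y Z T u g = Comp (PSh k a) Y Z T v g"
      by (simp_all add: opcat_def)
    have "Comp (PSh k a) X Y T (Comp (PSh k a) Y Z T u g) f = \<zero>\<^bsub>HomM (PSh k a) X T\<^esub>"
    proof (rule mor_eqI[of _ X T])
      fix A x assume A: "A \<in> Ob" "x \<in> crr X A"
      have "g A (f A x) = \<zero>\<^bsub>fobj Z A\<^esub>" using comp_apply[OF A, of Y Z g f] gf A by simp
      then show "Comp (PSh k a) X Y T (Comp (PSh k a) Y Z T u g) f A x = \<zero>\<^bsub>HomM (PSh k a) X T\<^esub> A x"
        using A mor_closed[OF f P(1,2) A] mor_zero[OF u P(3) _ A(1)] T by simp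
    qed (use P T u g f in auto)
    moreover have "Comp (PSh k a) Y Z T u g \<in> mor Y T" using P T u g by simp
    ultimately have "\<exists>!w. w \<in> mor Z T \<and> Comp (PSh k a) Y Z T w g = Comp (PSh k a) Y Z T u g"
      using coker T unfolding is_kernel_def by (simp add: opcat_def)
    then show "u = v" using u v eq by metis
  qed
  then show "lsurj Y Z g" by (rule epi_lsurj(2)[OF Y Z])
qed

text \<open>The kernel inclusion of \<open>f\<close> and the zero map have the same composite with
  \<open>f\<close>, so the kernel is zero.\<close>

lemma mono_inj:
  assumes X: "sheaf X" and Y: "sheaf Y" and mono: "is_mono SH X Y f"
  shows "f \<in> mor X Y" "inj_mor X f"
proof -
  note P = sheaf_psh[OF X] sheaf_psh[OF Y]
  show f: "f \<in> mor X Y" using mono by (simp add: is_mono_def)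
  show "inj_mor X f"
  proof (rule inj_morI[OF P f])
    fix A x assume A: "A \<in> Ob" and x: "x \<in> crr X A" and 0: "f A x = \<zero>\<^bsub>fobj Y A\<^esub>"
    obtain K m where K: "sheaf K" "m \<in> mor K X" "inj_mor K m" and m: "\<And>A x. A \<in> Ob \<Longrightarrow> x \<in> crr X A \<Longrightarrow> f A x = \<zero>\<^bsub>fobj Y A\<^esub> \<longleftrightarrow> x \<in> m A ` crr K A"
      using kernel_exists[OF X Y f] by blast
    note mc = mor_closed[OF K(2) sheaf_psh[OF K(1)] P(1)]
    have "Comp (PSh k a) K X Y f m = Comp (PSh k a) K X Y f \<zero>\<^bsub>HomM (PSh k a) K X\<^esub>"
    proof (rule mor_eqI[of _ K Y])
      fix A v assume A: "A \<in> Ob" and v: "v \<in> crr K A"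
      have "f A (m A v) = \<zero>\<^bsub>fobj Y A\<^esub>" using m[OF A mc[OF A v]] v by blast
      then show "Comp (PSh k a) K X Y f m A v = Comp (PSh k a) K X Y f \<zero>\<^bsub>HomM (PSh k a) K X\<^esub> A v"
        using A v mor_zero[OF f P A] by simp
    qed (use P K f in auto)
    then have eq: "m = \<zero>\<^bsub>HomM (PSh k a) K X\<^esub>" using mono K P unfolding is_mono_def by simp
    obtain v where v: "v \<in> crr K A" "x = m A v" using m[OF A x] 0 by blast
    then show "x = \<zero>\<^bsub>fobj X A\<^esub>" using eq A by simp
  qed
qed

text \<open>The kernel half gives injectivity and exactness in the middle, and the cokernel half
  adds local surjectivity. Exactness in the middle holds over each object, without passing to a
  cover.\<close>

lemma short_exact_iff:
  assumes X: "sheaf X" and Y: "sheaf Y" and Z: "sheaf Z" and f: "f \<in> mor X Y" and g: "g \<in> mor Y Z"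
  shows "short_exact SH X Y Z f g \<longleftrightarrow> inj_mor X f \<and> lsurj Y Z g \<and>
    (\<forall>A\<in>Ob. \<forall>y\<in>crr Y A. g A y = \<zero>\<^bsub>fobj Z A\<^esub> \<longleftrightarrow> y \<in> f A ` crr X A)"
proof
  assume "short_exact SH X Y Z f g"
  then have ker: "is_kernel SH Y Z g X f" and coker: "is_cokernel SH X Y f Z g" by (simp_all add: short_exact_def)
  show "inj_mor X f \<and> lsurj Y Z g \<and> (\<forall>A\<in>Ob. \<forall>y\<in>crr Y A. g A y = \<zero>\<^bsub>fobj Z A\<^esub> \<longleftrightarrow> y \<in> f A ` crr X A)"
    using is_kernelD[OF X Y Z g ker] cokernel_epi[OF X Y Z f coker] by blast
next
  assume *: "inj_mor X f \<and> lsurj Y Z g \<and> (\<forall>A\<in>Ob. \<forall>y\<in>crr Y A. g A y = \<zero>\<^bsub>fobj Z A\<^esub> \<longleftrightarrow> y \<in> f A ` crr X A)"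
  note P = sheaf_psh[OF X] sheaf_psh[OF Y] sheaf_psh[OF Z]
  have "is_kernel SH Y Z g X f" by (rule is_kernelI[OF X Y Z f g]) (use * in auto)
  moreover have "is_cokernel SH X Y f Z g"
  proof (rule is_cokernelI[OF X Y Z f g])
    show "g A (f A x) = \<zero>\<^bsub>fobj Z A\<^esub>" if "A \<in> Ob" "x \<in> crr X A" for A x
      using * that mor_closed[OF f P(1,2)] by blast
    show "locally A (\<lambda>B h. fmap Y A B h y \<in> f B ` crr X B)" if A: "A \<in> Ob" and y: "y \<in> crr Y A" and 0: "g A y = \<zero>\<^bsub>fobj Z A\<^esub>" for A y
    proof -
      obtain x where x: "x \<in> crr X A" "y = f A x" using * A y 0 by blast
      show ?thesis
      proof (rule locally_all[OF A])
        fix B h assume B: "B \<in> Ob" "h \<in> Arr a B A"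
        show "fmap Y A B h y \<in> f B ` crr X B"
          using mor_nat[OF f P(1,2) A B x(1)] psh_closed[OF P(1) A B x(1)] x(2) by (metis imageI)
      qed
    qed
  qed (use * in auto)
  ultimately show "short_exact SH X Y Z f g" by (simp add: short_exact_def)
qed

text \<open>The colimit of the empty family: each of its sections is locally zero.\<close>

lemma zero_object_exists: "\<exists>Z. is_zero_object SH Z"
proof -
  interpret cd: presheaf_diagram k a J "{} :: unit set" "\<lambda>_. undefined" "\<lambda>_. {}"
    by standard (auto simp: small_finite)
  obtain L :: "('k, 'o, 'u) presheaf" where L: "sheaf L"
    and dense: "\<forall>S. \<forall>A\<in>Ob. \<forall>x\<in>crr L A. (\<forall>B\<in>Ob. \<zero>\<^bsub>fobj L B\<^esub> \<in> S B) \<longrightarrow>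
       (\<forall>B\<in>Ob. \<forall>u\<in>S B. \<forall>v\<in>S B. u \<ominus>\<^bsub>fobj L B\<^esub> v \<in> S B) \<longrightarrow>
       locally A (\<lambda>B f. fmap L A B f x \<in> S B)"
    by (rule cd.sheaf_colimit) (simp add: that)
  have L': "psh L" using L by simp
  have zero: "x = \<zero>\<^bsub>fobj L A\<^esub>" if A: "A \<in> Ob" and x: "x \<in> crr L A" for A x
  proof -
    have "locally A (\<lambda>B f. fmap L A B f x \<in> {\<zero>\<^bsub>fobj L B\<^esub>})"
      by (rule dense[rule_format, OF A x]) (use L' in \<open>auto simp: psh_minus_zero_iff\<close>)
    then show ?thesis using L A x unfolding sheaf_def separated_def by simp
  qed
  have "\<exists>!f. f \<in> mor L X" if X: "sheaf X" for X
  proof (rule ex1I[of _ "\<zero>\<^bsub>HomM (PSh k a) L X\<^esub>"])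
    show "f = \<zero>\<^bsub>HomM (PSh k a) L X\<^esub>" if f: "f \<in> mor L X" for f
    proof (rule mor_eqI[OF f _ L' sheaf_psh[OF X]])
      fix A x assume A: "A \<in> Ob" and x: "x \<in> crr L A"
      show "f A x = \<zero>\<^bsub>HomM (PSh k a) L X\<^esub> A x"
        using zero[OF A x] mor_zero[OF f L' sheaf_psh[OF X] A] A x by simp
    qed (use L' X in simp)
  qed (use L' X in simp)
  moreover have "\<exists>!f. f \<in> mor X L" if X: "sheaf X" for X
  proof (rule ex1I[of _ "\<zero>\<^bsub>HomM (PSh k a) X L\<^esub>"])
    show "f = \<zero>\<^bsub>HomM (PSh k a) X L\<^esub>" if f: "f \<in> mor X L" for f
    proof (rule mor_eqI[OF f _ sheaf_psh[OF X] L'])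
      fix A x assume A: "A \<in> Ob" and x: "x \<in> crr X A"
      show "f A x = \<zero>\<^bsub>HomM (PSh k a) X L\<^esub> A x"
        using zero[OF A mor_closed[OF f sheaf_psh[OF X] L' A x]] A x by simp
    qed (use L' X in simp)
  qed (use L' X in simp)
  ultimately show ?thesis using L unfolding is_zero_object_def by (intro exI[of _ L]) simp
qed

text \<open>The coproduct from \<open>sheaf_colimit\<close> serves as the product. Its universal
  property provides the projections, and its uniqueness clause shows that the injections after the
  projections add up to the identity.\<close>

lemma product_exists:
  assumes X: "sheaf X" and Y: "sheaf Y"
  shows "\<exists>P p q. is_product SH X Y P p q"
proof -
  define D where "D b = (if b then X else Y)" for b
  define R :: "'o \<Rightarrow> ((bool \<times> 'u) \<times> (bool \<times> 'u)) set" where "R A = {}" for A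
  interpret cd: presheaf_diagram k a J "UNIV :: bool set" D R
    by standard (auto simp: small_finite D_def X Y R_def)
  obtain L l where L: "sheaf L" and l0: "\<forall>i\<in>UNIV. l i \<in> mor (D i) L"
    and univ: "\<forall>T t. sheaf T \<longrightarrow> (\<forall>i\<in>UNIV. t i \<in> mor (D i) T) \<longrightarrow>
       (\<forall>A\<in>Ob. \<forall>i x j y. ((i, x), (j, y)) \<in> R A \<longrightarrow> t i A x = t j A y) \<longrightarrow>
       (\<exists>h\<in>mor L T. \<forall>i\<in>UNIV. \<forall>A\<in>Ob. \<forall>x\<in>crr (D i) A. h A (l i A x) = t i A x)"
    and uniq: "\<forall>T h h'. sheaf T \<longrightarrow> h \<in> mor L T \<longrightarrow> h' \<in> mor L T \<longrightarrow>
       (\<forall>i\<in>UNIV. \<forall>A\<in>Ob. \<forall>x\<in>crr (D i) A. h A (l i A x) = h' A (l i A x)) \<longrightarrow> h = h'"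
    by (rule cd.sheaf_colimit) (rule that; assumption)
  note P = sheaf_psh[OF X] sheaf_psh[OF Y] sheaf_psh[OF L]
  have l: "l True \<in> mor X L" "l False \<in> mor Y L" using l0[rule_format, of True] l0[rule_format, of False] by (simp_all add: D_def)
  note lc = mor_closed[OF l(1) P(1,3)] mor_closed[OF l(2) P(2,3)]
  have "\<exists>h\<in>mor L X. \<forall>i\<in>UNIV. \<forall>A\<in>Ob. \<forall>x\<in>crr (D i) A. h A (l i A x) =
      (if i then Ident (PSh k a) X else \<zero>\<^bsub>HomM (PSh k a) Y X\<^esub>) A x"
    by (rule univ[rule_format, OF X]) (use P in \<open>auto simp: D_def R_def\<close>)
  then obtain p where p: "p \<in> mor L X" and pl: "\<forall>i\<in>UNIV. \<forall>A\<in>Ob. \<forall>x\<in>crr (D i) A. p A (l i A x) =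
      (if i then Ident (PSh k a) X else \<zero>\<^bsub>HomM (PSh k a) Y X\<^esub>) A x" by blast
  have p1: "p A (l True A x) = x" if "A \<in> Ob" "x \<in> crr X A" for A x using pl[rule_format, of True A x] that by (simp add: D_def)
  have p2: "p A (l False A x) = \<zero>\<^bsub>fobj X A\<^esub>" if "A \<in> Ob" "x \<in> crr Y A" for A x using pl[rule_format, of False A x] that by (simp add: D_def)
  have "\<exists>h\<in>mor L Y. \<forall>i\<in>UNIV. \<forall>A\<in>Ob. \<forall>x\<in>crr (D i) A. h A (l i A x) =
      (if i then \<zero>\<^bsub>HomM (PSh k a) X Y\<^esub> else Ident (PSh k a) Y) A x"
    by (rule univ[rule_format, OF Y]) (use P in \<open>auto simp: D_def R_def\<close>)
  then obtain q where q: "q \<in> mor L Y" and ql: "\<forall>i\<in>UNIV. \<forall>A\<in>Ob. \<forall>x\<in>crr (D i) A. q A (l i A x) =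
      (if i then \<zero>\<^bsub>HomM (PSh k a) X Y\<^esub> else Ident (PSh k a) Y) A x" by blast
  have q1: "q A (l True A x) = \<zero>\<^bsub>fobj Y A\<^esub>" if "A \<in> Ob" "x \<in> crr X A" for A x using ql[rule_format, of True A x] that by (simp add: D_def)
  have q2: "q A (l False A x) = x" if "A \<in> Ob" "x \<in> crr Y A" for A x using ql[rule_format, of False A x] that by (simp add: D_def)
  define \<epsilon> where "\<epsilon> = Comp (PSh k a) L X L (l True) p \<oplus>\<^bsub>HomM (PSh k a) L L\<^esub> Comp (PSh k a) L Y L (l False) q"
  have \<epsilon>: "\<epsilon> \<in> mor L L" using P p q l by (simp add: \<epsilon>_def)
  have "\<epsilon> = Ident (PSh k a) L"
  proof (rule uniq[rule_format, OF L \<epsilon>])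
    fix i A x assume A: "A \<in> Ob" and x: "x \<in> crr (D i) A"
    show "\<epsilon> A (l i A x) = Ident (PSh k a) L A (l i A x)"
      using A x P lc mor_zero[OF l(1) P(1,3) A] mor_zero[OF l(2) P(2,3) A]
      by (cases i) (simp_all add: \<epsilon>_def D_def p1 p2 q1 q2)
  qed (use P in simp)
  then have "\<epsilon> A v = v" if "A \<in> Ob" "v \<in> crr L A" for A v using that by simp
  then have split: "l True A (p A v) \<oplus>\<^bsub>fobj L A\<^esub> l False A (q A v) = v" if "A \<in> Ob" "v \<in> crr L A" for A v
    using that by (simp add: \<epsilon>_def)
  have "is_product SH X Y L p q"
    unfolding is_product_def SH_simps
  proof (intro conjI ballI L p q)
    fix T f g assume "T \<in> Obj SH" and f: "f \<in> mor T X" and g: "g \<in> mor T Y"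
    then have T: "psh T" by simp
    note fc = mor_closed[OF f T P(1)] and gc = mor_closed[OF g T P(2)]
    define h where "h = Comp (PSh k a) T X L (l True) f \<oplus>\<^bsub>HomM (PSh k a) T L\<^esub> Comp (PSh k a) T Y L (l False) g"
    have h: "h \<in> mor T L" using P T f g l by (simp add: h_def)
    have ha: "h A x = l True A (f A x) \<oplus>\<^bsub>fobj L A\<^esub> l False A (g A x)" if "A \<in> Ob" "x \<in> crr T A" for A x
      using that by (simp add: h_def)
    show "\<exists>!h. h \<in> mor T L \<and> Comp (PSh k a) T L X p h = f \<and> Comp (PSh k a) T L Y q h = g"
    proof (rule ex1I[of _ h])
      have "Comp (PSh k a) T L X p h = f"
      proof (rule mor_eqI[OF _ f T P(1)])
        fix A x assume A: "A \<in> Ob" and x: "x \<in> crr T A"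
        show "Comp (PSh k a) T L X p h A x = f A x"
          using A x fc gc lc P by (simp add: ha mor_add[OF p P(3,1) A] p1 p2)
      qed (use P T p h in simp)
      moreover have "Comp (PSh k a) T L Y q h = g"
      proof (rule mor_eqI[OF _ g T P(2)])
        fix A x assume A: "A \<in> Ob" and x: "x \<in> crr T A"
        show "Comp (PSh k a) T L Y q h A x = g A x"
          using A x fc gc lc P by (simp add: ha mor_add[OF q P(3,2) A] q1 q2)
      qed (use P T q h in simp)
      ultimately show "h \<in> mor T L \<and> Comp (PSh k a) T L X p h = f \<and> Comp (PSh k a) T L Y q h = g" using h by blast
      fix w assume w: "w \<in> mor T L \<and> Comp (PSh k a) T L X p w = f \<and> Comp (PSh k a) T L Y q w = g"
      show "w = h"
      proof (rule mor_eqI[OF _ h T P(3)])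
        fix A x assume A: "A \<in> Ob" and x: "x \<in> crr T A"
        have "p A (w A x) = f A x" "q A (w A x) = g A x"
          using w comp_apply[OF A x, of L X p w] comp_apply[OF A x, of L Y q w] by simp_all
        then show "w A x = h A x" using split[OF A mor_closed[of w T L A x]] w T P A x by (simp add: ha)
      qed (use w in blast)
    qed
  qed
  then show ?thesis by blast
qed

lemma abelian_SH: "abelian k SH"
  unfolding abelian_def
proof (intro conjI ballI allI impI lin_category_SH zero_object_exists)
  fix X Y assume "X \<in> Obj SH" "Y \<in> Obj SH"
  then have X: "sheaf X" and Y: "sheaf Y" by simp_all
  note P = sheaf_psh[OF X] sheaf_psh[OF Y]
  show "\<exists>P p q. is_product SH X Y P p q" using product_exists X Y .
  {
    fix f assume "f \<in> Arr SH X Y"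
    then have f: "f \<in> mor X Y" by simp
    obtain K m where K: "sheaf K" "m \<in> mor K X" "inj_mor K m" and m: "\<And>A x. A \<in> Ob \<Longrightarrow> x \<in> crr X A \<Longrightarrow> f A x = \<zero>\<^bsub>fobj Y A\<^esub> \<longleftrightarrow> x \<in> m A ` crr K A"
      using kernel_exists[OF X Y f] by blast
    have "is_kernel SH X Y f K m" by (rule is_kernelI[OF K(1) X Y K(2) f K(3) m])
    then show "\<exists>K m. is_kernel SH X Y f K m" by blast
    obtain Q e where "sheaf Q" "e \<in> mor Y Q" "lsurj Y Q e" "\<And>A x. A \<in> Ob \<Longrightarrow> x \<in> crr X A \<Longrightarrow> e A (f A x) = \<zero>\<^bsub>fobj Q A\<^esub>"
      "\<And>A y. A \<in> Ob \<Longrightarrow> y \<in> crr Y A \<Longrightarrow> e A y = \<zero>\<^bsub>fobj Q A\<^esub> \<Longrightarrow> locally A (\<lambda>B h. fmap Y A B h y \<in> f B ` crr X B)"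
      by (rule cokernel_exists[OF X Y f]) (rule that; assumption)
    then have "is_cokernel SH X Y f Q e" by (intro is_cokernelI[OF X Y _ f])
    then show "\<exists>Q e. is_cokernel SH X Y f Q e" by blast
  next
    fix f assume "is_mono SH X Y f"
    note f = mono_inj[OF X Y this]
    obtain Q e where Q: "sheaf Q" "e \<in> mor Y Q" and ef: "\<And>A x. A \<in> Ob \<Longrightarrow> x \<in> crr X A \<Longrightarrow> e A (f A x) = \<zero>\<^bsub>fobj Q A\<^esub>"
      and ker: "\<And>A y. A \<in> Ob \<Longrightarrow> y \<in> crr Y A \<Longrightarrow> e A y = \<zero>\<^bsub>fobj Q A\<^esub> \<Longrightarrow> locally A (\<lambda>B h. fmap Y A B h y \<in> f B ` crr X B)"
      by (rule cokernel_exists[OF X Y f(1)]) (rule that; assumption)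
    \<comment> \<open>A monomorphism is the kernel of its cokernel: a section killed by
      \<open>e\<close> is locally in the image of \<open>f\<close>, and \<open>image_local\<close>
      removes the word locally.\<close>
    have "is_kernel SH Y Q e X f"
    proof (rule is_kernelI[OF X Y Q(1) f(1) Q(2) f(2)])
      show "e A y = \<zero>\<^bsub>fobj Q A\<^esub> \<longleftrightarrow> y \<in> f A ` crr X A" if "A \<in> Ob" "y \<in> crr Y A" for A y
        using image_local[OF X Y f that ker[OF that]] ef that by blast
    qed
    then show "\<exists>Z\<in>Obj SH. \<exists>g\<in>Arr SH Y Z. is_kernel SH Y Z g X f" using Q by auto
  next
    fix f assume "is_epi SH X Y f"
    note f = epi_lsurj[OF X Y this]
    obtain K m where K: "sheaf K" "m \<in> mor K X" and m: "\<And>A x. A \<in> Ob \<Longrightarrow> x \<in> crr X A \<Longrightarrow> f A x = \<zero>\<^bsub>fobj Y A\<^esub> \<longleftrightarrow> x \<in> m A ` crr K A"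
      by (rule kernel_exists[OF X Y f(1)]) (rule that; assumption)
    note K' = sheaf_psh[OF K(1)]
    \<comment> \<open>An epimorphism is the cokernel of its kernel, as it is locally surjective and
      its kernel is known section by section.\<close>
    have "is_cokernel SH K X m Y f"
    proof (rule is_cokernelI[OF K(1) X Y K(2) f])
      show "f A (m A x) = \<zero>\<^bsub>fobj Y A\<^esub>" if "A \<in> Ob" "x \<in> crr K A" for A x
        using m that mor_closed[OF K(2) K' P(1)] by blast
      show "locally A (\<lambda>B h. fmap X A B h x \<in> m B ` crr K B)" if A: "A \<in> Ob" and x: "x \<in> crr X A" and 0: "f A x = \<zero>\<^bsub>fobj Y A\<^esub>" for A x
      proof (rule locally_all[OF A])
        fix B h assume B: "B \<in> Ob" "h \<in> Arr a B A"
        have "f B (fmap X A B h x) = \<zero>\<^bsub>fobj Y B\<^esub>" using mor_nat[OF f(1) P A B x] 0 P A B by simp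
        then show "fmap X A B h x \<in> m B ` crr K B" using m[OF B(1) psh_closed[OF P(1) A B x]] by blast
      qed
    qed
    then show "\<exists>Z\<in>Obj SH. \<exists>g\<in>Arr SH Z X. is_cokernel SH Z X g Y f" using K by auto
  }
qed

end

section \<open>Filtered colimits of abelian groups\<close>

locale filtered_system =
  fixes K :: "('j, 'm) cat" and M :: "'j \<Rightarrow> ('k, 'x) module" and \<phi> :: "'j \<Rightarrow> 'j \<Rightarrow> 'm \<Rightarrow> 'x \<Rightarrow> 'x"
  assumes cat: "category K" and filt: "filtered K" and M: "i \<in> Obj K \<Longrightarrow> abelian_group (M i)"
    and \<phi>_closed: "i \<in> Obj K \<Longrightarrow> j \<in> Obj K \<Longrightarrow> u \<in> Arr K i j \<Longrightarrow> x \<in> carrier (M i) \<Longrightarrow> \<phi> i j u x \<in> carrier (M j)"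
    and \<phi>_add: "i \<in> Obj K \<Longrightarrow> j \<in> Obj K \<Longrightarrow> u \<in> Arr K i j \<Longrightarrow> x \<in> carrier (M i) \<Longrightarrow> y \<in> carrier (M i) \<Longrightarrow>
      \<phi> i j u (x \<oplus>\<^bsub>M i\<^esub> y) = \<phi> i j u x \<oplus>\<^bsub>M j\<^esub> \<phi> i j u y"
    and \<phi>_id: "i \<in> Obj K \<Longrightarrow> x \<in> carrier (M i) \<Longrightarrow> \<phi> i i (Ident K i) x = x"
    and \<phi>_comp: "i \<in> Obj K \<Longrightarrow> j \<in> Obj K \<Longrightarrow> l \<in> Obj K \<Longrightarrow> u \<in> Arr K i j \<Longrightarrow> v \<in> Arr K j l \<Longrightarrow> x \<in> carrier (M i) \<Longrightarrow>
      \<phi> i l (Comp K i j l v u) x = \<phi> j l v (\<phi> i j u x)"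
begin

lemma K_comp: "i \<in> Obj K \<Longrightarrow> j \<in> Obj K \<Longrightarrow> l \<in> Obj K \<Longrightarrow> u \<in> Arr K i j \<Longrightarrow> v \<in> Arr K j l \<Longrightarrow> Comp K i j l v u \<in> Arr K i l"
  and K_id: "i \<in> Obj K \<Longrightarrow> Ident K i \<in> Arr K i i"
  and K_assoc: "i \<in> Obj K \<Longrightarrow> j \<in> Obj K \<Longrightarrow> l \<in> Obj K \<Longrightarrow> n \<in> Obj K \<Longrightarrow> u \<in> Arr K i j \<Longrightarrow> v \<in> Arr K j l \<Longrightarrow> w \<in> Arr K l n \<Longrightarrow>
    Comp K i j n (Comp K j l n w v) u = Comp K i l n w (Comp K i j l v u)"
  using cat unfolding category_def by (blast, blast, metis)

lemma bound: "i \<in> Obj K \<Longrightarrow> j \<in> Obj K \<Longrightarrow> \<exists>l\<in>Obj K. \<exists>u\<in>Arr K i l. \<exists>v\<in>Arr K j l. True"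
  and coequalize: "i \<in> Obj K \<Longrightarrow> j \<in> Obj K \<Longrightarrow> u \<in> Arr K i j \<Longrightarrow> v \<in> Arr K i j \<Longrightarrow> \<exists>l\<in>Obj K. \<exists>w\<in>Arr K j l. Comp K i j l w u = Comp K i j l w v"
  using filt unfolding filtered_def by blast+

text \<open>After a common bound of \<open>l\<close> and \<open>l'\<close>, one coequalising arrow
  is taken for the source \<open>j\<close> and then another for the source \<open>i\<close>; this
  keeps the first equation.\<close>

lemma refine:
  assumes i: "i \<in> Obj K" and j: "j \<in> Obj K" and l: "l \<in> Obj K" and l': "l' \<in> Obj K"
    and u: "u \<in> Arr K j l" and v: "v \<in> Arr K i l" and u': "u' \<in> Arr K j l'" and v': "v' \<in> Arr K i l'"
  obtains p s s' where "p \<in> Obj K" "s \<in> Arr K l p" "s' \<in> Arr K l' p"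
    "Comp K j l p s u = Comp K j l' p s' u'" "Comp K i l p s v = Comp K i l' p s' v'"
proof -
  obtain n r r' where n: "n \<in> Obj K" and r: "r \<in> Arr K l n" and r': "r' \<in> Arr K l' n" using bound[OF l l'] by blast
  obtain o1 t where o1: "o1 \<in> Obj K" and t: "t \<in> Arr K n o1" and teq: "Comp K j n o1 t (Comp K j l n r u) = Comp K j n o1 t (Comp K j l' n r' u')"
    using coequalize[OF j n K_comp[OF j l n u r] K_comp[OF j l' n u' r']] by blast
  define q where "q = Comp K l n o1 t r"
  define q' where "q' = Comp K l' n o1 t r'"
  have q: "q \<in> Arr K l o1" "q' \<in> Arr K l' o1" using K_comp[OF l n o1 r t] K_comp[OF l' n o1 r' t] by (auto simp: q_def q'_def)
  have qeq: "Comp K j l o1 q u = Comp K j l' o1 q' u'"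
    using teq K_assoc[OF j l n o1 u r t] K_assoc[OF j l' n o1 u' r' t] by (simp add: q_def q'_def)
  obtain p w where p: "p \<in> Obj K" and w: "w \<in> Arr K o1 p" and weq: "Comp K i o1 p w (Comp K i l o1 q v) = Comp K i o1 p w (Comp K i l' o1 q' v')"
    using coequalize[OF i o1 K_comp[OF i l o1 v q(1)] K_comp[OF i l' o1 v' q(2)]] by blast
  show thesis
  proof (rule that[OF p K_comp[OF l o1 p q(1) w] K_comp[OF l' o1 p q(2) w]])
    show "Comp K j l p (Comp K l o1 p w q) u = Comp K j l' p (Comp K l' o1 p w q') u'"
      using K_assoc[OF j l o1 p u q(1) w] K_assoc[OF j l' o1 p u' q(2) w] qeq by simp
    show "Comp K i l p (Comp K l o1 p w q) v = Comp K i l' p (Comp K l' o1 p w q') v'"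
      using K_assoc[OF i l o1 p v q(1) w] K_assoc[OF i l' o1 p v' q(2) w] weq by simp
  qed
qed

definition eqv :: "'j \<Rightarrow> 'x \<Rightarrow> 'j \<Rightarrow> 'x \<Rightarrow> bool" where
  "eqv i x j y \<longleftrightarrow> (\<exists>l\<in>Obj K. \<exists>u\<in>Arr K i l. \<exists>v\<in>Arr K j l. \<phi> i l u x = \<phi> j l v y)"

definition cl :: "'j \<Rightarrow> 'x \<Rightarrow> ('j \<times> 'x) set" where
  "cl i x = {(j, y). j \<in> Obj K \<and> y \<in> carrier (M j) \<and> eqv i x j y}"

lemma eqv_sym: "eqv i x j y \<Longrightarrow> eqv j y i x"
  unfolding eqv_def by metis

lemma eqv_refl: "i \<in> Obj K \<Longrightarrow> eqv i x i x"
  unfolding eqv_def using K_id by blast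

text \<open>The two stages are compared by \<open>refine\<close> with both sources equal to the
  middle index \<open>j\<close>.\<close>

lemma eqv_trans:
  assumes i: "i \<in> Obj K" and j: "j \<in> Obj K" and m: "m \<in> Obj K" and x: "x \<in> carrier (M i)" and y: "y \<in> carrier (M j)" and z: "z \<in> carrier (M m)"
    and 1: "eqv i x j y" and 2: "eqv j y m z"
  shows "eqv i x m z"
proof -
  obtain l u v where l: "l \<in> Obj K" "u \<in> Arr K i l" "v \<in> Arr K j l" "\<phi> i l u x = \<phi> j l v y" using 1 by (auto simp: eqv_def)
  obtain l' u' v' where l': "l' \<in> Obj K" "u' \<in> Arr K j l'" "v' \<in> Arr K m l'" "\<phi> j l' u' y = \<phi> m l' v' z" using 2 by (auto simp: eqv_def)
  obtain p s s' where p: "p \<in> Obj K" "s \<in> Arr K l p" "s' \<in> Arr K l' p" "Comp K j l p s v = Comp K j l' p s' u'"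
    by (rule refine[OF j j l(1) l'(1) l(3) l(3) l'(2) l'(2)])
  have "\<phi> i p (Comp K i l p s u) x = \<phi> l p s (\<phi> j l v y)" using \<phi>_comp[OF i l(1) p(1) l(2) p(2) x] l(4) by simp
  also have "\<dots> = \<phi> l' p s' (\<phi> j l' u' y)"
    using \<phi>_comp[OF j l(1) p(1) l(3) p(2) y] \<phi>_comp[OF j l'(1) p(1) l'(2) p(3) y] p(4) by simp
  also have "\<dots> = \<phi> m p (Comp K m l' p s' v') z" using \<phi>_comp[OF m l'(1) p(1) l'(3) p(3) z] l'(4) by simp
  finally show ?thesis
    unfolding eqv_def using p(1) K_comp[OF i l(1) p(1) l(2) p(2)] K_comp[OF m l'(1) p(1) l'(3) p(3)] by blast
qed

lemma cl_eq_iff: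
  assumes "i \<in> Obj K" "j \<in> Obj K" "x \<in> carrier (M i)" "y \<in> carrier (M j)"
  shows "cl i x = cl j y \<longleftrightarrow> eqv i x j y"
proof
  assume "cl i x = cl j y"
  moreover have "(j, y) \<in> cl j y" using assms eqv_refl by (simp add: cl_def)
  ultimately have "(j, y) \<in> cl i x" by simp
  then show "eqv i x j y" by (simp add: cl_def)
next
  assume e: "eqv i x j y"
  have "eqv i x m z \<longleftrightarrow> eqv j y m z" if "m \<in> Obj K" "z \<in> carrier (M m)" for m z
    using eqv_trans[OF assms(2,1) that(1) assms(4,3) that(2) eqv_sym[OF e]] eqv_trans[OF assms(1,2) that(1) assms(3,4) that(2) e] by blast
  then show "cl i x = cl j y" unfolding cl_def by auto
qed

lemma cl_push:
  assumes "i \<in> Obj K" "l \<in> Obj K" "u \<in> Arr K i l" "x \<in> carrier (M i)"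
  shows "cl l (\<phi> i l u x) = cl i x"
proof -
  have "eqv l (\<phi> i l u x) i x"
    unfolding eqv_def using assms K_id[OF assms(2)] \<phi>_id[OF assms(2) \<phi>_closed[OF assms]] by blast
  then show ?thesis using cl_eq_iff assms \<phi>_closed[OF assms] by blast
qed

lemma \<phi>_zero:
  assumes "i \<in> Obj K" "l \<in> Obj K" "u \<in> Arr K i l"
  shows "\<phi> i l u \<zero>\<^bsub>M i\<^esub> = \<zero>\<^bsub>M l\<^esub>"
proof -
  interpret Mi: abelian_group "M i" using M assms by blast
  interpret Ml: abelian_group "M l" using M assms by blast
  have "\<phi> i l u \<zero>\<^bsub>M i\<^esub> \<oplus>\<^bsub>M l\<^esub> \<phi> i l u \<zero>\<^bsub>M i\<^esub> = \<phi> i l u \<zero>\<^bsub>M i\<^esub>"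
    using \<phi>_add[OF assms Mi.zero_closed Mi.zero_closed] by simp
  then show ?thesis using \<phi>_closed[OF assms Mi.zero_closed] by simp
qed

definition base :: 'j where "base = (SOME i. i \<in> Obj K)"

lemma base: "base \<in> Obj K"
  using filt unfolding base_def filtered_def by (metis ex_in_conv someI_ex)

text \<open>The union in \<open>mult\<close> runs over all pairs of representatives at a common
  stage. By \<open>cl_mult\<close> they all give the same class, so the union is that class.\<close>

definition colim :: "('j \<times> 'x) set monoid" where
  "colim = \<lparr>carrier = {cl i x | i x. i \<in> Obj K \<and> x \<in> carrier (M i)},
     mult = (\<lambda>X Y. \<Union>{cl j (y \<oplus>\<^bsub>M j\<^esub> z) | j y z. (j, y) \<in> X \<and> (j, z) \<in> Y}), one = cl base \<zero>\<^bsub>M base\<^esub>\<rparr>"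

text \<open>Representatives of the two factors agree with \<open>x\<close> and \<open>y\<close> at
  two stages. \<open>refine\<close> provides one stage reached from \<open>j\<close> by a single
  arrow and from \<open>i\<close> by a single arrow, and there the sums can be compared.\<close>

lemma cl_mult:
  assumes i: "i \<in> Obj K" and x: "x \<in> carrier (M i)" and y: "y \<in> carrier (M i)"
  shows "cl i x \<otimes>\<^bsub>colim\<^esub> cl i y = cl i (x \<oplus>\<^bsub>M i\<^esub> y)"
proof -
  have sum: "v \<oplus>\<^bsub>M j\<^esub> w \<in> carrier (M j)" if "j \<in> Obj K" "v \<in> carrier (M j)" "w \<in> carrier (M j)" for j v w
    using abelian_groupE(1)[OF M[OF that(1)] that(2,3)] .
  have "cl j (v \<oplus>\<^bsub>M j\<^esub> w) = cl i (x \<oplus>\<^bsub>M i\<^esub> y)" if v: "(j, v) \<in> cl i x" and w: "(j, w) \<in> cl i y" for j v w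
  proof -
    have j: "j \<in> Obj K" and vM: "v \<in> carrier (M j)" and wM: "w \<in> carrier (M j)" and e: "eqv j v i x" "eqv j w i y"
      using v w eqv_sym by (auto simp: cl_def)
    obtain l u r where l: "l \<in> Obj K" "u \<in> Arr K j l" "r \<in> Arr K i l" "\<phi> j l u v = \<phi> i l r x" using e(1) by (auto simp: eqv_def)
    obtain l' u' r' where l': "l' \<in> Obj K" "u' \<in> Arr K j l'" "r' \<in> Arr K i l'" "\<phi> j l' u' w = \<phi> i l' r' y" using e(2) by (auto simp: eqv_def)
    obtain p s s' where p: "p \<in> Obj K" "s \<in> Arr K l p" "s' \<in> Arr K l' p"
      and su: "Comp K j l p s u = Comp K j l' p s' u'" and sr: "Comp K i l p s r = Comp K i l' p s' r'"
      by (rule refine[OF i j l(1) l'(1) l(2,3) l'(2,3)])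
    note a = K_comp[OF j l(1) p(1) l(2) p(2)] and b = K_comp[OF i l(1) p(1) l(3) p(2)]
    have "\<phi> j p (Comp K j l p s u) v = \<phi> i p (Comp K i l p s r) x"
      using \<phi>_comp[OF j l(1) p(1) l(2) p(2) vM] \<phi>_comp[OF i l(1) p(1) l(3) p(2) x] l(4) by simp
    moreover have "\<phi> j p (Comp K j l p s u) w = \<phi> i p (Comp K i l p s r) y"
      using \<phi>_comp[OF j l'(1) p(1) l'(2) p(3) wM] \<phi>_comp[OF i l'(1) p(1) l'(3) p(3) y] l'(4) su sr by simp
    ultimately have "\<phi> j p (Comp K j l p s u) (v \<oplus>\<^bsub>M j\<^esub> w) = \<phi> i p (Comp K i l p s r) (x \<oplus>\<^bsub>M i\<^esub> y)"
      using \<phi>_add[OF j p(1) a vM wM] \<phi>_add[OF i p(1) b x y] by simp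
    then have "eqv j (v \<oplus>\<^bsub>M j\<^esub> w) i (x \<oplus>\<^bsub>M i\<^esub> y)" unfolding eqv_def using p(1) a b by blast
    then show ?thesis using cl_eq_iff[OF j i sum[OF j vM wM] sum[OF i x y]] by blast
  qed
  moreover have "(i, x) \<in> cl i x" "(i, y) \<in> cl i y" using i x y eqv_refl by (auto simp: cl_def)
  ultimately have "{cl j (v \<oplus>\<^bsub>M j\<^esub> w) | j v w. (j, v) \<in> cl i x \<and> (j, w) \<in> cl i y} = {cl i (x \<oplus>\<^bsub>M i\<^esub> y)}" by blast
  then show ?thesis by (simp add: colim_def)
qed

lemma colim_carrier: "X \<in> carrier colim \<longleftrightarrow> (\<exists>i x. i \<in> Obj K \<and> x \<in> carrier (M i) \<and> X = cl i x)"
  by (auto simp: colim_def)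

text \<open>Used to bring several elements to one stage: each further element is taken at a stage
  above the previous one.\<close>

lemma common_stage:
  assumes X: "X \<in> carrier colim" and i: "i \<in> Obj K"
  obtains l u x where "l \<in> Obj K" "u \<in> Arr K i l" "x \<in> carrier (M l)" "X = cl l x"
proof -
  obtain j y where j: "j \<in> Obj K" "y \<in> carrier (M j)" "X = cl j y" using X by (auto simp: colim_carrier)
  obtain l u v where l: "l \<in> Obj K" "u \<in> Arr K i l" "v \<in> Arr K j l" using bound[OF i j(1)] by blast
  show thesis using that[OF l(1,2) \<phi>_closed[OF j(1) l(1,3) j(2)]] cl_push[OF j(1) l(1,3) j(2)] j(3) by simp
qed

lemma colim_zero: "i \<in> Obj K \<Longrightarrow> cl i \<zero>\<^bsub>M i\<^esub> = \<one>\<^bsub>colim\<^esub>"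
proof -
  assume i: "i \<in> Obj K"
  obtain l u v where l: "l \<in> Obj K" "u \<in> Arr K i l" "v \<in> Arr K base l" using bound[OF i base] by blast
  have "eqv i \<zero>\<^bsub>M i\<^esub> base \<zero>\<^bsub>M base\<^esub>"
    unfolding eqv_def using l \<phi>_zero[OF i l(1,2)] \<phi>_zero[OF base l(1,3)] by (metis)
  then show ?thesis
    using cl_eq_iff[OF i base] M[OF i] M[OF base] abelian_groupE(2) by (auto simp: colim_def)
qed

lemma colim_comm_group: "comm_group colim"
proof (rule comm_groupI)
  fix X Y assume X: "X \<in> carrier colim" and Y: "Y \<in> carrier colim"
  obtain i x where i: "i \<in> Obj K" "x \<in> carrier (M i)" "X = cl i x" using X by (auto simp: colim_carrier)
  obtain l u y where l: "l \<in> Obj K" "u \<in> Arr K i l" "y \<in> carrier (M l)" "Y = cl l y" using common_stage[OF Y i(1)] .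
  define x' where "x' = \<phi> i l u x"
  have x': "x' \<in> carrier (M l)" "X = cl l x'" using \<phi>_closed[OF i(1) l(1,2) i(2)] cl_push[OF i(1) l(1,2) i(2)] i(3) by (auto simp: x'_def)
  interpret Ml: abelian_group "M l" using M l by blast
  show "X \<otimes>\<^bsub>colim\<^esub> Y \<in> carrier colim"
    using cl_mult[OF l(1) x'(1) l(3)] x' l Ml.a_closed unfolding colim_carrier by auto
  show "X \<otimes>\<^bsub>colim\<^esub> Y = Y \<otimes>\<^bsub>colim\<^esub> X"
    using cl_mult[OF l(1) x'(1) l(3)] cl_mult[OF l(1) l(3) x'(1)] x' l Ml.a_comm by simp
  fix Z assume Z: "Z \<in> carrier colim"
  obtain n w z where n: "n \<in> Obj K" "w \<in> Arr K l n" "z \<in> carrier (M n)" "Z = cl n z" using common_stage[OF Z l(1)] .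
  interpret Mn: abelian_group "M n" using M n by blast
  define x2 where "x2 = \<phi> l n w x'"
  define y2 where "y2 = \<phi> l n w y"
  have x2: "x2 \<in> carrier (M n)" "X = cl n x2" using \<phi>_closed[OF l(1) n(1,2) x'(1)] cl_push[OF l(1) n(1,2) x'(1)] x'(2) by (auto simp: x2_def)
  have y2: "y2 \<in> carrier (M n)" "Y = cl n y2" using \<phi>_closed[OF l(1) n(1,2) l(3)] cl_push[OF l(1) n(1,2) l(3)] l(4) by (auto simp: y2_def)
  show "X \<otimes>\<^bsub>colim\<^esub> Y \<otimes>\<^bsub>colim\<^esub> Z = X \<otimes>\<^bsub>colim\<^esub> (Y \<otimes>\<^bsub>colim\<^esub> Z)"
    using x2 y2 n by (simp add: cl_mult Mn.a_assoc)
next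
  show "\<one>\<^bsub>colim\<^esub> \<in> carrier colim"
    unfolding colim_carrier using colim_zero[OF base] base abelian_groupE(2)[OF M[OF base]] by metis
next
  fix X assume "X \<in> carrier colim"
  then obtain i x where i: "i \<in> Obj K" "x \<in> carrier (M i)" "X = cl i x" by (auto simp: colim_carrier)
  interpret Mi: abelian_group "M i" using M i by blast
  show "\<one>\<^bsub>colim\<^esub> \<otimes>\<^bsub>colim\<^esub> X = X"
    using cl_mult[OF i(1) Mi.zero_closed i(2)] i by (simp add: colim_zero)
  show "\<exists>Y\<in>carrier colim. Y \<otimes>\<^bsub>colim\<^esub> X = \<one>\<^bsub>colim\<^esub>"
  proof (rule bexI[of _ "cl i (\<ominus>\<^bsub>M i\<^esub> x)"])
    show "cl i (\<ominus>\<^bsub>M i\<^esub> x) \<otimes>\<^bsub>colim\<^esub> X = \<one>\<^bsub>colim\<^esub>"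
      using cl_mult[OF i(1) Mi.a_inv_closed[OF i(2)] i(2)] i by (simp add: colim_zero Mi.l_neg)
    show "cl i (\<ominus>\<^bsub>M i\<^esub> x) \<in> carrier colim" unfolding colim_carrier using i Mi.a_inv_closed by blast
  qed
qed

lemma cl_eq_one:
  assumes i: "i \<in> Obj K" and x: "x \<in> carrier (M i)" and 1: "cl i x = \<one>\<^bsub>colim\<^esub>"
  shows "\<exists>l\<in>Obj K. \<exists>u\<in>Arr K i l. \<phi> i l u x = \<zero>\<^bsub>M l\<^esub>"
proof -
  have "cl i x = cl i \<zero>\<^bsub>M i\<^esub>" using 1 colim_zero[OF i] by simp
  then have "eqv i x i \<zero>\<^bsub>M i\<^esub>" using cl_eq_iff[OF i i x abelian_groupE(2)[OF M[OF i]]] by blast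
  then show ?thesis unfolding eqv_def using \<phi>_zero[OF i] by metis
qed

end

section \<open>The category of sheaves is a Grothendieck category\<close>

context linear_topology
begin

lemma
  assumes "is_functor K SH F"
  shows functor_sheaf: "i \<in> Obj K \<Longrightarrow> sheaf (fobj F i)"
    and functor_mor: "i \<in> Obj K \<Longrightarrow> j \<in> Obj K \<Longrightarrow> u \<in> Arr K i j \<Longrightarrow> fmap F i j u \<in> mor (fobj F i) (fobj F j)"
    and functor_id: "i \<in> Obj K \<Longrightarrow> fmap F i i (Ident K i) = Ident (PSh k a) (fobj F i)"
    and functor_comp: "i \<in> Obj K \<Longrightarrow> j \<in> Obj K \<Longrightarrow> l \<in> Obj K \<Longrightarrow> u \<in> Arr K i j \<Longrightarrow> v \<in> Arr K j l \<Longrightarrow>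
      fmap F i l (Comp K i j l v u) = Comp (PSh k a) (fobj F i) (fobj F j) (fobj F l) (fmap F j l v) (fmap F i j u)"
  using assms unfolding is_functor_def SH_simps by blast+

lemma
  assumes co: "is_cocone K SH F L l" and F: "is_functor K SH F"
  shows cocone_sheaf: "sheaf L"
    and cocone_mor: "\<And>i. i \<in> Obj K \<Longrightarrow> l i \<in> mor (fobj F i) L"
    and cocone_eq: "\<And>i j u A x. i \<in> Obj K \<Longrightarrow> j \<in> Obj K \<Longrightarrow> u \<in> Arr K i j \<Longrightarrow> A \<in> Ob \<Longrightarrow> x \<in> crr (fobj F i) A \<Longrightarrow>
      l j A (fmap F i j u A x) = l i A x"
proof -
  show "sheaf L" "\<And>i. i \<in> Obj K \<Longrightarrow> l i \<in> mor (fobj F i) L" using co by (auto simp: is_cocone_def)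
  fix i j u A x assume *: "i \<in> Obj K" "j \<in> Obj K" "u \<in> Arr K i j" and A: "A \<in> Ob" "x \<in> crr (fobj F i) A"
  have "Comp (PSh k a) (fobj F i) (fobj F j) L (l j) (fmap F i j u) = l i" using co * unfolding is_cocone_def by simp
  then show "l j A (fmap F i j u A x) = l i A x" using comp_apply[OF A, of "fobj F j" L "l j" "fmap F i j u"] by simp
qed

definition diagram_rel :: "('j, 'm) cat \<Rightarrow> ('j, 'm, ('k, 'o, 'u) presheaf, 'o \<Rightarrow> 'u \<Rightarrow> 'u) func \<Rightarrow> 'o \<Rightarrow> (('j \<times> 'u) \<times> ('j \<times> 'u)) set" where
  "diagram_rel K F A = {((i, x), (j, fmap F i j u A x)) | i j u x. i \<in> Obj K \<and> j \<in> Obj K \<and> u \<in> Arr K i j \<and> x \<in> crr (fobj F i) A}"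

lemma presheaf_diagram_functor:
  assumes K: "small TYPE('u) (Obj K)" and F: "is_functor K SH F"
  shows "presheaf_diagram k a J (Obj K) (fobj F) (diagram_rel K F)"
proof
  show "psh (fobj F i)" if "i \<in> Obj K" for i using functor_sheaf[OF F that] by simp
  show "i \<in> Obj K \<and> j \<in> Obj K \<and> x \<in> crr (fobj F i) A \<and> y \<in> crr (fobj F j) A"
    if "A \<in> Ob" "((i, x), (j, y)) \<in> diagram_rel K F A" for A i x j y
    using that mor_closed[OF functor_mor[OF F]] functor_sheaf[OF F] by (auto simp: diagram_rel_def)
  show "((i, fmap (fobj F i) A B f x), (j, fmap (fobj F j) A B f y)) \<in> diagram_rel K F B"
    if A: "A \<in> Ob" and B: "B \<in> Ob" and f: "f \<in> Arr a B A" and r: "((i, x), (j, y)) \<in> diagram_rel K F A" for A B f i x j y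
  proof -
    obtain u where u: "i \<in> Obj K" "j \<in> Obj K" "u \<in> Arr K i j" "x \<in> crr (fobj F i) A" "y = fmap F i j u A x"
      using r by (auto simp: diagram_rel_def)
    note s = sheaf_psh[OF functor_sheaf[OF F u(1)]] sheaf_psh[OF functor_sheaf[OF F u(2)]]
    have "fmap (fobj F j) A B f y = fmap F i j u B (fmap (fobj F i) A B f x)"
      using mor_nat[OF functor_mor[OF F u(1-3)] s A B f u(4)] u(5) by simp
    then show ?thesis using u psh_closed[OF s(1) A B f u(4)] unfolding diagram_rel_def by blast
  qed
qed (rule K)

text \<open>The cocone condition says that the family of maps respects \<open>diagram_rel\<close>,
  so the universal property is that of \<open>sheaf_colimit\<close>.\<close>

lemma colimit_exists:
  fixes K :: "('j, 'm) cat"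
  assumes K: "small TYPE('u) (Obj K)" and F: "is_functor K SH F"
  obtains L l where "is_colimit K SH F L l"
    "\<forall>A\<in>Ob. \<forall>i\<in>Obj K. \<forall>x\<in>crr (fobj F i) A. l i A x = \<zero>\<^bsub>fobj L A\<^esub> \<longrightarrow>
       locally A (\<lambda>B f. frag_of (i, fmap (fobj F i) A B f x) \<in> presheaf_diagram.rels (Obj K) (fobj F) (diagram_rel K F) B)"
    "\<forall>S. \<forall>A\<in>Ob. \<forall>x\<in>crr L A. (\<forall>B\<in>Ob. \<zero>\<^bsub>fobj L B\<^esub> \<in> S B) \<longrightarrow>
       (\<forall>B\<in>Ob. \<forall>i\<in>Obj K. \<forall>y\<in>crr (fobj F i) B. l i B y \<in> S B) \<longrightarrow>
       (\<forall>B\<in>Ob. \<forall>u\<in>S B. \<forall>v\<in>S B. u \<ominus>\<^bsub>fobj L B\<^esub> v \<in> S B) \<longrightarrow>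
       locally A (\<lambda>B f. fmap L A B f x \<in> S B)"
proof -
  interpret cd: presheaf_diagram k a J "Obj K" "fobj F" "diagram_rel K F"
    by (rule presheaf_diagram_functor[OF K F])
  obtain L l where L: "sheaf L" and l: "\<forall>i\<in>Obj K. l i \<in> mor (fobj F i) L"
    and l_rel: "\<forall>A\<in>Ob. \<forall>i x j y. ((i, x), (j, y)) \<in> diagram_rel K F A \<longrightarrow> l i A x = l j A y"
    and univ: "\<forall>T t. sheaf T \<longrightarrow> (\<forall>i\<in>Obj K. t i \<in> mor (fobj F i) T) \<longrightarrow>
       (\<forall>A\<in>Ob. \<forall>i x j y. ((i, x), (j, y)) \<in> diagram_rel K F A \<longrightarrow> t i A x = t j A y) \<longrightarrow>
       (\<exists>h\<in>mor L T. \<forall>i\<in>Obj K. \<forall>A\<in>Ob. \<forall>x\<in>crr (fobj F i) A. h A (l i A x) = t i A x)"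
    and uniq: "\<forall>T h h'. sheaf T \<longrightarrow> h \<in> mor L T \<longrightarrow> h' \<in> mor L T \<longrightarrow>
       (\<forall>i\<in>Obj K. \<forall>A\<in>Ob. \<forall>x\<in>crr (fobj F i) A. h A (l i A x) = h' A (l i A x)) \<longrightarrow> h = h'"
    and ker: "\<forall>A\<in>Ob. \<forall>i\<in>Obj K. \<forall>x\<in>crr (fobj F i) A. l i A x = \<zero>\<^bsub>fobj L A\<^esub> \<longrightarrow>
       locally A (\<lambda>B f. frag_of (i, fmap (fobj F i) A B f x) \<in> cd.rels B)"
    and dense: "\<forall>S. \<forall>A\<in>Ob. \<forall>x\<in>crr L A. (\<forall>B\<in>Ob. \<zero>\<^bsub>fobj L B\<^esub> \<in> S B) \<longrightarrow>
       (\<forall>B\<in>Ob. \<forall>i\<in>Obj K. \<forall>y\<in>crr (fobj F i) B. l i B y \<in> S B) \<longrightarrow>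
       (\<forall>B\<in>Ob. \<forall>u\<in>S B. \<forall>v\<in>S B. u \<ominus>\<^bsub>fobj L B\<^esub> v \<in> S B) \<longrightarrow>
       locally A (\<lambda>B f. fmap L A B f x \<in> S B)"
    by (rule cd.sheaf_colimit) (rule that; assumption)
  note s = sheaf_psh[OF functor_sheaf[OF F]]
  note L' = sheaf_psh[OF L]
  have co: "is_cocone K SH F L l"
    unfolding is_cocone_def SH_simps
  proof (intro conjI ballI L)
    show "l i \<in> mor (fobj F i) L" if "i \<in> Obj K" for i using l that by blast
    fix i j u assume *: "i \<in> Obj K" "j \<in> Obj K" "u \<in> Arr K i j"
    show "Comp (PSh k a) (fobj F i) (fobj F j) L (l j) (fmap F i j u) = l i"
    proof (rule mor_eqI[OF comp_mor[OF s[OF *(1)] s[OF *(2)] L' functor_mor[OF F *]] _ s[OF *(1)] L'])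
      fix A x assume A: "A \<in> Ob" and x: "x \<in> crr (fobj F i) A"
      have "((i, x), (j, fmap F i j u A x)) \<in> diagram_rel K F A" using * x by (auto simp: diagram_rel_def)
      then show "Comp (PSh k a) (fobj F i) (fobj F j) L (l j) (fmap F i j u) A x = l i A x" using l_rel A x by fastforce
    qed (use l * in auto)
  qed
  have "\<exists>!h. h \<in> mor L T \<and> (\<forall>i\<in>Obj K. Comp (PSh k a) (fobj F i) L T h (l i) = t i)" if T: "is_cocone K SH F T t" for T t
  proof -
    note T' = cocone_sheaf[OF T F] and t = cocone_mor[OF T F] and teq = cocone_eq[OF T F]
    have "t i A x = t j A y" if "A \<in> Ob" "((i, x), (j, y)) \<in> diagram_rel K F A" for A i x j y
      using that teq by (auto simp: diagram_rel_def)
    then have "\<exists>h\<in>mor L T. \<forall>i\<in>Obj K. \<forall>A\<in>Ob. \<forall>x\<in>crr (fobj F i) A. h A (l i A x) = t i A x"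
      using univ[rule_format, of T t] T' t by blast
    then obtain h where h: "h \<in> mor L T" and hl: "\<And>i A x. i \<in> Obj K \<Longrightarrow> A \<in> Ob \<Longrightarrow> x \<in> crr (fobj F i) A \<Longrightarrow> h A (l i A x) = t i A x" by blast
    show ?thesis
    proof (rule ex1I[of _ h])
      have "Comp (PSh k a) (fobj F i) L T h (l i) = t i" if i: "i \<in> Obj K" for i
        by (rule mor_eqI[OF comp_mor[OF s[OF i] L' sheaf_psh[OF T'] _ h] t[OF i] s[OF i] sheaf_psh[OF T']]) (use l i hl in auto)
      then show "h \<in> mor L T \<and> (\<forall>i\<in>Obj K. Comp (PSh k a) (fobj F i) L T h (l i) = t i)" using h by blast
      fix g assume g: "g \<in> mor L T \<and> (\<forall>i\<in>Obj K. Comp (PSh k a) (fobj F i) L T g (l i) = t i)"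
      show "g = h"
      proof (rule uniq[rule_format, OF T' _ h])
        fix i A x assume i: "i \<in> Obj K" and A: "A \<in> Ob" "x \<in> crr (fobj F i) A"
        show "g A (l i A x) = h A (l i A x)"
          using g i comp_apply[OF A, of L T g "l i"] hl[OF i A] by simp
      qed (use g in blast)
    qed
  qed
  then have "is_colimit K SH F L l" unfolding is_colimit_def using co by simp
  then show thesis using that ker dense by blast
qed

text \<open>The description in terms of sections is known for the constructed colimit; a given one
  is compared with it through the universal properties. Filteredness turns finite sums of sections
  of terms into single sections, and relations into vanishing at a later stage.\<close>

lemma colimit_filtered:
  fixes K :: "('j, 'm) cat"
  assumes K: "small TYPE('u) (Obj K)" "category K" "filtered K" and F: "is_functor K SH F" and colim: "is_colimit K SH F L l"
  shows colimit_dense: "\<And>A x. A \<in> Ob \<Longrightarrow> x \<in> crr L A \<Longrightarrow> locally A (\<lambda>B h. \<exists>i\<in>Obj K. fmap L A B h x \<in> l i B ` crr (fobj F i) B)"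
    and colimit_kernel: "\<And>A i x. A \<in> Ob \<Longrightarrow> i \<in> Obj K \<Longrightarrow> x \<in> crr (fobj F i) A \<Longrightarrow> l i A x = \<zero>\<^bsub>fobj L A\<^esub> \<Longrightarrow>
      locally A (\<lambda>B h. \<exists>j\<in>Obj K. \<exists>u\<in>Arr K i j. fmap F i j u B (fmap (fobj F i) A B h x) = \<zero>\<^bsub>fobj (fobj F j) B\<^esub>)"
proof -
  obtain L0 l0 where colim0: "is_colimit K SH F L0 l0"
    and ker: "\<forall>A\<in>Ob. \<forall>i\<in>Obj K. \<forall>x\<in>crr (fobj F i) A. l0 i A x = \<zero>\<^bsub>fobj L0 A\<^esub> \<longrightarrow>
       locally A (\<lambda>B f. frag_of (i, fmap (fobj F i) A B f x) \<in> presheaf_diagram.rels (Obj K) (fobj F) (diagram_rel K F) B)"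
    and dense: "\<forall>S. \<forall>A\<in>Ob. \<forall>x\<in>crr L0 A. (\<forall>B\<in>Ob. \<zero>\<^bsub>fobj L0 B\<^esub> \<in> S B) \<longrightarrow>
       (\<forall>B\<in>Ob. \<forall>i\<in>Obj K. \<forall>y\<in>crr (fobj F i) B. l0 i B y \<in> S B) \<longrightarrow>
       (\<forall>B\<in>Ob. \<forall>u\<in>S B. \<forall>v\<in>S B. u \<ominus>\<^bsub>fobj L0 B\<^esub> v \<in> S B) \<longrightarrow>
       locally A (\<lambda>B f. fmap L0 A B f x \<in> S B)"
    by (rule colimit_exists[OF K(1) F]) (rule that; assumption)
  interpret cd: presheaf_diagram k a J "Obj K" "fobj F" "diagram_rel K F"
    by (rule presheaf_diagram_functor[OF K(1) F])
  have co: "is_cocone K SH F L l" and co0: "is_cocone K SH F L0 l0" using colim colim0 by (simp_all add: is_colimit_def)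
  note L = cocone_sheaf[OF co F] and L0 = cocone_sheaf[OF co0 F]
  note lm = cocone_mor[OF co F] and l0m = cocone_mor[OF co0 F]
  note P = sheaf_psh[OF L] sheaf_psh[OF L0]
  note s = sheaf_psh[OF functor_sheaf[OF F]]
  have "\<exists>!h. h \<in> mor L L0 \<and> (\<forall>i\<in>Obj K. Comp (PSh k a) (fobj F i) L L0 h (l i) = l0 i)"
    using colim co0 unfolding is_colimit_def by simp
  then obtain g where g: "g \<in> mor L L0" "\<And>i. i \<in> Obj K \<Longrightarrow> Comp (PSh k a) (fobj F i) L L0 g (l i) = l0 i" by blast
  have "\<exists>!h. h \<in> mor L0 L \<and> (\<forall>i\<in>Obj K. Comp (PSh k a) (fobj F i) L0 L h (l0 i) = l i)"
    using colim0 co unfolding is_colimit_def by simp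
  then obtain h where h: "h \<in> mor L0 L" "\<And>i. i \<in> Obj K \<Longrightarrow> Comp (PSh k a) (fobj F i) L0 L h (l0 i) = l i" by blast
  have gl: "g A (l i A x) = l0 i A x" if "i \<in> Obj K" "A \<in> Ob" "x \<in> crr (fobj F i) A" for i A x
    using comp_apply[OF that(2,3), of L L0 g "l i"] g(2)[OF that(1)] by simp
  have hl: "h A (l0 i A x) = l i A x" if "i \<in> Obj K" "A \<in> Ob" "x \<in> crr (fobj F i) A" for i A x
    using comp_apply[OF that(2,3), of L0 L h "l0 i"] h(2)[OF that(1)] by simp
  have "\<exists>!e. e \<in> mor L L \<and> (\<forall>i\<in>Obj K. Comp (PSh k a) (fobj F i) L L e (l i) = l i)"
    using colim co unfolding is_colimit_def by simp
  moreover have "Comp (PSh k a) L L0 L h g \<in> mor L L" using P g h by simp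
  moreover have "\<forall>i\<in>Obj K. Comp (PSh k a) (fobj F i) L L (Comp (PSh k a) L L0 L h g) (l i) = l i"
  proof
    fix i assume i: "i \<in> Obj K"
    show "Comp (PSh k a) (fobj F i) L L (Comp (PSh k a) L L0 L h g) (l i) = l i"
      by (rule mor_eqI[OF _ lm[OF i] s[OF i] P(1)])
        (use P g h lm[OF i] s[OF i] i gl hl mor_closed[OF lm[OF i] s[OF i] P(1)] in auto)
  qed
  moreover have "Ident (PSh k a) L \<in> mor L L" using P by simp
  moreover have "\<forall>i\<in>Obj K. Comp (PSh k a) (fobj F i) L L (Ident (PSh k a) L) (l i) = l i"
  proof
    fix i assume i: "i \<in> Obj K"
    show "Comp (PSh k a) (fobj F i) L L (Ident (PSh k a) L) (l i) = l i"
      by (rule mor_eqI[OF _ lm[OF i] s[OF i] P(1)]) (use P lm[OF i] s[OF i] mor_closed[OF lm[OF i] s[OF i] P(1)] in auto)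
  qed
  \<comment> \<open>The composite and the identity both solve the universal problem for
    \<open>L\<close>.\<close>
  ultimately have "Comp (PSh k a) L L0 L h g = Ident (PSh k a) L" by blast
  then have hg: "h A (g A x) = x" if "A \<in> Ob" "x \<in> crr L A" for A x
    using comp_apply[OF that, of L0 L h g] that by simp
  show "locally A (\<lambda>B f. \<exists>i\<in>Obj K. fmap L A B f x \<in> l i B ` crr (fobj F i) B)" if A: "A \<in> Ob" and x: "x \<in> crr L A" for A x
  proof -
    \<comment> \<open>Images of sections of a single term. A difference of two of them is again one,
      at a common bound of the two indices.\<close>
    define S where "S B = {w. \<exists>i\<in>Obj K. w \<in> l0 i B ` crr (fobj F i) B}" for B
    have push: "\<exists>y'\<in>crr (fobj F j) B. l0 j B y' = l0 i B y"
      if "i \<in> Obj K" "j \<in> Obj K" "u \<in> Arr K i j" "B \<in> Ob" "y \<in> crr (fobj F i) B" for i j u B y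
      using cocone_eq[OF co0 F that] mor_closed[OF functor_mor[OF F that(1-3)] s[OF that(1)] s[OF that(2)] that(4,5)] by blast
    have "locally A (\<lambda>B f. fmap L0 A B f (g A x) \<in> S B)"
    proof (rule dense[rule_format, OF A mor_closed[OF g(1) P A x]])
      fix B assume B: "B \<in> Ob"
      obtain i where i: "i \<in> Obj K" using K(3) by (auto simp: filtered_def)
      have "l0 i B \<zero>\<^bsub>fobj (fobj F i) B\<^esub> = \<zero>\<^bsub>fobj L0 B\<^esub>" using mor_zero[OF l0m[OF i] s[OF i] P(2) B] .
      then show "\<zero>\<^bsub>fobj L0 B\<^esub> \<in> S B"
        unfolding S_def using i psh_zero_closed[OF s[OF i] B] by (metis (mono_tags, lifting) imageI mem_Collect_eq)
      show "l0 i B y \<in> S B" if "i \<in> Obj K" "y \<in> crr (fobj F i) B" for i y using that by (auto simp: S_def)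
      fix v w assume "v \<in> S B" "w \<in> S B"
      then obtain i j y z where i: "i \<in> Obj K" "y \<in> crr (fobj F i) B" "v = l0 i B y" and j: "j \<in> Obj K" "z \<in> crr (fobj F j) B" "w = l0 j B z"
        by (auto simp: S_def)
      obtain m u u' where m: "m \<in> Obj K" "u \<in> Arr K i m" "u' \<in> Arr K j m" using K(3) i(1) j(1) unfolding filtered_def by blast
      obtain y' where y': "y' \<in> crr (fobj F m) B" "l0 m B y' = v" using push[OF i(1) m(1,2) B i(2)] i(3) by blast
      obtain z' where z': "z' \<in> crr (fobj F m) B" "l0 m B z' = w" using push[OF j(1) m(1,3) B j(2)] j(3) by blast
      have "l0 m B (y' \<ominus>\<^bsub>fobj (fobj F m) B\<^esub> z') = v \<ominus>\<^bsub>fobj L0 B\<^esub> w"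
        using mor_minus[OF l0m[OF m(1)] s[OF m(1)] P(2) B y'(1) z'(1)] y' z' by simp
      moreover have "y' \<ominus>\<^bsub>fobj (fobj F m) B\<^esub> z' \<in> crr (fobj F m) B"
        using abelian_group.minus_closed[OF psh_group[OF s[OF m(1)] B] y'(1) z'(1)] .
      ultimately show "v \<ominus>\<^bsub>fobj L0 B\<^esub> w \<in> S B" unfolding S_def using m(1) by (metis (mono_tags, lifting) imageI mem_Collect_eq)
    qed
    then show ?thesis
    proof (rule locally_mono)
      fix B f assume B: "B \<in> Ob" "f \<in> Arr a B A" and "fmap L0 A B f (g A x) \<in> S B"
      then obtain i y where i: "i \<in> Obj K" "y \<in> crr (fobj F i) B" "fmap L0 A B f (g A x) = l0 i B y" by (auto simp: S_def)
      have "fmap L A B f x = h B (g B (fmap L A B f x))" using hg[OF B(1) psh_closed[OF P(1) A B x]] by simp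
      also have "\<dots> = l i B y" using mor_nat[OF g(1) P A B x] i hl B by simp
      finally show "\<exists>i\<in>Obj K. fmap L A B f x \<in> l i B ` crr (fobj F i) B" using i by blast
    qed
  qed
  show "locally A (\<lambda>B f. \<exists>j\<in>Obj K. \<exists>u\<in>Arr K i j. fmap F i j u B (fmap (fobj F i) A B f x) = \<zero>\<^bsub>fobj (fobj F j) B\<^esub>)"
    if A: "A \<in> Ob" and i: "i \<in> Obj K" and x: "x \<in> crr (fobj F i) A" and 0: "l i A x = \<zero>\<^bsub>fobj L A\<^esub>" for A i x
  proof -
    have "l0 i A x = \<zero>\<^bsub>fobj L0 A\<^esub>" using gl[OF i A x] 0 mor_zero[OF g(1) P A] by simp
    then have "locally A (\<lambda>B f. frag_of (i, fmap (fobj F i) A B f x) \<in> cd.rels B)" using ker[rule_format, OF A i x] by blast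
    then show ?thesis
    proof (rule locally_mono)
      fix B f assume B: "B \<in> Ob" and f: "f \<in> Arr a B A" and r: "frag_of (i, fmap (fobj F i) A B f x) \<in> cd.rels B"
      \<comment> \<open>The sections over \<open>B\<close> form a filtered system of abelian groups,
        whose colimit is the test group for \<open>relations_kernel\<close>.\<close>
      interpret fs: filtered_system K "\<lambda>i. fobj (fobj F i) B" "\<lambda>i j u. fmap F i j u B"
      proof (rule filtered_system.intro)
        show "category K" "filtered K" using K by blast+
        show "abelian_group (fobj (fobj F i) B)" if "i \<in> Obj K" for i using psh_group[OF s[OF that] B] .
        fix i j u x assume *: "i \<in> Obj K" "j \<in> Obj K" "u \<in> Arr K i j" and x: "x \<in> crr (fobj F i) B"
        note m = functor_mor[OF F *] and sij = s[OF *(1)] s[OF *(2)]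
        show "fmap F i j u B x \<in> crr (fobj F j) B" using mor_closed[OF m sij B x] .
        show "fmap F i j u B (x \<oplus>\<^bsub>fobj (fobj F i) B\<^esub> y) = fmap F i j u B x \<oplus>\<^bsub>fobj (fobj F j) B\<^esub> fmap F i j u B y"
          if "y \<in> crr (fobj F i) B" for y using mor_add[OF m sij B x that] .
        show "fmap F i l (Comp K i j l v u) B x = fmap F j l v B (fmap F i j u B x)" if "l \<in> Obj K" "v \<in> Arr K j l" for l v
          using functor_comp[OF F *(1,2) that(1) *(3) that(2)] comp_apply[OF B x] by simp
      next
        show "fmap F i i (Ident K i) B x = x" if "i \<in> Obj K" "x \<in> crr (fobj F i) B" for i x
          using functor_id[OF F that(1)] ident_apply[OF B that(2)] by simp
      qed
      have fx: "fmap (fobj F i) A B f x \<in> crr (fobj F i) B" using psh_closed[OF s[OF i] A B f x] .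
      have "fs.cl i (fmap (fobj F i) A B f x) = \<one>\<^bsub>fs.colim\<^esub>"
      proof (rule cd.relations_kernel[OF fs.colim_comm_group B, where c = fs.cl])
        show "fs.cl i y \<in> carrier fs.colim" if "i \<in> Obj K" "y \<in> crr (fobj F i) B" for i y
          using that fs.colim_carrier by blast
        show "fs.cl i (y \<oplus>\<^bsub>fobj (fobj F i) B\<^esub> z) = fs.cl i y \<otimes>\<^bsub>fs.colim\<^esub> fs.cl i z"
          if "i \<in> Obj K" "y \<in> crr (fobj F i) B" "z \<in> crr (fobj F i) B" for i y z
          using fs.cl_mult[OF that] by simp
        show "fs.cl i y = fs.cl j z" if "((i, y), (j, z)) \<in> diagram_rel K F B" for i y j z
          using that fs.cl_push by (auto simp: diagram_rel_def)
      qed (use i fx r in auto)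
      then show "\<exists>j\<in>Obj K. \<exists>u\<in>Arr K i j. fmap F i j u B (fmap (fobj F i) A B f x) = \<zero>\<^bsub>fobj (fobj F j) B\<^esub>"
        using fs.cl_eq_one[OF i fx] by blast
    qed
  qed
qed

lemma cocomplete_SH: "cocomplete TYPE('u) SH"
  unfolding cocomplete_def
proof (intro allI impI)
  fix K :: "('u, 'u) cat" and F
  assume K: "small_category TYPE('u) K \<and> is_functor K SH F"
  then have "small TYPE('u) (Obj K)" "is_functor K SH F" by (simp_all add: small_category_def)
  then obtain L l where "is_colimit K SH F L l" by (rule colimit_exists)
  then show "\<exists>L l. is_colimit K SH F L l" by blast
qed

text \<open>By density a section of a colimit comes from some stage, where the exact sequence of
  that stage applies, and by \<open>colimit_kernel\<close> a vanishing section vanishes at a later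
  stage. Each of these moves costs a cover.\<close>

lemma exact_filtered_colimits_SH: "exact_filtered_colimits TYPE('u) SH"
  unfolding exact_filtered_colimits_def
proof (intro allI impI, elim conjE)
  fix K :: "('u, 'u) cat" and F G H \<alpha> \<beta> X Y Z x y z p q
  assume "small_category TYPE('u) K" and filt: "filtered K"
    and F: "is_functor K SH F" and G: "is_functor K SH G" and H: "is_functor K SH H"
    and \<alpha>: "\<alpha> \<in> nat_trans K SH F G" and \<beta>: "\<beta> \<in> nat_trans K SH G H"
    and ex: "\<forall>j\<in>Obj K. short_exact SH (fobj F j) (fobj G j) (fobj H j) (\<alpha> j) (\<beta> j)"
    and cF: "is_colimit K SH F X x" and cG: "is_colimit K SH G Y y" and cH: "is_colimit K SH H Z z"
    and p0: "p \<in> Arr SH X Y" and px: "\<forall>j\<in>Obj K. Comp SH (fobj F j) X Y p (x j) = Comp SH (fobj F j) (fobj G j) Y (y j) (\<alpha> j)"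
    and q0: "q \<in> Arr SH Y Z" and qy: "\<forall>j\<in>Obj K. Comp SH (fobj G j) Y Z q (y j) = Comp SH (fobj G j) (fobj H j) Z (z j) (\<beta> j)"
  then have K: "small TYPE('u) (Obj K)" "category K" by (simp_all add: small_category_def)
  have p: "p \<in> mor X Y" and q: "q \<in> mor Y Z" using p0 q0 by simp_all
  have co: "is_cocone K SH F X x" "is_cocone K SH G Y y" "is_cocone K SH H Z z" using cF cG cH by (simp_all add: is_colimit_def)
  note X = cocone_sheaf[OF co(1) F] and Y = cocone_sheaf[OF co(2) G] and Z = cocone_sheaf[OF co(3) H]
  note P = sheaf_psh[OF X] sheaf_psh[OF Y] sheaf_psh[OF Z]
  note xm = cocone_mor[OF co(1) F] and ym = cocone_mor[OF co(2) G] and zm = cocone_mor[OF co(3) H]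
  note sF = functor_sheaf[OF F] and sG = functor_sheaf[OF G] and sH = functor_sheaf[OF H]
  note PF = sheaf_psh[OF sF] and PG = sheaf_psh[OF sG] and PH = sheaf_psh[OF sH]
  have \<alpha>m: "\<alpha> j \<in> mor (fobj F j) (fobj G j)" if "j \<in> Obj K" for j using \<alpha> that by (auto simp: nat_trans_def)
  have \<beta>m: "\<beta> j \<in> mor (fobj G j) (fobj H j)" if "j \<in> Obj K" for j using \<beta> that by (auto simp: nat_trans_def)
  have \<alpha>n: "\<alpha> j A (fmap F i j u A v) = fmap G i j u A (\<alpha> i A v)"
    if "i \<in> Obj K" "j \<in> Obj K" "u \<in> Arr K i j" and A: "A \<in> Ob" "v \<in> crr (fobj F i) A" for i j u A v
  proof -
    have "Comp SH (fobj F i) (fobj F j) (fobj G j) (\<alpha> j) (fmap F i j u) = Comp SH (fobj F i) (fobj G i) (fobj G j) (fmap G i j u) (\<alpha> i)"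
      using \<alpha> that(1-3) unfolding nat_trans_def by blast
    then show ?thesis
      using comp_apply[OF A, of "fobj F j" "fobj G j" "\<alpha> j" "fmap F i j u"] comp_apply[OF A, of "fobj G i" "fobj G j" "fmap G i j u" "\<alpha> i"] by simp
  qed
  have \<beta>n: "\<beta> j A (fmap G i j u A v) = fmap H i j u A (\<beta> i A v)"
    if "i \<in> Obj K" "j \<in> Obj K" "u \<in> Arr K i j" and A: "A \<in> Ob" "v \<in> crr (fobj G i) A" for i j u A v
  proof -
    have "Comp SH (fobj G i) (fobj G j) (fobj H j) (\<beta> j) (fmap G i j u) = Comp SH (fobj G i) (fobj H i) (fobj H j) (fmap H i j u) (\<beta> i)"
      using \<beta> that(1-3) unfolding nat_trans_def by blast
    then show ?thesis
      using comp_apply[OF A, of "fobj G j" "fobj H j" "\<beta> j" "fmap G i j u"] comp_apply[OF A, of "fobj H i" "fobj H j" "fmap H i j u" "\<beta> i"] by simp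
  qed
  have pxe: "p A (x j A v) = y j A (\<alpha> j A v)" if "j \<in> Obj K" and A: "A \<in> Ob" "v \<in> crr (fobj F j) A" for j A v
    using arg_cong[OF px[rule_format, OF that(1)], of "\<lambda>e. e A v"] comp_apply[OF A, of X Y p "x j"] comp_apply[OF A, of "fobj G j" Y "y j" "\<alpha> j"] by simp
  have qye: "q A (y j A v) = z j A (\<beta> j A v)" if "j \<in> Obj K" and A: "A \<in> Ob" "v \<in> crr (fobj G j) A" for j A v
    using arg_cong[OF qy[rule_format, OF that(1)], of "\<lambda>e. e A v"] comp_apply[OF A, of Y Z q "y j"] comp_apply[OF A, of "fobj H j" Z "z j" "\<beta> j"] by simp
  have inj: "inj_mor (fobj F j) (\<alpha> j)" and surj: "lsurj (fobj G j) (fobj H j) (\<beta> j)"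
    and mid: "\<And>A v. A \<in> Ob \<Longrightarrow> v \<in> crr (fobj G j) A \<Longrightarrow> \<beta> j A v = \<zero>\<^bsub>fobj (fobj H j) A\<^esub> \<longleftrightarrow> v \<in> \<alpha> j A ` crr (fobj F j) A"
    if j: "j \<in> Obj K" for j
    using short_exact_iff[OF sF[OF j] sG[OF j] sH[OF j] \<alpha>m[OF j] \<beta>m[OF j]] ex j by blast+
  note denseF = colimit_dense[OF K filt F cF] and kerG = colimit_kernel[OF K filt G cG]
  note denseG = colimit_dense[OF K filt G cG] and kerH = colimit_kernel[OF K filt H cH]
  note denseH = colimit_dense[OF K filt H cH]
  \<comment> \<open>A section killed by \<open>p\<close> comes locally from some \<open>w\<close> at
    a stage. The image of \<open>w\<close> under \<open>\<alpha>\<close> dies locally at a later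
    stage, where \<open>\<alpha>\<close> is injective.\<close>
  have p_inj: "inj_mor X p"
  proof (rule inj_morI[OF P(1,2) p])
    fix A v assume A: "A \<in> Ob" and v: "v \<in> crr X A" and 0: "p A v = \<zero>\<^bsub>fobj Y A\<^esub>"
    show "v = \<zero>\<^bsub>fobj X A\<^esub>"
    proof (rule sheaf_eq[OF X A v psh_zero_closed[OF P(1) A]])
      show "locally A (\<lambda>B h. fmap X A B h v = fmap X A B h \<zero>\<^bsub>fobj X A\<^esub>)"
        using denseF[OF A v]
      proof (rule locally_mono)
        fix B h assume B: "B \<in> Ob" and h: "h \<in> Arr a B A" and "\<exists>i\<in>Obj K. fmap X A B h v \<in> x i B ` crr (fobj F i) B"
        then obtain i w where i: "i \<in> Obj K" and w: "w \<in> crr (fobj F i) B" and vw: "fmap X A B h v = x i B w" by blast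
        have aw: "\<alpha> i B w \<in> crr (fobj G i) B" using mor_closed[OF \<alpha>m[OF i] PF[OF i] PG[OF i] B w] .
        have "y i B (\<alpha> i B w) = \<zero>\<^bsub>fobj Y B\<^esub>"
          using pxe[OF i B w] vw mor_nat[OF p P(1,2) A B h v] 0 P A B h by simp
        then have loc: "locally B (\<lambda>C g. \<exists>j\<in>Obj K. \<exists>u\<in>Arr K i j. fmap G i j u C (fmap (fobj G i) B C g (\<alpha> i B w)) = \<zero>\<^bsub>fobj (fobj G j) C\<^esub>)"
          using kerG[OF B i aw] by blast
        have "x i B w = \<zero>\<^bsub>fobj X B\<^esub>"
        proof (rule sheaf_eq[OF X B mor_closed[OF xm[OF i] PF[OF i] P(1) B w] psh_zero_closed[OF P(1) B]])
          show "locally B (\<lambda>C g. fmap X B C g (x i B w) = fmap X B C g \<zero>\<^bsub>fobj X B\<^esub>)"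
            using loc
          proof (rule locally_mono)
            fix C g assume C: "C \<in> Ob" and g: "g \<in> Arr a C B"
              and "\<exists>j\<in>Obj K. \<exists>u\<in>Arr K i j. fmap G i j u C (fmap (fobj G i) B C g (\<alpha> i B w)) = \<zero>\<^bsub>fobj (fobj G j) C\<^esub>"
            then obtain j u where j: "j \<in> Obj K" and u: "u \<in> Arr K i j"
              and u0: "fmap G i j u C (fmap (fobj G i) B C g (\<alpha> i B w)) = \<zero>\<^bsub>fobj (fobj G j) C\<^esub>" by blast
            define w' where "w' = fmap (fobj F i) B C g w"
            have w': "w' \<in> crr (fobj F i) C" using psh_closed[OF PF[OF i] B C g w] by (simp add: w'_def)
            have uw: "fmap F i j u C w' \<in> crr (fobj F j) C" using mor_closed[OF functor_mor[OF F i j u] PF[OF i] PF[OF j] C w'] .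
            have "\<alpha> j C (fmap F i j u C w') = \<alpha> j C \<zero>\<^bsub>fobj (fobj F j) C\<^esub>"
              using \<alpha>n[OF i j u C w'] mor_nat[OF \<alpha>m[OF i] PF[OF i] PG[OF i] B C g w] u0 mor_zero[OF \<alpha>m[OF j] PF[OF j] PG[OF j] C]
              by (simp add: w'_def)
            then have "fmap F i j u C w' = \<zero>\<^bsub>fobj (fobj F j) C\<^esub>"
              using inj_morD[OF inj[OF j] C uw psh_zero_closed[OF PF[OF j] C]] by blast
            then have "x i C w' = \<zero>\<^bsub>fobj X C\<^esub>"
              using cocone_eq[OF co(1) F i j u C w'] mor_zero[OF xm[OF j] PF[OF j] P(1) C] by simp
            then show "fmap X B C g (x i B w) = fmap X B C g \<zero>\<^bsub>fobj X B\<^esub>"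
              using mor_nat[OF xm[OF i] PF[OF i] P(1) B C g w] P B C g by (simp add: w'_def)
          qed
        qed
        then show "fmap X A B h v = fmap X A B h \<zero>\<^bsub>fobj X A\<^esub>" using vw P A B h by simp
      qed
    qed
  qed
  have q_surj: "lsurj Y Z q"
    unfolding lsurj_def
  proof (intro ballI)
    fix A v assume A: "A \<in> Ob" and v: "v \<in> crr Z A"
    \<comment> \<open>Two covers are involved, one to reach a stage and one to lift along
      \<open>\<beta>\<close>; collecting the arrows in a sieve lets \<open>locally_trans\<close>
      merge them.\<close>
    define S where "S = (\<lambda>B. if B \<in> Ob then {h \<in> Arr a B A. fmap Z A B h v \<in> q B ` crr Y B} else {})"
    have S: "sieve A S"
      unfolding sieve_def
    proof (intro conjI allI impI ballI)
      fix B assume B: "B \<in> Ob"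
      show "S B \<subseteq> Arr a B A" using B by (simp add: S_def)
      have "\<zero>\<^bsub>fobj Z B\<^esub> \<in> q B ` crr Y B" using mor_zero[OF q P(2,3) B] psh_zero_closed[OF P(2) B] by (metis imageI)
      then show "hzero B A \<in> S B" using A B P v by (simp add: S_def)
      fix f g assume "f \<in> S B" "g \<in> S B"
      then obtain v1 v2 where fg: "f \<in> Arr a B A" "g \<in> Arr a B A" "v1 \<in> crr Y B" "v2 \<in> crr Y B" "fmap Z A B f v = q B v1" "fmap Z A B g v = q B v2"
        using B by (auto simp: S_def)
      have "fmap Z A B (hplus B A f g) v = q B (v1 \<oplus>\<^bsub>fobj Y B\<^esub> v2)"
        using psh_plus[OF P(3) A B fg(1,2) v] mor_add[OF q P(2,3) B fg(3,4)] fg by simp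
      then show "hplus B A f g \<in> S B" using A B fg P by (simp add: S_def)
    next
      fix B C f g assume B: "B \<in> Ob" and C: "C \<in> Ob" and "f \<in> S B" and g: "g \<in> Arr a C B"
      then obtain v1 where f: "f \<in> Arr a B A" "v1 \<in> crr Y B" "fmap Z A B f v = q B v1" by (auto simp: S_def)
      have "fmap Z A C (Comp a C B A f g) v = q C (fmap Y B C g v1)"
        using psh_comp[OF P(3) A B C f(1) g v] mor_nat[OF q P(2,3) B C g f(2)] f by simp
      then show "Comp a C B A f g \<in> S C" using A B C f g psh_closed[OF P(2) B C g f(2)] by (simp add: S_def)
    qed (simp add: S_def)
    have "J A S"
    proof (rule locally_trans[OF S])
      show "locally A (\<lambda>B h. locally B (\<lambda>C g. Comp a C B A h g \<in> S C))"
        using denseH[OF A v]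
      proof (rule locally_mono)
        fix B h assume B: "B \<in> Ob" and h: "h \<in> Arr a B A" and "\<exists>i\<in>Obj K. fmap Z A B h v \<in> z i B ` crr (fobj H i) B"
        then obtain i w where i: "i \<in> Obj K" and w: "w \<in> crr (fobj H i) B" and vw: "fmap Z A B h v = z i B w" by blast
        have "locally B (\<lambda>C g. fmap (fobj H i) B C g w \<in> \<beta> i C ` crr (fobj G i) C)" using surj[OF i] B w by (simp add: lsurj_def)
        then show "locally B (\<lambda>C g. Comp a C B A h g \<in> S C)"
        proof (rule locally_mono)
          fix C g assume C: "C \<in> Ob" and g: "g \<in> Arr a C B" and "fmap (fobj H i) B C g w \<in> \<beta> i C ` crr (fobj G i) C"
          then obtain r where r: "r \<in> crr (fobj G i) C" "fmap (fobj H i) B C g w = \<beta> i C r" by blast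
          have "fmap Z A C (Comp a C B A h g) v = z i C (fmap (fobj H i) B C g w)"
            using psh_comp[OF P(3) A B C h g v] mor_nat[OF zm[OF i] PH[OF i] P(3) B C g w] vw by simp
          also have "\<dots> = q C (y i C r)" using qye[OF i C r(1)] r(2) by simp
          finally show "Comp a C B A h g \<in> S C"
            using A B C h g mor_closed[OF ym[OF i] PG[OF i] P(2) C r(1)] by (simp add: S_def)
        qed
      qed
    qed
    then show "locally A (\<lambda>B h. fmap Z A B h v \<in> q B ` crr Y B)" by (rule J_locally) (simp add: S_def)
  qed
  have qp: "q A (p A v) = \<zero>\<^bsub>fobj Z A\<^esub>" if A: "A \<in> Ob" and v: "v \<in> crr X A" for A v
  proof -
    note pv = mor_closed[OF p P(1,2) A v]
    show ?thesis
    proof (rule sheaf_eq[OF Z A mor_closed[OF q P(2,3) A pv] psh_zero_closed[OF P(3) A]])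
      show "locally A (\<lambda>B h. fmap Z A B h (q A (p A v)) = fmap Z A B h \<zero>\<^bsub>fobj Z A\<^esub>)"
        using denseF[OF A v]
      proof (rule locally_mono)
        fix B h assume B: "B \<in> Ob" and h: "h \<in> Arr a B A" and "\<exists>i\<in>Obj K. fmap X A B h v \<in> x i B ` crr (fobj F i) B"
        then obtain i w where i: "i \<in> Obj K" and w: "w \<in> crr (fobj F i) B" and vw: "fmap X A B h v = x i B w" by blast
        have aw: "\<alpha> i B w \<in> crr (fobj G i) B" using mor_closed[OF \<alpha>m[OF i] PF[OF i] PG[OF i] B w] .
        have "fmap Z A B h (q A (p A v)) = q B (p B (x i B w))"
          using mor_nat[OF q P(2,3) A B h pv] mor_nat[OF p P(1,2) A B h v] vw by simp
        also have "\<dots> = z i B (\<beta> i B (\<alpha> i B w))" using pxe[OF i B w] qye[OF i B aw] by simp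
        also have "\<beta> i B (\<alpha> i B w) = \<zero>\<^bsub>fobj (fobj H i) B\<^esub>" using mid[OF i B aw] w by blast
        finally show "fmap Z A B h (q A (p A v)) = fmap Z A B h \<zero>\<^bsub>fobj Z A\<^esub>"
          using mor_zero[OF zm[OF i] PH[OF i] P(3) B] P A B h by simp
      qed
    qed
  qed
  have exact: "v \<in> p A ` crr X A" if A: "A \<in> Ob" and v: "v \<in> crr Y A" and 0: "q A v = \<zero>\<^bsub>fobj Z A\<^esub>" for A v
  proof (rule image_local[OF X Y p p_inj A v])
    show "locally A (\<lambda>B h. fmap Y A B h v \<in> p B ` crr X B)"
      using denseG[OF A v]
    proof (rule locally_mono)
      fix B h assume B: "B \<in> Ob" and h: "h \<in> Arr a B A" and "\<exists>i\<in>Obj K. fmap Y A B h v \<in> y i B ` crr (fobj G i) B"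
      then obtain i w where i: "i \<in> Obj K" and w: "w \<in> crr (fobj G i) B" and vw: "fmap Y A B h v = y i B w" by blast
      have bw: "\<beta> i B w \<in> crr (fobj H i) B" using mor_closed[OF \<beta>m[OF i] PG[OF i] PH[OF i] B w] .
      have "z i B (\<beta> i B w) = \<zero>\<^bsub>fobj Z B\<^esub>" using qye[OF i B w] vw mor_nat[OF q P(2,3) A B h v] 0 P A B h by simp
      then have loc: "locally B (\<lambda>C g. \<exists>j\<in>Obj K. \<exists>u\<in>Arr K i j. fmap H i j u C (fmap (fobj H i) B C g (\<beta> i B w)) = \<zero>\<^bsub>fobj (fobj H j) C\<^esub>)"
        using kerH[OF B i bw] by blast
      \<comment> \<open>The cover on which the image under \<open>\<beta>\<close> dies at a later
        stage is absorbed by \<open>image_local\<close>, which relies on the injectivity of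
        \<open>p\<close>.\<close>
      have "y i B w \<in> p B ` crr X B"
      proof (rule image_local[OF X Y p p_inj B mor_closed[OF ym[OF i] PG[OF i] P(2) B w]])
        show "locally B (\<lambda>C g. fmap Y B C g (y i B w) \<in> p C ` crr X C)"
          using loc
        proof (rule locally_mono)
          fix C g assume C: "C \<in> Ob" and g: "g \<in> Arr a C B"
            and "\<exists>j\<in>Obj K. \<exists>u\<in>Arr K i j. fmap H i j u C (fmap (fobj H i) B C g (\<beta> i B w)) = \<zero>\<^bsub>fobj (fobj H j) C\<^esub>"
          then obtain j u where j: "j \<in> Obj K" and u: "u \<in> Arr K i j"
            and u0: "fmap H i j u C (fmap (fobj H i) B C g (\<beta> i B w)) = \<zero>\<^bsub>fobj (fobj H j) C\<^esub>" by blast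
          define w' where "w' = fmap (fobj G i) B C g w"
          have w': "w' \<in> crr (fobj G i) C" using psh_closed[OF PG[OF i] B C g w] by (simp add: w'_def)
          have uw: "fmap G i j u C w' \<in> crr (fobj G j) C" using mor_closed[OF functor_mor[OF G i j u] PG[OF i] PG[OF j] C w'] .
          have "\<beta> j C (fmap G i j u C w') = \<zero>\<^bsub>fobj (fobj H j) C\<^esub>"
            using \<beta>n[OF i j u C w'] mor_nat[OF \<beta>m[OF i] PG[OF i] PH[OF i] B C g w] u0 by (simp add: w'_def)
          then obtain r where r: "r \<in> crr (fobj F j) C" "fmap G i j u C w' = \<alpha> j C r" using mid[OF j C uw] by blast
          have "fmap Y B C g (y i B w) = y i C w'" using mor_nat[OF ym[OF i] PG[OF i] P(2) B C g w] by (simp add: w'_def)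
          also have "\<dots> = y j C (\<alpha> j C r)" using cocone_eq[OF co(2) G i j u C w'] r(2) by simp
          also have "\<dots> = p C (x j C r)" using pxe[OF j C r(1)] by simp
          finally show "fmap Y B C g (y i B w) \<in> p C ` crr X C"
            using mor_closed[OF xm[OF j] PF[OF j] P(1) C r(1)] by simp
        qed
      qed
      then show "fmap Y A B h v \<in> p B ` crr X B" using vw by simp
    qed
  qed
  show "short_exact SH X Y Z p q"
    unfolding short_exact_iff[OF X Y Z p q] using p_inj q_surj qp exact by blast
qed

text \<open>The coproduct of the sheaves associated with the representables of objects in
  \<open>O0\<close>. Distinct maps differ on some section over an object of \<open>O0\<close>, and
  this section defines an arrow from the coproduct that is zero on the other summands.\<close>

lemma generator_exists: "\<exists>G. is_generator SH G"
proof -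
  obtain O0 where O0: "O0 \<subseteq> Ob" "small TYPE('u) O0" "\<And>X. X \<in> Ob \<Longrightarrow> \<exists>Y\<in>O0. \<exists>f. is_iso a X Y f"
    using ess unfolding essentially_small_def by blast
  define R :: "'o \<Rightarrow> (('o \<times> 'u) \<times> ('o \<times> 'u)) set" where "R A = {}" for A
  interpret cd: presheaf_diagram k a J O0 "yoneda a" R
    by standard (use O0 in \<open>auto simp: R_def\<close>)
  obtain G l where G: "sheaf G" and l: "\<forall>i\<in>O0. l i \<in> mor (yoneda a i) G"
    and univ: "\<forall>T t. sheaf T \<longrightarrow> (\<forall>i\<in>O0. t i \<in> mor (yoneda a i) T) \<longrightarrow>
       (\<forall>A\<in>Ob. \<forall>i x j y. ((i, x), (j, y)) \<in> R A \<longrightarrow> t i A x = t j A y) \<longrightarrow>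
       (\<exists>h\<in>mor G T. \<forall>i\<in>O0. \<forall>A\<in>Ob. \<forall>x\<in>crr (yoneda a i) A. h A (l i A x) = t i A x)"
    by (rule cd.sheaf_colimit) (rule that; assumption)
  have "is_generator SH G"
    unfolding is_generator_def SH_simps
  proof (intro conjI ballI impI G)
    fix X Y f g assume "X \<in> Obj SH" "Y \<in> Obj SH" and f: "f \<in> mor X Y" and g: "g \<in> mor X Y" and neq: "f \<noteq> g"
    then have X: "sheaf X" and Y: "sheaf Y" by simp_all
    note P = sheaf_psh[OF X] sheaf_psh[OF Y]
    obtain A x where A: "A \<in> Ob" and x: "x \<in> crr X A" and fx: "f A x \<noteq> g A x"
      using mor_eqI[OF f g P] neq by blast
    obtain B u v where B: "B \<in> O0" and u: "u \<in> Arr a A B" and v: "v \<in> Arr a B A" and vu: "Comp a A B A v u = Ident a A"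
      using O0(3)[OF A] unfolding is_iso_def by blast
    have BO: "B \<in> Ob" using B O0 by blast
    define y where "y = fmap X A B v x"
    have y: "y \<in> crr X B" using psh_closed[OF P(1) A BO v x] by (simp add: y_def)
    have "fmap X B A u y = x" using psh_comp[OF P(1) A BO A v u x] psh_id[OF P(1) A x] vu by (simp add: y_def)
    then have fy: "f B y \<noteq> g B y" using mor_nat[OF f P BO A u y] mor_nat[OF g P BO A u y] fx by metis
    define t where "t C = (if C = B then mk (yoneda a B) (\<lambda>A h. fmap X B A h y) else \<zero>\<^bsub>HomM (PSh k a) (yoneda a C) X\<^esub>)" for C
    have "mk (yoneda a B) (\<lambda>A h. fmap X B A h y) \<in> mor (yoneda a B) X"
      by (rule mk_mor) (use BO P y in \<open>auto simp: psh_closed psh_plus psh_comp\<close>)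
    then have tm: "t C \<in> mor (yoneda a C) X" if "C \<in> O0" for C using that O0 P by (auto simp: t_def)
    have "\<exists>h\<in>mor G X. \<forall>i\<in>O0. \<forall>A\<in>Ob. \<forall>x\<in>crr (yoneda a i) A. h A (l i A x) = t i A x"
      by (rule univ[rule_format, OF X]) (use tm in \<open>auto simp: R_def\<close>)
    then obtain h where h: "h \<in> mor G X" and hl: "\<And>i A x. i \<in> O0 \<Longrightarrow> A \<in> Ob \<Longrightarrow> x \<in> crr (yoneda a i) A \<Longrightarrow> h A (l i A x) = t i A x" by blast
    define w where "w = l B B (Ident a B)"
    have w: "w \<in> crr G B" using mor_closed[of "l B" "yoneda a B" G B "Ident a B"] l B BO G by (simp add: w_def)
    have hw: "h B w = y" using hl[OF B BO, of "Ident a B"] BO y P by (simp add: w_def t_def psh_id)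
    show "\<exists>h\<in>mor G X. Comp (PSh k a) G X Y f h \<noteq> Comp (PSh k a) G X Y g h"
    proof (rule bexI[OF _ h])
      show "Comp (PSh k a) G X Y f h \<noteq> Comp (PSh k a) G X Y g h"
        using comp_apply[OF BO w, of X Y f h] comp_apply[OF BO w, of X Y g h] hw fy by metis
    qed
  qed
  then show ?thesis by blast
qed

theorem grothendieck_SH: "grothendieck_category TYPE('u) k SH"
  unfolding grothendieck_category_def
  using abelian_SH small_mor cocomplete_SH exact_filtered_colimits_SH generator_exists by simp

end

theorem theorem2p3p1:
  fixes k :: "'k ring" and a :: "('k, 'o, 'u) lincat" and S :: "('o, 'u) fseq set"
  assumes "universe TYPE('u)"
    and "cring k" and "small TYPE('u) (carrier k)"
    and "lin_category k a" and "essentially_small TYPE('u) a"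
    and "pretopology a S"
  shows "ShS k a S = Sh k a (top_of k a S) \<and> grothendieck_category TYPE('u) k (ShS k a S)"
proof -
  interpret linear_pretopology k a S
    by (intro linear_pretopology.intro linear_category.intro universe_type.intro linear_category_axioms.intro linear_pretopology_axioms.intro) (rule assms)+
  show ?thesis using grothendieck_SH by (simp add: ShS_sheaf Sh_sheaf)
qed

end
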